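(* Let $\tfrac14\le\alpha<\tfrac38$ and $0<T\le1$. Assume that $$0<\epsilon<\frac{(5-8\alpha)^2}{32(1-\alpha)},\qquad0<\delta<\frac{2\epsilon}{5-8\alpha}.$$ Then there exists $\eta=\eta(\epsilon,\alpha)>0$ such that for all $u,v,w$, $$\|uvw\|_{\mathcal X_T^{2\alpha-\frac14+\epsilon-1,-\frac12+\delta}}\lesssim T^\eta\,\|u\|_{\mathcal X'}\|v\|_{\mathcal X'}\|w\|_{\mathcal X'},\qquad\mathcal X'=\mathcal X_T^{2\alpha-\frac14+\epsilon,\frac12+\delta},$$ with a constant independent of $u,v,w$ and $T$.
   Context: $\mathbb T^2=(\mathbb R/2\pi\mathbb Z)^2$, $\langle x\rangle=\sqrt{1+|x|^2}$. $\mathcal X^{s,b}$ is the closure of the Schwartz functions on $\mathbb R\times\mathbb T^2$ under $\|u\|_{\mathcal X^{s,b}}=\|\langle n\rangle^s\langle|\lambda|-\langle n\rangle\rangle^b\,\widetilde u(\lambda,n)\|_{L^2_\lambda\ell^2_n(\mathbb R\times\mathbb Z^2)}$, $\widetilde u$ being the space-time Fourier transform. $\|u\|_{\mathcal X^{s,b}_T}=\inf\{\|w\|_{\mathcal X^{s,b}}:w|_{[0,T]}=u\}$. *)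

theory Defs
  imports "HOL-Analysis.Analysis"
begin

text \<open>
  A function on \<open>\<real> \<times> \<T>\<^sup>2\<close> is a function of \<open>(t, x\<^sub>1, x\<^sub>2)\<close> that is
  \<open>2\<pi>\<close>-periodic in \<open>x\<^sub>1\<close> and \<open>x\<^sub>2\<close>; integrals over the torus are taken over the
  fundamental domain \<open>[0, 2\<pi>)\<^sup>2\<close>. Dual variables are \<open>(\<tau>, n\<^sub>1, n\<^sub>2) \<in> \<real> \<times> \<int>\<^sup>2\<close>.
\<close>

type_synonym spacetime = "real \<times> real \<times> real"
type_synonym frequency = "real \<times> int \<times> int"
type_synonym functional = "(spacetime \<Rightarrow> complex) \<Rightarrow> complex"

definition periodic_space :: "(spacetime \<Rightarrow> complex) \<Rightarrow> bool" where
  "periodic_space f \<longleftrightarrow>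
     (\<forall>t x y. f (t, x + 2 * pi, y) = f (t, x, y) \<and> f (t, x, y + 2 * pi) = f (t, x, y))"

definition slab :: "real set \<Rightarrow> spacetime set" where
  "slab I = I \<times> {0..<2 * pi} \<times> {0..<2 * pi}"

definition frequency_measure :: "frequency measure" where
  "frequency_measure = lborel \<Otimes>\<^sub>M count_space UNIV"


subsection \<open>Schwartz functions and tempered distributions on \<open>\<real> \<times> \<T>\<^sup>2\<close>\<close>

primrec iter_deriv :: "spacetime list \<Rightarrow> (spacetime \<Rightarrow> complex) \<Rightarrow> spacetime \<Rightarrow> complex" where
  "iter_deriv [] f = f"
| "iter_deriv (v # vs) f = (\<lambda>z. frechet_derivative (iter_deriv vs f) (at z) v)"

definition schwartz :: "(spacetime \<Rightarrow> complex) set" where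
  "schwartz = {\<phi>. periodic_space \<phi> \<and>
     (\<forall>vs z. iter_deriv vs \<phi> differentiable (at z)) \<and>
     (\<forall>k vs. bounded (range (\<lambda>z. \<bar>fst z\<bar> ^ k *\<^sub>R iter_deriv vs \<phi> z)))}"

definition schwartz_null_seq :: "(nat \<Rightarrow> spacetime \<Rightarrow> complex) \<Rightarrow> bool" where
  "schwartz_null_seq \<Phi> \<longleftrightarrow> (\<forall>j. \<Phi> j \<in> schwartz) \<and>
     (\<forall>k vs. uniform_limit UNIV (\<lambda>j z. \<bar>fst z\<bar> ^ k *\<^sub>R iter_deriv vs (\<Phi> j) z) (\<lambda>z. 0) sequentially)"

text \<open>
  Only the values of a functional on \<^const>\<open>schwartz\<close> are relevant. Sequential continuity
  suffices, since the Schwartz space is metrizable.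
\<close>

definition tempered :: "functional \<Rightarrow> bool" where
  "tempered U \<longleftrightarrow>
     (\<forall>\<phi>\<in>schwartz. \<forall>\<psi>\<in>schwartz. U (\<lambda>z. \<phi> z + \<psi> z) = U \<phi> + U \<psi>) \<and>
     (\<forall>c. \<forall>\<phi>\<in>schwartz. U (\<lambda>z. c * \<phi> z) = c * U \<phi>) \<and>
     (\<forall>\<Phi>. schwartz_null_seq \<Phi> \<longrightarrow> (\<lambda>j. U (\<Phi> j)) \<longlonglongrightarrow> 0)"

definition dist_of :: "(spacetime \<Rightarrow> complex) \<Rightarrow> functional" where
  "dist_of f = (\<lambda>\<psi>. LINT z:slab UNIV|lborel. f z * \<psi> z)"


subsection \<open>Space-time Fourier transform\<close>

definition ft :: "(spacetime \<Rightarrow> complex) \<Rightarrow> frequency \<Rightarrow> complex" where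
  "ft \<phi> = (\<lambda>(\<tau>, n1, n2). LINT (t, x, y):slab UNIV|lborel.
     cis (- (\<tau> * t + of_int n1 * x + of_int n2 * y)) * \<phi> (t, x, y))"

text \<open>
  \<open>has_ft U F\<close>: the Fourier transform of the distribution \<open>U\<close> is the function \<open>F\<close>. The pairing
  is Parseval's identity, with the constant that belongs to the normalization of \<^const>\<open>ft\<close>, so
  for a Schwartz function \<open>\<phi>\<close> the distribution \<open>dist_of \<phi>\<close> has the transform \<open>ft \<phi>\<close>.
\<close>

definition has_ft :: "functional \<Rightarrow> (frequency \<Rightarrow> complex) \<Rightarrow> bool" where
  "has_ft U F \<longleftrightarrow> F \<in> borel_measurable frequency_measure \<and>
     (\<forall>\<phi>\<in>schwartz.
        integrable frequency_measure (\<lambda>(\<tau>, n1, n2). F (\<tau>, n1, n2) * ft \<phi> (- \<tau>, - n1, - n2)) \<and>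
        U \<phi> = (1 / (2 * pi) ^ 3) *\<^sub>R
          (LINT (\<tau>, n1, n2)|frequency_measure. F (\<tau>, n1, n2) * ft \<phi> (- \<tau>, - n1, - n2)))"


subsection \<open>The spaces \<open>\<X>\<^sup>s\<^sup>,\<^sup>b\<close>\<close>

definition japanese :: "'a::real_normed_vector \<Rightarrow> real" where
  "japanese x = sqrt (1 + (norm x)\<^sup>2)"

definition xsb_weight :: "real \<Rightarrow> real \<Rightarrow> frequency \<Rightarrow> real" where
  "xsb_weight s b = (\<lambda>(\<tau>, n1, n2).
     let n = (of_int n1, of_int n2) :: real \<times> real
     in japanese n powr s * japanese (\<bar>\<tau>\<bar> - japanese n) powr b)"

definition l2_norm :: "(frequency \<Rightarrow> complex) \<Rightarrow> ennreal" where
  "l2_norm F =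
     (let I = (\<integral>\<^sup>+ z. ennreal ((cmod (F z))\<^sup>2) \<partial>frequency_measure)
      in if I = \<infinity> then \<infinity> else ennreal (sqrt (enn2real I)))"

text \<open>
  The Fourier transform of \<open>U\<close> is unique almost everywhere if it is a function; the infimum picks
  its weighted norm, and is \<open>\<infinity>\<close> if the transform is not a function.
\<close>

definition xsb_norm :: "real \<Rightarrow> real \<Rightarrow> functional \<Rightarrow> ennreal" where
  "xsb_norm s b U = (INF F\<in>{F. has_ft U F}. l2_norm (\<lambda>z. of_real (xsb_weight s b z) * F z))"

definition Xsb :: "real \<Rightarrow> real \<Rightarrow> functional set" where
  "Xsb s b = {U. tempered U \<and>
     (\<forall>e>0. \<exists>\<phi>\<in>schwartz. xsb_norm s b (\<lambda>\<psi>. U \<psi> - dist_of \<phi> \<psi>) < e)}"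


subsection \<open>Restriction to \<open>[0, T]\<close>\<close>

text \<open>
  Restrictions are compared as distributions on the open set \<open>(0, T) \<times> \<T>\<^sup>2\<close>. The end points carry
  no information for \<open>b > -1/2\<close>: then no nonzero element of \<open>\<X>\<^sup>s\<^sup>,\<^sup>b\<close> is supported in
  \<open>{0, T} \<times> \<T>\<^sup>2\<close>.
\<close>

definition test_functions :: "real \<Rightarrow> (spacetime \<Rightarrow> complex) set" where
  "test_functions T = {\<phi> \<in> schwartz.
     \<exists>a b. 0 < a \<and> b < T \<and> (\<forall>t x y. t \<notin> {a..b} \<longrightarrow> \<phi> (t, x, y) = 0)}"

definition restricts_to :: "real \<Rightarrow> functional \<Rightarrow> functional \<Rightarrow> bool" where
  "restricts_to T W U \<longleftrightarrow> (\<forall>\<phi>\<in>test_functions T. W \<phi> = U \<phi>)"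

definition XsbT :: "real \<Rightarrow> real \<Rightarrow> real \<Rightarrow> functional set" where
  "XsbT T s b = {U. \<exists>W\<in>Xsb s b. restricts_to T W U}"

definition xsbT_norm :: "real \<Rightarrow> real \<Rightarrow> real \<Rightarrow> functional \<Rightarrow> ennreal" where
  "xsbT_norm T s b U = (INF W\<in>{W \<in> Xsb s b. restricts_to T W U}. xsb_norm s b W)"

text \<open>
  Integrable functions on \<open>[0, T] \<times> \<T>\<^sup>2\<close> that belong to the restricted space. For \<open>s, b \<ge> 0\<close> these
  are all its elements, since \<open>\<X>\<^sup>s\<^sup>,\<^sup>b\<close> is then contained in \<open>L\<^sup>2\<close>. Values at times outside
  \<open>[0, T]\<close> play no role.
\<close>

definition XsbT_fun :: "real \<Rightarrow> real \<Rightarrow> real \<Rightarrow> (spacetime \<Rightarrow> complex) set" where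
  "XsbT_fun T s b = {f. periodic_space f \<and> set_integrable lborel (slab {0..T}) f \<and>
     dist_of f \<in> XsbT T s b}"

end

theory Submission
  imports Defs "HOL-Probability.Probability" "HOL-Real_Asymp.Real_Asymp"
begin


text \<open>
  The estimate is proved on the Fourier side. Write \<open>s = 2\<alpha> - 1/4 + \<epsilon>\<close> and \<open>b = 1/2 + \<delta>\<close>; the hypotheses say
  \<open>1/4 < s \<le> 1\<close> and \<open>\<delta> < 1/4\<close> (\<open>exponents_admissible\<close>). The transform of a product is a convolution,
  so everything reduces to a bound for \<open>F\<^sub>1 * F\<^sub>2 * F\<^sub>3\<close> in weighted \<open>L\<^sup>2\<close>, for nonnegative \<open>F\<^sub>i\<close>.

  The only input about the torus is a count: the lattice points \<open>m\<close> with \<open>\<langle>m\<rangle> \<le> R\<close> for which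
  \<open>\<langle>m\<rangle> + \<langle>n - m\<rangle>\<close> lies in a given interval of length \<open>L\<close> number at most \<open>C R\<^sup>3\<^sup>/\<^sup>2 L\<^sup>1\<^sup>/\<^sup>2\<close>
  (\<open>card_lattice_ellipse\<close>). Summed dyadically it gives the bilinear \<open>L\<^sup>2\<close> estimate with any loss
  \<open>\<theta> > 3/4\<close> of the smaller frequency (\<open>bilinear_estimate\<close>); this is the periodic Strichartz estimate in
  bilinear form. In the trilinear form the weights \<open>\<langle>n\<^sub>1\<rangle>\<^sup>-\<^sup>s\<langle>n\<^sub>2\<rangle>\<^sup>-\<^sup>s\<langle>n\<^sub>3\<rangle>\<^sup>-\<^sup>s\<langle>n\<^sub>1 + n\<^sub>2 + n\<^sub>3\<rangle>\<^sup>s\<^sup>-\<^sup>1\<close> are at most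
  the power \<open>- (s + 1/2)\<close> of the product of the two smallest frequencies; since \<open>s + 1/2 > 3/4\<close>, after dualizing
  the four functions can be paired in two pairs that both satisfy the bilinear estimate
  (\<open>trilinear_estimate\<close>). The estimate uses the modulation weight only to a power \<open>a' > 1/4\<close>, and \<open>1/2 - \<delta>\<close>
  is larger; a smooth cutoff at time scale \<open>T\<close> turns the difference into a power of \<open>T\<close>
  (\<open>time_cutoff_gain\<close>). For Schwartz functions this is \<open>schwartz_trilinear\<close>.

  The passage to the restricted spaces needs the products to be the right distributions. Elements of
  \<open>\<X>\<^sup>s\<^sup>,\<^sup>b\<close> are limits of Schwartz functions in \<open>L\<^sup>3\<close>: dyadic pieces are bounded in \<open>L\<^sup>4\<close> by the bilinear
  estimate, in \<open>L\<^sup>2\<close> by Plancherel, and are summed (\<open>l3_estimate\<close>). Approximating sequences of the three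
  extensions thus converge almost everywhere, and their limits agree on \<open>(0, T)\<close> with \<open>u\<close>, \<open>v\<close>, \<open>w\<close>, since
  test functions separate integrable functions (\<open>extension_limit_eq\<close>). The cutoff product of the limits
  is integrable, its transform is the pointwise limit of the transforms of the Schwartz products, and
  Fatou's lemma transfers both the norm bound and the approximability (\<open>product_extension\<close>). Taking the
  infimum over all extensions finishes the proof.

  The Fourier analysis of \<open>\<real> \<times> \<T>\<^sup>2\<close> that this requires (inversion, Parseval, Plancherel as an
  inequality, uniqueness) is developed for the transform \<^const>\<open>ft\<close> itself, and the Schwartz class of the
  definitions is shown to contain enough smooth bumps.

  Notation: \<open>NF\<close>, \<open>NS\<close>, \<open>NT\<close> are nonnegative (extended) integrals over frequency space, over the
  fundamental slab and over the line; \<open>BF\<close>, \<open>BS\<close>, \<open>BT\<close> are the corresponding Bochner integrals.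
  \<open>BM\<close> stands for \<^const>\<open>borel_measurable\<close>. Greek variables of the comments are spelled out in Latin letters in
  the formulas (\<open>xi\<close>, \<open>ze\<close>, \<open>ta\<close>, \<open>ph\<close>, \<open>ps\<close> for \<open>\<xi>\<close>, \<open>\<zeta>\<close>, \<open>\<tau>\<close>, \<open>\<phi>\<close>, \<open>\<psi>\<close>, and so on).
\<close>

section \<open>Counting lattice points between ellipses\<close>

abbreviation bm_abbr ("BM") where "BM == borel_measurable"
abbreviation nn_freq (binder "NF " 10) where "nn_freq f == nn_integral frequency_measure f"
abbreviation int_freq (binder "BF " 10) where "int_freq f == integral\<^sup>L frequency_measure f"
abbreviation nn_line (binder "NT " 10) where "nn_line f == nn_integral lborel f"
abbreviation int_line (binder "BT " 10) where "int_line f == integral\<^sup>L lborel f"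

definition jb :: "real => real" where "jb x = sqrt (1 + x^2)"
definition jn :: "int \<times> int => real" where
 "jn n = sqrt (1 + (real_of_int (fst n))^2 + (real_of_int (snd n))^2)"

lemma jb_ge1: "1 <= jb x" and jn_ge1: "1 <= jn n"
 by (simp_all add: jb_def jn_def)
lemma jb_pos: "0 < jb x" and jn_pos: "0 < jn n"
 using jb_ge1[of x] jn_ge1[of n] by linarith+
lemma abs_le_jb: "\<bar>x\<bar> <= jb x"
 unfolding jb_def by (rule real_le_rsqrt) simp
lemma jb_minus: "jb (- x) = jb x" by (simp add: jb_def)
lemma jn_minus: "jn (- n) = jn n" by (simp add: jn_def)
lemma jb_mono: "\<bar>x\<bar> <= \<bar>y\<bar> ==> jb x <= jb y"
 by (simp add: jb_def abs_le_square_iff)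
lemma jb_triangle: "jb (x + y) <= jb x + \<bar>y\<bar>"
proof -
 have "jb (x + y) <= jb (\<bar>x\<bar> + \<bar>y\<bar>)" by (rule jb_mono) simp
 also have "... <= jb x + \<bar>y\<bar>"
  unfolding jb_def
 proof (rule real_le_lsqrt)
  have "\<bar>x\<bar>*\<bar>y\<bar> <= jb x*\<bar>y\<bar>" using abs_le_jb[of x] by (rule mult_right_mono) simp
  then show "1 + (\<bar>x\<bar> + \<bar>y\<bar>)^2 <= (sqrt (1 + x^2) + \<bar>y\<bar>)^2"
   unfolding jb_def by (simp add: power2_sum)
 qed simp_all
 finally show ?thesis .
qed

lemma jb_triangle2: "jb (x + y) <= jb x + jb y"
 using jb_triangle[of x y] abs_le_jb[of y] by linarith

text \<open>Uniform convexity of the bracket along a line: on an interval where it stays below \<open>R\<close> its second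
derivative is of size \<open>1/R\<close>, which makes its graph lie above the tangent by a quadratic term.\<close>

lemma sqrt_quadratic_tangent:
 fixes E x z :: real
 assumes "0 < E"
 shows "sqrt (E + x^2) + x / sqrt (E + x^2)*(z - x) <= sqrt (E + z^2)" (is ?A)
  and "x^2 <= E ==> sqrt (E + z^2) <= R ==>
   sqrt (E + x^2) + x / sqrt (E + x^2)*(z - x) + (z - x)^2 / (4 * R) <= sqrt (E + z^2)" (is "_ ==> _ ==> ?B")
proof -
 define g h where "g = sqrt (E + x^2)" and "h = sqrt (E + z^2)"
 have pos: "0 < g" "0 < h" using assms by (auto simp: g_def h_def add_pos_nonneg)
 have g2: "g^2 = E + x^2" and h2: "h^2 = E + z^2" using assms by (auto simp: g_def h_def)
 have id: "(g*h)^2 - (E + x*z)\<^sup>2 = E*(z - x)^2"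
  by (simp add: power_mult_distrib g2 h2) (simp add: power2_eq_square algebra_simps)
 then have "(E + x*z)^2 <= (g*h)^2" using assms by (metis diff_ge_0_iff_ge less_eq_real_def mult_nonneg_nonneg zero_le_power2)
 then have cs: "E + x*z <= g*h" using pos by (simp add: abs_le_square_iff[symmetric])
 have tr: "g*(g + x / g*(z - x)) = E + x*z" using pos
  using g2 by (simp add: distrib_left power2_eq_square) (simp add: algebra_simps)
 show ?A unfolding g_def[symmetric] h_def[symmetric]
  using cs tr pos by (metis mult_le_cancel_left_pos)
 assume a: "x^2 <= E" "sqrt (E + z^2) <= R"
 then have R: "h <= R" by (simp add: h_def)
 have "E*(z - x)^2 = (g*h - (E + x*z))*(g*h + (E + x*z))"
  using id by (simp add: power2_eq_square algebra_simps)
 also have "... <= (g*h - (E + x*z))*(2*(g*h))"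
  using cs by (intro mult_left_mono) auto
 finally have 1: "E*(z - x)^2 <= (g*h - (E + x*z))*(2*(g*h))" .
 have "g^2 / 2*(z - x)^2 <= E*(z - x)^2" using a g2 by (intro mult_right_mono) auto
 from order_trans[OF this 1] have "g*(g*(z - x)^2) <= g*((g*h - (E + x*z))*(4*h))"
  unfolding power2_eq_square[of g] by (simp add: mult_ac)
 then have "g*(z - x)^2 <= (g*h - (E + x*z))*(4*h)" using pos by simp
 also have "... <= (g*h - (E + x*z))*(4 * R)" using cs R by (intro mult_left_mono) auto
 finally have "g*((z - x)^2 / (4 * R)) <= g*h - (E + x*z)"
  using R pos by (simp add: divide_simps mult_ac)
 then have "g*(g + x / g*(z - x) + (z - x)^2 / (4 * R)) <= g*h"
  using tr by (simp add: distrib_left)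
 then show ?B unfolding g_def[symmetric] h_def[symmetric] using pos by simp
qed

lemma card_int_small_diameter:
 fixes S :: "int set" and B :: real
 assumes "!!x z. x : S ==> z : S ==> x < z ==> (real_of_int z - real_of_int x)^2 <= B" "0 <= B"
 shows "finite S & real (card S) <= 1 + sqrt B"
proof (cases "S = {}")
 case True then show ?thesis using assms by simp
next
 case False
 then obtain w where w: "w : S" by auto
 have bd: "real_of_int z - real_of_int x <= sqrt B" if "x : S" "z : S" for x z
 proof (cases "x < z")
  case True
  then show ?thesis using assms(1)[OF that] by (intro real_le_rsqrt) auto
 next
  case False
  then have "real_of_int z - real_of_int x <= 0" by simp
  also have "0 <= sqrt B" using assms(2) by simp
  finally show ?thesis .
 qed
 have "\<bar>x - w\<bar> <= \<lfloor>sqrt B\<rfloor>" if "x : S" for x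
  using bd[OF that w] bd[OF w that] by (simp add: le_floor_iff abs_le_iff)
 then have "S \<subseteq> {w - \<lfloor>sqrt B\<rfloor> .. w + \<lfloor>sqrt B\<rfloor>}" by (force simp: abs_le_iff)
 then have fin: "finite S" by (rule finite_subset) simp
 have "S \<subseteq> {Min S .. Min S + \<lfloor>sqrt B\<rfloor>}"
 proof
  fix x assume "x : S"
  then have "Min S <= x" "real_of_int x - real_of_int (Min S) <= sqrt B"
   using fin False bd[of "Min S" x] by auto
  then show "x : {Min S .. Min S + \<lfloor>sqrt B\<rfloor>}" by (auto simp: le_floor_iff) linarith
 qed
 then have "card S <= card {Min S .. Min S + \<lfloor>sqrt B\<rfloor>}" by (rule card_mono[rotated]) simp
 also have "... = nat (\<lfloor>sqrt B\<rfloor> + 1)" by simp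
 finally have "real (card S) <= 1 + sqrt B" using assms(2) real_sqrt_ge_zero[of B] by linarith
 with fin show ?thesis by simp
qed

text \<open>Along a column the sum of the two brackets is uniformly convex, so a sublevel shell of width \<open>L\<close> meets the
column in two sets (left and right of the minimum) of diameter at most \<open>C (RL)\<^sup>1\<^sup>/\<^sup>2\<close>.\<close>

lemma card_lattice_column:
 fixes p n1 n2 :: int and R L l :: real
 assumes "1 <= R" "0 <= L"
 defines "S == {y::int. \<bar>y\<bar> <= \<bar>p\<bar> & jn (p, y) <= R & \<bar>l - jn (p, y) - jn (n1 - p, n2 - y)\<bar> <= L}"
 shows "finite S & real (card S) <= 2*(1 + sqrt (8*L * R))"
proof -
 define E where "E = 1 + (real_of_int p)^2"
 define E' where "E' = 1 + (real_of_int (n1 - p))^2"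
 have E: "0 < E" "0 < E'" by (auto simp: E_def E'_def add_pos_nonneg)
 define f where "f y = jn (p, y) + jn (n1 - p, n2 - y)" for y
 define d where "d y = real_of_int y / jn (p, y) + (real_of_int y - real_of_int n2) / jn (n1 - p, n2 - y)" for y
 have key: "f x + d x*(real_of_int z - real_of_int x) + (real_of_int z - real_of_int x)^2 / (4 * R) <= f z"
  if "x : S" "z : S" for x z
 proof -
  have "\<bar>real_of_int x\<bar> <= \<bar>real_of_int p\<bar>" using that(1) by (auto simp: S_def)
  then have "(real_of_int x)^2 <= E" unfolding E_def abs_le_square_iff by linarith
  moreover have "sqrt (E + (real_of_int z)^2) <= R" using that(2) by (simp add: S_def jn_def E_def)
  ultimately have 1: "jn (p, x) + real_of_int x / jn (p, x)*(real_of_int z - real_of_int x)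
    + (real_of_int z - real_of_int x)^2 / (4 * R) <= jn (p, z)"
   using sqrt_quadratic_tangent(2)[OF E(1)] by (simp add: jn_def E_def)
  have e: "sqrt (E' + (real_of_int y - real_of_int n2)^2) = jn (n1 - p, n2 - y)" for y
   by (simp add: jn_def E'_def power2_commute)
  have 2: "jn (n1 - p, n2 - x) + (real_of_int x - real_of_int n2) / jn (n1 - p, n2 - x)*(real_of_int z - real_of_int x)
    <= jn (n1 - p, n2 - z)"
   using sqrt_quadratic_tangent(1)[OF E(2), of "real_of_int x - real_of_int n2" "real_of_int z - real_of_int n2"]
   unfolding e by simp
  show ?thesis using 1 2 by (simp add: f_def d_def algebra_simps)
 qed
 have osc: "f z - f x <= 2*L" if "x : S" "z : S" for x z
  using that by (auto simp: S_def f_def)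
 have R4: "t^2 <= 8*L * R" if "t^2 / (4 * R) <= 2*L" for t :: real
  using that assms(1) by (simp add: divide_simps)
 define P N where "P = {x\<in>S. 0 <= d x}" and "N = {x\<in>S. d x < 0}"
 have B: "0 <= 8*L * R" using assms by simp
 have 1: "finite P & real (card P) <= 1 + sqrt (8*L * R)"
 proof (rule card_int_small_diameter[OF _ B])
  fix x z assume "x : P" "z : P" "x < z"
  then have "0 <= d x*(real_of_int z - real_of_int x)" by (auto simp: P_def)
  then show "(real_of_int z - real_of_int x)^2 <= 8*L * R"
   using key[of x z] osc[of x z] \<open>x : P\<close> \<open>z : P\<close> by (intro R4) (auto simp: P_def)
 qed
 have 2: "finite N & real (card N) <= 1 + sqrt (8*L * R)"
 proof (rule card_int_small_diameter[OF _ B])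
  fix x z assume "x : N" "z : N" "x < z"
  then have "0 <= d z*(real_of_int x - real_of_int z)" by (auto simp: N_def mult_nonpos_nonpos)
  then show "(real_of_int z - real_of_int x)^2 <= 8*L * R"
   using key[of z x] osc[of z x] \<open>x : N\<close> \<open>z : N\<close>
   by (intro R4) (auto simp: N_def power2_commute)
 qed
 have "S = P \<union> N" by (auto simp: P_def N_def)
 then show ?thesis using 1 2 card_Un_le[of P N] by auto
qed

text \<open>There are \<open>O(R)\<close> columns, and each contributes \<open>O((RL)\<^sup>1\<^sup>/\<^sup>2)\<close>. Convexity is uniform only along the
direction of the smaller coordinate, so the points are split by which coordinate is larger and the roles of
the coordinates are exchanged.\<close>

lemma card_lattice_ellipse:
 fixes n :: "int \<times> int" and R L l :: real
 assumes R: "1 <= R" and L: "1 <= L"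
 defines "S == {m. jn m <= R & \<bar>l - jn m - jn (n - m)\<bar> <= L}"
 shows "finite S & real (card S) <= 48 * R powr (3/2)*L powr (1/2)"
proof -
 define k where "k = \<lfloor>R\<rfloor>"
 define K where "K = {-k..k}"
 define A where "A p = {y::int. \<bar>y\<bar> <= \<bar>p\<bar> & jn (p, y) <= R & \<bar>l - jn (p, y) - jn (fst n - p, snd n - y)\<bar> <= L}" for p
 define A' where "A' p = {y::int. \<bar>y\<bar> <= \<bar>p\<bar> & jn (p, y) <= R & \<bar>l - jn (p, y) - jn (snd n - p, fst n - y)\<bar> <= L}" for p
 define B where "B = 2*(1 + sqrt (8*L * R))"
 have A: "finite (A p)" "real (card (A p)) <= B" for p
  using card_lattice_column[of R L p l "fst n" "snd n"] R L unfolding A_def B_def by auto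
 have A': "finite (A' p)" "real (card (A' p)) <= B" for p
  using card_lattice_column[of R L p l "snd n" "fst n"] R L unfolding A'_def B_def by auto
 have swap: "jn (a, b) = jn (b, a)" for a b by (simp add: jn_def algebra_simps)
 have inK: "a : K" "b : K" if "jn (a, b) <= R" for a b
 proof -
  have "\<bar>real_of_int a\<bar> <= jn (a, b)" "\<bar>real_of_int b\<bar> <= jn (a, b)"
   unfolding jn_def by (auto intro!: real_le_rsqrt)
  with that have "\<bar>real_of_int a\<bar> <= R" "\<bar>real_of_int b\<bar> <= R" by linarith+
  then show "a : K" "b : K" unfolding K_def k_def by (auto simp: le_floor_iff abs_le_iff) linarith+
 qed
 have sub: "S \<subseteq> Sigma K A \<union> (%(x, y). (y, x)) ` Sigma K A'"
 proof
  fix m assume m: "m : S"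
  obtain a b where ab: "m = (a, b)" by (cases m)
  have mm: "jn (a, b) <= R" "\<bar>l - jn (a, b) - jn (fst n - a, snd n - b)\<bar> <= L"
   using m by (auto simp: S_def ab minus_prod_def)
  show "m : Sigma K A \<union> (%(x, y). (y, x)) ` Sigma K A'"
  proof (cases "\<bar>b\<bar> <= \<bar>a\<bar>")
   case True then show ?thesis using mm inK by (auto simp: ab A_def)
  next
   case False
   then have "(b, a) : Sigma K A'" using mm inK by (auto simp: A'_def swap)
   then show ?thesis by (force simp: ab)
  qed
 qed
 have finK: "finite K" by (simp add: K_def)
 have cK: "real (card K) <= 3 * R" using R unfolding K_def k_def by simp linarith
 have B0: "0 <= B" using R L by (simp add: B_def)
 have sig: "finite (Sigma K X) & real (card (Sigma K X)) <= 3 * R*B"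
  if "!!p. finite (X p)" "!!p. real (card (X p)) <= B" for X :: "int => int set"
 proof -
  have "real (card (Sigma K X)) = (\<Sum>p\<in>K. real (card (X p)))"
   using finK that by (simp add: card_SigmaI)
  also have "... <= (\<Sum>p\<in>K. B)" by (intro sum_mono that)
  also have "... <= 3 * R*B" using cK B0 by (simp add: mult_right_mono)
  finally show ?thesis using finK that by auto
 qed
 have f: "finite (Sigma K A \<union> (%(x, y). (y, x)) ` Sigma K A')" using sig A A' by auto
 have "card S <= card (Sigma K A \<union> (%(x, y). (y, x)) ` Sigma K A')" by (rule card_mono[OF f sub])
 also have "... <= card (Sigma K A) + card ((%(x, y). (y, x)) ` Sigma K A')"
  by (rule card_Un_le)
 also have "... <= card (Sigma K A) + card (Sigma K A')"
  by (intro add_left_mono card_image_le) (use sig[of A', OF A'] in simp)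
 finally have "real (card S) <= 6 * R*B" using sig[of A, OF A] sig[of A', OF A'] by linarith
 also have "... <= 48 * R powr (3/2)*L powr (1/2)"
 proof -
  have sq: "sqrt (8*L * R) <= 3 * sqrt (L * R)"
  proof -
   have "sqrt (8*L * R) <= sqrt (9*(L * R))" using R L by (intro real_sqrt_le_mono) (simp add: mult_right_mono)
   then show ?thesis by (simp add: real_sqrt_mult)
  qed
  have "1*1 <= L * R" using R L by (intro mult_mono) auto
  then have "1 <= sqrt (L * R)" by simp
  moreover have "2*(1 + t) <= 8 * s" if "1 <= s" "t <= 3 * s" for s t :: real
   using that by (simp add: algebra_simps)
  ultimately have "2*(1 + sqrt (8*L * R)) <= 8 * sqrt (L * R)" using sq by blast
  then have "B <= 8 * sqrt (L * R)" unfolding B_def .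
  then have "6 * R*B <= 6 * R*(8 * sqrt (L * R))" using R by (intro mult_left_mono) auto
  also have "... = 48*(R * sqrt R) * sqrt L" by (simp add: real_sqrt_mult mult_ac)
  also have "R * sqrt R = R powr (3/2)" using R powr_add[of R 1 "1/2"] by (simp add: powr_half_sqrt)
  also have "sqrt L = L powr (1/2)" using L by (simp add: powr_half_sqrt)
  finally show ?thesis .
 qed
 finally show ?thesis using finite_subset[OF sub f] by simp
qed

section \<open>Integration over frequency space\<close>

abbreviation "fm == frequency_measure"

lemma space_fm[simp]: "space fm = UNIV" by (simp add: frequency_measure_def space_pair_measure)

lemma sets_fm[measurable_cong]: "sets fm = sets (borel \<Otimes>\<^sub>M count_space UNIV)"
 unfolding frequency_measure_def by (intro sets_pair_measure_cong) auto

lemma sf_count: "sigma_finite_measure (count_space (UNIV::(int\<times>int) set))"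
 by (rule sigma_finite_measure_count_space)

interpretation fmp: pair_sigma_finite "lborel::real measure" "count_space (UNIV::(int\<times>int) set)"
 by (intro pair_sigma_finite.intro sigma_finite_lborel sf_count)

interpretation fms: sigma_finite_measure fm
 unfolding frequency_measure_def by (rule sigma_finite_pair_measure[OF sigma_finite_lborel sf_count])

interpretation fm2: pair_sigma_finite fm fm
 by (intro pair_sigma_finite.intro fms.sigma_finite_measure_axioms)

text \<open>Since the spatial frequencies are discrete, measurability may be tested on each line.\<close>

lemma meas_fm_iff:
 "f : measurable fm N \<longleftrightarrow> (ALL n. (%ta. f (ta, n)) : measurable borel N)"
proof
 assume f: "f : measurable fm N"
 show "ALL n. (%ta. f (ta, n)) : measurable borel N"
  using f by (auto simp: frequency_measure_def intro: measurable_compose[OF measurable_Pair2'])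
next
 assume f: "ALL n. (%ta. f (ta, n)) : measurable borel N"
 have "(%z. f (fst z, snd z)) : measurable (borel \<Otimes>\<^sub>M count_space UNIV) N"
 proof (rule measurable_compose_countable[where f="%n z. f (fst z, n)" and g=snd])
  fix n show "(%z. f (fst z, n)) : measurable (borel \<Otimes>\<^sub>M count_space UNIV) N"
   by (rule measurable_compose[OF measurable_fst]) (use f in blast)
 qed measurable
 then show "f : measurable fm N" by (simp add: measurable_cong_sets[OF sets_fm refl])
qed

lemma nn_integral_fm:
 assumes [measurable]: "f : BM fm"
 shows "(NF xi. f xi) = (\<integral>\<^sup>+n. (NT ta. f (ta, n)) \<partial>count_space UNIV)"
 using assms fmp.nn_integral_snd[of f] by (simp add: frequency_measure_def)

lemma meas_add_fm[measurable]: "(%(x, y). x + y :: frequency) : measurable (fm \<Otimes>\<^sub>M fm) fm"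
 and meas_diff_fm[measurable]: "(%(x, y). x - y :: frequency) : measurable (fm \<Otimes>\<^sub>M fm) fm"
 and meas_uminus_fm[measurable]: "(%x. - x :: frequency) : measurable fm fm"
proof -
 have c: "(%x. h (snd (fst x)) (snd (snd x))) : measurable (fm \<Otimes>\<^sub>M fm) (count_space UNIV)" for h :: "int\<times>int=>int\<times>int=>int\<times>int"
 proof (rule measurable_compose_countable[where g="%x. snd (fst x)" and f="%n x. h n (snd (snd x))"])
  fix n show "(%x. h n (snd (snd x))) : measurable (fm \<Otimes>\<^sub>M fm) (count_space UNIV)"
   by (rule measurable_compose[where N="count_space UNIV" and f="%x. snd (snd x)" and g="h n"]) measurable
 qed measurable
 show "(%(x, y). x + y :: frequency) : measurable (fm \<Otimes>\<^sub>M fm) fm"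
  unfolding measurable_cong_sets[OF refl sets_fm] plus_prod_def[where ?'a=real and ?'b="int\<times>int"] split_beta
  using c[of "(+)"] by (intro measurable_Pair) auto
 show "(%(x, y). x - y :: frequency) : measurable (fm \<Otimes>\<^sub>M fm) fm"
  unfolding measurable_cong_sets[OF refl sets_fm] minus_prod_def[where ?'a=real and ?'b="int\<times>int"] split_beta
  using c[of "(-)"] by (intro measurable_Pair) auto
 show "(%x. - x :: frequency) : measurable fm fm"
  unfolding measurable_cong_sets[OF refl sets_fm] uminus_prod_def[where ?'a=real and ?'b="int\<times>int"]
  by (intro measurable_Pair measurable_compose[where N="count_space UNIV" and f=snd and g="%n. - n"]) auto
qed

lemma meas_add_fm'[measurable (raw)]:
 assumes [measurable]: "f : measurable M fm" "g : measurable M fm"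
 shows "(%x. f x + g x) : measurable M fm"
 using measurable_compose[OF measurable_Pair[OF assms] meas_add_fm] by simp
lemma meas_diff_fm'[measurable (raw)]:
 assumes [measurable]: "f : measurable M fm" "g : measurable M fm"
 shows "(%x. f x - g x) : measurable M fm"
 using measurable_compose[OF measurable_Pair[OF assms] meas_diff_fm] by simp
lemma meas_uminus_fm'[measurable (raw)]:
 assumes [measurable]: "f : measurable M fm"
 shows "(%x. - f x) : measurable M fm"
 using measurable_compose[OF assms meas_uminus_fm] by simp

lemma nn_integral_fm_translate:
 assumes [measurable]: "f : BM fm"
 shows "(NF xi. f (xi + ze)) = (NF xi. f xi)"
proof -
 obtain s m where z: "ze = (s, m)" by (cases ze)
 have [measurable]: "(%ta. f (ta, n)) : BM borel" for n
  using assms by (simp add: meas_fm_iff)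
 have "(NF xi. f (xi + ze)) = (\<integral>\<^sup>+n. (NT ta. f (ta + s, n + m)) \<partial>count_space UNIV)"
  by (subst nn_integral_fm) (auto simp: z)
 also have "... = (\<integral>\<^sup>+n. (NT ta. f (ta, n + m)) \<partial>count_space UNIV)"
 proof (rule nn_integral_cong)
  fix n show "(NT ta. f (ta + s, n + m)) = (NT ta. f (ta, n + m))"
   using nn_integral_real_affine[of "%ta. f (ta, n + m)" 1 s] by (simp add: add.commute)
 qed
 also have "... = (\<integral>\<^sup>+n. (NT ta. f (ta, n)) \<partial>count_space UNIV)"
  by (rule nn_integral_bij_count_space[of "%n. n + m"]) (rule bij_betw_byWitness[of _ "%n. n - m"]; auto)
 finally show ?thesis by (simp add: nn_integral_fm)
qed

lemma nn_integral_fm_uminus: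
 assumes [measurable]: "f : BM fm"
 shows "(NF xi. f (- xi)) = (NF xi. f xi)"
proof -
 have [measurable]: "(%ta. f (ta, n)) : BM borel" for n
  using assms by (simp add: meas_fm_iff)
 have "(NF xi. f (- xi)) = (\<integral>\<^sup>+n. (NT ta. f (- ta, - n)) \<partial>count_space UNIV)"
  by (subst nn_integral_fm) auto
 also have "... = (\<integral>\<^sup>+n. (NT ta. f (ta, - n)) \<partial>count_space UNIV)"
 proof (rule nn_integral_cong)
  fix n show "(NT ta. f (- ta, - n)) = (NT ta. f (ta, - n))"
   using nn_integral_real_affine[of "%ta. f (ta, - n)" "-1" 0] by simp
 qed
 also have "... = (\<integral>\<^sup>+n. (NT ta. f (ta, n)) \<partial>count_space UNIV)"
  by (rule nn_integral_bij_count_space[of "%n. - n"]) (rule bij_betw_byWitness[of _ "%n. - n"]; auto)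
 finally show ?thesis by (simp add: nn_integral_fm)
qed

lemma nn_integral_fm_reflect:
 assumes [measurable]: "f : BM fm"
 shows "(NF xi. f (ze - xi)) = (NF xi. f xi)"
 using nn_integral_fm_uminus[of "%xi. f (xi + ze)"] nn_integral_fm_translate[of f ze] assms
 by (simp add: add.commute)

section \<open>Lattice sums and convolution of weights\<close>

text \<open>A negative power is dominated by a superposition of indicators of dyadic balls; this turns counting
estimates into bounds for sums.\<close>

lemma dyadic_majorant:
 fixes x a :: real
 assumes "1 <= x" "0 <= a"
 shows "ennreal (x powr (- a)) <= (\<Sum>k. ennreal ((2 powr (- a)) ^ k)*indicator {y. y <= 2 ^ Suc k} x)"
proof -
 define k where "k = nat \<lfloor>log 2 x\<rfloor>"
 have l0: "0 <= log 2 x" using assms by simp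
 then have k: "real k <= log 2 x" "log 2 x < real k + 1" unfolding k_def by (auto simp: of_nat_nat)
 have "2 powr real k <= x" using k assms by (subst powr_le_iff) auto
 have up: "x <= 2 ^ Suc k"
 proof -
  have "x <= 2 powr (real k + 1)" using k assms by (subst le_powr_iff) auto
  then show ?thesis by (simp add: powr_add powr_realpow)
 qed
 have "x powr (- a) <= (2 powr real k) powr (- a)"
  using \<open>2 powr real k <= x\<close> assms by (intro powr_mono2') auto
 also have "... = (2 powr (- a)) ^ k"
  by (simp add: powr_powr mult.commute flip: powr_realpow)
 finally have "ennreal (x powr (- a)) <= ennreal ((2 powr (- a)) ^ k)*indicator {y. y <= 2 ^ Suc k} x"
  using up by (simp add: ennreal_leI)
 also have "... <= (\<Sum>k. ennreal ((2 powr (- a)) ^ k)*indicator {y. y <= 2 ^ Suc k} x)"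
  using sum_le_suminf[OF summableI, of "{k}" "%k. ennreal ((2 powr (- a)) ^ k)*indicator {y. y <= 2 ^ Suc k} x"]
  by (simp del: sum_mult_indicator)
 finally show ?thesis .
qed

lemma suminf_geometric_ennreal:
 fixes r :: real assumes "0 <= r" "r < 1"
 shows "(\<Sum>k. ennreal (r ^ k)) = ennreal (1 / (1 - r))"
proof -
 have "(%k. r ^ k) sums (1 / (1 - r))" using assms geometric_sums[of r] by simp
 then show ?thesis using assms by (intro sums_unique[symmetric]) (simp add: sums_ennreal)
qed

text \<open>The count \<open>R\<^sup>3\<^sup>/\<^sup>2 L\<^sup>1\<^sup>/\<^sup>2\<close> is summed against \<open>R\<^sup>-\<^sup>2\<^sup>\<theta> L\<^sup>-\<^sup>q\<close> over dyadic \<open>R\<close> and \<open>L\<close>; both series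
converge exactly when \<open>\<theta> > 3/4\<close> and \<open>q > 1/2\<close>.\<close>

lemma lattice_sum_bounded:
 fixes tht q :: real
 assumes tht: "3/4 < tht" and q: "1/2 < q"
 shows "EX C>=0. ALL l n. (\<integral>\<^sup>+m. ennreal (jn m powr (- (2*tht))*jb (l - jn m - jn (n - m)) powr (- q)) \<partial>count_space UNIV) <= ennreal C"
proof -
 define r1 where "r1 = 2 powr (3/2 - 2*tht)"
 define r2 where "r2 = 2 powr (1/2 - q)"
 have r1: "0 <= r1" "r1 < 1" and r2: "0 <= r2" "r2 < 1"
  using tht q by (auto simp: r1_def r2_def powr_less_one)
 define C where "C = 48*2 powr (3/2)*2 powr (1/2)*(1 / (1 - r1))*(1 / (1 - r2))"
 have "0 <= C" using r1 r2 by (simp add: C_def)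
 moreover have "(\<integral>\<^sup>+m. ennreal (jn m powr (- (2*tht))*jb (l - jn m - jn (n - m)) powr (- q)) \<partial>count_space UNIV) <= ennreal C" for l n
 proof -
  define d where "d m = l - jn m - jn (n - m)" for m
  define A where "A k = ennreal ((2 powr (- (2*tht))) ^ k)" for k
  define B where "B k = ennreal ((2 powr (- q)) ^ k)" for k
  define S where "S k j = {m. jn m <= 2 ^ Suc k & \<bar>d m\<bar> <= 2 ^ Suc j}" for k j
  have "ennreal (jn m powr (- (2*tht))*jb (d m) powr (- q)) <= (\<Sum>k. \<Sum>j. A k*B j*indicator (S k j) m)" for m
  proof -
   have "ennreal (jn m powr (- (2*tht))*jb (d m) powr (- q)) = ennreal (jn m powr (- (2*tht)))*ennreal (jb (d m) powr (- q))"
    by (simp add: ennreal_mult)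
   also have "... <= (\<Sum>k. A k*indicator {y. y <= 2 ^ Suc k} (jn m))*(\<Sum>j. B j*indicator {y. y <= 2 ^ Suc j} (jb (d m)))"
    unfolding A_def B_def using tht q by (intro mult_mono dyadic_majorant jn_ge1 jb_ge1) auto
   also have "... = (\<Sum>k. \<Sum>j. (A k*indicator {y. y <= 2 ^ Suc k} (jn m))*(B j*indicator {y. y <= 2 ^ Suc j} (jb (d m))))"
    by simp
   also have "... <= (\<Sum>k. \<Sum>j. A k*B j*indicator (S k j) m)"
   proof (intro suminf_le allI summableI)
    fix k j
    show "(A k*indicator {y. y <= 2 ^ Suc k} (jn m))*(B j*indicator {y. y <= 2 ^ Suc j} (jb (d m)))
     <= A k*B j*indicator (S k j) m"
     using abs_le_jb[of "d m"] by (auto simp: S_def split: split_indicator)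
   qed
   finally show ?thesis .
  qed
  then have "(\<integral>\<^sup>+m. ennreal (jn m powr (- (2*tht))*jb (d m) powr (- q)) \<partial>count_space UNIV)
    <= (\<integral>\<^sup>+m. (\<Sum>k. \<Sum>j. A k*B j*indicator (S k j) m) \<partial>count_space UNIV)"
   by (intro nn_integral_mono)
  also have "... = (\<Sum>k. \<Sum>j. A k*B j*emeasure (count_space UNIV) (S k j))"
   by (simp add: nn_integral_suminf nn_integral_cmult)
  also have "... <= (\<Sum>k. \<Sum>j. ennreal (48*2 powr (3/2)*2 powr (1/2))*(ennreal (r1 ^ k)*ennreal (r2 ^ j)))"
  proof (intro suminf_le allI summableI)
   fix k j :: nat
   have c: "finite (S k j)" "real (card (S k j)) <= 48*(2 ^ Suc k) powr (3/2)*(2 ^ Suc j) powr (1/2)"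
    using card_lattice_ellipse[OF one_le_power one_le_power, of 2 2 "Suc k" l n "Suc j"]
    unfolding S_def d_def by simp_all
   have p: "(2 ^ Suc k :: real) powr a = 2 powr a*(2 powr a) ^ k" for a k
    by (simp add: powr_mult powr_powr mult.commute flip: powr_realpow)
   have "emeasure (count_space UNIV) (S k j) = ennreal (real (card (S k j)))"
    using c(1) by (simp add: ennreal_of_nat_eq_real_of_nat)
   also have "... <= ennreal (48*(2 ^ Suc k) powr (3/2)*(2 ^ Suc j) powr (1/2))"
    using c(2) by (rule ennreal_leI)
   finally have "A k*B j*emeasure (count_space UNIV) (S k j)
    <= A k*B j*ennreal (48*(2 ^ Suc k) powr (3/2)*(2 ^ Suc j) powr (1/2))"
    by (intro mult_left_mono) auto
   also have "... = ennreal ((2 powr (- (2*tht))) ^ k*(2 powr (- q)) ^ j*(48*(2 ^ Suc k) powr (3/2)*(2 ^ Suc j) powr (1/2)))"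
    unfolding A_def B_def by (simp add: ennreal_mult)
   also have "(2 powr (- (2*tht))) ^ k*(2 powr (- q)) ^ j*(48*(2 ^ Suc k) powr (3/2)*(2 ^ Suc j) powr (1/2))
    = (48*2 powr (3/2)*2 powr (1/2))*((2 powr (- (2*tht))*2 powr (3/2)) ^ k*(2 powr (- q)*2 powr (1/2)) ^ j)"
    unfolding p power_mult_distrib by simp
   also have "2 powr (- (2*tht))*2 powr (3/2) = r1" unfolding r1_def by (simp flip: powr_add)
   also have "2 powr (- q)*2 powr (1/2) = r2" unfolding r2_def by (simp flip: powr_add)
   finally show "A k*B j*emeasure (count_space UNIV) (S k j)
    <= ennreal (48*2 powr (3/2)*2 powr (1/2))*(ennreal (r1 ^ k)*ennreal (r2 ^ j))"
    using r1 r2 by (simp add: ennreal_mult mult.assoc)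
  qed
  also have "... = ennreal C"
  proof -
   have "(\<Sum>k. \<Sum>j. ennreal (48*2 powr (3/2)*2 powr (1/2))*(ennreal (r1 ^ k)*ennreal (r2 ^ j)))
    = ennreal (48*2 powr (3/2)*2 powr (1/2))*((\<Sum>k. ennreal (r1 ^ k))*(\<Sum>j. ennreal (r2 ^ j)))"
    unfolding ennreal_suminf_cmult ennreal_suminf_multc ..
   also have "... = ennreal (48*2 powr (3/2)*2 powr (1/2))*(ennreal (1 / (1 - r1))*ennreal (1 / (1 - r2)))"
    using r1 r2 by (simp only: suminf_geometric_ennreal)
   also have "... = ennreal C" using r1 r2 unfolding C_def
    by (subst ennreal_mult[symmetric], simp, simp, subst ennreal_mult[symmetric], auto simp: mult.assoc)
   finally show ?thesis .
  qed
  finally show ?thesis by (simp add: d_def)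
 qed
 ultimately show ?thesis by blast
qed

text \<open>One of \<open>\<bar>x\<bar>\<close>, \<open>\<bar>y\<bar>\<close> is at least \<open>\<bar>x + y\<bar>/2\<close>, and its factor provides the power \<open>q\<close> of the sum.\<close>

lemma jb_product_bound:
 fixes x y p q :: real
 assumes q: "0 < q" "q <= p"
 shows "jb x powr (- p)*jb y powr (- q) <= 2 powr q*jb (x + y) powr (- q)*(jb x powr (- p) + jb y powr (- p))"
  (is "?L <= _")
proof -
 have tri: "jb (x + y) <= 2*max (jb x) (jb y)" using jb_triangle2[of x y] by linarith
 have key: "m powr (- q) <= 2 powr q*jb (x + y) powr (- q)" if "jb (x + y) <= 2*m" "0 < m" for m
 proof -
  have "(2*m) powr (- q) <= jb (x + y) powr (- q)" using that jb_pos q by (intro powr_mono2') auto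
  then have "2 powr q*((2*m) powr (- q)) <= 2 powr q*jb (x + y) powr (- q)" by simp
  moreover have "2 powr q*((2*m) powr (- q)) = m powr (- q)"
   using that by (simp add: powr_mult powr_minus field_simps)
  ultimately show ?thesis by simp
 qed
 show ?thesis
 proof (cases "jb x <= jb y")
  case True
  then have "jb y powr (- q) <= 2 powr q*jb (x + y) powr (- q)" using tri jb_pos by (intro key) auto
  then have "?L <= jb x powr (- p)*(2 powr q*jb (x + y) powr (- q))" by (intro mult_left_mono) auto
  also have "... <= 2 powr q*jb (x + y) powr (- q)*(jb x powr (- p) + jb y powr (- p))"
   by (simp add: distrib_left mult_ac)
  finally show ?thesis .
 next
  case False
  then have 1: "jb x powr (- q) <= 2 powr q*jb (x + y) powr (- q)" using tri jb_pos by (intro key) auto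
  have 2: "jb x powr (- (p - q))*jb y powr (- q) <= jb y powr (- p)"
  proof -
   have "jb x powr (- (p - q)) <= jb y powr (- (p - q))" using False jb_pos q by (intro powr_mono2') auto
   then have "jb x powr (- (p - q))*jb y powr (- q) <= jb y powr (- (p - q))*jb y powr (- q)"
    by (rule mult_right_mono) simp
   also have "... = jb y powr (- p)" by (simp flip: powr_add)
   finally show ?thesis .
  qed
  have "?L = jb x powr (- q)*(jb x powr (- (p - q))*jb y powr (- q))"
   by (simp add: mult.assoc[symmetric] flip: powr_add)
  also have "... <= (2 powr q*jb (x + y) powr (- q))*jb y powr (- p)"
   using 1 2 by (intro mult_mono) auto
  also have "... <= 2 powr q*jb (x + y) powr (- q)*(jb x powr (- p) + jb y powr (- p))"
   by (intro mult_left_mono) auto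
  finally show ?thesis .
 qed
qed

lemma jb_measurable[measurable]: "jb : BM borel"
 unfolding jb_def[abs_def] by measurable

lemma nn_integral_jb_shift:
 "(NT mu. ennreal (jb (mu - a) powr (- p))) = (NT mu. ennreal (jb mu powr (- p)))"
 "(NT mu. ennreal (jb (a - mu) powr (- p))) = (NT mu. ennreal (jb mu powr (- p)))"
 using nn_integral_real_affine[of "%mu. ennreal (jb mu powr (- p))" 1 "-a"]
  nn_integral_real_affine[of "%mu. ennreal (jb mu powr (- p))" "-1" a] by simp_all

lemma nn_integral_jb_finite:
 assumes p: "1 < p"
 shows "EX C>=0. (NT mu. ennreal (jb mu powr (- p))) <= ennreal C"
proof -
 define h where "h x = x powr (- p)" for x :: real
 have I: "(NT x. ennreal (h x)*indicator {1..} x) = ennreal (0 - (1 / (1 - p))*1 powr (1 - p))"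
 proof (rule nn_integral_FTC_atLeast[where F="%x. (1 / (1 - p))*x powr (1 - p)" and T=0])
  fix x :: real assume x: "1 <= x"
  show "((%x. (1 / (1 - p))*x powr (1 - p)) has_real_derivative h x) (at x)"
   using DERIV_cmult[OF has_real_derivative_powr[of x "1 - p"], of "1 / (1 - p)"] x p by (simp add: h_def)
  show "0 <= h x" by (simp add: h_def)
 next
  have "((%x::real. x powr (1 - p)) \<longlongrightarrow> 0) at_top"
   using p by (intro tendsto_neg_powr filterlim_ident) auto
  then show "((%x. (1 / (1 - p))*x powr (1 - p)) \<longlongrightarrow> 0) at_top"
   using tendsto_mult_left[of _ 0 _ "1 / (1 - p)"] by fastforce
 qed (simp add: h_def[abs_def])
 have I': "(NT x. ennreal (h (- x))*indicator {1..} (- x)) = (NT x. ennreal (h x)*indicator {1..} x)"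
  using nn_integral_real_affine[of "%x. ennreal (h x)*indicator {1..} x" "-1" 0] by (simp add: h_def[abs_def])
 have "(NT mu. ennreal (jb mu powr (- p))) <= (NT x. indicator {-1..1} x + (ennreal (h x)*indicator {1..} x + ennreal (h (- x))*indicator {1..} (- x)))"
 proof (rule nn_integral_mono)
  fix x :: real
  have a: "jb x powr (- p) <= 1" using powr_mono[of "- p" 0 "jb x"] jb_ge1[of x] jb_pos[of x] p by simp
  have b: "jb x powr (- p) <= \<bar>x\<bar> powr (- p)" if "1 <= \<bar>x\<bar>" using that abs_le_jb[of x] p by (intro powr_mono2') auto
  consider "-1 <= x & x <= 1" | "1 < x" | "x < -1" by linarith
  then show "ennreal (jb x powr (- p)) <= indicator {-1..1} x + (ennreal (h x)*indicator {1..} x + ennreal (h (- x))*indicator {1..} (- x))"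
  proof cases
   case 1 then show ?thesis using a by (auto simp: indicator_def intro: order_trans[OF ennreal_leI[OF a]])
  next
   case 2 then show ?thesis using b by (auto simp: h_def indicator_def ennreal_leI)
  next
   case 3 then show ?thesis using b by (auto simp: h_def indicator_def ennreal_leI)
  qed
 qed
 also have "... = 2 + (ennreal (0 - (1 / (1 - p))*1 powr (1 - p)) + ennreal (0 - (1 / (1 - p))*1 powr (1 - p)))"
  using I I' by (subst nn_integral_add; simp add: h_def[abs_def] nn_integral_add)
 also have "... < \<top>" by simp
 finally show ?thesis by (intro exI[of _ "enn2real (NT mu. ennreal (jb mu powr (- p)))"]) simp
qed

section \<open>Convolution of nonnegative functions\<close>

text \<open>The weights of the spaces as extended nonnegative functions: \<open>wt\<close> is a negative power of the spatial
frequency, \<open>md\<close> a negative power of the modulation, the distance to the cone.\<close>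

definition wt :: "real => frequency => ennreal" where "wt r xi = ennreal (jn (snd xi) powr (- r))"
definition md :: "real => frequency => ennreal" where "md r xi = ennreal (jb (\<bar>fst xi\<bar> - jn (snd xi)) powr (- r))"

lemma jn_snd_measurable[measurable]: "(%xi. jn (snd xi)) : BM fm"
 and fst_fm_measurable[measurable]: "fst : BM fm"
 by (simp_all add: meas_fm_iff)
lemma wt_measurable[measurable]: "wt r : BM fm"
 unfolding wt_def[abs_def] by measurable
lemma md_measurable[measurable]: "md r : BM fm"
 unfolding md_def[abs_def] by measurable
lemma wt_uminus[simp]: "wt r (- xi) = wt r xi" by (simp add: wt_def jn_minus)
lemma md_uminus[simp]: "md r (- xi) = md r xi" by (simp add: md_def jn_minus)

lemma nn_integral_fm_swap:
 assumes [measurable]: "(%(x, y). h x y) : BM (fm \<Otimes>\<^sub>M fm)"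
 shows "(NF x. (NF y. h x y)) = (NF y. (NF x. h x y))"
 using fm2.Fubini'[of "%y x. h x y"] assms by (simp add: measurable_split_conv)

lemma powr_neg_square: "(x powr (- r))^2 = x powr (- (2*r))" for x r :: real
 by (simp add: power2_eq_square flip: powr_add)

text \<open>Without absolute values on the time frequencies, integrating them out convolves the two modulation weights and
leaves a function of \<open>\<langle>m\<rangle> + \<langle>n - m\<rangle>\<close>, to which the lattice sum applies.\<close>

lemma ellipse_kernel_bounded:
 fixes tht p1 p2 :: real
 assumes tht: "3/4 < tht" and p: "1/2 < p1" "1/2 < p2" "1 < max p1 p2"
 shows "EX C>=0. ALL ze. (NF xi. ennreal (jn (snd xi) powr (- (2*tht))*(jb (fst xi - jn (snd xi)) powr (- p1)
      * jb (fst (ze - xi) - jn (snd (ze - xi))) powr (- p2)))) <= ennreal C"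
proof -
 define q where "q = min p1 p2"
 define P where "P = max p1 p2"
 have q: "1/2 < q" "q <= P" "1 < P" using p by (auto simp: q_def P_def)
 obtain C1 where C1: "0 <= C1" and C1b: "!!l n. (\<integral>\<^sup>+m. ennreal (jn m powr (- (2*tht))*jb (l - jn m - jn (n - m)) powr (- q)) \<partial>count_space UNIV) <= ennreal C1"
  using lattice_sum_bounded[OF tht q(1)] by blast
 obtain C2 where C2: "0 <= C2" "(NT mu. ennreal (jb mu powr (- P))) <= ennreal C2"
  using nn_integral_jb_finite[OF q(3)] by blast
 have pw: "jb x powr (- p1)*jb y powr (- p2) <= 2 powr q*jb (x + y) powr (- q)*(jb x powr (- P) + jb y powr (- P))" for x y
 proof (cases "p1 <= p2")
  case True
  then show ?thesis using jb_product_bound[of q P y x] q p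
   by (simp add: q_def P_def add.commute mult.commute)
 next
  case False
  then show ?thesis using jb_product_bound[of q P x y] q p
   by (simp add: q_def P_def add.commute mult.commute)
 qed
 define C where "C = 2 powr q*(2*C2)*C1"
 have "(NF xi. ennreal (jn (snd xi) powr (- (2*tht))*(jb (fst xi - jn (snd xi)) powr (- p1)
      * jb (fst (ze - xi) - jn (snd (ze - xi))) powr (- p2)))) <= ennreal C" (is "?I <= _") for ze
 proof -
  obtain l n where z: "ze = (l, n)" by (cases ze)
  define D where "D m = jb (l - jn m - jn (n - m)) powr (- q)" for m
  have "?I = (\<integral>\<^sup>+m. (NT ta. ennreal (jn m powr (- (2*tht))*(jb (ta - jn m) powr (- p1)
      * jb (l - ta - jn (n - m)) powr (- p2)))) \<partial>count_space UNIV)"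
   by (subst nn_integral_fm) (auto simp: z)
  also have "... <= (\<integral>\<^sup>+m. ennreal (2 powr q*(2*C2))*ennreal (jn m powr (- (2*tht))*D m) \<partial>count_space UNIV)"
  proof (rule nn_integral_mono)
   fix m
   have "(NT ta. ennreal (jn m powr (- (2*tht))*(jb (ta - jn m) powr (- p1)*jb (l - ta - jn (n - m)) powr (- p2))))
    <= (NT ta. ennreal (2 powr q*(jn m powr (- (2*tht))*D m)) *
       (ennreal (jb (ta - jn m) powr (- P)) + ennreal (jb ((l - jn (n - m)) - ta) powr (- P))))"
   proof (rule nn_integral_mono)
    fix ta :: real
    have "jb (ta - jn m) powr (- p1)*jb (l - ta - jn (n - m)) powr (- p2)
      <= 2 powr q*D m*(jb (ta - jn m) powr (- P) + jb (l - ta - jn (n - m)) powr (- P))"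
     using pw[of "ta - jn m" "l - ta - jn (n - m)"] by (simp add: D_def algebra_simps)
    then have "jn m powr (- (2*tht))*(jb (ta - jn m) powr (- p1)*jb (l - ta - jn (n - m)) powr (- p2))
      <= jn m powr (- (2*tht))*(2 powr q*D m*(jb (ta - jn m) powr (- P) + jb (l - ta - jn (n - m)) powr (- P)))"
     by (intro mult_left_mono) auto
    also have "... = (2 powr q*(jn m powr (- (2*tht))*D m))*(jb (ta - jn m) powr (- P) + jb ((l - jn (n - m)) - ta) powr (- P))"
     by (simp add: algebra_simps)
    finally show "ennreal (jn m powr (- (2*tht))*(jb (ta - jn m) powr (- p1)*jb (l - ta - jn (n - m)) powr (- p2)))
     <= ennreal (2 powr q*(jn m powr (- (2*tht))*D m)) *
       (ennreal (jb (ta - jn m) powr (- P)) + ennreal (jb ((l - jn (n - m)) - ta) powr (- P)))"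
     by (simp add: D_def ennreal_leI flip: ennreal_mult ennreal_plus)
   qed
   also have "... = ennreal (2 powr q*(jn m powr (- (2*tht))*D m))*((NT mu. ennreal (jb mu powr (- P))) + (NT mu. ennreal (jb mu powr (- P))))"
    by (subst nn_integral_cmult, measurable, subst nn_integral_add, measurable) (simp add: nn_integral_jb_shift)
   also have "... <= ennreal (2 powr q*(jn m powr (- (2*tht))*D m))*(ennreal C2 + ennreal C2)"
    by (intro mult_left_mono add_mono C2) auto
   also have "... = ennreal (2 powr q*(2*C2))*ennreal (jn m powr (- (2*tht))*D m)"
    using C2 by (simp add: D_def algebra_simps flip: ennreal_mult ennreal_plus)
   finally show "(NT ta. ennreal (jn m powr (- (2*tht))*(jb (ta - jn m) powr (- p1)*jb (l - ta - jn (n - m)) powr (- p2))))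
    <= ennreal (2 powr q*(2*C2))*ennreal (jn m powr (- (2*tht))*D m)" .
  qed
  also have "... = ennreal (2 powr q*(2*C2))*(\<integral>\<^sup>+m. ennreal (jn m powr (- (2*tht))*D m) \<partial>count_space UNIV)"
   by (rule nn_integral_cmult) simp
  also have "... <= ennreal (2 powr q*(2*C2))*ennreal C1"
   unfolding D_def by (intro mult_left_mono C1b) auto
  also have "... = ennreal C" unfolding C_def using C1 C2 by (simp flip: ennreal_mult)
  finally show ?thesis .
 qed
 moreover have "0 <= C" using C1 C2 by (simp add: C_def)
 ultimately show ?thesis by blast
qed

definition csq :: "(frequency => ennreal) => (frequency => ennreal) => ennreal" where
 "csq F G = (NF ze. (NF xi. F xi*G (ze - xi))^2)"

text \<open>Expanded as a quadrilinear form the square depends only on the two autocorrelations, and for nonnegative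
functions each of these is invariant under reflection of its function.\<close>

lemma csq_expand:
 assumes [measurable]: "F : BM fm" "G : BM fm"
 shows "csq F G = (NF x. (NF y. F x*F y*(NF ze. G (ze - x)*G (ze - y))))"
proof -
 have "csq F G = (NF ze. (NF x. (NF y. (F x*G (ze - x))*(F y*G (ze - y)))))"
  unfolding csq_def power2_eq_square
  by (simp add: nn_integral_cmult nn_integral_multc)
 also have "... = (NF x. (NF ze. (NF y. (F x*G (ze - x))*(F y*G (ze - y)))))"
  by (rule nn_integral_fm_swap) measurable
 also have "... = (NF x. (NF y. (NF ze. (F x*G (ze - x))*(F y*G (ze - y)))))"
  by (intro nn_integral_cong nn_integral_fm_swap) measurable
 also have "... = (NF x. (NF y. F x*F y*(NF ze. G (ze - x)*G (ze - y))))"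
  by (intro nn_integral_cong) (simp add: nn_integral_cmult[symmetric] mult_ac)
 finally show ?thesis .
qed

text \<open>This is the reason why only time frequencies of equal sign have to be treated: reflecting one factor
changes \<open>F * G\<close> but not its \<open>L\<^sup>2\<close> norm.\<close>

lemma csq_flip_right:
 assumes [measurable]: "F : BM fm" "G : BM fm"
 shows "csq F (%xi. G (- xi)) = csq F G"
proof -
 have "(NF ze. G (- (ze - x))*G (- (ze - y))) = (NF ze. G (ze - x)*G (ze - y))" for x y
  using nn_integral_fm_reflect[of "%ze. G (ze - x)*G (ze - y)" "x + y"] by (simp add: mult.commute)
 then show ?thesis by (simp add: csq_expand)
qed

lemma csq_commute:
 assumes [measurable]: "F : BM fm" "G : BM fm"
 shows "csq F G = csq G F"
proof -
 have "(NF xi. F xi*G (ze - xi)) = (NF xi. G xi*F (ze - xi))" for ze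
  using nn_integral_fm_reflect[of "%xi. F xi*G (ze - xi)" ze] by (simp add: mult.commute)
 then show ?thesis by (simp add: csq_def)
qed

lemma csq_flip_left:
 assumes [measurable]: "F : BM fm" "G : BM fm"
 shows "csq (%xi. F (- xi)) G = csq F G"
 using csq_flip_right[of G F] csq_commute[of F G] csq_commute[of "%xi. F (- xi)" G] by simp

lemma ennreal_square_add_le: "(a + b)^2 <= 2*a^2 + 2*b^2" for a b :: ennreal
proof (cases a; cases b)
 fix x y :: real assume ab: "a = ennreal x" "0 <= x" "b = ennreal y" "0 <= y"
 have "(x + y)^2 <= 2*x^2 + 2*y^2"
  using zero_le_power2[of "x - y"] by (simp add: power2_eq_square algebra_simps)
 moreover have "2*(ennreal x)^2 + 2*(ennreal y)^2 = ennreal (2*x^2 + 2*y^2)"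
  using ab by (simp add: ennreal_power ennreal_mult)
 moreover have "(ennreal x + ennreal y)^2 = ennreal ((x + y)^2)"
  using ab by (simp add: ennreal_power flip: ennreal_plus)
 ultimately show ?thesis using ab by (simp only: ennreal_leI)
qed (auto simp: power2_eq_square ennreal_mult_top ennreal_top_mult)

lemma csq_add_left:
 assumes [measurable]: "F : BM fm" "F' : BM fm" "G : BM fm"
 shows "csq (%xi. F xi + F' xi) G <= 2*csq F G + 2*csq F' G"
proof -
 have "csq (%xi. F xi + F' xi) G = (NF ze. ((NF xi. F xi*G (ze - xi)) + (NF xi. F' xi*G (ze - xi)))^2)"
  unfolding csq_def by (simp add: distrib_right nn_integral_add)
 also have "... <= (NF ze. 2*(NF xi. F xi*G (ze - xi))^2 + 2*(NF xi. F' xi*G (ze - xi))^2)"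
  by (intro nn_integral_mono ennreal_square_add_le)
 also have "... = 2*csq F G + 2*csq F' G"
  unfolding csq_def by (simp add: nn_integral_add nn_integral_cmult)
 finally show ?thesis .
qed

text \<open>Cauchy--Schwarz in the convolution integral, with the kernel bounded uniformly.\<close>

lemma bilinear_same_sign:
 fixes tht p1 p2 :: real
 assumes "3/4 < tht" and "1/2 < p1" "1/2 < p2" "1 < max p1 p2"
 shows "EX C>=0. ALL f:BM fm. ALL g:BM fm.
   (ALL xi. fst xi < 0 --> f xi = 0) --> (ALL xi. fst xi < 0 --> g xi = 0) -->
   csq (%xi. wt tht xi*md (p1 / 2) xi*f xi) (%xi. md (p2 / 2) xi*g xi)
    <= ennreal C*((NF xi. (f xi)^2)*(NF xi. (g xi)^2))"
proof -
 obtain C where C: "0 <= C" and Cb: "!!ze. (NF xi. ennreal (jn (snd xi) powr (- (2*tht))*(jb (fst xi - jn (snd xi)) powr (- p1)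
      * jb (fst (ze - xi) - jn (snd (ze - xi))) powr (- p2)))) <= ennreal C"
  using ellipse_kernel_bounded[OF assms] by blast
 have "csq (%xi. wt tht xi*md (p1 / 2) xi*f xi) (%xi. md (p2 / 2) xi*g xi)
    <= ennreal C*((NF xi. (f xi)^2)*(NF xi. (g xi)^2))"
  if [measurable]: "f : BM fm" "g : BM fm"
   and sf: "!!xi. fst xi < 0 ==> f xi = 0" and sg: "!!xi. fst xi < 0 ==> g xi = 0" for f g
 proof -
  define A where "A ze xi = ennreal (jn (snd xi) powr (- tht)*(jb (fst xi - jn (snd xi)) powr (- (p1 / 2))
      * jb (fst (ze - xi) - jn (snd (ze - xi))) powr (- (p2 / 2))))" for ze xi :: frequency
  have [measurable]: "(%(ze, xi). A ze xi) : BM (fm \<Otimes>\<^sub>M fm)"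
   unfolding A_def by measurable
  have [measurable]: "A ze : BM fm" for ze
   unfolding A_def by measurable
  have "csq (%xi. wt tht xi*md (p1 / 2) xi*f xi) (%xi. md (p2 / 2) xi*g xi)
   = (NF ze. (NF xi. A ze xi*(f xi*g (ze - xi)))^2)"
   unfolding csq_def
  proof (intro nn_integral_cong arg_cong[where f="%x. x^2"])
   fix ze xi
   show "wt tht xi*md (p1 / 2) xi*f xi*(md (p2 / 2) (ze - xi)*g (ze - xi)) = A ze xi*(f xi*g (ze - xi))"
   proof (cases "fst xi < 0 | fst (ze - xi) < 0")
    case True then show ?thesis using sf[of xi] sg[of "ze - xi"] by auto
   next
    case False then show ?thesis
     by (simp add: wt_def md_def A_def ennreal_mult mult_ac)
   qed
  qed
  also have "... <= (NF ze. ennreal C*(NF xi. (f xi*g (ze - xi))^2))"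
  proof (rule nn_integral_mono)
   fix ze
   have "(NF xi. A ze xi*(f xi*g (ze - xi)))^2 <= (NF xi. (A ze xi)^2)*(NF xi. (f xi*g (ze - xi))^2)"
    by (rule Cauchy_Schwarz_nn_integral) measurable
   also have "(NF xi. (A ze xi)^2) <= ennreal C"
    using Cb[of ze] unfolding A_def by (simp add: ennreal_power power_mult_distrib powr_neg_square)
   finally show "(NF xi. A ze xi*(f xi*g (ze - xi)))^2 <= ennreal C*(NF xi. (f xi*g (ze - xi))^2)"
    by (simp add: mult_right_mono)
  qed
  also have "... = ennreal C*(NF ze. (NF xi. (f xi)^2*(g (ze - xi))^2))"
   by (simp add: nn_integral_cmult power_mult_distrib)
  also have "(NF ze. (NF xi. (f xi)^2*(g (ze - xi))^2)) = (NF xi. (NF ze. (f xi)^2*(g (ze - xi))^2))"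
   by (rule nn_integral_fm_swap) measurable
  also have "... = (NF xi. (f xi)^2*(NF ze. (g ze)^2))"
  proof (rule nn_integral_cong)
   fix xi
   have "(NF ze. (g (ze - xi))^2) = (NF ze. (g ze)^2)"
    using nn_integral_fm_translate[of "%ze. (g ze)^2" "- xi"] by simp
   then show "(NF ze. (f xi)^2*(g (ze - xi))^2) = (f xi)^2*(NF ze. (g ze)^2)"
    by (simp add: nn_integral_cmult)
  qed
  also have "... = (NF xi. (f xi)^2)*(NF xi. (g xi)^2)"
   by (simp add: nn_integral_multc)
  finally show ?thesis .
 qed
 then show ?thesis using C by (intro exI[of _ C]) auto
qed

section \<open>The bilinear estimate\<close>

text \<open>Each function is split by the sign of its time frequency. The four products reduce to equal signs by
reflecting one factor.\<close>

lemma bilinear_estimate_left: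
 fixes tht p1 p2 :: real
 assumes "3/4 < tht" and "1/2 < p1" "1/2 < p2" "1 < max p1 p2"
 shows "EX C>=0. ALL f:BM fm. ALL g:BM fm.
   csq (%xi. wt tht xi*md (p1 / 2) xi*f xi) (%xi. md (p2 / 2) xi*g xi)
    <= ennreal C*((NF xi. (f xi)^2)*(NF xi. (g xi)^2))"
proof -
 obtain C where C: "0 <= C" and Cb: "ALL f:BM fm. ALL g:BM fm.
   (ALL xi. fst xi < 0 --> f xi = 0) --> (ALL xi. fst xi < 0 --> g xi = 0) -->
   csq (%xi. wt tht xi*md (p1 / 2) xi*f xi) (%xi. md (p2 / 2) xi*g xi)
    <= ennreal C*((NF xi. (f xi)^2)*(NF xi. (g xi)^2))"
  using bilinear_same_sign[OF assms] by (elim exE conjE) (rule that)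
 have "csq (%xi. wt tht xi*md (p1 / 2) xi*f xi) (%xi. md (p2 / 2) xi*g xi)
    <= ennreal (16*C)*((NF xi. (f xi)^2)*(NF xi. (g xi)^2))" (is "?L <= _ * (?f*?g)")
  if [measurable]: "f : BM fm" "g : BM fm" for f g
 proof -
  define P where "P h = (%xi. h xi*indicator {xi. 0 <= fst xi} xi)" for h :: "frequency => ennreal"
  define N where "N h = (%xi. h (- xi)*indicator {xi. 0 < fst xi} xi)" for h :: "frequency => ennreal"
  have "{xi\<in>space fm. 0 <= fst xi} : sets fm" "{xi\<in>space fm. 0 < fst xi} : sets fm" by measurable
  then have [measurable]: "{xi. 0 <= fst xi} : sets fm" "{xi. 0 < fst xi} : sets fm" by simp_all
  have PN[measurable]: "P h : BM fm" "N h : BM fm" if [measurable]: "h : BM fm" for h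
   unfolding P_def N_def by measurable
  have split: "h xi = P h xi + N h (- xi)" for h xi
   by (auto simp: P_def N_def indicator_def)
  have supp: "P h xi = 0" "N h xi = 0" if "fst xi < 0" for h xi
   using that by (auto simp: P_def N_def)
  have Ple: "(NF xi. (P h xi)^2) <= (NF xi. (h xi)^2)" for h
   by (intro nn_integral_mono) (auto simp: P_def indicator_def)
  have Nle: "(NF xi. (N h xi)^2) <= (NF xi. (h xi)^2)" if [measurable]: "h : BM fm" for h
  proof -
   have "(NF xi. (N h xi)^2) <= (NF xi. (h (- xi))^2)"
    by (intro nn_integral_mono) (auto simp: N_def indicator_def)
   also have "... = (NF xi. (h xi)^2)" by (rule nn_integral_fm_uminus) measurable
   finally show ?thesis .
  qed
  define A where "A h = (%xi. wt tht xi*md (p1 / 2) xi*h xi)" for h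
  define B where "B h = (%xi. md (p2 / 2) xi*h xi)" for h
  have mA[measurable]: "A h : BM fm" "B h : BM fm" if [measurable]: "h : BM fm" for h
   unfolding A_def B_def by measurable
  have flip: "A (%xi. h (- xi)) = (%xi. A h (- xi))" "B (%xi. h (- xi)) = (%xi. B h (- xi))" for h
   by (simp_all add: A_def B_def)
  have bd: "csq (A h) (B k) <= ennreal C*(?f*?g)"
   if "h : {P f, N f}" "k : {P g, N g}" for h k
  proof -
   have "csq (A h) (B k) <= ennreal C*((NF xi. (h xi)^2)*(NF xi. (k xi)^2))"
    unfolding A_def B_def using that supp by (intro Cb[rule_format]) auto
   also have "... <= ennreal C*(?f*?g)"
    using that Ple[of f] Ple[of g] Nle[of f] Nle[of g] by (intro mult_left_mono mult_mono) auto
   finally show ?thesis .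
  qed
  have bdk: "csq (A h) (B g) <= 4*(ennreal C*(?f*?g))" if h: "h : {P f, N f}" for h
  proof -
   have [measurable]: "h : BM fm" using h by auto
   have "B g = (%xi. B (P g) xi + B (N g) (- xi))"
    by (rule ext) (simp add: B_def split[of g] distrib_left[symmetric])
   then have "csq (A h) (B g) = csq (%xi. B (P g) xi + B (N g) (- xi)) (A h)"
    using csq_commute[of "A h" "B g"] by simp
   also have "... <= 2*csq (B (P g)) (A h) + 2*csq (%xi. B (N g) (- xi)) (A h)"
    by (rule csq_add_left) measurable
   also have "... = 2*csq (A h) (B (P g)) + 2*csq (A h) (B (N g))"
    by (simp add: csq_flip_left csq_commute[of "A h"])
   also have "... <= 2*(ennreal C*(?f*?g)) + 2*(ennreal C*(?f*?g))"
    using bd h by (intro add_mono mult_left_mono) auto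
   also have "... = 4*(ennreal C*(?f*?g))"
    by (simp flip: distrib_right)
   finally show ?thesis .
  qed
  have "A f = (%xi. A (P f) xi + A (N f) (- xi))"
   by (rule ext) (simp add: A_def split[of f] distrib_left[symmetric])
  then have "csq (A f) (B g) = csq (%xi. A (P f) xi + A (N f) (- xi)) (B g)" by simp
  also have "... <= 2*csq (A (P f)) (B g) + 2*csq (%xi. A (N f) (- xi)) (B g)"
   by (rule csq_add_left) measurable
  also have "... = 2*csq (A (P f)) (B g) + 2*csq (A (N f)) (B g)"
   by (simp add: csq_flip_left)
  also have "... <= 2*(4*(ennreal C*(?f*?g))) + 2*(4*(ennreal C*(?f*?g)))"
   using bdk by (intro add_mono mult_left_mono) auto
  also have "... = ennreal (16*C)*(?f*?g)"
   using C by (simp add: ennreal_mult mult.assoc flip: distrib_right)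
  finally show ?thesis by (simp add: A_def B_def)
 qed
 then show ?thesis using C by (intro exI[of _ "16*C"]) auto
qed

text \<open>The weight may sit on either factor, hence on the smaller of the two frequencies up to a constant.\<close>

lemma bilinear_estimate:
 fixes tht p1 p2 :: real
 assumes "3/4 < tht" and "1/2 < p1" "1/2 < p2" "1 < max p1 p2"
 shows "EX C>=0. ALL f:BM fm. ALL g:BM fm.
   (NF ze. (NF xi. (wt tht xi + wt tht (ze - xi))*((md (p1 / 2) xi*f xi)*(md (p2 / 2) (ze - xi)*g (ze - xi))))^2)
    <= ennreal C*((NF xi. (f xi)^2)*(NF xi. (g xi)^2))"
proof -
 obtain C where C: "0 <= C" and Cb: "ALL f:BM fm. ALL g:BM fm.
   csq (%xi. wt tht xi*md (p1 / 2) xi*f xi) (%xi. md (p2 / 2) xi*g xi)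
    <= ennreal C*((NF xi. (f xi)^2)*(NF xi. (g xi)^2))"
  using bilinear_estimate_left[OF assms] by (elim exE conjE) (rule that)
 obtain D where D: "0 <= D" and Db: "ALL f:BM fm. ALL g:BM fm.
   csq (%xi. wt tht xi*md (p2 / 2) xi*f xi) (%xi. md (p1 / 2) xi*g xi)
    <= ennreal D*((NF xi. (f xi)^2)*(NF xi. (g xi)^2))"
  using bilinear_estimate_left[OF assms(1,3,2) assms(4)[unfolded max.commute[of p1]]] by (elim exE conjE) (rule that)
 have "(NF ze. (NF xi. (wt tht xi + wt tht (ze - xi))*((md (p1 / 2) xi*f xi)*(md (p2 / 2) (ze - xi)*g (ze - xi))))^2)
    <= ennreal (2*C + 2*D)*((NF xi. (f xi)^2)*(NF xi. (g xi)^2))" (is "?L <= _ * (?f*?g)")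
  if [measurable]: "f : BM fm" "g : BM fm" for f g
 proof -
  define F where "F = (%xi. md (p1 / 2) xi*f xi)"
  define G where "G = (%xi. md (p2 / 2) xi*g xi)"
  have [measurable]: "F : BM fm" "G : BM fm" by (simp_all add: F_def G_def)
  have "?L = (NF ze. ((NF xi. (wt tht xi*F xi)*G (ze - xi)) + (NF xi. F xi*(wt tht (ze - xi)*G (ze - xi))))^2)"
   by (subst nn_integral_add[symmetric]) (auto simp: F_def G_def distrib_right distrib_left mult_ac)
  also have "... <= (NF ze. 2*(NF xi. (wt tht xi*F xi)*G (ze - xi))^2 + 2*(NF xi. F xi*(wt tht (ze - xi)*G (ze - xi)))^2)"
   by (intro nn_integral_mono ennreal_square_add_le)
  also have "... = 2*csq (%xi. wt tht xi*F xi) G + 2*csq F (%xi. wt tht xi*G xi)"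
   unfolding csq_def by (simp add: nn_integral_add nn_integral_cmult)
  also have "csq F (%xi. wt tht xi*G xi) = csq (%xi. wt tht xi*G xi) F"
   by (rule csq_commute) measurable
  also have "2*csq (%xi. wt tht xi*F xi) G + 2*csq (%xi. wt tht xi*G xi) F
    <= 2*(ennreal C*(?f*?g)) + 2*(ennreal D*(?g*?f))"
   using Cb[rule_format, of f g] Db[rule_format, of g f] unfolding F_def G_def by (intro add_mono mult_left_mono) (auto simp: mult.assoc)
  also have "... = ennreal (2*C + 2*D)*(?f*?g)"
   using C D by (simp add: ennreal_mult distrib_right distrib_left mult_ac)
  finally show ?thesis .
 qed
 then show ?thesis using C D by (intro exI[of _ "2*C + 2*D"]) auto
qed

text \<open>The converse of Cauchy--Schwarz: testing against truncations of the function itself.\<close>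

lemma nn_integral_square_le_by_duality:
 assumes "sigma_finite_measure M" and [measurable]: "h : BM M"
  and K: "!!f. f : BM M ==> (\<integral>\<^sup>+x. h x*f x \<partial>M)^2 <= K*(\<integral>\<^sup>+x. (f x)\<^sup>2 \<partial>M)"
 shows "(\<integral>\<^sup>+x. (h x)\<^sup>2 \<partial>M) <= (K::ennreal)"
proof -
 interpret sigma_finite_measure M by fact
 obtain A :: "nat => 'a set" where A: "range A \<subseteq> sets M" "(\<Union>i. A i) = space M" "!!i. emeasure M (A i) ~= \<infinity>" "incseq A"
  using sigma_finite_incseq by blast
 define f where "f i x = min (h x) (of_nat i)*indicator (A i) x" for i x
 have [measurable]: "A i : sets M" for i using A by auto
 have [measurable]: "f i : BM M" for i unfolding f_def by measurable
 have inc: "incseq (%i. f i x)" for x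
 proof (rule incseq_SucI)
  fix i
  have "min (h x) (of_nat i) <= min (h x) (of_nat (Suc i))" by (intro min.mono) auto
  moreover have "indicator (A i) x <= (indicator (A (Suc i)) x :: ennreal)"
   using A(4) by (auto simp: indicator_def dest: incseq_SucD)
  ultimately show "f i x <= f (Suc i) x" unfolding f_def by (rule mult_mono) auto
 qed
 have sup: "(SUP i. (f i x)\<^sup>2) = (h x)^2" if x: "x : space M" for x
 proof -
  obtain j where j: "x : A j" using A(2) x by blast
  have "(%i. f i x) \<longlonglongrightarrow> h x"
  proof (rule Lim_transform_eventually)
   have "(%i. min (h x) (of_nat i)) \<longlonglongrightarrow> min (h x) \<top>"
    by (intro tendsto_min tendsto_const of_nat_tendsto_top_ennreal)
   then show "(%i. min (h x) (of_nat i)) \<longlonglongrightarrow> h x" by (simp add: min_def)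
   show "\<forall>\<^sub>F i in sequentially. min (h x) (of_nat i) = f i x"
    using eventually_ge_at_top[of j] by eventually_elim (use j A(4) in \<open>auto simp: f_def incseq_def indicator_def\<close>)
  qed
  then have "(%i. f i x*f i x) \<longlonglongrightarrow> h x*h x" by (intro tendsto_mult_ennreal) auto
  moreover have "incseq (%i. f i x*f i x)" using inc[of x] by (auto simp: incseq_def intro!: mult_mono)
  ultimately show ?thesis using LIMSEQ_unique LIMSEQ_SUP unfolding power2_eq_square by blast
 qed
 have le: "(\<integral>\<^sup>+x. (f i x)\<^sup>2 \<partial>M) <= K" for i
 proof -
  define X where "X = (\<integral>\<^sup>+x. (f i x)\<^sup>2 \<partial>M)"
  have "X <= (\<integral>\<^sup>+x. (of_nat i)\<^sup>2*indicator (A i) x \<partial>M)"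
   unfolding X_def by (intro nn_integral_mono) (auto simp: f_def indicator_def intro!: power_mono)
  also have "... < \<top>" using A(3)[of i] by (simp add: nn_integral_cmult_indicator ennreal_mult_less_top less_top power_less_top_ennreal of_nat_less_top)
  finally have fin: "X < \<top>" .
  have "X <= (\<integral>\<^sup>+x. h x*f i x \<partial>M)"
   unfolding X_def by (intro nn_integral_mono) (auto simp: f_def power2_eq_square indicator_def intro!: mult_right_mono)
  then have "X^2 <= (\<integral>\<^sup>+x. h x*f i x \<partial>M)^2" by (intro power_mono) auto
  also have "... <= K*X" unfolding X_def by (rule K) measurable
  finally have XK: "X*X <= K*X" by (simp add: power2_eq_square)
  show "X <= K"
  proof (cases "X = 0 | K = \<top>")
   case False
   obtain x k where xk: "X = ennreal x" "0 <= x" "K = ennreal k" "0 <= k"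
    using False fin by (cases X; cases K) auto
   then have "x*x <= k*x" using XK by (simp flip: ennreal_mult)
   moreover have "0 < x" using False xk by auto
   ultimately show ?thesis using xk by (simp add: ennreal_leI)
  qed auto
 qed
 have "(\<integral>\<^sup>+x. (h x)\<^sup>2 \<partial>M) = (\<integral>\<^sup>+x. (SUP i. (f i x)\<^sup>2) \<partial>M)"
  using sup by (intro nn_integral_cong) auto
 also have "... = (SUP i. \<integral>\<^sup>+x. (f i x)\<^sup>2 \<partial>M)"
  using inc by (intro nn_integral_monotone_convergence_SUP) (auto simp: incseq_def le_fun_def intro!: power_mono)
 also have "... <= K" using le by (intro SUP_least)
 finally show ?thesis .
qed

section \<open>The trilinear estimate\<close>

text \<open>Both sides have the same total exponent \<open>- 2 s - 1\<close>; on the left part of it sits on the larger numbers, and is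
moved to the two smallest in equal shares.\<close>

lemma powr_two_smallest:
 fixes a b c d x s :: real
 assumes ge1: "1 <= a" "1 <= b" and ord: "a <= c" "a <= d" "b <= c" "b <= d"
  and x: "x : {a, b, c, d}" and s: "1/4 <= s" "s <= 1"
 shows "a powr (- s)*b powr (- s)*c powr (- s)*d powr (- s)*x powr (2 * s - 1)
  <= a powr (- (s + 1/2))*b powr (- (s + 1/2))"
proof -
 define m where "m = min c d"
 define D where "D = max c d"
 have m: "a <= m" "b <= m" "m <= D" "m > 0" "D > 0" "1 <= c" "1 <= d" using ge1 ord by (auto simp: m_def D_def)
 have cd: "c powr (- s)*d powr (- s) = m powr (- s)*D powr (- s)"
  unfolding m_def D_def by (auto simp: min_def max_def)
 have half: "m powr (- 1) <= a powr (- (1/2))*b powr (- (1/2))"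
 proof -
  have "m powr (- 1) = m powr (- (1/2))*m powr (- (1/2))" by (simp flip: powr_add)
  also have "... <= a powr (- (1/2))*b powr (- (1/2))"
   using m ge1 by (intro mult_mono powr_mono2') auto
  finally show ?thesis .
 qed
 have key: "m powr (- s)*D powr (- s)*x powr (2 * s - 1) <= a powr (- (1/2))*b powr (- (1/2))"
 proof (cases "1/2 <= s")
  case True
  have "x powr (2 * s - 1) <= D powr (2 * s - 1)"
   using True x ge1 ord by (intro powr_mono2) (auto simp: D_def)
  then have "m powr (- s)*D powr (- s)*x powr (2 * s - 1) <= m powr (- s)*D powr (- s)*D powr (2 * s - 1)"
   by (intro mult_left_mono) auto
  also have "... = m powr (- s)*D powr (- (1 - s))" by (simp add: mult.assoc flip: powr_add)
  also have "... <= m powr (- s)*m powr (- (1 - s))" using m s by (intro mult_left_mono powr_mono2') auto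
  also have "... = m powr (- 1)" by (simp flip: powr_add)
  finally show ?thesis using half by linarith
 next
  case False
  have Dm: "m powr (- s)*D powr (- s) <= m powr (- (2 * s))"
  proof -
   have "m powr (- s)*D powr (- s) <= m powr (- s)*m powr (- s)" using m s by (intro mult_left_mono powr_mono2') auto
   then show ?thesis by (simp flip: powr_add)
  qed
  have low: "m powr (- (2 * s))*y powr (2 * s - 1) <= y powr (- (1/2))*z powr (- (1/2))"
   if yz: "1 <= y" "1 <= z" "y <= m" "z <= m" for y z
  proof -
   have "m powr (- (2 * s)) = m powr (- (1/2))*m powr (- (2 * s - 1/2))" by (simp flip: powr_add)
   also have "... <= z powr (- (1/2))*y powr (- (2 * s - 1/2))"
    using yz s by (intro mult_mono powr_mono2') auto
   finally have "m powr (- (2 * s))*y powr (2 * s - 1) <= z powr (- (1/2))*y powr (- (2 * s - 1/2))*y powr (2 * s - 1)"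
    by (rule mult_right_mono) simp
   also have "... = y powr (- (1/2))*z powr (- (1/2))" by (simp add: mult.assoc flip: powr_add)
   finally show ?thesis .
  qed
  have "m powr (- (2 * s))*x powr (2 * s - 1) <= a powr (- (1/2))*b powr (- (1/2))"
  proof (cases "x = a | x = b")
   case True
   then show ?thesis using low[of a b] low[of b a] m ge1 by (auto simp: mult.commute)
  next
   case xf: False
   then have "m <= x" using x by (auto simp: m_def)
   then have "x powr (2 * s - 1) <= m powr (2 * s - 1)" using False m by (intro powr_mono2') auto
   then have "m powr (- (2 * s))*x powr (2 * s - 1) <= m powr (- (2 * s))*m powr (2 * s - 1)"
    by (intro mult_left_mono) auto
   also have "... = m powr (- 1)" by (simp flip: powr_add)
   finally show ?thesis using half by linarith
  qed
  moreover have "m powr (- s)*D powr (- s)*x powr (2 * s - 1) <= m powr (- (2 * s))*x powr (2 * s - 1)"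
   using Dm by (rule mult_right_mono) simp
  ultimately show ?thesis by linarith
 qed
 have "a powr (- s)*b powr (- s)*c powr (- s)*d powr (- s)*x powr (2 * s - 1)
   = a powr (- s)*b powr (- s)*(m powr (- s)*D powr (- s)*x powr (2 * s - 1))"
  using cd by (simp add: mult.assoc)
 also have "... <= a powr (- s)*b powr (- s)*(a powr (- (1/2))*b powr (- (1/2)))"
  by (intro mult_left_mono key) auto
 also have "... = a powr (- (s + 1/2))*b powr (- (s + 1/2))"
 proof -
  have e: "t powr (- (s + 1/2)) = t powr (- s)*t powr (- (1/2))" for t :: real by (simp flip: powr_add)
  show ?thesis unfolding e by (simp only: mult_ac)
 qed
 finally show ?thesis .
qed

text \<open>The pair of the two smallest frequencies either lies across the pairing \<open>12|34\<close> or across \<open>13|24\<close>, so the sum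
of two products of the kind admitted by the bilinear estimate dominates.\<close>

lemma wt_product_le_pairings:
 fixes s :: real
 assumes s: "1/4 <= s" "s <= 1"
 shows "wt s xi1*wt s xi2*wt s xi3*wt (1 - s) xi4
   <= (wt (s + 1/2) xi1 + wt (s + 1/2) xi2)*(wt (s + 1/2) xi3 + wt (s + 1/2) xi4)
   + (wt (s + 1/2) xi1 + wt (s + 1/2) xi3)*(wt (s + 1/2) xi2 + wt (s + 1/2) xi4)"
proof -
 define a b c d where "a = jn (snd xi1)" and "b = jn (snd xi2)" and "c = jn (snd xi3)" and "d = jn (snd xi4)"
 have ge: "1 <= a" "1 <= b" "1 <= c" "1 <= d" by (auto simp: a_def b_def c_def d_def jn_ge1)
 define W where "W = a powr (- s)*b powr (- s)*c powr (- s)*d powr (- (1 - s))"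
 \<comment> \<open>above \<open>3/4\<close> exactly when \<open>s > 1/4\<close>\<close>
 define tht where "tht = s + 1/2"
 have Wd: "W = a powr (- s)*b powr (- s)*c powr (- s)*d powr (- s)*d powr (2 * s - 1)"
  unfolding W_def by (simp add: mult.assoc flip: powr_add)
 define p where "p y z = y powr (- tht)*z powr (- tht)" for y z
 have pos: "0 <= p y z" for y z by (simp add: p_def)
 have cases6: "(a <= c & a <= d & b <= c & b <= d) | (a <= b & a <= d & c <= b & c <= d) | (a <= b & a <= c & d <= b & d <= c)
  | (b <= a & b <= d & c <= a & c <= d) | (b <= a & b <= c & d <= a & d <= c) | (c <= a & c <= b & d <= a & d <= b)"
  by linarith
 have "W <= p a c | W <= p a d | W <= p b c | W <= p b d | W <= p a b | W <= p c d"
  using cases6 powr_two_smallest[of a b c d d s] powr_two_smallest[of a c b d d s] powr_two_smallest[of a d b c d s]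
   powr_two_smallest[of b c a d d s] powr_two_smallest[of b d a c d s] powr_two_smallest[of c d a b d s] ge s
  unfolding Wd p_def tht_def by (elim disjE) (simp_all add: mult_ac)
 then have "W <= p a c + p a d + p b c + p b d + (p a b + p a d + p c b + p c d)"
  using pos[of a c] pos[of a d] pos[of b c] pos[of b d] pos[of a b] pos[of c b] pos[of c d] by linarith
 also have "... = (a powr (- tht) + b powr (- tht))*(c powr (- tht) + d powr (- tht))
   + (a powr (- tht) + c powr (- tht))*(b powr (- tht) + d powr (- tht))"
  by (simp add: p_def algebra_simps)
 finally have "ennreal W <= ennreal ..." by (rule ennreal_leI)
 then show ?thesis
  unfolding wt_def a_def[symmetric] b_def[symmetric] c_def[symmetric] d_def[symmetric] tht_def[symmetric] W_def
  by (simp add: ennreal_mult)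
qed

text \<open>For a given value of \<open>\<xi>\<^sub>1 + \<xi>\<^sub>2\<close> the form factors, so it is an inner product of the convolution of the first two
functions with the correlation of the last two, each bounded in \<open>L\<^sup>2\<close>.\<close>

lemma quadrilinear_pairing:
 fixes tht b a :: real
 assumes tht: "3/4 < tht" and b: "1/2 < b" and a: "1/4 < a"
 shows "EX C>=0. ALL f1:BM fm. ALL f2:BM fm. ALL f3:BM fm. ALL f4:BM fm.
  (NF xi1. (NF xi2. (NF xi3. (wt tht xi1 + wt tht xi2)*(wt tht xi3 + wt tht (xi1 + xi2 + xi3)) *
    ((md b xi1*f1 xi1)*(md b xi2*f2 xi2)*(md b xi3*f3 xi3)*(md a (xi1 + xi2 + xi3)*f4 (xi1 + xi2 + xi3))))))\<^sup>2
   <= ennreal C*((NF xi. (f1 xi)^2)*(NF xi. (f2 xi)^2)*(NF xi. (f3 xi)^2)*(NF xi. (f4 xi)^2))"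
proof -
 obtain C where C: "0 <= C" and Cb: "ALL f:BM fm. ALL g:BM fm.
   (NF ze. (NF xi. (wt tht xi + wt tht (ze - xi))*((md (2*b / 2) xi*f xi)*(md (2*b / 2) (ze - xi)*g (ze - xi))))^2)
    <= ennreal C*((NF xi. (f xi)^2)*(NF xi. (g xi)^2))"
  using bilinear_estimate[of tht "2*b" "2*b"] tht b by auto
 obtain D where D: "0 <= D" and Db: "ALL f:BM fm. ALL g:BM fm.
   (NF ze. (NF xi. (wt tht xi + wt tht (ze - xi))*((md (2*b / 2) xi*f xi)*(md (2*a / 2) (ze - xi)*g (ze - xi))))^2)
    <= ennreal D*((NF xi. (f xi)^2)*(NF xi. (g xi)^2))"
 proof -
  have "1 < max (2*b) (2*a)" using b by simp
  from bilinear_estimate[OF tht _ _ this] b a that show thesis by auto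
 qed
 have "(NF xi1. (NF xi2. (NF xi3. (wt tht xi1 + wt tht xi2)*(wt tht xi3 + wt tht (xi1 + xi2 + xi3)) *
    ((md b xi1*f1 xi1)*(md b xi2*f2 xi2)*(md b xi3*f3 xi3)*(md a (xi1 + xi2 + xi3)*f4 (xi1 + xi2 + xi3))))))^2
   <= ennreal (C*D)*((NF xi. (f1 xi)^2)*(NF xi. (f2 xi)^2)*(NF xi. (f3 xi)^2)*(NF xi. (f4 xi)^2))" (is "?L\<^sup>2 <= _")
  if [measurable]: "f1 : BM fm" "f2 : BM fm" "f3 : BM fm" "f4 : BM fm" for f1 f2 f3 f4
 proof -
  define F1 F2 F3 F4 where "F1 = (%xi. md b xi*f1 xi)" and "F2 = (%xi. md b xi*f2 xi)"
   and "F3 = (%xi. md b xi*f3 xi)" and "F4 = (%xi. md a xi*f4 xi)"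
  have [measurable]: "F1 : BM fm" "F2 : BM fm" "F3 : BM fm" "F4 : BM fm"
   by (simp_all add: F1_def F2_def F3_def F4_def)
  define B where "B ze = (NF xi. (wt tht xi + wt tht (ze - xi))*(F1 xi*F2 (ze - xi)))" for ze
  define E where "E ze = (NF xi. (wt tht xi + wt tht (ze - xi))*(F3 (- xi)*F4 (ze - xi)))" for ze
  have [measurable]: "B : BM fm" "E : BM fm"
   unfolding B_def[abs_def] E_def[abs_def] by measurable
  have E: "E ze = (NF xi. (wt tht xi + wt tht (ze + xi))*(F3 xi*F4 (ze + xi)))" for ze
   unfolding E_def using nn_integral_fm_uminus[of "%xi. (wt tht xi + wt tht (ze + xi))*(F3 xi*F4 (ze + xi))"] by simp
  have "?L = (NF xi1. (NF xi2. (wt tht xi1 + wt tht xi2)*(F1 xi1*F2 xi2)*E (xi1 + xi2)))"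
   unfolding E by (simp add: nn_integral_cmult[symmetric] F1_def F2_def F3_def F4_def mult_ac)
  also have "... = (NF xi1. (NF ze. (wt tht xi1 + wt tht (ze - xi1))*(F1 xi1*F2 (ze - xi1))*E ze))"
  proof (rule nn_integral_cong)
   fix xi1
   show "(NF xi2. (wt tht xi1 + wt tht xi2)*(F1 xi1*F2 xi2)*E (xi1 + xi2))
    = (NF ze. (wt tht xi1 + wt tht (ze - xi1))*(F1 xi1*F2 (ze - xi1))*E ze)"
    using nn_integral_fm_translate[of "%xi2. (wt tht xi1 + wt tht xi2)*(F1 xi1*F2 xi2)*E (xi1 + xi2)" "- xi1"] by simp
  qed
  also have "... = (NF ze. (NF xi1. (wt tht xi1 + wt tht (ze - xi1))*(F1 xi1*F2 (ze - xi1))*E ze))"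
   by (rule nn_integral_fm_swap) measurable
  also have "... = (NF ze. B ze*E ze)"
   by (simp add: B_def nn_integral_multc)
  finally have L: "?L = (NF ze. B ze*E ze)" .
  have "?L\<^sup>2 <= (NF ze. (B ze)^2)*(NF ze. (E ze)^2)"
   unfolding L by (rule Cauchy_Schwarz_nn_integral) measurable
  also have "... <= (ennreal C*((NF xi. (f1 xi)^2)*(NF xi. (f2 xi)^2)))
     * (ennreal D*((NF xi. (f3 (- xi))^2)*(NF xi. (f4 xi)^2)))"
  proof (rule mult_mono)
   show "(NF ze. (B ze)^2) <= ennreal C*((NF xi. (f1 xi)^2)*(NF xi. (f2 xi)^2))"
    using bspec[OF bspec[OF Cb, of f1], of f2] unfolding B_def F1_def F2_def by simp
   have "(%xi. f3 (- xi)) : BM fm" by measurable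
   from bspec[OF bspec[OF Db this], of f4]
   show "(NF ze. (E ze)^2) <= ennreal D*((NF xi. (f3 (- xi))^2)*(NF xi. (f4 xi)^2))"
    unfolding E_def F3_def F4_def by simp
  qed auto
  also have "(NF xi. (f3 (- xi))^2) = (NF xi. (f3 xi)^2)" by (rule nn_integral_fm_uminus) measurable
  finally show ?thesis using C D by (simp add: ennreal_mult mult_ac)
 qed
 then show ?thesis using C D by (intro exI[of _ "C*D"]) auto
qed

lemma nn_integral_fm_triple_add:
 assumes T: "(%(x, y, z). T x y z) : BM (fm \<Otimes>\<^sub>M fm \<Otimes>\<^sub>M fm)"
  and T': "(%(x, y, z). T' x y z) : BM (fm \<Otimes>\<^sub>M fm \<Otimes>\<^sub>M fm)"
 shows "(NF x. (NF y. (NF z. T x y z + T' x y z)))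
  = (NF x. (NF y. (NF z. T x y z))) + (NF x. (NF y. (NF z. T' x y z)))"
proof -
 have m1: "(%z. U x y z) : BM fm"
  and m2: "(%y. (NF z. U x y z)) : BM fm"
  and m3: "(%x. (NF y. (NF z. U x y z))) : BM fm"
  if U: "(%(x, y, z). U x y z) : BM (fm \<Otimes>\<^sub>M fm \<Otimes>\<^sub>M fm)" for U :: "frequency => frequency => frequency => ennreal" and x y
 proof -
  have [measurable]: "(%(a, z). U (fst a) (snd a) z) : BM ((fm \<Otimes>\<^sub>M fm) \<Otimes>\<^sub>M fm)"
   using measurable_compose[OF _ U, of "%p. (fst (fst p), snd (fst p), snd p)" "(fm \<Otimes>\<^sub>M fm) \<Otimes>\<^sub>M fm"]
   by (simp add: split_beta')
  have [measurable]: "(%(x, y). (NF z. U x y z)) : BM (fm \<Otimes>\<^sub>M fm)"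
   unfolding split_beta' by measurable
  show "(%z. U x y z) : BM fm"
   using measurable_compose[OF _ U, of "%z. (x, y, z)" fm] by simp
  show "(%y. (NF z. U x y z)) : BM fm" by measurable
  show "(%x. (NF y. (NF z. U x y z))) : BM fm" by measurable
 qed
 show ?thesis
  using m1[OF T] m1[OF T'] m2[OF T] m2[OF T'] m3[OF T] m3[OF T'] by (simp add: nn_integral_add)
qed

definition tri :: "(frequency => ennreal) => (frequency => ennreal) => (frequency => ennreal) => frequency => ennreal" where
 "tri F G H ze = (NF x. (NF y. F x*G y*H (ze - x - y)))"

text \<open>By duality the square norm becomes a quadrilinear form, whose weight is split into the two admissible
pairings. The dual function carries the modulation weight \<open>a > 1/4\<close>, half of what its own pair needs; the
other member of the pair compensates with \<open>b > 1/2\<close>.\<close>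

theorem trilinear_estimate:
 fixes s b a :: real
 assumes s: "1/4 < s" "s <= 1" and b: "1/2 < b" and a: "1/4 < a"
 shows "EX C>=0. ALL f1:BM fm. ALL f2:BM fm. ALL f3:BM fm.
  (NF ze. (wt (1 - s) ze*md a ze*tri (%xi. wt s xi*md b xi*f1 xi) (%xi. wt s xi*md b xi*f2 xi) (%xi. wt s xi*md b xi*f3 xi) ze)^2)
   <= ennreal C*((NF xi. (f1 xi)^2)*(NF xi. (f2 xi)^2)*(NF xi. (f3 xi)^2))"
proof -
 define tht where "tht = s + 1/2"
 obtain C where C: "0 <= C" and Cb: "ALL f1:BM fm. ALL f2:BM fm. ALL f3:BM fm. ALL f4:BM fm.
  (NF xi1. (NF xi2. (NF xi3. (wt tht xi1 + wt tht xi2)*(wt tht xi3 + wt tht (xi1 + xi2 + xi3)) *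
    ((md b xi1*f1 xi1)*(md b xi2*f2 xi2)*(md b xi3*f3 xi3)*(md a (xi1 + xi2 + xi3)*f4 (xi1 + xi2 + xi3))))))\<^sup>2
   <= ennreal C*((NF xi. (f1 xi)^2)*(NF xi. (f2 xi)^2)*(NF xi. (f3 xi)^2)*(NF xi. (f4 xi)^2))"
  using quadrilinear_pairing[of tht b a] s b a unfolding tht_def by auto
 have "(NF ze. (wt (1 - s) ze*md a ze*tri (%xi. wt s xi*md b xi*f1 xi) (%xi. wt s xi*md b xi*f2 xi) (%xi. wt s xi*md b xi*f3 xi) ze)^2)
   <= ennreal (4*C)*((NF xi. (f1 xi)^2)*(NF xi. (f2 xi)^2)*(NF xi. (f3 xi)^2))"
  if m[measurable]: "f1 : BM fm" "f2 : BM fm" "f3 : BM fm" for f1 f2 f3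
 proof (rule nn_integral_square_le_by_duality)
  define G where "G f = (%xi. wt s xi*md b xi*f xi)" for f :: "frequency => ennreal"
  have [measurable]: "G f : BM fm" if [measurable]: "f : BM fm" for f
   unfolding G_def by measurable
  show "sigma_finite_measure fm" by (rule fms.sigma_finite_measure_axioms)
  have trim: "tri (G f1) (G f2) (G f3) : BM fm"
   unfolding tri_def[abs_def] by measurable
  then show "(%ze. wt (1 - s) ze*md a ze*tri (%xi. wt s xi*md b xi*f1 xi) (%xi. wt s xi*md b xi*f2 xi) (%xi. wt s xi*md b xi*f3 xi) ze) : BM fm"
   unfolding G_def by measurable
  fix f4 :: "frequency => ennreal" assume [measurable]: "f4 : BM fm"
  define K where "K = (%xi. wt (1 - s) xi*md a xi*f4 xi)"
  have [measurable]: "K : BM fm" unfolding K_def by measurable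
  define Q where "Q g h = (NF xi1. (NF xi2. (NF xi3. (wt tht xi1 + wt tht xi2)*(wt tht xi3 + wt tht (xi1 + xi2 + xi3)) *
    ((md b xi1*f1 xi1)*(md b xi2*g xi2)*(md b xi3*h xi3)*(md a (xi1 + xi2 + xi3)*f4 (xi1 + xi2 + xi3))))))" for g h :: "frequency => ennreal"
  have "(NF ze. wt (1 - s) ze*md a ze*tri (G f1) (G f2) (G f3) ze*f4 ze)
   = (NF ze. (NF x. (NF y. G f1 x*G f2 y*(G f3 (ze - x - y)*K ze))))"
   unfolding tri_def K_def by (simp add: nn_integral_cmult[symmetric] nn_integral_multc[symmetric] mult_ac)
  also have "... = (NF x. (NF ze. (NF y. G f1 x*G f2 y*(G f3 (ze - x - y)*K ze))))"
   by (rule nn_integral_fm_swap) measurable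
  also have "... = (NF x. (NF y. (NF ze. G f1 x*G f2 y*(G f3 (ze - x - y)*K ze))))"
   by (intro nn_integral_cong nn_integral_fm_swap) measurable
  also have "... = (NF x. (NF y. (NF z. G f1 x*G f2 y*(G f3 z*K (x + y + z)))))"
  proof (rule nn_integral_cong, rule nn_integral_cong)
   fix x y
   show "(NF ze. G f1 x*G f2 y*(G f3 (ze - x - y)*K ze)) = (NF z. G f1 x*G f2 y*(G f3 z*K (x + y + z)))"
    using nn_integral_fm_translate[of "%ze. G f1 x*G f2 y*(G f3 (ze - x - y)*K ze)" "x + y"] by (simp add: add_ac)
  qed
  also have "... <= (NF x. (NF y. (NF z.
     (wt tht x + wt tht y)*(wt tht z + wt tht (x + y + z))*((md b x*f1 x)*(md b y*f2 y)*(md b z*f3 z)*(md a (x + y + z)*f4 (x + y + z)))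
    + (wt tht x + wt tht z)*(wt tht y + wt tht (x + z + y))*((md b x*f1 x)*(md b z*f3 z)*(md b y*f2 y)*(md a (x + z + y)*f4 (x + z + y))))))"
  proof (intro nn_integral_mono)
   fix x y z
   define R where "R = (md b x*f1 x)*(md b y*f2 y)*(md b z*f3 z)*(md a (x + y + z)*f4 (x + y + z))"
   have "G f1 x*G f2 y*(G f3 z*K (x + y + z)) = wt s x*wt s y*wt s z*wt (1 - s) (x + y + z) * R"
    by (simp add: G_def K_def R_def mult_ac)
   also have "... <= ((wt tht x + wt tht y)*(wt tht z + wt tht (x + y + z)) + (wt tht x + wt tht z)*(wt tht y + wt tht (x + y + z))) * R"
    unfolding tht_def using s by (intro mult_right_mono wt_product_le_pairings) auto
   finally show "G f1 x*G f2 y*(G f3 z*K (x + y + z)) <=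
     (wt tht x + wt tht y)*(wt tht z + wt tht (x + y + z))*((md b x*f1 x)*(md b y*f2 y)*(md b z*f3 z)*(md a (x + y + z)*f4 (x + y + z)))
    + (wt tht x + wt tht z)*(wt tht y + wt tht (x + z + y))*((md b x*f1 x)*(md b z*f3 z)*(md b y*f2 y)*(md a (x + z + y)*f4 (x + z + y)))"
   proof -
    have 1: "x + z + y = x + y + z" by (simp add: add_ac)
    have 2: "(md b x*f1 x)*(md b z*f3 z)*(md b y*f2 y)*(md a (x + y + z)*f4 (x + y + z)) = R"
     unfolding R_def by (simp only: mult_ac)
    assume "G f1 x*G f2 y*(G f3 z*K (x + y + z)) <= ((wt tht x + wt tht y)*(wt tht z + wt tht (x + y + z)) + (wt tht x + wt tht z)*(wt tht y + wt tht (x + y + z))) * R"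
    then show ?thesis unfolding 1 2 distrib_right[of _ _ R] R_def[symmetric] .
   qed
  qed
  also have "... = Q f2 f3 + (NF x. (NF y. (NF z. (wt tht x + wt tht z)*(wt tht y + wt tht (x + z + y))*((md b x*f1 x)*(md b z*f3 z)*(md b y*f2 y)*(md a (x + z + y)*f4 (x + z + y))))))"
   unfolding Q_def by (rule nn_integral_fm_triple_add) measurable
  also have "... = Q f2 f3 + Q f3 f2"
   unfolding Q_def by (rule arg_cong2[where f="(+)", OF refl], rule nn_integral_cong, rule nn_integral_fm_swap) measurable
  finally have "(NF ze. wt (1 - s) ze*md a ze*tri (G f1) (G f2) (G f3) ze*f4 ze)^2 <= (Q f2 f3 + Q f3 f2)^2"
   by (rule power_mono) simp
  also have "... <= 2*(Q f2 f3)^2 + 2*(Q f3 f2)^2" by (rule ennreal_square_add_le)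
  also have "... <= 2*(ennreal C*((NF xi. (f1 xi)^2)*(NF xi. (f2 xi)^2)*(NF xi. (f3 xi)^2)*(NF xi. (f4 xi)^2)))
    + 2*(ennreal C*((NF xi. (f1 xi)^2)*(NF xi. (f3 xi)^2)*(NF xi. (f2 xi)^2)*(NF xi. (f4 xi)^2)))"
   unfolding Q_def using Cb m by (intro add_mono mult_left_mono) simp_all
  also have "... = ennreal (4*C)*((NF xi. (f1 xi)^2)*(NF xi. (f2 xi)^2)*(NF xi. (f3 xi)^2))*(NF xi. (f4 xi)^2)"
  proof -
   have "2*(ennreal C*(x*y*z*w)) + 2*(ennreal C*(x*z*y*w)) = ennreal (4*C)*(x*y*z)*w" for x y z w :: ennreal
   proof -
    define P where "P = ennreal C*(x*y*z*w)"
    have "2*P + 2*P = 4*P" by (simp flip: distrib_right)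
    moreover have "ennreal C*(x*z*y*w) = P" by (simp add: P_def mult_ac)
    moreover have "ennreal (4*C)*(x*y*z)*w = 4*P" using C by (simp add: P_def ennreal_mult mult_ac)
    ultimately show ?thesis by (simp add: P_def)
   qed
   then show ?thesis .
  qed
  finally show "(NF ze. wt (1 - s) ze*md a ze*tri (%xi. wt s xi*md b xi*f1 xi) (%xi. wt s xi*md b xi*f2 xi) (%xi. wt s xi*md b xi*f3 xi) ze*f4 ze)^2
    <= ennreal (4*C)*((NF xi. (f1 xi)^2)*(NF xi. (f2 xi)^2)*(NF xi. (f3 xi)^2))*(NF xi. (f4 xi)^2)"
   unfolding G_def .
 qed
 then show ?thesis using C by (intro exI[of _ "4*C"]) auto
qed

section \<open>Gain from a short time cutoff\<close>

lemma nn_integral_abs_powr_unit: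
 fixes c :: real assumes c: "0 < c" "c < 1"
 shows "(NT z. ennreal (\<bar>z - y\<bar> powr (- c)*indicator {-1..1} (z - y))) <= ennreal (2 / (1 - c))"
proof -
 define h where "h z = z powr (- c)*indicator {0..1} z" for z :: real
 have [measurable]: "h : BM borel" unfolding h_def[abs_def] by measurable
 have h_if: "h = (%z. if z : {0..1} then z powr (- c) else 0)" by (auto simp: h_def indicator_def)
 have "((%z. z powr (- c)) has_integral (1 powr (- c + 1) / (- c + 1))) {0..1}"
  using c by (intro has_integral_powr_from_0) auto
 then have "(h has_integral (1 / (1 - c))) UNIV"
  unfolding h_if has_integral_restrict_UNIV by (simp add: add.commute)
 then have I: "(NT z. ennreal (h z)) = ennreal (1 / (1 - c))"
 proof (rule nn_integral_has_integral_lborel[rotated 2])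
  show "h : BM borel" by measurable
  show "0 <= h z" for z by (simp add: h_def)
 qed
 have "(NT z. ennreal (\<bar>z - y\<bar> powr (- c)*indicator {-1..1} (z - y)))
   <= (NT z. ennreal (h (z - y)) + ennreal (h (y - z)))"
  by (intro nn_integral_mono) (auto simp: h_def indicator_def abs_if)
 also have "... = (NT z. ennreal (h (z - y))) + (NT z. ennreal (h (y - z)))"
  by (rule nn_integral_add) measurable
 also have "(NT z. ennreal (h (z - y))) = (NT z. ennreal (h z))"
  using nn_integral_real_affine[of "%z. ennreal (h z)" 1 "- y"] by simp
 also have "(NT z. ennreal (h (y - z))) = (NT z. ennreal (h z))"
  using nn_integral_real_affine[of "%z. ennreal (h z)" "-1" y] by simp
 also have "(NT z. ennreal (h z)) + (NT z. ennreal (h z)) = ennreal (2 / (1 - c))"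
  using c by (simp add: I flip: ennreal_plus)
 finally show ?thesis .
qed

text \<open>Scaling by \<open>T\<close> about the centre of the kernel produces the power of \<open>T\<close>. What is left is a kernel with an
integrable tail, since \<open>e < 1\<close>, against a singularity that is integrable, since \<open>c < 1\<close>.\<close>

lemma cutoff_kernel_moment_centered:
 fixes c e :: real
 assumes c: "0 < c" "c < 1" and e: "0 <= e" "e < 1"
 shows "EX C>=0. ALL T mu \<nu>. 0 < T --> T <= 1 -->
  (NT x. ennreal (jb (x - \<nu>) powr (- c)*(\<bar>x - mu\<bar> powr e*(T / (1 + (T*(x - mu))^2))))) <= ennreal (C*T powr (c - e))"
proof -
 obtain D where D: "0 <= D" "(NT x. ennreal (jb x powr (- (2 - e)))) <= ennreal D"
  using nn_integral_jb_finite[of "2 - e"] e by auto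
 define C where "C = 2 / (1 - c) + D"
 have "(NT x. ennreal (jb (x - \<nu>) powr (- c)*(\<bar>x - mu\<bar> powr e*(T / (1 + (T*(x - mu))^2))))) <= ennreal (C*T powr (c - e))"
  if T: "0 < T" "T <= 1" for T mu \<nu>
 proof -
  define y0 where "y0 = T*(\<nu> - mu)"
  define g where "g x = ennreal (jb (x - \<nu>) powr (- c)*(\<bar>x - mu\<bar> powr e*(T / (1 + (T*(x - mu))^2))))" for x
  have [measurable]: "g : BM borel" unfolding g_def[abs_def] by measurable
  have pw: "ennreal (1 / T)*g (mu + 1 / T*y) <= ennreal (T powr (c - e))*(ennreal (\<bar>y - y0\<bar> powr (- c)*indicator {-1..1} (y - y0)) + ennreal (jb y powr (- (2 - e))))"
   if "y ~= y0" for y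
  proof -
   define z where "z = y - y0"
   have z: "z ~= 0" using that by (simp add: z_def)
   have arg: "mu + 1 / T*y - \<nu> = z / T" using T by (simp add: z_def y0_def field_simps)
   have dec: "\<bar>y\<bar> powr e*(1 / (1 + y^2)) <= jb y powr (- (2 - e))"
   proof -
    have "\<bar>y\<bar> powr e <= jb y powr e" using e abs_le_jb by (intro powr_mono2) auto
    moreover have "1 / (1 + y^2) = jb y powr (- 2)"
     using jb_pos[of y] by (simp add: powr_minus jb_def powr_numeral divide_inverse add_nonneg_nonneg)
    ultimately have "\<bar>y\<bar> powr e*(1 / (1 + y^2)) <= jb y powr e*jb y powr (- 2)"
     by (simp add: mult_right_mono)
    then show ?thesis by (simp flip: powr_add)
   qed
   have dec1: "jb y powr (- (2 - e)) <= 1"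
    using powr_mono[of "- (2 - e)" 0 "jb y"] jb_ge1[of y] jb_pos[of y] e by simp
   have jz: "jb (z / T) powr (- c) <= T powr c*\<bar>z\<bar> powr (- c)"
   proof -
    have "jb (z / T) powr (- c) <= (\<bar>z\<bar> / T) powr (- c)"
     using abs_le_jb[of "z / T"] z T c by (intro powr_mono2') (auto simp: abs_divide)
    also have "... = T powr c*\<bar>z\<bar> powr (- c)"
     using T by (simp add: powr_divide powr_minus field_simps)
    finally show ?thesis .
   qed
   have "1 / T*(jb (z / T) powr (- c)*(\<bar>1 / T*y\<bar> powr e*(T / (1 + y^2))))
     = T powr (- e)*(jb (z / T) powr (- c)*(\<bar>y\<bar> powr e*(1 / (1 + y^2))))"
    using T by (simp add: abs_mult powr_mult powr_minus powr_divide divide_simps)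
   also have "... <= T powr (- e)*((T powr c*\<bar>z\<bar> powr (- c))*jb y powr (- (2 - e)))"
    using jz dec by (intro mult_left_mono mult_mono) auto
   also have "... = T powr (c - e)*(\<bar>z\<bar> powr (- c)*jb y powr (- (2 - e)))"
    using T by (simp add: powr_diff powr_minus field_simps)
   also have "... <= T powr (c - e)*(\<bar>z\<bar> powr (- c)*indicator {-1..1} z + jb y powr (- (2 - e)))"
   proof (intro mult_left_mono)
    show "\<bar>z\<bar> powr (- c)*jb y powr (- (2 - e)) <= \<bar>z\<bar> powr (- c)*indicator {-1..1} z + jb y powr (- (2 - e))"
    proof (cases "\<bar>z\<bar> <= 1")
     case True
     then have "\<bar>z\<bar> powr (- c)*jb y powr (- (2 - e)) <= \<bar>z\<bar> powr (- c)*1"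
      using dec1 by (intro mult_left_mono) auto
     moreover have "indicator {-1..1} z = (1::real)" using True by (auto simp: indicator_def)
     ultimately have "\<bar>z\<bar> powr (- c)*jb y powr (- (2 - e)) <= \<bar>z\<bar> powr (- c)*indicator {-1..1} z" by simp
     then show ?thesis by (rule order_trans) simp
    next
     case False
     then have "\<bar>z\<bar> powr (- c) <= 1 powr (- c)" using c by (intro powr_mono2') auto
     then have "\<bar>z\<bar> powr (- c)*jb y powr (- (2 - e)) <= 1*jb y powr (- (2 - e))"
      by (intro mult_right_mono) auto
     then show ?thesis by (simp add: add_increasing)
    qed
   qed simp
   finally have "1 / T*(jb (z / T) powr (- c)*(\<bar>1 / T*y\<bar> powr e*(T / (1 + y^2))))
    <= T powr (c - e)*(\<bar>z\<bar> powr (- c)*indicator {-1..1} z + jb y powr (- (2 - e)))" .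
   then have "ennreal (1 / T*(jb (z / T) powr (- c)*(\<bar>1 / T*y\<bar> powr e*(T / (1 + y^2)))))
    <= ennreal (T powr (c - e)*(\<bar>z\<bar> powr (- c)*indicator {-1..1} z + jb y powr (- (2 - e))))"
    by (rule ennreal_leI)
   moreover have "ennreal (1 / T)*g (mu + 1 / T*y) = ennreal (1 / T*(jb (z / T) powr (- c)*(\<bar>1 / T*y\<bar> powr e*(T / (1 + y^2)))))"
    unfolding g_def arg using T by (subst ennreal_mult[symmetric]) auto
   moreover have "ennreal (T powr (c - e)*(\<bar>z\<bar> powr (- c)*indicator {-1..1} z + jb y powr (- (2 - e))))
    = ennreal (T powr (c - e))*(ennreal (\<bar>z\<bar> powr (- c)*indicator {-1..1} z) + ennreal (jb y powr (- (2 - e))))"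
    by (subst ennreal_mult, simp, simp, subst ennreal_plus) auto
   ultimately show ?thesis by (simp only: z_def)
  qed
  have "(NT x. g x) = ennreal (1 / T)*(NT y. g (mu + 1 / T*y))"
   using nn_integral_real_affine[of g "1 / T" mu] T by simp
  also have "... = (NT y. ennreal (1 / T)*g (mu + 1 / T*y))"
   by (rule nn_integral_cmult[symmetric]) measurable
  also have "... <= (NT y. ennreal (T powr (c - e))*(ennreal (\<bar>y - y0\<bar> powr (- c)*indicator {-1..1} (y - y0)) + ennreal (jb y powr (- (2 - e)))))"
   by (rule nn_integral_mono_AE, rule AE_mp[OF AE_lborel_singleton[of y0]]) (use pw in auto)
  also have "... = ennreal (T powr (c - e))*((NT y. ennreal (\<bar>y - y0\<bar> powr (- c)*indicator {-1..1} (y - y0))) + (NT y. ennreal (jb y powr (- (2 - e)))))"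
   by (subst nn_integral_cmult, measurable, subst nn_integral_add, measurable)
  also have "... <= ennreal (T powr (c - e))*(ennreal (2 / (1 - c)) + ennreal D)"
   using nn_integral_abs_powr_unit[OF c, of y0] D by (intro mult_left_mono add_mono) auto
  also have "... = ennreal (C*T powr (c - e))"
   using c D unfolding C_def by (subst ennreal_plus[symmetric], simp, simp, subst ennreal_mult[symmetric]) (auto simp: mult.commute)
  finally show ?thesis unfolding g_def .
 qed
 moreover have "0 <= C" using c D by (simp add: C_def)
 ultimately show ?thesis by (intro exI[of _ C]) auto
qed

text \<open>On each half-line the modulation is the distance to a single point, \<open>J\<close> or \<open>- J\<close>.\<close>

lemma cutoff_kernel_moment:
 fixes c e :: real
 assumes c: "0 < c" "c < 1" and e: "0 <= e" "e < 1"
 shows "EX C>=0. ALL T mu J. 0 < T --> T <= 1 -->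
  (NT x. ennreal (jb (\<bar>x\<bar> - J) powr (- c)*(\<bar>x - mu\<bar> powr e*(T / (1 + (T*(x - mu))^2))))) <= ennreal (C*T powr (c - e))"
proof -
 obtain C where C: "0 <= C" and Cb: "ALL T mu \<nu>. 0 < T --> T <= 1 -->
  (NT x. ennreal (jb (x - \<nu>) powr (- c)*(\<bar>x - mu\<bar> powr e*(T / (1 + (T*(x - mu))^2))))) <= ennreal (C*T powr (c - e))"
  using cutoff_kernel_moment_centered[OF assms] by blast
 have "(NT x. ennreal (jb (\<bar>x\<bar> - J) powr (- c)*(\<bar>x - mu\<bar> powr e*(T / (1 + (T*(x - mu))^2))))) <= ennreal ((2*C)*T powr (c - e))"
  if T: "0 < T" "T <= 1" for T mu J
 proof -
  define k where "k x = \<bar>x - mu\<bar> powr e*(T / (1 + (T*(x - mu))^2))" for x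
  have k: "0 <= k x" for x using T by (simp add: k_def)
  have [measurable]: "k : BM borel" unfolding k_def[abs_def] by measurable
  have "(NT x. ennreal (jb (\<bar>x\<bar> - J) powr (- c)*k x))
    <= (NT x. ennreal (jb (x - J) powr (- c)*k x) + ennreal (jb (x - (- J)) powr (- c)*k x))"
  proof (rule nn_integral_mono)
   fix x :: real
   have "jb (- x - J) = jb (x - (- J))" using jb_minus[of "x + J"] by simp
   then have "jb (\<bar>x\<bar> - J) powr (- c) <= jb (x - J) powr (- c) + jb (x - (- J)) powr (- c)"
    by (cases "0 <= x") (auto simp: abs_if)
   then have "jb (\<bar>x\<bar> - J) powr (- c)*k x <= jb (x - J) powr (- c)*k x + jb (x - (- J)) powr (- c)*k x"
    using k[of x] by (simp add: mult_right_mono flip: distrib_right)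
   then show "ennreal (jb (\<bar>x\<bar> - J) powr (- c)*k x) <= ennreal (jb (x - J) powr (- c)*k x) + ennreal (jb (x - (- J)) powr (- c)*k x)"
    using k[of x] by (simp add: ennreal_leI flip: ennreal_plus)
  qed
  also have "... = (NT x. ennreal (jb (x - J) powr (- c)*k x)) + (NT x. ennreal (jb (x - (- J)) powr (- c)*k x))"
   by (rule nn_integral_add) measurable
  also have "... <= ennreal (C*T powr (c - e)) + ennreal (C*T powr (c - e))"
   unfolding k_def using Cb T by (intro add_mono) blast+
  also have "... = ennreal ((2*C)*T powr (c - e))"
   using C by (subst ennreal_plus[symmetric]) auto
  finally show ?thesis unfolding k_def .
 qed
 then show ?thesis using C by (intro exI[of _ "2*C"]) auto
qed

lemma powr_sum_le: "(x + y) powr p <= 2*(x powr p + y powr p)" if "0 <= x" "0 <= y" "0 < p" "p < 1" for x y p :: real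
proof -
 have "(x + y) powr p <= (2*max x y) powr p" using that by (intro powr_mono2) auto
 also have "... = 2 powr p*(max x y) powr p" using that by (simp add: powr_mult)
 also have "... <= 2 powr 1*(max x y) powr p" using that by (intro mult_right_mono powr_mono) auto
 also have "... <= 2*(x powr p + y powr p)" by (auto simp: max_def)
 finally show ?thesis .
qed

text \<open>Up to a constant a majorant of the transform of a smooth cutoff at time scale \<open>T\<close>.\<close>

definition ckern :: "real => real => real" where "ckern T x = T / (1 + (T*x)^2)"

lemma ckern_measurable[measurable]: "ckern T : BM borel"
 unfolding ckern_def[abs_def] by measurable

text \<open>Cauchy--Schwarz with respect to the kernel, whose mass is bounded independently of \<open>T\<close>. The modulation weight at
the inner frequency is bounded by the one at the outer frequency plus a power of their difference, and the
kernel moments show that lowering the exponent from \<open>a\<close> to \<open>a'\<close> is worth \<open>T powr (a - a')\<close>.\<close>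

lemma time_cutoff_gain:
 fixes a a' :: real
 assumes a: "0 < a'" "a' < a" "a < 1/2"
 shows "EX C>=0. ALL T. ALL G:BM fm. 0 < T --> T <= 1 -->
   (NF ze. (md a ze*(NT mu. ennreal (ckern T (fst ze - mu))*G (mu, snd ze)))^2)
    <= ennreal (C*T powr (2*(a - a')))*(NF ze. (md a' ze*G ze)^2)"
proof -
 define c1 where "c1 = 2*(a - a')"
 obtain C1 where C1: "0 <= C1" and C1b: "ALL T mu J. 0 < T --> T <= 1 -->
  (NT x. ennreal (jb (\<bar>x\<bar> - J) powr (- c1)*(\<bar>x - mu\<bar> powr 0*(T / (1 + (T*(x - mu))^2))))) <= ennreal (C1*T powr (c1 - 0))"
  using cutoff_kernel_moment[of c1 0] a by (auto simp: c1_def)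
 obtain C2 where C2: "0 <= C2" and C2b: "ALL T mu J. 0 < T --> T <= 1 -->
  (NT x. ennreal (jb (\<bar>x\<bar> - J) powr (- (2*a))*(\<bar>x - mu\<bar> powr (2*a')*(T / (1 + (T*(x - mu))^2))))) <= ennreal (C2*T powr (2*a - 2*a'))"
  using cutoff_kernel_moment[of "2*a" "2*a'"] a by auto
 obtain D where D: "0 <= D" "(NT x. ennreal (jb x powr (- 2))) <= ennreal D"
  using nn_integral_jb_finite[of 2] by auto
 define C where "C = D*(2*(C1 + C2))"
 have main: "(NF ze. (md a ze*(NT mu. ennreal (ckern T (fst ze - mu))*G (mu, snd ze)))^2)
    <= ennreal (C*T powr (2*(a - a')))*(NF ze. (md a' ze*G ze)^2)"
  if T: "0 < T" "T <= 1" and G[measurable]: "G : BM fm" for T G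
 proof -
  have Gn[measurable]: "(%ta. G (ta, n)) : BM borel" for n
   using G by (simp add: meas_fm_iff)
  define k where "k x = ennreal (ckern T x)" for x
  have [measurable]: "k : BM borel" unfolding k_def[abs_def] by measurable
  have kpos: "0 <= ckern T x" for x using T by (simp add: ckern_def)
  have kint: "(NT mu. k (l - mu)) <= ennreal D" for l
  proof -
   have "(NT mu. ennreal (jb mu powr (- 2))) = ennreal T*(NT mu. ennreal (jb (T*l + (- T)*mu) powr (- 2)))"
    using nn_integral_real_affine[of "%mu. ennreal (jb mu powr (- 2))" "- T" "T*l"] T by simp
   also have "... = (NT mu. ennreal T*ennreal (jb (T*l + (- T)*mu) powr (- 2)))"
    by (rule nn_integral_cmult[symmetric]) measurable
   also have "... = (NT mu. k (l - mu))"
   proof (rule nn_integral_cong)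
    fix mu
    have "jb y powr (- 2) = 1 / (1 + y^2)" for y
     using jb_pos[of y] by (simp add: powr_minus jb_def powr_numeral divide_inverse add_nonneg_nonneg)
    then show "ennreal T*ennreal (jb (T*l + (- T)*mu) powr (- 2)) = k (l - mu)"
     using T by (simp add: k_def ckern_def right_diff_distrib flip: ennreal_mult)
   qed
   finally show ?thesis using D by simp
  qed
  have inner: "(NT l. ennreal (jb (\<bar>l\<bar> - J) powr (- (2*a)))*k (l - mu))
    <= ennreal (2*(C1 + C2)*T powr (2*(a - a')))*ennreal (jb (\<bar>mu\<bar> - J) powr (- (2*a')))" for J mu
  proof -
   define M where "M = jb (\<bar>mu\<bar> - J) powr (2*a')"
   have M: "0 < M" using jb_pos[of "\<bar>mu\<bar> - J"] by (simp add: M_def)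
   have "ennreal M*(NT l. ennreal (jb (\<bar>l\<bar> - J) powr (- (2*a)))*k (l - mu))
    = (NT l. ennreal M*(ennreal (jb (\<bar>l\<bar> - J) powr (- (2*a)))*k (l - mu)))"
    by (rule nn_integral_cmult[symmetric]) measurable
   also have "... <= (NT l. 2*(ennreal (jb (\<bar>l\<bar> - J) powr (- c1)*(\<bar>l - mu\<bar> powr 0*(T / (1 + (T*(l - mu))^2))))
     + ennreal (jb (\<bar>l\<bar> - J) powr (- (2*a))*(\<bar>l - mu\<bar> powr (2*a')*(T / (1 + (T*(l - mu))^2))))))"
   proof (rule nn_integral_mono_AE, rule AE_mp[OF AE_lborel_singleton[of mu]], rule AE_I2, rule impI)
    fix l :: real assume ne: "l ~= mu"
    define A where "A = jb (\<bar>l\<bar> - J)"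
    have A: "0 < A" using jb_pos by (simp add: A_def)
    have "jb (\<bar>mu\<bar> - J) <= A + \<bar>l - mu\<bar>"
     using jb_triangle[of "\<bar>l\<bar> - J" "\<bar>mu\<bar> - \<bar>l\<bar>"] by (simp add: A_def)
    then have "M <= (A + \<bar>l - mu\<bar>) powr (2*a')" unfolding M_def using a jb_pos[of "\<bar>mu\<bar> - J"] by (intro powr_mono2) auto
    also have "... <= 2*(A powr (2*a') + \<bar>l - mu\<bar> powr (2*a'))" using A a by (intro powr_sum_le) auto
    finally have "M*(A powr (- (2*a))*ckern T (l - mu)) <= 2*(A powr (2*a') + \<bar>l - mu\<bar> powr (2*a'))*(A powr (- (2*a))*ckern T (l - mu))"
     using kpos by (intro mult_right_mono) auto
    also have "... = 2*((A powr (2*a')*A powr (- (2*a)))*ckern T (l - mu) + A powr (- (2*a))*(\<bar>l - mu\<bar> powr (2*a')*ckern T (l - mu)))"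
     by (simp add: algebra_simps)
    also have "A powr (2*a')*A powr (- (2*a)) = A powr (- c1)" by (simp add: c1_def algebra_simps flip: powr_add)
    finally have le: "M*(A powr (- (2*a))*ckern T (l - mu)) <= 2*(A powr (- c1)*(\<bar>l - mu\<bar> powr 0*ckern T (l - mu)) + A powr (- (2*a))*(\<bar>l - mu\<bar> powr (2*a')*ckern T (l - mu)))"
     using ne by simp
    have "ennreal M*(ennreal (A powr (- (2*a)))*k (l - mu)) = ennreal (M*(A powr (- (2*a))*ckern T (l - mu)))"
     using M kpos by (simp add: k_def ennreal_mult)
    also have "... <= ennreal (2*(A powr (- c1)*(\<bar>l - mu\<bar> powr 0*ckern T (l - mu)) + A powr (- (2*a))*(\<bar>l - mu\<bar> powr (2*a')*ckern T (l - mu))))"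
     using le by (rule ennreal_leI)
    also have "... = 2*(ennreal (A powr (- c1)*(\<bar>l - mu\<bar> powr 0*ckern T (l - mu))) + ennreal (A powr (- (2*a))*(\<bar>l - mu\<bar> powr (2*a')*ckern T (l - mu))))"
     using kpos by (subst ennreal_mult, simp, simp, subst ennreal_plus) auto
    finally show "ennreal M*(ennreal (jb (\<bar>l\<bar> - J) powr (- (2*a)))*k (l - mu))
     <= 2*(ennreal (jb (\<bar>l\<bar> - J) powr (- c1)*(\<bar>l - mu\<bar> powr 0*(T / (1 + (T*(l - mu))^2))))
     + ennreal (jb (\<bar>l\<bar> - J) powr (- (2*a))*(\<bar>l - mu\<bar> powr (2*a')*(T / (1 + (T*(l - mu))^2)))))"
     unfolding A_def ckern_def .
   qed
   also have "... = 2*((NT l. ennreal (jb (\<bar>l\<bar> - J) powr (- c1)*(\<bar>l - mu\<bar> powr 0*(T / (1 + (T*(l - mu))^2)))))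
     + (NT l. ennreal (jb (\<bar>l\<bar> - J) powr (- (2*a))*(\<bar>l - mu\<bar> powr (2*a')*(T / (1 + (T*(l - mu))^2))))))"
    by (subst nn_integral_cmult, measurable, subst nn_integral_add, measurable)
   also have "... <= 2*(ennreal (C1*T powr (c1 - 0)) + ennreal (C2*T powr (2*a - 2*a')))"
    using C1b C2b T by (intro mult_left_mono add_mono) (blast, blast, simp)
   also have "... = ennreal (2*(C1 + C2)*T powr (2*(a - a')))"
    using C1 C2 unfolding c1_def by (subst ennreal_plus[symmetric], simp, simp) (simp add: ennreal_mult algebra_simps)
   finally have "ennreal (1 / M)*(ennreal M*(NT l. ennreal (jb (\<bar>l\<bar> - J) powr (- (2*a)))*k (l - mu)))
     <= ennreal (1 / M)*ennreal (2*(C1 + C2)*T powr (2*(a - a')))" by (rule mult_left_mono) simp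
   moreover have cancel: "ennreal (1 / M)*(ennreal M*X) = X" for X
    using M by (simp add: mult.assoc[symmetric] flip: ennreal_mult)
   moreover have "1 / M = jb (\<bar>mu\<bar> - J) powr (- (2*a'))" by (simp add: M_def powr_minus divide_inverse)
   ultimately show ?thesis unfolding cancel by (simp only: mult.commute)
  qed
  have colm: "(NT l. (md a (l, n)*(NT mu. k (l - mu)*G (mu, n)))^2)
    <= ennreal (C*T powr (2*(a - a')))*(NT mu. (md a' (mu, n)*G (mu, n))^2)" for n
  proof -
   define ka where "ka x = ennreal (sqrt (ckern T x))" for x
   have [measurable]: "ka : BM borel" unfolding ka_def[abs_def] by measurable
   have ka2: "ka x*ka x = k x" for x using kpos[of x] by (simp add: ka_def k_def flip: ennreal_mult)
   define g where "g mu = G (mu, n)" for mu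
   have [measurable]: "g : BM borel" unfolding g_def[abs_def] by measurable
   define w where "w r l = ennreal (jb (\<bar>l\<bar> - jn n) powr (- r))" for r l
   have [measurable]: "w r : BM borel" for r unfolding w_def[abs_def] by measurable
   have w2: "(w r l)^2 = w (2*r) l" for r l unfolding w_def by (simp add: ennreal_power powr_neg_square)
   have "(NT l. (w a l*(NT mu. k (l - mu)*g mu))^2)
     <= (NT l. ennreal D*(NT mu. w (2*a) l*k (l - mu)*(g mu)^2))"
   proof (rule nn_integral_mono)
    fix l
    have "(NT mu. k (l - mu)*g mu)^2 = (NT mu. ka (l - mu)*(ka (l - mu)*g mu))^2"
     by (simp add: ka2[symmetric] mult.assoc)
    also have "... <= (NT mu. (ka (l - mu))^2)*(NT mu. (ka (l - mu)*g mu)^2)"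
     by (rule Cauchy_Schwarz_nn_integral) measurable
    also have "... <= ennreal D*(NT mu. k (l - mu)*(g mu)^2)"
     using kint[of l] by (simp add: power_mult_distrib power2_eq_square[of "ka _"] ka2 mult_right_mono)
    finally have "w (2*a) l*(NT mu. k (l - mu)*g mu)^2 <= w (2*a) l*(ennreal D*(NT mu. k (l - mu)*(g mu)^2))"
     by (rule mult_left_mono) simp
    also have "... = ennreal D*(NT mu. w (2*a) l*k (l - mu)*(g mu)^2)"
     by (simp add: nn_integral_cmult[symmetric] mult.assoc mult.left_commute)
    finally show "(w a l*(NT mu. k (l - mu)*g mu))^2 <= ennreal D*(NT mu. w (2*a) l*k (l - mu)*(g mu)^2)"
     by (simp add: power_mult_distrib w2)
   qed
   also have "... = ennreal D*(NT l. (NT mu. w (2*a) l*k (l - mu)*(g mu)^2))"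
    by (rule nn_integral_cmult) measurable
   also have "(NT l. (NT mu. w (2*a) l*k (l - mu)*(g mu)^2)) = (NT mu. (NT l. w (2*a) l*k (l - mu)*(g mu)^2))"
    by (rule lborel_pair.Fubini') measurable
   also have "... = (NT mu. (NT l. w (2*a) l*k (l - mu))*(g mu)^2)"
    by (intro nn_integral_cong nn_integral_multc) measurable
   also have "... <= (NT mu. ennreal (2*(C1 + C2)*T powr (2*(a - a')))*(w a' mu*g mu)^2)"
   proof (rule nn_integral_mono)
    fix mu
    have "(NT l. w (2*a) l*k (l - mu))*(g mu)^2 <= ennreal (2*(C1 + C2)*T powr (2*(a - a')))*w (2*a') mu*(g mu)^2"
     using inner[of "jn n" mu] unfolding w_def by (intro mult_right_mono) auto
    then show "(NT l. w (2*a) l*k (l - mu))*(g mu)^2 <= ennreal (2*(C1 + C2)*T powr (2*(a - a')))*(w a' mu*g mu)^2"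
     by (simp add: power_mult_distrib w2 mult.assoc)
   qed
   also have "... = ennreal (2*(C1 + C2)*T powr (2*(a - a')))*(NT mu. (w a' mu*g mu)^2)"
    by (rule nn_integral_cmult) measurable
   finally have "(NT l. (w a l*(NT mu. k (l - mu)*g mu))^2)
     <= ennreal D*(ennreal (2*(C1 + C2)*T powr (2*(a - a')))*(NT mu. (w a' mu*g mu)^2))"
    by (simp add: mult_left_mono)
   also have "... = ennreal (C*T powr (2*(a - a')))*(NT mu. (w a' mu*g mu)^2)"
    using C1 C2 D unfolding C_def by (simp add: mult.assoc[symmetric] flip: ennreal_mult)
   finally show ?thesis unfolding w_def g_def md_def by simp
  qed
  have [measurable]: "(%ze. md a ze*(NT mu. k (fst ze - mu)*G (mu, snd ze))) : BM fm"
   unfolding meas_fm_iff md_def by simp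
  have "(NF ze. (md a ze*(NT mu. k (fst ze - mu)*G (mu, snd ze)))^2)
   = (\<integral>\<^sup>+n. (NT l. (md a (l, n)*(NT mu. k (l - mu)*G (mu, n)))^2) \<partial>count_space UNIV)"
   by (subst nn_integral_fm) auto
  also have "... <= (\<integral>\<^sup>+n. ennreal (C*T powr (2*(a - a')))*(NT mu. (md a' (mu, n)*G (mu, n))^2) \<partial>count_space UNIV)"
   by (intro nn_integral_mono colm)
  also have "... = ennreal (C*T powr (2*(a - a')))*(NF ze. (md a' ze*G ze)^2)"
   by (simp add: nn_integral_cmult nn_integral_fm)
  finally show ?thesis unfolding k_def .
 qed
 have "0 <= C" using C1 C2 D by (simp add: C_def)
 then show ?thesis using main by (intro exI[of _ C]) auto
qed

section \<open>The Schwartz class\<close>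

lemma schwartz_iter_deriv_differentiable: "ph : schwartz ==> iter_deriv vs ph differentiable (at z)"
 unfolding schwartz_def by blast
lemma schwartz_periodic: "ph : schwartz ==> periodic_space ph"
 unfolding schwartz_def by blast
lemma schwartz_bounded: "ph : schwartz ==> bounded (range (%z. \<bar>fst z\<bar> ^ k *\<^sub>R iter_deriv vs ph z))"
 unfolding schwartz_def by blast

lemma iter_deriv_append: "iter_deriv (vs @ ws) f = iter_deriv vs (iter_deriv ws f)"
 by (induction vs) auto

lemma schwartz_continuous: "ph : schwartz ==> continuous_on UNIV ph"
 using schwartz_iter_deriv_differentiable[of ph "[]"]
 by (auto simp: continuous_on_eq_continuous_at differentiable_imp_continuous_within)

lemma schwartz_frechet:
 assumes "ph : schwartz"
 shows "(iter_deriv vs ph has_derivative (%v. iter_deriv (v # vs) ph z)) (at z)"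
 using schwartz_iter_deriv_differentiable[OF assms] by (simp add: frechet_derivative_works[symmetric])

lemma iter_deriv_Cons:
 assumes "(iter_deriv vs f has_derivative D) (at z)"
 shows "iter_deriv (v # vs) f z = D v"
 using frechet_derivative_at[OF assms] by simp

lemma periodic_frechet:
 assumes "periodic_space f" shows "periodic_space (%z. frechet_derivative f (at z) v)"
proof -
 have sh: "frechet_derivative f (at (z + w)) = frechet_derivative f (at z)" if w: "!!z. f (z + w) = f z" for w z
 proof -
  have "(f has_derivative D) (at (z + w)) \<longleftrightarrow> (f has_derivative D) (at z)" for D
  proof -
   have "((%x. f (x + w)) has_derivative D) (at z) \<longleftrightarrow> (f has_derivative D) (at (z + w))"
   proof
    assume "((%x. f (x + w)) has_derivative D) (at z)"
    then have 1: "((%x. f (x + w)) has_derivative D) (at ((z + w) - w))" by simp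
    have 2: "((%x. x + (- w)) has_derivative (%x. x)) (at (z + w))"
     by (rule has_derivative_add_const[OF has_derivative_ident])
    have "((%x. f (x + w)) has_derivative D) (at ((z + w) + (- w)))" using 1 by simp
    from has_derivative_compose[OF 2 this] show "(f has_derivative D) (at (z + w))" by simp
   next
    assume "(f has_derivative D) (at (z + w))"
    from has_derivative_compose[OF has_derivative_add_const[OF has_derivative_ident] this]
    show "((%x. f (x + w)) has_derivative D) (at z)" by simp
   qed
   then show ?thesis using w by simp
  qed
  then show ?thesis by (simp add: frechet_derivative_def)
 qed
 have "f (z + (0, 2*pi, 0)) = f z" "f (z + (0, 0, 2*pi)) = f z" for z
  using assms by (cases z; simp add: periodic_space_def)+
 from sh[OF this(1)] sh[OF this(2)]
 have "frechet_derivative f (at (t, x + 2*pi, y)) = frechet_derivative f (at (t, x, y))"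
  "frechet_derivative f (at (t, x, y + 2*pi)) = frechet_derivative f (at (t, x, y))" for t x y
  by (force dest: meta_spec[of _ "(t, x, y)"])+
 then show ?thesis unfolding periodic_space_def by simp
qed

lemma periodic_iter_deriv: "periodic_space f ==> periodic_space (iter_deriv vs f)"
 by (induction vs) (auto intro: periodic_frechet)

lemma schwartz_deriv: "ph : schwartz ==> iter_deriv ws ph : schwartz"
 using periodic_iter_deriv[of ph ws]
 by (auto simp: schwartz_def iter_deriv_append[symmetric])

lemma iter_deriv_in_class:
 assumes cl: "!!f z. f : S ==> EX D. (f has_derivative (%v. D v z)) (at z) & (ALL v. D v : S & (ALL y. (f has_derivative (%v. D v y)) (at y)))"
  and f: "f : S"
 shows "iter_deriv vs f : S"
proof (induction vs)
 case (Cons v vs)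
 then obtain D where D: "!!v. D v : S" "!!y. (iter_deriv vs f has_derivative (%v. D v y)) (at y)" using cl by blast
 have "iter_deriv (v # vs) f = D v" using iter_deriv_Cons[OF D(2)] by (auto simp: fun_eq_iff)
 then show ?case using D by simp
qed (use f in simp)

text \<open>Sets of functions that contain the directional derivatives of their elements. They replace an induction on
the order of differentiation: membership in such a set gives derivatives of all orders at once.\<close>

definition deriv_closed :: "(spacetime => complex) set => bool" where
 "deriv_closed S \<longleftrightarrow> (ALL f:S. EX D. (ALL v. D v : S) & (ALL z. (f has_derivative (%v. D v z)) (at z)))"

lemma deriv_closedD: "deriv_closed S ==> f : S ==> iter_deriv vs f : S"
 by (rule iter_deriv_in_class) (auto simp: deriv_closed_def, blast)

lemma deriv_closed_differentiable: "deriv_closed S ==> f : S ==> iter_deriv vs f differentiable (at z)"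
 using deriv_closedD[of S f vs] unfolding deriv_closed_def differentiable_def by blast

lemma schwartzI_class:
 assumes S: "deriv_closed S" and per: "!!f. f : S ==> periodic_space f"
  and bd: "!!f k. f : S ==> bounded (range (%z. \<bar>fst z\<bar> ^ k *\<^sub>R f z))" and f: "f : S"
 shows "f : schwartz"
 unfolding schwartz_def using deriv_closedD[OF S f] deriv_closed_differentiable[OF S f] per[OF f] bd by auto

lemma schwartz_deriv_closed: "deriv_closed schwartz"
 unfolding deriv_closed_def
proof (intro ballI exI conjI allI)
 fix ph v z assume "ph : schwartz"
 then show "iter_deriv [v] ph : schwartz" "(ph has_derivative (%v. iter_deriv [v] ph z)) (at z)"
  using schwartz_deriv[of ph "[v]"] schwartz_frechet[of ph "[]" z] by auto
qed

lemma schwartz_bdd: "ph : schwartz ==> EX B. ALL z. \<bar>fst z\<bar> ^ k*cmod (ph z) <= B"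
 using schwartz_bounded[of ph k "[]"] by (auto simp: bounded_iff)

lemma bounded_rangeI: "(!!z. \<bar>fst z\<bar> ^ k*cmod (f z) <= B) ==> bounded (range (%z. \<bar>fst z\<bar> ^ k *\<^sub>R (f z :: complex)))"
 unfolding bounded_iff by (intro exI[of _ B]) (auto simp: image_iff)

lemma schwartz_add:
 assumes "ph : schwartz" "ps : schwartz" shows "(%z. ph z + ps z) : schwartz"
proof (rule schwartzI_class[where S="{%z. f z + g z | f g. f : schwartz & g : schwartz}"])
 show "deriv_closed {%z. f z + g z | f g. f : schwartz & g : schwartz}"
  unfolding deriv_closed_def
 proof clarify
  fix f g assume fg: "f : schwartz" "g : schwartz"
  then show "EX D. (ALL v. D v : {%z. f z + g z | f g. f : schwartz & g : schwartz}) & (ALL z. ((%z. f z + g z) has_derivative (%v. D v z)) (at z))"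
   using schwartz_deriv schwartz_frechet[of f "[]"] schwartz_frechet[of g "[]"]
   by (intro exI[of _ "%v z. iter_deriv [v] f z + iter_deriv [v] g z"])
     (auto simp del: iter_deriv.simps(2) intro!: has_derivative_add)
 qed
next
 fix f assume "f : {%z. f z + g z | f g. f : schwartz & g : schwartz}"
 then show "periodic_space f" by (auto simp: periodic_space_def dest!: schwartz_periodic)
next
 fix f k assume "f : {%z. f z + g z | f g. f : schwartz & g : schwartz}"
 then obtain g h where f: "f = (%z. g z + h z)" "g : schwartz" "h : schwartz" by auto
 show "bounded (range (%z. \<bar>fst z\<bar> ^ k *\<^sub>R f z))"
  using bounded_plus_comp[OF schwartz_bounded[OF f(2), of k "[]"] schwartz_bounded[OF f(3), of k "[]"]]
  by (simp add: f scaleR_add_right)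
qed (use assms in auto)

lemma sum_lessThan_add: "(\<Sum>i<n + m. f i) = (\<Sum>i<n. f i) + (\<Sum>i<m. f (n + i))"
 for f :: "nat => complex"
 by (induction m) (auto simp: add.assoc)

text \<open>By the Leibniz rule the finite sums of products are again closed under derivatives.\<close>

lemma schwartz_mult_bounded_class:
 assumes S: "deriv_closed S" and per: "!!f. f : S ==> periodic_space f"
  and bd: "!!f. f : S ==> EX B. ALL z. cmod (f z) <= B" and f: "f : S" and g: "g : schwartz"
 shows "(%z. f z*g z) : schwartz"
proof -
 define P where "P = {%z. (\<Sum>i<n. a i z*b i z) | n a b. (ALL i<n::nat. a i : S & b i : schwartz)}"
 have in1: "(%z. f z*g z) : P"
  unfolding P_def using f g by (intro CollectI exI[of _ 1] exI[of _ "%_. f"] exI[of _ "%_. g"]) auto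
 have "deriv_closed P"
  unfolding deriv_closed_def
 proof
  fix h assume "h : P"
  then obtain n a b where h: "h = (%z. (\<Sum>i<n. a i z*b i z))" "ALL i<n::nat. a i : S & b i : schwartz"
   unfolding P_def by auto
  have "ALL i<n. EX D. (ALL v. D v : S) & (ALL z. (a i has_derivative (%v. D v z)) (at z))"
   using S h(2) by (auto simp: deriv_closed_def)
  then obtain A where A: "!!i v. i < n ==> A i v : S" "!!i z. i < n ==> (a i has_derivative (%v. A i v z)) (at z)"
   by metis
  define B where "B i v = iter_deriv [v] (b i)" for i v
  have B: "B i v : schwartz" "(b i has_derivative (%v. B i v z)) (at z)" if "i < n" for i v z
   using that h(2) schwartz_deriv[of "b i" "[v]"] schwartz_frechet[of "b i" "[]" z] by (auto simp: B_def)
  define D where "D v z = (\<Sum>i<n. a i z*B i v z + A i v z*b i z)" for v z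
  have "D v : P" for v
  proof -
   define a' b' where "a' i = (if i < n then a i else A (i - n) v)" and "b' i = (if i < n then B i v else b (i - n))" for i
   have "D v = (%z. \<Sum>i<n + n. a' i z*b' i z)"
   proof
    fix z
    have "(\<Sum>i<n + n. a' i z*b' i z) = (\<Sum>i<n. a' i z*b' i z) + (\<Sum>i<n. a' (n + i) z*b' (n + i) z)"
     by (rule sum_lessThan_add)
    then show "D v z = (\<Sum>i<n + n. a' i z*b' i z)"
     by (simp add: D_def a'_def b'_def sum.distrib)
   qed
   moreover have "ALL i<n + n. a' i : S & b' i : schwartz" using A B h(2) by (auto simp: a'_def b'_def)
   ultimately show ?thesis unfolding P_def by blast
  qed
  moreover have "(h has_derivative (%v. D v z)) (at z)" for z
   unfolding h(1) D_def using A B by (intro has_derivative_sum has_derivative_mult) auto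
  ultimately show "EX D. (ALL v. D v : P) & (ALL z. (h has_derivative (%v. D v z)) (at z))" by blast
 qed
 moreover have "periodic_space h" if hP: "h : P" for h
 proof -
  obtain n a b where h: "h = (%z. (\<Sum>i<n. a i z*b i z))" "ALL i<n::nat. a i : S & b i : schwartz"
   using hP unfolding P_def by blast
  have "periodic_space (a i)" "periodic_space (b i)" if "i < n" for i
   using per schwartz_periodic h(2) that by blast+
  then show ?thesis unfolding periodic_space_def h(1) by (auto intro!: sum.cong)
 qed
 moreover have "bounded (range (%z. \<bar>fst z\<bar> ^ k *\<^sub>R h z))" if hP: "h : P" for h k
 proof -
  obtain n a b where h: "h = (%z. (\<Sum>i<n. a i z*b i z))" "ALL i<n::nat. a i : S & b i : schwartz"
   using hP unfolding P_def by blast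
  have "ALL i<n. EX C. ALL z. \<bar>fst z\<bar> ^ k*cmod (a i z*b i z) <= C"
  proof (intro allI impI)
   fix i assume "i < n"
   then obtain A B where AB: "!!z. cmod (a i z) <= A" "!!z. \<bar>fst z\<bar> ^ k*cmod (b i z) <= B"
    using h(2) bd schwartz_bdd[of "b i" k] by meson
   have "\<bar>fst z\<bar> ^ k*cmod (a i z*b i z) <= A*B" for z
   proof -
    have "cmod (a i z)*(\<bar>fst z\<bar> ^ k*cmod (b i z)) <= A*B"
     using AB order_trans[OF norm_ge_zero AB(1)] by (intro mult_mono) auto
    then show ?thesis by (simp add: norm_mult mult_ac)
   qed
   then show "EX C. ALL z. \<bar>fst z\<bar> ^ k*cmod (a i z*b i z) <= C" by blast
  qed
  then obtain C where C: "!!i z. i < n ==> \<bar>fst z\<bar> ^ k*cmod (a i z*b i z) <= C i" by metis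
  show ?thesis
  proof (rule bounded_rangeI)
   fix z :: spacetime
   have "\<bar>fst z\<bar> ^ k*cmod (h z) <= \<bar>fst z\<bar> ^ k*(\<Sum>i<n. cmod (a i z*b i z))"
    unfolding h(1) by (intro mult_left_mono norm_sum) auto
   also have "... <= (\<Sum>i<n. C i)" unfolding sum_distrib_left using C by (intro sum_mono) auto
   finally show "\<bar>fst z\<bar> ^ k*cmod (h z) <= (\<Sum>i<n. C i)" .
  qed
 qed
 ultimately show ?thesis using in1 by (rule schwartzI_class)
qed

lemma schwartz_mult:
 assumes "ph : schwartz" "ps : schwartz" shows "(%z. ph z*ps z) : schwartz"
proof (rule schwartz_mult_bounded_class[OF schwartz_deriv_closed schwartz_periodic _ assms])
 fix f assume "f : schwartz"
 then show "EX B. ALL z. cmod (f z) <= B" using schwartz_bdd[of f 0] by simp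
qed

lemma schwartz_scale:
 assumes "ph : schwartz" shows "(%z. c*ph z) : schwartz"
proof (rule schwartz_mult_bounded_class[where S="range (%c z. c)" and f="%z. c"])
 show "deriv_closed (range (%c z. c))" unfolding deriv_closed_def
  by (auto intro!: exI[of _ "%v z. 0"])
qed (use assms in \<open>auto simp: periodic_space_def\<close>)

lemma schwartz_diff:
 assumes "ph : schwartz" "ps : schwartz" shows "(%z. ph z - ps z) : schwartz"
 using schwartz_add[OF assms(1) schwartz_scale[OF assms(2), of "-1"]] by simp

section \<open>Smooth functions with compact support in time\<close>

text \<open>The functions \<open>p(1/x) exp(-1/x)\<close>, extended by zero to \<open>x \<le> 0\<close>. Allowing a polynomial makes the family closed
under differentiation.\<close>

definition flatf :: "real poly => real => real" where
 "flatf p x = (if 0 < x then poly p (1 / x)*exp (- (1 / x)) else 0)"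

lemma poly_exp_tendsto: "0 < c ==> ((%y. poly p y*exp (- (c*y))) \<longlongrightarrow> 0) at_top" for p :: "real poly" and c :: real
proof (induction p arbitrary: c)
 case (pCons a p)
 have 1: "((%y::real. exp (- (c*y))) \<longlongrightarrow> 0) at_top" using pCons.prems by real_asymp
 have 2: "((%y::real. y*exp (- (c / 2*y))) \<longlongrightarrow> 0) at_top" using pCons.prems by real_asymp
 have 3: "((%y. poly p y*exp (- (c / 2*y))) \<longlongrightarrow> 0) at_top" using pCons.IH[of "c / 2"] pCons.prems by simp
 have "((%y. a*exp (- (c*y)) + (y*exp (- (c / 2*y)))*(poly p y*exp (- (c / 2*y)))) \<longlongrightarrow> a*0 + 0*0) at_top"
  by (intro tendsto_intros 1 2 3)
 moreover have "a*exp (- (c*y)) + (y*exp (- (c / 2*y)))*(poly p y*exp (- (c / 2*y))) = poly (pCons a p) y*exp (- (c*y))" for y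
 proof -
  have "exp (- (c*y)) = exp (- (c / 2*y))*exp (- (c / 2*y))" by (simp flip: exp_add)
  then show ?thesis by (simp add: algebra_simps)
 qed
 ultimately show ?case by simp
qed simp

lemma flat_tendsto_0: "(flatf p \<longlongrightarrow> 0) (at 0)"
proof -
 have "((%x. poly p (1 / x)*exp (- (1*(1 / x)))) \<longlongrightarrow> 0) (at_right 0)"
  by (rule filterlim_compose[OF poly_exp_tendsto]) (simp, real_asymp)
 then have "(flatf p \<longlongrightarrow> 0) (at_right 0)"
  by (rule Lim_transform_eventually) (auto simp: eventually_at_right_field flatf_def intro!: exI[of _ 1])
 moreover have "(flatf p \<longlongrightarrow> 0) (at_left 0)"
  by (rule Lim_transform_eventually[OF tendsto_const[of 0]]) (auto simp: eventually_at_left_field flatf_def intro!: exI[of _ "-1"])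
 ultimately show ?thesis by (simp add: filterlim_split_at)
qed

definition flat_deriv :: "real poly => real poly" where
 "flat_deriv p = [:0, 0, 1:]*(p - pderiv p)"

lemma flat_has_derivative: "(flatf p has_real_derivative flatf (flat_deriv p) x) (at x)"
proof -
 consider "0 < x" | "x < 0" | "x = 0" by linarith
 then show ?thesis
 proof cases
  case 1
  have "((%x. poly p (1 / x)*exp (- (1 / x))) has_real_derivative flatf (flat_deriv p) x) (at x)"
   using 1 by (auto intro!: derivative_eq_intros poly_DERIV simp: flatf_def flat_deriv_def field_simps power2_eq_square)
  moreover have "\<forall>\<^sub>F y in nhds x. poly p (1 / y)*exp (- (1 / y)) = flatf p y"
   using eventually_nhds_in_open[of "{0<..}" x] 1 by (auto simp: flatf_def elim: eventually_mono)
  ultimately show ?thesis using DERIV_cong_ev[OF refl _ refl, of "%y. poly p (1 / y)*exp (- (1 / y))" "flatf p" x] by simp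
 next
  case 2
  have "\<forall>\<^sub>F y in nhds x. 0 = flatf p y"
   using eventually_nhds_in_open[of "{..<0}" x] 2 by (auto simp: flatf_def elim: eventually_mono)
  then have "(flatf p has_real_derivative 0) (at x)" using DERIV_cong_ev[OF refl _ refl, of "%_. 0" "flatf p" x 0] by simp
  then show ?thesis using 2 by (simp add: flatf_def)
 next
  case 3
  have "((%h. (flatf p (0 + h) - flatf p 0) / h) \<longlongrightarrow> 0) (at 0)"
  proof (rule Lim_transform_eventually[OF flat_tendsto_0[of "[:0, 1:]*p"]])
   show "\<forall>\<^sub>F h in at 0. flatf ([:0, 1:]*p) h = (flatf p (0 + h) - flatf p 0) / h"
    by (auto simp: flatf_def eventually_at intro!: exI[of _ 1])
  qed
  then show ?thesis using 3 by (simp add: DERIV_def flatf_def)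
 qed
qed

text \<open>A class of smooth functions that contains the bumps needed below. Sine phases provide functions that are
periodic in space; quotients are needed for plateaus. Linear phases do not give periodic functions, so
periodicity is imposed separately.\<close>

inductive_set smf :: "(spacetime => complex) set" where
 const: "(%z. c) : smf"
| sine: "(%z. of_real (sin (z \<bullet> w + c))) : smf"
| flat_t: "(%z. of_real (flatf p (z \<bullet> w + c))) : smf"
| flat_s: "(%z. of_real (flatf p (k * sin (z \<bullet> w + c) + d))) : smf"
| add: "f : smf ==> g : smf ==> (%z. f z + g z) : smf"
| mult: "f : smf ==> g : smf ==> (%z. f z*g z) : smf"
| inv: "f : smf ==> (!!z. f z ~= 0) ==> (%z. inverse (f z)) : smf"

lemma has_derivative_inner_phase:
 assumes "(h has_real_derivative h') (at (z \<bullet> w + c))"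
 shows "((%z::spacetime. complex_of_real (h (z \<bullet> w + c))) has_derivative (%v. of_real h' * of_real (v \<bullet> w))) (at z)"
proof -
 have "((%z::spacetime. z \<bullet> w + c) has_derivative (%v. v \<bullet> w)) (at z)"
  by (auto intro!: derivative_eq_intros)
 from has_derivative_compose[OF this, of h "(*) h'"] assms
 have "((%z. h (z \<bullet> w + c)) has_derivative (%v. h'*(v \<bullet> w))) (at z)"
  by (simp add: has_field_derivative_def)
 from has_derivative_of_real[OF this, where 'a=complex] show ?thesis by simp
qed

lemma smf_deriv_closed: "deriv_closed smf"
 unfolding deriv_closed_def
proof
 fix f assume "f : smf"
 then show "EX D. (ALL v. D v : smf) & (ALL z. (f has_derivative (%v. D v z)) (at z))"
 proof induction
  case (const c)
  show ?case by (rule exI[of _ "%v z. 0"]) (auto intro: smf.const)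
 next
  case (sine w c)
  have 1: "(%z. complex_of_real (sin (z \<bullet> w + (c + pi / 2))) * of_real (v \<bullet> w)) : smf" for v
   by (intro smf.mult smf.sine smf.const)
  have 2: "((%z::spacetime. complex_of_real (sin (z \<bullet> w + c))) has_derivative (%v. of_real (sin (z \<bullet> w + (c + pi / 2))) * of_real (v \<bullet> w))) (at z)" for z
  proof (rule has_derivative_inner_phase)
   have "sin (z \<bullet> w + (c + pi / 2)) = cos (z \<bullet> w + c)"
    unfolding add.assoc[symmetric] by (simp add: sin_add)
   then show "(sin has_real_derivative sin (z \<bullet> w + (c + pi / 2))) (at (z \<bullet> w + c))"
    using DERIV_sin by simp
  qed
  show ?case using 1 2 by (intro exI[of _ "%v z. complex_of_real (sin (z \<bullet> w + (c + pi / 2))) * of_real (v \<bullet> w)"]) blast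
 next
  case (flat_t p w c)
  have 1: "(%z. complex_of_real (flatf (flat_deriv p) (z \<bullet> w + c)) * of_real (v \<bullet> w)) : smf" for v
   by (intro smf.mult smf.flat_t smf.const)
  have 2: "((%z::spacetime. complex_of_real (flatf p (z \<bullet> w + c))) has_derivative (%v. of_real (flatf (flat_deriv p) (z \<bullet> w + c)) * of_real (v \<bullet> w))) (at z)" for z
   by (rule has_derivative_inner_phase[OF flat_has_derivative])
  show ?case using 1 2 by (intro exI[of _ "%v z. complex_of_real (flatf (flat_deriv p) (z \<bullet> w + c)) * of_real (v \<bullet> w)"]) blast
 next
  case (flat_s p k w c d)
  define D where "D v z = complex_of_real (flatf (flat_deriv p) (k * sin (z \<bullet> w + c) + d))*(of_real k * of_real (sin (z \<bullet> w + (c + pi / 2)))) * of_real (v \<bullet> w)" for v z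
  have 1: "D v : smf" for v
   unfolding D_def by (intro smf.mult smf.flat_s smf.const smf.sine)
  have 2: "((%z::spacetime. complex_of_real (flatf p (k * sin (z \<bullet> w + c) + d))) has_derivative (%v. D v z)) (at z)" for z
  proof -
   have s: "sin (z \<bullet> w + (c + pi / 2)) = cos (z \<bullet> w + c)"
    unfolding add.assoc[symmetric] by (simp add: sin_add)
   have "((%x. k * sin x + d) has_real_derivative k*cos (z \<bullet> w + c)) (at (z \<bullet> w + c))"
    by (auto intro!: derivative_eq_intros)
   from DERIV_chain2[OF flat_has_derivative this]
   have "((%x. flatf p (k * sin x + d)) has_real_derivative flatf (flat_deriv p) (k * sin (z \<bullet> w + c) + d)*(k*cos (z \<bullet> w + c))) (at (z \<bullet> w + c))" .
   from has_derivative_inner_phase[OF this] show ?thesis by (simp add: D_def s)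
  qed
  show ?case using 1 2 by (intro exI[of _ D]) blast
 next
  case (add f g)
  then obtain A B where A: "!!v. A v : smf" "!!z. (f has_derivative (%v. A v z)) (at z)"
   and B: "!!v. B v : smf" "!!z. (g has_derivative (%v. B v z)) (at z)" by blast
  then show ?case by (intro exI[of _ "%v z. A v z + B v z"] conjI allI smf.add has_derivative_add)
 next
  case (mult f g)
  then obtain A B where A: "!!v. A v : smf" "!!z. (f has_derivative (%v. A v z)) (at z)"
   and B: "!!v. B v : smf" "!!z. (g has_derivative (%v. B v z)) (at z)" by blast
  then show ?case using mult.hyps
   by (intro exI[of _ "%v z. f z*B v z + A v z*g z"] conjI allI smf.add smf.mult has_derivative_mult)
 next
  case (inv f)
  then obtain A where A: "!!v. A v : smf" "!!z. (f has_derivative (%v. A v z)) (at z)" by blast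
  define D where "D v z = (- 1)*(inverse (f z)*A v z*inverse (f z))" for v z
  have "D v : smf" for v
   unfolding D_def by (intro smf.mult smf.const smf.inv A inv.hyps)
  moreover have "((%z. inverse (f z)) has_derivative (%v. D v z)) (at z)" for z
   using Deriv.has_derivative_inverse[OF inv.hyps(2) A(2)] by (simp add: D_def)
  ultimately show ?case by blast
 qed
qed

text \<open>Periodic in space and compactly supported in time, the function and all its derivatives live on a compact
set, so continuity gives all the bounds.\<close>

lemma schwartz_compact_timeI:
 assumes S: "deriv_closed S" "f : S" and per: "periodic_space f"
  and supp: "!!t x y. t \<notin> {a..b} ==> f (t, x, y) = 0"
 shows "f : schwartz"
proof (rule schwartzI_class[where S="{g. g : S & periodic_space g & (ALL t x y. t \<notin> {a..b} --> g (t, x, y) = 0)}"])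
 show "deriv_closed {g. g : S & periodic_space g & (ALL t x y. t \<notin> {a..b} --> g (t, x, y) = 0)}"
  unfolding deriv_closed_def
 proof
  fix g assume "g : {g. g : S & periodic_space g & (ALL t x y. t \<notin> {a..b} --> g (t, x, y) = 0)}"
  then have g: "g : S" "periodic_space g" "!!t x y. t \<notin> {a..b} ==> g (t, x, y) = 0" by auto
  obtain D where D: "!!v. D v : S" "!!z. (g has_derivative (%v. D v z)) (at z)"
   using S g(1) unfolding deriv_closed_def by blast
  have fr: "D v z = frechet_derivative g (at z) v" for v z
   using frechet_derivative_at[OF D(2)] by (metis)
  have "D v = (%z. frechet_derivative g (at z) v)" for v using fr by (rule ext)
  then have p: "periodic_space (D v)" for v
   using periodic_frechet[OF g(2), of v] by simp
  have z: "D v (t, x, y) = 0" if t: "t \<notin> {a..b}" for v t x y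
  proof -
   have "open ((UNIV - {a..b}) \<times> (UNIV :: (real \<times> real) set))" by (intro open_Times) auto
   then have "(g has_derivative (%v. 0)) (at (t, x, y))"
    using t g(3) by (intro has_derivative_transform_within_open[OF has_derivative_const[of 0]]) auto
   then have "(%v. D v (t, x, y)) = (%v. 0)" using D(2) has_derivative_unique by blast
   then show ?thesis by meson
  qed
  show "EX D. (ALL v. D v : {g. g : S & periodic_space g & (ALL t x y. t \<notin> {a..b} --> g (t, x, y) = 0)}) & (ALL z. (g has_derivative (%v. D v z)) (at z))"
   using D p z by (intro exI[of _ D]) auto
 qed
next
 fix g k assume "g : {g. g : S & periodic_space g & (ALL t x y. t \<notin> {a..b} --> g (t, x, y) = 0)}"
 then have g: "g : S" "periodic_space g" "!!t x y. t \<notin> {a..b} ==> g (t, x, y) = 0" by auto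
 define K where "K = {a..b} \<times> {0..2*pi} \<times> {0..2*pi}"
 have "compact K" unfolding K_def by (intro compact_Times) auto
 moreover have "continuous_on K (%z. \<bar>fst z\<bar> ^ k*cmod (g z))"
 proof -
  have "continuous_on UNIV g" using S(1) g(1) deriv_closed_differentiable[OF S(1) g(1), of "[]"]
   by (auto simp: continuous_on_eq_continuous_at differentiable_imp_continuous_within)
  then have "continuous_on K g" by (rule continuous_on_subset) simp
  then show ?thesis by (intro continuous_intros)
 qed
 ultimately have "bounded ((%z. \<bar>fst z\<bar> ^ k*cmod (g z)) ` K)"
  by (intro compact_imp_bounded compact_continuous_image)
 then obtain B where B: "!!z. z : K ==> \<bar>fst z\<bar> ^ k*cmod (g z) <= B" unfolding bounded_iff by auto
 have shift: "g (t, x + 2*pi * of_int m, y) = g (t, x, y)" "g (t, x, y + 2*pi * of_int m) = g (t, x, y)" for t x y m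
 proof -
  interpret px: periodic_fun_simple "%x. g (t, x, y)" "2*pi" for y using g(2) by unfold_locales (simp add: periodic_space_def)
  interpret py: periodic_fun_simple "%y. g (t, x, y)" "2*pi" for x using g(2) by unfold_locales (simp add: periodic_space_def)
  show "g (t, x + 2*pi * of_int m, y) = g (t, x, y)" using px.plus_of_int[of x m y] by (simp add: mult.commute)
  show "g (t, x, y + 2*pi * of_int m) = g (t, x, y)" using py.plus_of_int[of x y m] by (simp add: mult.commute)
 qed
 have red: "EX x':{0..2*pi}. EX m::int. x = x' + 2*pi * of_int m" for x :: real
 proof -
  define m where "m = \<lfloor>x / (2*pi)\<rfloor>"
  have "of_int m <= x / (2*pi)" "x / (2*pi) < of_int m + 1" unfolding m_def by linarith+
  then have "of_int m*(2*pi) <= x" "x < (of_int m + 1)*(2*pi)" by (simp_all add: field_simps)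
  then show ?thesis by (intro bexI[of _ "x - 2*pi * of_int m"] exI[of _ m]) (auto simp: algebra_simps)
 qed
 show "bounded (range (%z. \<bar>fst z\<bar> ^ k *\<^sub>R g z))"
 proof (rule bounded_rangeI)
  fix z :: spacetime
  obtain t x y where z: "z = (t, x, y)" by (cases z)
  obtain x' m y' l where xy: "x = x' + 2*pi * of_int m" "x' : {0..2*pi}" "y = y' + 2*pi * of_int l" "y' : {0..2*pi}"
   using red[of x] red[of y] by blast
  have gz: "g z = g (t, x', y')" by (simp only: z xy shift)
  show "\<bar>fst z\<bar> ^ k*cmod (g z) <= max B 0"
  proof (cases "t : {a..b}")
   case True
   then have "(t, x', y') : K" using xy by (simp add: K_def)
   from B[OF this] show ?thesis unfolding gz by (simp add: z)
  next
   case False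
   then show ?thesis using g(3) by (simp add: z)
  qed
 qed
qed (use S per supp in auto)

section \<open>The fundamental slab and its characters\<close>

text \<open>The circle as Lebesgue measure on a fundamental interval, without identification of the end points.\<close>

definition tm :: "real measure" where "tm = density lborel (%x. ennreal (indicator {0..<2*pi} x))"
definition sl :: "spacetime measure" where "sl = lborel \<Otimes>\<^sub>M (tm \<Otimes>\<^sub>M tm)"

abbreviation nn_slab (binder "NS " 10) where "nn_slab f == nn_integral sl f"
abbreviation int_slab (binder "BS " 10) where "int_slab f == integral\<^sup>L sl f"

lemma sets_tm[measurable_cong, simp]: "sets tm = sets borel" and space_tm[simp]: "space tm = UNIV"
 by (simp_all add: tm_def)

lemma emeasure_tm: "emeasure tm UNIV = ennreal (2*pi)"
proof -
 have "emeasure tm UNIV = (NT x. indicator {0..<2*pi} x)"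
  unfolding tm_def by (subst emeasure_density) (auto simp: ennreal_indicator)
 then show ?thesis by simp
qed

interpretation tm: finite_measure tm
 by standard (simp add: emeasure_tm)

interpretation tm2: pair_sigma_finite tm tm ..

interpretation slp: pair_sigma_finite lborel "tm \<Otimes>\<^sub>M tm"
 by (intro pair_sigma_finite.intro sigma_finite_lborel sigma_finite_pair_measure tm.sigma_finite_measure_axioms)

interpretation sls: sigma_finite_measure sl
 unfolding sl_def by (intro sigma_finite_pair_measure sigma_finite_lborel tm.sigma_finite_measure_axioms)

interpretation slfm: pair_sigma_finite sl fm
 by (intro pair_sigma_finite.intro sls.sigma_finite_measure_axioms fms.sigma_finite_measure_axioms)

interpretation fmsl: pair_sigma_finite fm sl
 by (intro pair_sigma_finite.intro sls.sigma_finite_measure_axioms fms.sigma_finite_measure_axioms)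

lemma sl_density: "sl = density lborel (%z. ennreal (indicator (slab UNIV) z))"
proof -
 have l: "(lborel :: real measure) = density lborel (%x. 1)" by (simp add: density_1)
 have t2: "tm \<Otimes>\<^sub>M tm = density (lborel :: (real \<times> real) measure) (%(x, y). ennreal (indicator {0..<2*pi} x)*ennreal (indicator {0..<2*pi} y))"
  unfolding tm_def
  by (subst pair_measure_density) (auto simp: lborel_prod sigma_finite_lborel tm.sigma_finite_measure_axioms[unfolded tm_def])
 have "sl = density lborel (%x. 1) \<Otimes>\<^sub>M density (lborel :: (real \<times> real) measure) (%(x, y). ennreal (indicator {0..<2*pi} x)*ennreal (indicator {0..<2*pi} y))"
  unfolding sl_def t2 using l by simp
 also have "... = density (lborel \<Otimes>\<^sub>M lborel) (%(t, p). 1*(case p of (x, y) => ennreal (indicator {0..<2*pi} x)*ennreal (indicator {0..<2*pi} y)))"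
 proof (rule pair_measure_density)
  have "sigma_finite_measure (tm \<Otimes>\<^sub>M tm)" by (intro sigma_finite_pair_measure tm.sigma_finite_measure_axioms)
  then show "sigma_finite_measure (density (lborel :: (real \<times> real) measure) (%(x, y). ennreal (indicator {0..<2*pi} x)*ennreal (indicator {0..<2*pi} y)))"
   unfolding t2 .
  show "(%(x, y). ennreal (indicator {0..<2*pi} x)*ennreal (indicator {0..<2*pi} y)) : BM (lborel :: (real \<times> real) measure)"
   unfolding lborel_prod[symmetric] by measurable
 qed (auto simp: sigma_finite_lborel)
 also have "... = density lborel (%z. ennreal (indicator (slab UNIV) z))"
  unfolding lborel_prod by (intro arg_cong[where f="density lborel"]) (auto simp: slab_def indicator_def fun_eq_iff)
 finally show ?thesis .
qed

lemma sets_sl[measurable_cong, simp]: "sets sl = sets borel" and space_sl[simp]: "space sl = UNIV"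
 by (simp_all add: sl_density)

lemma slab_UNIV_borel[measurable]: "slab UNIV : sets (borel :: spacetime measure)"
proof -
 have "slab UNIV : sets ((borel :: real measure) \<Otimes>\<^sub>M (borel \<Otimes>\<^sub>M borel))"
  unfolding slab_def by (intro pair_measureI) auto
 then show ?thesis unfolding borel_prod .
qed

lemma integrable_sl:
 fixes f :: "spacetime => complex" assumes "f : BM borel"
 shows "integrable sl f \<longleftrightarrow> set_integrable lborel (slab UNIV) f"
 unfolding sl_density set_integrable_def using assms
 by (subst integrable_density) auto

lemma integral_sl:
 fixes f :: "spacetime => complex" assumes "f : BM borel"
 shows "integral\<^sup>L sl f = (LINT z:slab UNIV|lborel. f z)"
 unfolding sl_density set_lebesgue_integral_def using assms
 by (subst integral_density) auto

definition ch :: "frequency => spacetime => complex" where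
 "ch xi z = cis (fst xi*fst z + of_int (fst (snd xi))*fst (snd z) + of_int (snd (snd xi)) * snd (snd z))"

lemma norm_ch[simp]: "cmod (ch xi z) = 1" by (simp add: ch_def)
lemma ch_add: "ch (xi + ze) z = ch xi z*ch ze z"
 by (simp add: ch_def cis_mult algebra_simps)
lemma ch_uminus: "ch (- xi) z = cnj (ch xi z)"
 by (simp add: ch_def cis_cnj algebra_simps)
lemma ch_diff: "ch (xi - ze) z = ch xi z*ch (- ze) z"
 using ch_add[of xi "- ze" z] by simp
lemma ch_mult_uminus[simp]: "ch xi z*ch (- xi) z = 1"
 using ch_add[of xi "- xi" z] by (simp add: ch_def)

lemma coords_measurable[measurable]:
 "(fst :: spacetime => real) : BM borel"
 "(%z::spacetime. fst (snd z)) : BM borel"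
 "(%z::spacetime. snd (snd z)) : BM borel"
 by (auto intro!: borel_measurable_continuous_onI continuous_intros)

lemma ints_measurable[measurable]:
 "(%xi::frequency. real_of_int (fst (snd xi))) : BM fm"
 "(%xi::frequency. real_of_int (snd (snd xi))) : BM fm"
 by (simp_all add: meas_fm_iff)

lemma cis_measurable[measurable]: "cis : BM borel"
 by (intro borel_measurable_continuous_onI continuous_intros)

lemma ch_measurable[measurable (raw)]:
 assumes [measurable]: "f : measurable M fm" "g : BM M"
 shows "(%x. ch (f x) (g x)) : BM M"
 unfolding ch_def by measurable

lemma ft_ch: "ft ph xi = (LINT z:slab UNIV|lborel. ch (- xi) z*ph z)"
proof -
 obtain ta n1 n2 where "xi = (ta, n1, n2)" by (cases xi)
 then show ?thesis
  unfolding ft_def ch_def by (simp add: split_beta' uminus_prod_def algebra_simps)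
qed

lemma ft_sl:
 assumes "ph : BM borel"
 shows "ft ph xi = (BS z. ch (- xi) z*ph z)"
 unfolding ft_ch using assms by (subst integral_sl) auto

lemma fm_split_case: "(case xi of (ta, n1, n2) => F (ta, n1, n2)*G (- ta, - n1, - n2)) = F xi*G (- xi)"
 for xi :: frequency and F G :: "frequency => complex"
 by (cases xi) simp

lemma has_ft_iff:
 "has_ft U F \<longleftrightarrow> F : BM fm & (ALL ph:schwartz. integrable fm (%xi. F xi*ft ph (- xi)) &
   U ph = (1 / (2*pi) ^ 3) *\<^sub>R (BF xi. F xi*ft ph (- xi)))"
 unfolding has_ft_def fm_split_case ..

lemma xsb_weight_eq: "xsb_weight s b xi = jn (snd xi) powr s*jb (\<bar>fst xi\<bar> - jn (snd xi)) powr b"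
proof -
 obtain ta n1 n2 where x: "xi = (ta, n1, n2)" by (cases xi)
 have "japanese (real_of_int n1, real_of_int n2) = jn (n1, n2)"
  by (simp add: japanese_def jn_def norm_Pair add.assoc)
 moreover have "japanese r = jb r" for r :: real by (simp add: japanese_def jb_def)
 ultimately show ?thesis by (simp add: xsb_weight_def x)
qed

text \<open>Comparing squares avoids the square root of an extended real.\<close>

lemma l2_norm_eq:
 "l2_norm F <= ennreal c \<longleftrightarrow> (NF xi. ennreal ((cmod (F xi))^2)) <= ennreal (c^2)" if "0 <= c"
proof -
 let ?I = "(NF xi. ennreal ((cmod (F xi))^2))"
 show ?thesis
 proof (cases ?I)
  case (real r)
  then show ?thesis using that
   by (auto simp: l2_norm_def Let_def real_le_lsqrt dest: sqrt_le_D)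
 next
  case top then show ?thesis by (simp add: l2_norm_def Let_def top_unique)
 qed
qed

lemma integral_tm:
 fixes f :: "real => complex" assumes "f : BM borel"
 shows "integral\<^sup>L tm f = (LINT x:{0..<2*pi}|lborel. f x)"
 unfolding tm_def set_lebesgue_integral_def using assms
 by (subst integral_density) auto

lemma integral_tm_FTC:
 fixes F f :: "real => complex"
 assumes "!!x. (F has_vector_derivative f x) (at x)" "continuous_on UNIV f"
 shows "integral\<^sup>L tm f = F (2*pi) - F 0"
proof -
 have [measurable]: "f : BM borel" using assms(2) by (rule borel_measurable_continuous_onI)
 have "integral\<^sup>L tm f = (BT x. indicator {0..2*pi} x *\<^sub>R f x)"
  unfolding integral_tm[OF \<open>f : BM borel\<close>] set_lebesgue_integral_def
 proof (rule integral_cong_AE)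
  show "AE x in lborel. indicat_real {0..<2*pi} x *\<^sub>R f x = indicat_real {0..2*pi} x *\<^sub>R f x"
   using AE_lborel_singleton[of "2*pi"] by eventually_elim (auto simp: indicator_def)
 qed measurable
 also have "... = F (2*pi) - F 0"
 proof (rule integral_FTC_Icc)
  show "(F has_vector_derivative f x) (at x within {0..2*pi})" for x
   using assms(1)[of x] by (rule has_vector_derivative_at_within)
  show "continuous_on {0..2*pi} f" using assms(2) by (rule continuous_on_subset) simp
 qed simp
 finally show ?thesis .
qed

lemma integral_tm_cis: "(\<integral>x. cis (of_int n*x) \<partial>tm) = (if n = 0 then of_real (2*pi) else 0)"
proof (cases "n = 0")
 case True
 then show ?thesis by (simp add: measure_def emeasure_tm scaleR_conv_of_real)
next
 case False
 define F where "F x = cis (of_int n*x) / (\<i> * of_int n)" for x :: real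
 have d: "(F has_vector_derivative cis (of_int n*x)) (at x)" for x
 proof -
  have "((%z. exp (\<i> * of_int n*z) / (\<i> * of_int n)) has_field_derivative exp (\<i> * of_int n * of_real x)) (at (of_real x))"
   using False by (auto intro!: derivative_eq_intros)
  from has_vector_derivative_real_field[OF this] show ?thesis
   unfolding F_def cis_conv_exp by (simp add: mult.assoc)
 qed
 have "(\<integral>x. cis (of_int n*x) \<partial>tm) = F (2*pi) - F 0"
  by (intro integral_tm_FTC d continuous_intros)
 also have "cis (of_int n*(2*pi)) = 1"
  using cis_multiple_2pi[of "of_int n"] by (simp add: mult_ac)
 then have "F (2*pi) - F 0 = 0" by (simp add: F_def)
 finally show ?thesis using False by simp
qed

section \<open>Fourier inversion on the line\<close>

lemma gaussian_fourier:
 fixes a u :: real assumes a: "0 < a"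
 shows "integrable lborel (%ta. cis (ta*u) * of_real (exp (- (a*ta)\<^sup>2 / 2)))"
  and "(BT ta. cis (ta*u) * of_real (exp (- (a*ta)\<^sup>2 / 2)))
    = of_real (sqrt (2*pi) / a*exp (- (u / a)\<^sup>2 / 2))"
proof -
 have base: "integrable lborel (%x. cis (x*t) * of_real (exp (- x\<^sup>2 / 2)))"
  "(BT x. cis (x*t) * of_real (exp (- x\<^sup>2 / 2))) = of_real (sqrt (2*pi)*exp (- t\<^sup>2 / 2))" for t
 proof -
  have e: "std_normal_density x *\<^sub>R iexp (t*x) = of_real (1 / sqrt (2*pi))*(cis (x*t) * of_real (exp (- x\<^sup>2 / 2)))" for x
   by (simp add: std_normal_density_def scaleR_conv_of_real cis_conv_exp mult_ac)
  have [measurable]: "(%x. cis (x*t) * of_real (exp (- x\<^sup>2 / 2))) : BM borel" by measurable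
  have "integrable lborel (%x. std_normal_density x *\<^sub>R iexp (t*x))"
  proof (rule Bochner_Integration.integrable_bound)
   show "integrable lborel std_normal_density" by simp
   show "AE x in lborel. norm (std_normal_density x *\<^sub>R iexp (t*x)) <= norm (std_normal_density x)"
    by (simp add: norm_mult)
  qed measurable
  then have i: "integrable lborel (%x. of_real (1 / sqrt (2*pi))*(cis (x*t) * of_real (exp (- x\<^sup>2 / 2))))"
   unfolding e .
  then show int: "integrable lborel (%x. cis (x*t) * of_real (exp (- x\<^sup>2 / 2)))"
  proof -
   have "(%x. cis (x*t) * of_real (exp (- x\<^sup>2 / 2))) = (%x. of_real (sqrt (2*pi))*(of_real (1 / sqrt (2*pi))*(cis (x*t)*complex_of_real (exp (- x\<^sup>2 / 2)))))"
    by (simp add: fun_eq_iff flip: of_real_mult)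
   then show ?thesis using integrable_mult_right[OF i] by (simp only:)
  qed
  have "char std_normal_distribution t = (BT x. std_normal_density x *\<^sub>R iexp (t*x))"
   unfolding char_def by (subst integral_density) auto
  then have "of_real (1 / sqrt (2*pi))*(BT x. cis (x*t) * of_real (exp (- x\<^sup>2 / 2))) = complex_of_real (exp (- t\<^sup>2 / 2))"
   unfolding e char_std_normal_distribution by (simp add: int)
  then have "of_real (sqrt (2*pi))*(of_real (1 / sqrt (2*pi))*(BT x. cis (x*t) * of_real (exp (- x\<^sup>2 / 2)))) = of_real (sqrt (2*pi))*complex_of_real (exp (- t\<^sup>2 / 2))"
   by simp
  moreover have "complex_of_real (sqrt (2*pi))*complex_of_real (1 / sqrt (2*pi)) = 1"
   by (subst of_real_mult[symmetric]) simp
  ultimately show "(BT x. cis (x*t) * of_real (exp (- x\<^sup>2 / 2))) = of_real (sqrt (2*pi)*exp (- t\<^sup>2 / 2))"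
   by (simp only: mult.assoc[symmetric] mult_1_left of_real_mult)
 qed
 define h where "h x = cis (x*(u / a))*complex_of_real (exp (- x\<^sup>2 / 2))" for x
 have hs: "h (0 + a*ta) = cis (ta*u) * of_real (exp (- (a*ta)\<^sup>2 / 2))" for ta
  using a by (simp add: h_def)
 show "integrable lborel (%ta. cis (ta*u) * of_real (exp (- (a*ta)\<^sup>2 / 2)))"
  using lborel_integrable_real_affine[of h a 0] base(1)[of "u / a"] a unfolding hs by (simp add: h_def[abs_def])
 have "(BT x. h x) = a *\<^sub>R (BT ta. cis (ta*u) * of_real (exp (- (a*ta)\<^sup>2 / 2)))"
  using lborel_integral_real_affine[of a h 0] a unfolding hs by simp
 then show "(BT ta. cis (ta*u) * of_real (exp (- (a*ta)\<^sup>2 / 2)))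
    = of_real (sqrt (2*pi) / a*exp (- (u / a)\<^sup>2 / 2))"
  using base(2)[of "u / a"] a unfolding h_def by (simp add: scaleR_conv_of_real field_simps)
qed

lemma gaussian_integral:
 "integrable lborel (%s::real. exp (- s\<^sup>2 / 2))" "(BT s. exp (- s\<^sup>2 / 2)) = sqrt (2*pi)"
proof -
 have e: "exp (- s\<^sup>2 / 2) = sqrt (2*pi) * std_normal_density s" for s :: real
  by (simp add: std_normal_density_def)
 show "integrable lborel (%s::real. exp (- s\<^sup>2 / 2))" "(BT s. exp (- s\<^sup>2 / 2)) = sqrt (2*pi)"
  unfolding e by simp_all
qed

text \<open>Gaussian summation: inserting the factor \<open>exp(-(a\<tau>)\<^sup>2/2)\<close> turns the inverse transform into an average of \<open>e\<close> over
a Gaussian of width \<open>a\<close>, and \<open>a \<rightarrow> 0\<close> on both sides by dominated convergence.\<close>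

lemma fourier_inversion_line:
 fixes e :: "real => complex"
 assumes cont: "continuous_on UNIV e" and bd: "!!t. cmod (e t) <= B" and int: "integrable lborel e"
  and E_def: "!!ta. E ta = (BT t. e t*cis (- (ta*t)))" and Eint: "integrable lborel E"
 shows "(BT ta. E ta*cis (ta * s)) = of_real (2*pi)*e s"
proof -
 have [measurable]: "e : BM borel" using cont by (rule borel_measurable_continuous_onI)
 define g where "g a ta = complex_of_real (exp (- (a*ta)\<^sup>2 / 2))" for a ta :: real
 have [measurable]: "g a : BM borel" for a unfolding g_def by measurable
 have eq: "(BT ta. E ta*cis (ta * s)*g a ta) = of_real (sqrt (2*pi))*(BT y. e (s + a*y) * of_real (exp (- y\<^sup>2 / 2)))"
  if a: "0 < a" for a
 proof -
  have G: "integrable lborel (%ta. cis (ta*u)*g a ta)" "(BT ta. cis (ta*u)*g a ta) = of_real (sqrt (2*pi) / a*exp (- (u / a)\<^sup>2 / 2))" for u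
   using gaussian_fourier[OF a, of u] unfolding g_def by auto
  have Gi: "integrable lborel (g a)" using G(1)[of 0] by simp
  have prod: "integrable (lborel \<Otimes>\<^sub>M lborel) (%(ta, t). e t*cis (ta*(s - t))*g a ta)"
  proof (rule Bochner_Integration.integrable_bound)
   show "integrable (lborel \<Otimes>\<^sub>M lborel) (%(ta, t). g a ta*e t)"
   proof (subst lborel_pair.integrable_product_swap_iff[symmetric], rule lborel_pair.Fubini_integrable)
    show "integrable lborel (%x. (BT y. cmod (case (x, y) of (x, y) => case (y, x) of (ta, t) => g a ta*e t)))"
     using int by (simp add: norm_mult)
   next
    show "AE x in lborel. integrable lborel (%y. case (x, y) of (x, y) => case (y, x) of (ta, t) => g a ta*e t)"
     using Gi by simp
   qed measurable
   show "AE x in lborel \<Otimes>\<^sub>M lborel. norm (case x of (ta, t) => e t*cis (ta*(s - t))*g a ta) <= norm (case x of (ta, t) => g a ta*e t)"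
    by (auto simp: norm_mult)
  qed measurable
  have "(BT ta. E ta*cis (ta * s)*g a ta) = (BT ta. (BT t. e t*cis (ta*(s - t))*g a ta))"
  proof (rule Bochner_Integration.integral_cong[OF refl])
   fix ta :: real
   have i: "integrable lborel (%t. e t*cis (- (ta*t)))"
    by (rule Bochner_Integration.integrable_bound[OF int]) (auto simp: norm_mult)
   have e1: "e t*cis (ta*(s - t))*g a ta = (e t*cis (- (ta*t)))*(cis (ta * s)*g a ta)" for t
   proof -
    have "cis (ta*(s - t)) = cis (- (ta*t))*cis (ta * s)" by (simp add: cis_mult algebra_simps)
    then show ?thesis by (simp add: mult_ac)
   qed
   have "(BT t. e t*cis (ta*(s - t))*g a ta) = (BT t. (e t*cis (- (ta*t)))*(cis (ta * s)*g a ta))"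
    unfolding e1 ..
   also have "... = E ta*(cis (ta * s)*g a ta)" unfolding E_def by (rule integral_mult_left_zero)
   finally show "E ta*cis (ta * s)*g a ta = (BT t. e t*cis (ta*(s - t))*g a ta)" by (simp add: mult.assoc)
  qed
  also have "... = (BT t. (BT ta. e t*cis (ta*(s - t))*g a ta))"
   using lborel_pair.Fubini_integral[OF prod] by simp
  also have "... = (BT t. e t * of_real (sqrt (2*pi) / a*exp (- ((s - t) / a)\<^sup>2 / 2)))"
   by (simp only: mult.assoc G integral_mult_right_zero)
  also have "... = a *\<^sub>R (BT y. e (s + a*y) * of_real (sqrt (2*pi) / a*exp (- ((s - (s + a*y)) / a)\<^sup>2 / 2)))"
   using lborel_integral_real_affine[of a "%t. e t * of_real (sqrt (2*pi) / a*exp (- ((s - t) / a)\<^sup>2 / 2))" s] a by simp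
  also have "... = a *\<^sub>R (BT y. of_real (sqrt (2*pi) / a)*(e (s + a*y) * of_real (exp (- y\<^sup>2 / 2))))"
   using a by (simp add: mult_ac)
  also have "... = of_real (sqrt (2*pi))*(BT y. e (s + a*y) * of_real (exp (- y\<^sup>2 / 2)))"
   unfolding integral_mult_right_zero scaleR_conv_of_real using a by simp
  finally show ?thesis .
 qed
 define sgm where "sgm k = 1 / (real k + 1)" for k
 have sgm: "0 < sgm k" for k by (simp add: sgm_def)
 have sgm0: "sgm \<longlonglongrightarrow> 0" unfolding sgm_def by real_asymp
 have L: "(%k. (BT ta. E ta*cis (ta * s)*g (sgm k) ta)) \<longlonglongrightarrow> (BT ta. E ta*cis (ta * s))"
 proof (rule integral_dominated_convergence)
  show "integrable lborel (%ta. cmod (E ta))" using Eint by simp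
  have [measurable]: "E : BM borel" using Eint by auto
  show "(%ta. E ta*cis (ta * s)) : BM lborel" by measurable
  show "(%ta. E ta*cis (ta * s)*g (sgm k) ta) : BM lborel" for k by measurable
  have "(%k. E ta*cis (ta * s)*g (sgm k) ta) \<longlonglongrightarrow> E ta*cis (ta * s) * of_real (exp (- (0*ta)\<^sup>2 / 2))" for ta
   unfolding g_def by (intro tendsto_intros sgm0) auto
  then show "AE ta in lborel. (%k. E ta*cis (ta * s)*g (sgm k) ta) \<longlonglongrightarrow> E ta*cis (ta * s)" by simp
  show "AE ta in lborel. norm (E ta*cis (ta * s)*g (sgm k) ta) <= cmod (E ta)" for k
   by (auto simp: norm_mult g_def mult_left_le)
 qed
 have R: "(%k. (BT y. e (s + sgm k*y) * of_real (exp (- y\<^sup>2 / 2)))) \<longlonglongrightarrow> (BT y. e s*complex_of_real (exp (- y\<^sup>2 / 2)))"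
 proof (rule integral_dominated_convergence)
  show "integrable lborel (%y. B*exp (- y\<^sup>2 / 2))" using gaussian_integral(1) by simp
  have "(%k. e (s + sgm k*y) * of_real (exp (- y\<^sup>2 / 2))) \<longlonglongrightarrow> e s*complex_of_real (exp (- y\<^sup>2 / 2))" for y
  proof -
   have "(%k. s + sgm k*y) \<longlonglongrightarrow> s + 0*y" by (intro tendsto_intros sgm0)
   then have "(%k. e (s + sgm k*y)) \<longlonglongrightarrow> e s"
    using cont continuous_on_tendsto_compose[of UNIV e] by simp
   then show ?thesis by (intro tendsto_intros)
  qed
  then show "AE y in lborel. (%k. e (s + sgm k*y) * of_real (exp (- y\<^sup>2 / 2))) \<longlonglongrightarrow> e s*complex_of_real (exp (- y\<^sup>2 / 2))" by simp
  show "AE y in lborel. norm (e (s + sgm k*y) * of_real (exp (- y\<^sup>2 / 2))) <= B*exp (- y\<^sup>2 / 2)" for k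
   using bd by (auto simp: norm_mult mult_right_mono)
 qed measurable
 have "(BT y. e s*complex_of_real (exp (- y\<^sup>2 / 2))) = e s * of_real (sqrt (2*pi))"
  unfolding integral_mult_right_zero integral_complex_of_real gaussian_integral(2) ..
 with R have "(%k. (BT y. e (s + sgm k*y) * of_real (exp (- y\<^sup>2 / 2)))) \<longlonglongrightarrow> e s * of_real (sqrt (2*pi))"
  by (simp only:)
 from tendsto_mult_left[OF this, of "of_real (sqrt (2*pi))"]
 have "(%k. (BT ta. E ta*cis (ta * s)*g (sgm k) ta)) \<longlonglongrightarrow> of_real (sqrt (2*pi))*(e s * of_real (sqrt (2*pi)))"
  unfolding eq[OF sgm] .
 then have "(BT ta. E ta*cis (ta * s)) = of_real (sqrt (2*pi))*(e s * of_real (sqrt (2*pi)))"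
  using L LIMSEQ_unique by blast
 also have "... = of_real (sqrt (2*pi) * sqrt (2*pi))*e s" unfolding of_real_mult by (simp add: mult_ac)
 also have "sqrt (2*pi) * sqrt (2*pi) = 2*pi" by simp
 finally show ?thesis .
qed

section \<open>Fourier series on the circle\<close>

definition fcoeff :: "(real => complex) => int => complex" where
 "fcoeff f n = (\<integral>x. f x*cis (- (of_int n*x)) \<partial>tm)"

lemma integrable_tm_bounded:
 fixes f :: "real => complex"
 assumes [measurable]: "f : BM borel" and "!!x. cmod (f x) <= B"
 shows "integrable tm f"
 by (rule tm.integrable_const_bound[of _ B]) (use assms in auto)

lemma cnj_borel_measurable[measurable]: "cnj : BM borel"
 by (intro borel_measurable_continuous_onI continuous_intros)

text \<open>The square norm of \<open>f\<close> minus its partial Fourier sum is nonnegative.\<close>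

lemma bessel_inequality:
 fixes f :: "real => complex"
 assumes f[measurable]: "f : BM borel" and bd: "!!x. cmod (f x) <= B" and fin: "finite A"
 shows "(\<Sum>n\<in>A. (cmod (fcoeff f n))\<^sup>2) <= (2*pi*B)^2"
proof -
 have B0: "0 <= B" using order_trans[OF norm_ge_zero bd] .
 define c where "c = fcoeff f"
 define S where "S x = (\<Sum>n\<in>A. c n*cis (of_int n*x))" for x
 have [measurable]: "S : BM borel" unfolding S_def by measurable
 define D where "D = (\<Sum>n\<in>A. cmod (c n))"
 have Sb: "cmod (S x) <= D" for x
  unfolding S_def D_def by (rule order_trans[OF norm_sum]) (simp add: norm_mult)
 have D0: "0 <= D" using order_trans[OF norm_ge_zero Sb] .
 have S2: "(\<integral>x. S x*cnj (S x) \<partial>tm) = of_real (2*pi*(\<Sum>n\<in>A. (cmod (c n))\<^sup>2))"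
 proof -
  have e: "S x*cnj (S x) = (\<Sum>n\<in>A. \<Sum>m\<in>A. c n*cnj (c m)*cis (of_int (n - m)*x))" for x
   unfolding S_def cnj_sum sum_product
  proof (intro sum.cong refl)
   fix n m
   have "cis (of_int (n - m)*x) = cis (of_int n*x)*cis (- (of_int m*x))"
    by (simp add: cis_mult algebra_simps)
   then show "c n*cis (of_int n*x)*cnj (c m*cis (of_int m*x)) = c n*cnj (c m)*cis (of_int (n - m)*x)"
    by (simp add: cis_cnj mult_ac)
  qed
  have i: "integrable tm (%x. c n*cnj (c m)*cis (of_int (n - m)*x))" for n m
   by (rule integrable_tm_bounded[of _ "cmod (c n*cnj (c m))"]) (auto simp: norm_mult)
  have "(\<integral>x. S x*cnj (S x) \<partial>tm) = (\<Sum>n\<in>A. \<Sum>m\<in>A. c n*cnj (c m)*(if n - m = 0 then of_real (2*pi) else 0))"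
   unfolding e by (subst Bochner_Integration.integral_sum, rule Bochner_Integration.integrable_sum, rule i)
     (subst Bochner_Integration.integral_sum, rule i, simp only: integral_mult_right_zero integral_tm_cis)
  also have "... = (\<Sum>n\<in>A. c n*cnj (c n) * of_real (2*pi))"
  proof (rule sum.cong[OF refl])
   fix n assume "n : A"
   have "(\<Sum>m\<in>A. c n*cnj (c m)*(if n - m = 0 then of_real (2*pi) else 0)) = (\<Sum>m\<in>A. if m = n then c n*cnj (c n) * of_real (2*pi) else 0)"
    by (intro sum.cong) auto
   then show "(\<Sum>m\<in>A. c n*cnj (c m)*(if n - m = 0 then of_real (2*pi) else 0)) = c n*cnj (c n) * of_real (2*pi)"
    using fin \<open>n : A\<close> by simp
  qed
  also have "... = of_real (2*pi*(\<Sum>n\<in>A. (cmod (c n))\<^sup>2))"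
   by (simp add: complex_norm_square[symmetric] sum_distrib_left mult.commute)
  finally show ?thesis .
 qed
 have fS: "(\<integral>x. f x*cnj (S x) \<partial>tm) = of_real (\<Sum>n\<in>A. (cmod (c n))\<^sup>2)"
 proof -
  have e: "f x*cnj (S x) = (\<Sum>n\<in>A. cnj (c n)*(f x*cis (- (of_int n*x))))" for x
   unfolding S_def cnj_sum sum_distrib_left by (intro sum.cong refl) (simp add: cis_cnj mult_ac)
  have i: "integrable tm (%x. cnj (c n)*(f x*cis (- (of_int n*x))))" for n
   by (rule integrable_tm_bounded[of _ "cmod (c n)*B"]) (auto simp: norm_mult intro!: mult_left_mono bd)
  have "(\<integral>x. f x*cnj (S x) \<partial>tm) = (\<Sum>n\<in>A. cnj (c n)*c n)"
   unfolding e by (subst Bochner_Integration.integral_sum, rule i) (simp only: integral_mult_right_zero c_def fcoeff_def)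
  then show ?thesis unfolding of_real_sum complex_norm_square by (simp add: mult.commute)
 qed
 have i2: "integrable tm (%x. f x*cnj (S x))" by (rule integrable_tm_bounded[of _ "B*D"]) (auto simp: norm_mult intro!: mult_mono bd Sb B0 D0)
 have Sf: "(\<integral>x. cnj (f x)*S x \<partial>tm) = of_real (\<Sum>n\<in>A. (cmod (c n))\<^sup>2)"
 proof -
  have "(\<integral>x. cnj (f x)*S x \<partial>tm) = (\<integral>x. cnj (f x*cnj (S x)) \<partial>tm)" by simp
  also have "... = cnj (\<integral>x. f x*cnj (S x) \<partial>tm)" by (rule integral_bounded_linear[OF bounded_linear_cnj i2])
  finally show ?thesis by (simp add: fS)
 qed
 define X where "X = (\<Sum>n\<in>A. (cmod (c n))\<^sup>2)"
 have i1: "integrable tm (%x. f x*cnj (f x))" by (rule integrable_tm_bounded[of _ "B*B"]) (auto simp: norm_mult intro!: mult_mono bd B0)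
 have i3: "integrable tm (%x. cnj (f x)*S x)" by (rule integrable_tm_bounded[of _ "B*D"]) (auto simp: norm_mult intro!: mult_mono bd Sb B0 D0)
 have i4: "integrable tm (%x. S x*cnj (S x))" by (rule integrable_tm_bounded[of _ "D*D"]) (auto simp: norm_mult intro!: mult_mono Sb D0)
 define k where "k = complex_of_real (1 / (2*pi))"
 have "(\<integral>x. (f x - k*S x)*cnj (f x - k*S x) \<partial>tm)
  = (\<integral>x. f x*cnj (f x) - k*(f x*cnj (S x)) - k*(cnj (f x)*S x) + k*k*(S x*cnj (S x)) \<partial>tm)"
  by (simp add: k_def algebra_simps)
 also have "... = (\<integral>x. f x*cnj (f x) \<partial>tm) - k * of_real X - k * of_real X + k*k * of_real (2*pi*X)"
  using i1 i2 i3 i4 by (simp add: fS Sf S2 X_def)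
 also have "k*k * of_real (2*pi*X) = k * of_real X"
  unfolding k_def of_real_mult[symmetric] by simp
 finally have eq: "(\<integral>x. (f x - k*S x)*cnj (f x - k*S x) \<partial>tm) = (\<integral>x. f x*cnj (f x) \<partial>tm) - of_real (X / (2*pi))"
  by (simp add: k_def flip: of_real_mult)
 have r: "(\<integral>x. h x*cnj (h x) \<partial>tm) = complex_of_real (\<integral>x. (cmod (h x))\<^sup>2 \<partial>tm)" for h
  by (simp only: complex_norm_square[symmetric] integral_complex_of_real)
 have "complex_of_real (\<integral>x. (cmod (f x - k*S x))\<^sup>2 \<partial>tm) = of_real ((\<integral>x. (cmod (f x))\<^sup>2 \<partial>tm) - X / (2*pi))"
  using eq unfolding r by simp
 then have "(\<integral>x. (cmod (f x - k*S x))\<^sup>2 \<partial>tm) = (\<integral>x. (cmod (f x))\<^sup>2 \<partial>tm) - X / (2*pi)"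
  by (simp only: of_real_eq_iff)
 moreover have "0 <= (\<integral>x. (cmod (f x - k*S x))\<^sup>2 \<partial>tm)" by simp
 moreover have "(\<integral>x. (cmod (f x))\<^sup>2 \<partial>tm) <= (\<integral>x. B\<^sup>2 \<partial>tm)"
  using bd by (intro integral_mono tm.integrable_const_bound[of _ "B^2"]) (auto intro!: power_mono)
 moreover have "(\<integral>x. B\<^sup>2 \<partial>tm) = 2*pi*B^2" by (simp add: measure_def emeasure_tm)
 ultimately have "X / (2*pi) <= 2*pi*B^2" by linarith
 then have "X <= 2*pi*B^2*(2*pi)" by (simp add: pos_divide_le_eq)
 then show ?thesis unfolding X_def c_def by (simp add: power2_eq_square mult_ac)
qed

lemma riemann_lebesgue_circle:
 fixes f :: "real => complex" and h :: "nat => int"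
 assumes "f : BM borel" and "!!x. cmod (f x) <= B" and h: "inj h"
 shows "(%N. fcoeff f (h N)) \<longlonglongrightarrow> 0"
proof -
 have "(\<Sum>i<n. (cmod (fcoeff f (h i)))\<^sup>2) <= (2*pi*B)^2" for n
 proof -
  have "(\<Sum>i<n. (cmod (fcoeff f (h i)))\<^sup>2) = (\<Sum>m\<in>h ` {..<n}. (cmod (fcoeff f m))\<^sup>2)"
   by (subst sum.reindex) (auto intro: inj_on_subset[OF h])
  also have "... <= (2*pi*B)^2" by (rule bessel_inequality[OF assms(1,2)]) simp
  finally show ?thesis .
 qed
 then have "summable (%i. (cmod (fcoeff f (h i)))^2)" by (intro summableI_nonneg_bounded) auto
 then have "(%i. (cmod (fcoeff f (h i)))^2) \<longlonglongrightarrow> 0" by (rule summable_LIMSEQ_zero)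
 then have "(%i. sqrt ((cmod (fcoeff f (h i)))^2)) \<longlonglongrightarrow> sqrt 0" by (rule tendsto_real_sqrt)
 then show ?thesis by (simp add: tendsto_norm_zero_iff)
qed

lemma abs_le_norm_cis_diff:
 fixes tht :: real assumes "\<bar>tht\<bar> <= pi"
 shows "\<bar>tht\<bar> <= 4*cmod (cis tht - 1)"
proof -
 have n: "cmod (cis tht - 1) = 2*\<bar>sin (tht / 2)\<bar>"
 proof -
  have "(cmod (cis tht - 1))^2 = (cos tht - 1)^2 + (sin tht)^2" by (simp add: cmod_power2)
  also have "... = 2 - 2*cos tht" using sin_cos_squared_add[of tht] by (simp add: power2_eq_square algebra_simps)
  also have "... = (2*\<bar>sin (tht / 2)\<bar>)^2" using cos_double_sin[of "tht / 2"] by (simp add: power_mult_distrib)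
  finally show ?thesis by (rule power2_eq_imp_eq) auto
 qed
 have pos: "y <= 4*(2 * sin (y / 2))" if y: "0 <= y" "y <= pi" for y :: real
 proof (cases "y = 0")
  case False
  then have y0: "0 < y / 4" using y by simp
  have c: "1 / 2 <= (cos u)^2" "0 <= cos u" "cos (y / 4) <= cos u" if "0 <= u" "u <= y / 4" for u
  proof -
   have "cos (pi / 4) <= cos u" using that y by (intro cos_monotone_0_pi_le) auto
   then have "sqrt 2 / 2 <= cos u" by (simp add: cos_45)
   then have "(sqrt 2 / 2)^2 <= (cos u)^2" by (intro power_mono) auto
   then show "1 / 2 <= (cos u)^2" by (simp add: power_divide)
   have "0 <= sqrt 2 / 2" by simp
   then show "0 <= cos u" using \<open>sqrt 2 / 2 <= cos u\<close> by linarith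
   show "cos (y / 4) <= cos u" using that y by (intro cos_monotone_0_pi_le) auto
  qed
  obtain u where u: "0 < u" "u < y / 4" "sin (y / 4) - sin 0 = (y / 4 - 0)*cos u"
   using MVT2[of 0 "y / 4" sin cos] y0 DERIV_sin by auto
  have "sin (y / 2) = 2 * sin (y / 4)*cos (y / 4)" using sin_double[of "y / 4"] by simp
  also have "... = (y / 2)*(cos u*cos (y / 4))" using u(3) by simp
  finally have s: "sin (y / 2) = (y / 2)*(cos u*cos (y / 4))" .
  have "cos (y / 4)*cos (y / 4) <= cos u*cos (y / 4)"
   using c(3)[of u] c(2)[of "y / 4"] u y0 by (intro mult_right_mono) auto
  then have "1 / 2 <= cos u*cos (y / 4)" using c(1)[of "y / 4"] y0 by (simp add: power2_eq_square)
  then have "y / 2*(1 / 2) <= y / 2*(cos u*cos (y / 4))" using y by (intro mult_left_mono) auto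
  then show ?thesis using s y by simp
 qed simp
 show ?thesis
 proof (cases "0 <= tht")
  case True
  then have "\<bar>tht\<bar> <= 4*(2 * sin (tht / 2))" using pos[of tht] assms by simp
  also have "... <= 4*(2*\<bar>sin (tht / 2)\<bar>)" by (intro mult_left_mono) auto
  finally show ?thesis unfolding n .
 next
  case False
  then have "\<bar>tht\<bar> <= 4*(2 * sin (- tht / 2))" using pos[of "- tht"] assms by simp
  also have "sin (- tht / 2) = - sin (tht / 2)" by simp
  also have "4*(2*(- sin (tht / 2))) <= 4*(2*\<bar>sin (tht / 2)\<bar>)" by (intro mult_left_mono) auto
  finally show ?thesis unfolding n .
 qed
qed

text \<open>After dividing \<open>f - f(s)\<close> by \<open>e\<^sup>i\<^sup>(\<^sup>x\<^sup>-\<^sup>s\<^sup>) - 1\<close>, which leaves a bounded function for Lipschitz \<open>f\<close>, the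
partial sums telescope to two Fourier coefficients of the quotient; these tend to zero.\<close>

lemma fourier_series_inversion:
 fixes f :: "real => complex"
 assumes lip: "!!x y. cmod (f x - f y) <= K*\<bar>x - y\<bar>" and per: "!!x. f (x + 2*pi) = f x"
 shows "(%N. \<Sum>n=-int N..int N. fcoeff f n*cis (of_int n * s)) \<longlonglongrightarrow> of_real (2*pi)*f s"
proof -
 have K0: "0 <= K" using order_trans[OF norm_ge_zero lip[of 1 0]] by simp
 have cont: "continuous_on UNIV f"
 proof (rule lipschitz_on_continuous_on)
  show "K-lipschitz_on UNIV f" using lip K0 by (auto simp: lipschitz_on_def dist_norm)
 qed
 then have [measurable]: "f : BM borel" by (rule borel_measurable_continuous_onI)
 interpret pf: periodic_fun_simple f "2*pi" by unfold_locales (rule per)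
 define g where "g x = (f x - f s) / (cis (x - s) - 1)" for x
 have [measurable]: "g : BM borel" unfolding g_def by measurable
 have bound: "cmod (f x - f s) <= 4*K*cmod (cis (x - s) - 1)" for x
 proof -
  define k where "k = \<lfloor>(x - s + pi) / (2*pi)\<rfloor>"
  define tht where "tht = x - s - of_int k*(2*pi)"
  have "of_int k <= (x - s + pi) / (2*pi)" "(x - s + pi) / (2*pi) < of_int k + 1" unfolding k_def by linarith+
  then have "of_int k*(2*pi) <= x - s + pi" "x - s + pi < (of_int k + 1)*(2*pi)" by (simp_all add: field_simps)
  then have th: "\<bar>tht\<bar> <= pi" by (simp add: tht_def algebra_simps abs_le_iff)
  have "cis (x - s) = cis (tht + of_int k*(2*pi))" by (simp add: tht_def)
  also have "... = cis tht*cis (of_int k*(2*pi))" by (rule cis_mult[symmetric])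
  also have "cis (of_int k*(2*pi)) = 1"
   using cis_multiple_2pi[of "of_int k"] by (simp add: mult_ac)
  finally have c: "cis (x - s) = cis tht" by simp
  have "f x = f (s + tht + of_int k*(2*pi))" by (simp add: tht_def)
  also have "... = f (s + tht)" by (rule pf.plus_of_int)
  finally have "cmod (f x - f s) <= K*\<bar>tht\<bar>" using lip[of "s + tht" s] by simp
  also have "... <= K*(4*cmod (cis tht - 1))" using abs_le_norm_cis_diff[OF th] K0 by (intro mult_left_mono) auto
  finally show ?thesis by (simp add: c mult_ac)
 qed
 have gb: "cmod (g x) <= 4*K" for x
  using bound[of x] K0 by (cases "cis (x - s) - 1 = 0") (auto simp: g_def norm_divide pos_divide_le_eq)
 have fg: "f x - f s = g x*(cis (x - s) - 1)" for x
  using bound[of x] by (cases "cis (x - s) - 1 = 0") (auto simp: g_def)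
 define ga where "ga n = fcoeff g n*cis (of_int n * s)" for n
 have ig: "integrable tm (%x. g x*cis (c x))" if [measurable]: "c : BM borel" for c
  by (rule integrable_tm_bounded[of _ "4*K"]) (auto simp: norm_mult gb)
 have coef: "fcoeff f n*cis (of_int n * s) = (if n = 0 then of_real (2*pi)*f s else 0) + (ga (n - 1) - ga n)" for n
 proof -
  have e: "f x*cis (- (of_int n*x)) = f s*cis (of_int (- n)*x) + (g x*cis (- (of_int (n - 1)*x))*cis (- s) - g x*cis (- (of_int n*x)))" for x
  proof -
   define A C where "A = cis (x - s)" and "C = cis (- (of_int n*x))"
   have AC: "A*C = cis (- (of_int (n - 1)*x))*cis (- s)"
    unfolding A_def C_def by (simp add: cis_mult algebra_simps)
   have C': "cis (of_int (- n)*x) = C" by (simp add: C_def)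
   have "f x = f s + g x*(A - 1)" using fg[of x] by (simp add: A_def algebra_simps)
   then have "f x*C = (f s + g x*(A - 1))*C" by (simp only:)
   also have "... = f s*C + (g x*(A*C) - g x*C)" by (simp add: algebra_simps)
   finally have "f x*C = f s*C + (g x*(A*C) - g x*C)" .
   then show ?thesis unfolding AC by (simp only: C' C_def mult.assoc)
  qed
  have i0: "integrable tm (%x. f s*cis (of_int (- n)*x))"
   by (rule integrable_tm_bounded[of _ "cmod (f s)"]) (auto simp: norm_mult)
  have "fcoeff f n = (\<integral>x. f s*cis (of_int (- n)*x) \<partial>tm) + ((\<integral>x. g x*cis (- (of_int (n - 1)*x))*cis (- s) \<partial>tm) - (\<integral>x. g x*cis (- (of_int n*x)) \<partial>tm))"
   unfolding fcoeff_def e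
   by (subst Bochner_Integration.integral_add[OF i0], rule Bochner_Integration.integrable_diff,
     rule integrable_mult_left, rule ig, simp, rule ig, simp,
     subst Bochner_Integration.integral_diff, rule integrable_mult_left, rule ig, simp, rule ig, simp, rule refl)
  also have "... = f s*(if n = 0 then of_real (2*pi) else 0) + (fcoeff g (n - 1)*cis (- s) - fcoeff g n)"
   unfolding integral_mult_right_zero integral_mult_left_zero integral_tm_cis fcoeff_def by simp
  finally have f: "fcoeff f n = f s*(if n = 0 then of_real (2*pi) else 0) + (fcoeff g (n - 1)*cis (- s) - fcoeff g n)" .
  have "cis (- s)*cis (of_int n * s) = cis (of_int (n - 1) * s)" by (simp add: cis_mult algebra_simps)
  then show ?thesis unfolding f ga_def by (simp add: algebra_simps)
 qed
 have sum: "(\<Sum>n=-int N..int N. fcoeff f n*cis (of_int n * s)) = of_real (2*pi)*f s + (ga (- int (Suc N)) - ga (int N))" for N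
 proof -
  have tel: "(\<Sum>n=-int N..int N. ga (n - 1) - ga n) = ga (- int (Suc N)) - ga (int N)"
  proof (induction N)
   case (Suc N)
   have "{- int (Suc N)..int (Suc N)} = insert (- int (Suc N)) (insert (int (Suc N)) {- int N..int N})" by auto
   then show ?case using Suc by simp
  qed simp
  have "(\<Sum>n=-int N..int N. (if n = 0 then of_real (2*pi)*f s else 0)) = of_real (2*pi)*f s" by simp
  then show ?thesis unfolding coef sum.distrib tel by simp
 qed
 have "(%N. fcoeff g (- int (Suc N))) \<longlonglongrightarrow> 0" "(%N. fcoeff g (int N)) \<longlonglongrightarrow> 0"
  by (rule riemann_lebesgue_circle[OF _ gb]; auto simp: inj_def)+
 note rl = this[THEN tendsto_norm_zero]
 have g1: "(%N. ga (- int (Suc N))) \<longlonglongrightarrow> 0"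
  by (rule tendsto_norm_zero_cancel) (use rl(1) in \<open>simp add: ga_def norm_mult del: of_nat_Suc\<close>)
 have g2: "(%N. ga (int N)) \<longlonglongrightarrow> 0"
  by (rule tendsto_norm_zero_cancel) (use rl(2) in \<open>simp add: ga_def norm_mult\<close>)
 from tendsto_add[OF tendsto_const tendsto_diff[OF g1 g2]]
 show ?thesis unfolding sum by simp
qed

section \<open>Transforms of derivatives\<close>

text \<open>Integrability on the slab in a form that is stable under freezing any of the variables, which makes every
order of integration available.\<close>

definition time_dominated :: "(spacetime => complex) => bool" where
 "time_dominated g \<longleftrightarrow> g : BM borel & (EX B. ALL z. cmod (g z) <= B / (1 + (fst z)^2))"

lemma integrable_inverse_quadratic: "integrable lborel (%t::real. B / (1 + t^2))"
proof -
 obtain C where C: "(NT x. ennreal (jb x powr (- 2))) <= ennreal C"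
  using nn_integral_jb_finite[of 2] by auto
 have j: "jb x powr (- 2) = 1 / (1 + x^2)" for x
  using jb_pos[of x] by (simp add: powr_minus jb_def powr_numeral divide_inverse add_nonneg_nonneg)
 have "(NT x. ennreal (1 / (1 + x^2))) < \<infinity>"
  using C unfolding j by (simp add: le_less_trans)
 then have "integrable lborel (%t::real. 1 / (1 + t^2))"
  by (intro integrableI_nonneg) auto
 from integrable_mult_right[OF this, of B] show ?thesis by simp
qed

lemma time_dominated_integrable:
 assumes "time_dominated g" shows "integrable sl g"
  and "integrable lborel (%t. g (t, p))" and "integrable (tm \<Otimes>\<^sub>M tm) (%p. g (t, p))"
proof -
 obtain B where [measurable]: "g : BM borel" and B: "!!z. cmod (g z) <= B / (1 + (fst z)^2)"
  using assms unfolding time_dominated_def by blast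
 have B0: "0 <= B" using order_trans[OF norm_ge_zero B[of "(0, 0, 0)"]] by simp
 have gm[measurable]: "g : BM (borel \<Otimes>\<^sub>M (borel \<Otimes>\<^sub>M borel))" by (simp add: borel_prod)
 have [measurable]: "g : BM (lborel \<Otimes>\<^sub>M (tm \<Otimes>\<^sub>M tm))"
  using gm by (simp add: measurable_cong_sets[OF sets_pair_measure_cong[OF sets_lborel sets_pair_measure_cong[OF sets_tm sets_tm]] refl])
 interpret t2: finite_measure "tm \<Otimes>\<^sub>M tm" by (rule finite_measure_pair_measure) unfold_locales
 show "integrable sl g"
  unfolding sl_def
 proof (rule Bochner_Integration.integrable_bound)
  show "integrable (lborel \<Otimes>\<^sub>M (tm \<Otimes>\<^sub>M tm)) (%z. B / (1 + (fst z)^2))"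
  proof (rule slp.Fubini_integrable)
   show "integrable lborel (%t. \<integral>p. norm (B / (1 + (fst (t, p))^2)) \<partial>(tm \<Otimes>\<^sub>M tm))"
    using integrable_mult_right[OF integrable_inverse_quadratic[of B], of "measure (tm \<Otimes>\<^sub>M tm) (space (tm \<Otimes>\<^sub>M tm))"] B0 by simp
  qed simp_all
  show "AE z in lborel \<Otimes>\<^sub>M (tm \<Otimes>\<^sub>M tm). cmod (g z) <= norm (B / (1 + (fst z)^2))"
   using B B0 by (intro AE_I2) (simp add: order_trans[OF B])
 qed measurable
 show "integrable lborel (%t. g (t, p))"
 proof (rule Bochner_Integration.integrable_bound[OF integrable_inverse_quadratic[of B]])
  show "(%t. g (t, p)) : BM lborel" by measurable
  show "AE t in lborel. cmod (g (t, p)) <= norm (B / (1 + t^2))" using B[of "(_, p)"] B0 by (intro AE_I2) simp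
 qed
 show "integrable (tm \<Otimes>\<^sub>M tm) (%p. g (t, p))"
 proof (rule t2.integrable_const_bound[of _ "B / (1 + t^2)"])
  show "AE p in tm \<Otimes>\<^sub>M tm. cmod (g (t, p)) <= B / (1 + t^2)" using B[of "(t, _)"] by (intro AE_I2) simp
 qed measurable
qed

lemma integral_sl_iterated:
 assumes "time_dominated g"
 shows "integral\<^sup>L sl g = (BT t. (\<integral>x. (\<integral>y. g (t, x, y) \<partial>tm) \<partial>tm))"
  and "integral\<^sup>L sl g = (BT t. (\<integral>y. (\<integral>x. g (t, x, y) \<partial>tm) \<partial>tm))"
  and "integral\<^sup>L sl g = (\<integral>p. (BT t. g (t, p)) \<partial>(tm \<Otimes>\<^sub>M tm))"
proof -
 have i: "integrable (lborel \<Otimes>\<^sub>M (tm \<Otimes>\<^sub>M tm)) g" using time_dominated_integrable(1)[OF assms] by (simp add: sl_def)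
 have 1: "integral\<^sup>L sl g = (BT t. (\<integral>p. g (t, p) \<partial>(tm \<Otimes>\<^sub>M tm)))"
  unfolding sl_def using slp.integral_fst'[OF i] by simp
 have 2: "(\<integral>p. g (t, p) \<partial>(tm \<Otimes>\<^sub>M tm)) = (\<integral>x. (\<integral>y. g (t, x, y) \<partial>tm) \<partial>tm)" for t
  using tm2.integral_fst'[OF time_dominated_integrable(3)[OF assms, of t]] by simp
 have 3: "(\<integral>p. g (t, p) \<partial>(tm \<Otimes>\<^sub>M tm)) = (\<integral>y. (\<integral>x. g (t, x, y) \<partial>tm) \<partial>tm)" for t
  using tm2.integral_snd[of "%x y. g (t, x, y)"] time_dominated_integrable(3)[OF assms, of t] by (simp add: split_beta')
 show "integral\<^sup>L sl g = (BT t. (\<integral>x. (\<integral>y. g (t, x, y) \<partial>tm) \<partial>tm))" unfolding 1 2 ..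
 show "integral\<^sup>L sl g = (BT t. (\<integral>y. (\<integral>x. g (t, x, y) \<partial>tm) \<partial>tm))" unfolding 1 3 ..
 show "integral\<^sup>L sl g = (\<integral>p. (BT t. g (t, p)) \<partial>(tm \<Otimes>\<^sub>M tm))"
  unfolding sl_def using slp.integral_snd[of "%t p. g (t, p)"] i by simp
qed

lemma integral_line_derivative_zero:
 fixes F f :: "real => complex"
 assumes d: "!!t. (F has_vector_derivative f t) (at t)" and c: "continuous_on UNIV f" and i: "integrable lborel f"
  and F: "(%n. F (real n)) \<longlonglongrightarrow> 0" "(%n. F (- real n)) \<longlonglongrightarrow> 0"
 shows "integral\<^sup>L lborel f = 0"
proof -
 have fm: "f : BM lborel" using i by auto
 have "(%n. (BT t. indicator {- real n..real n} t *\<^sub>R f t)) \<longlonglongrightarrow> integral\<^sup>L lborel f"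
 proof (rule integral_dominated_convergence[where w="%t. cmod (f t)"])
  show "AE t in lborel. (%n. indicat_real {- real n..real n} t *\<^sub>R f t) \<longlonglongrightarrow> f t"
  proof (rule AE_I2)
   fix t :: real
   obtain N where N: "\<bar>t\<bar> < real N" using reals_Archimedean2 by blast
   have "\<forall>\<^sub>F n in sequentially. f t = indicat_real {- real n..real n} t *\<^sub>R f t"
    using eventually_ge_at_top[of N] by eventually_elim (use N in \<open>auto simp: indicator_def\<close>)
   then show "(%n. indicat_real {- real n..real n} t *\<^sub>R f t) \<longlonglongrightarrow> f t"
    by (rule Lim_transform_eventually[OF tendsto_const])
  qed
 qed (use i fm in \<open>auto simp: indicator_def\<close>)
 moreover have "(BT t. indicator {- real n..real n} t *\<^sub>R f t) = F (real n) - F (- real n)" for n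
  by (rule integral_FTC_Icc) (auto intro!: has_vector_derivative_at_within d continuous_on_subset[OF c])
 ultimately have "(%n. F (real n) - F (- real n)) \<longlonglongrightarrow> integral\<^sup>L lborel f" by simp
 moreover have "(%n. F (real n) - F (- real n)) \<longlonglongrightarrow> 0 - 0" by (intro tendsto_diff F)
 ultimately show ?thesis using LIMSEQ_unique by fastforce
qed

lemma schwartz_time_dominated:
 assumes "ph : schwartz" shows "time_dominated ph"
proof -
 obtain B0 B2 where B: "!!z. cmod (ph z) <= B0" "!!z. \<bar>fst z\<bar> ^ 2*cmod (ph z) <= B2"
  using schwartz_bdd[OF assms, of 0, unfolded power_0 mult_1_left] schwartz_bdd[OF assms, of 2] by blast
 have "cmod (ph z) <= (B0 + B2) / (1 + (fst z)^2)" for z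
 proof -
  have "cmod (ph z)*(1 + (fst z)^2) <= B0 + B2" using B[of z] by (simp add: algebra_simps)
  moreover have "0 < 1 + (fst z)^2" by (simp add: add_pos_nonneg)
  ultimately show ?thesis by (simp add: pos_le_divide_eq)
 qed
 moreover have "ph : BM borel" using schwartz_continuous[OF assms] by (rule borel_measurable_continuous_onI)
 ultimately show ?thesis unfolding time_dominated_def by blast
qed

lemma schwartz_measurable[measurable_dest]: "ph : schwartz ==> ph : BM borel"
 using schwartz_time_dominated by (simp add: time_dominated_def)

lemma time_dominated_mult_bounded:
 assumes g: "time_dominated g" and [measurable]: "h : BM borel" and h: "!!z. cmod (h z) <= K"
 shows "time_dominated (%z. h z*g z)"
proof -
 obtain B where [measurable]: "g : BM borel" and B: "!!z. cmod (g z) <= B / (1 + (fst z)^2)"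
  using g unfolding time_dominated_def by blast
 have K: "0 <= K" using order_trans[OF norm_ge_zero h] .
 have "cmod (h z*g z) <= (K*B) / (1 + (fst z)^2)" for z
  using mult_mono[OF h B K norm_ge_zero, of z z] by (simp add: norm_mult)
 then show ?thesis unfolding time_dominated_def by (intro conjI exI[of _ "K*B"]) auto
qed

lemma ch_slice_measurable[measurable]: "ch xi : BM borel"
 unfolding ch_def[abs_def] by measurable

definition pair :: "frequency => spacetime => real" where
 "pair xi w = fst xi*fst w + of_int (fst (snd xi))*fst (snd w) + of_int (snd (snd xi)) * snd (snd w)"

lemma ch_pair: "ch xi z = cis (pair xi z)" by (simp add: ch_def pair_def)

lemma pair_line: "pair xi (z + r *\<^sub>R w) = pair xi z + r*pair xi w"
 by (cases z; cases w) (simp add: pair_def algebra_simps)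

lemma ch_line_derivative:
 "((%r. ch xi (z + r *\<^sub>R w)) has_vector_derivative \<i> * of_real (pair xi w)*ch xi (z + r *\<^sub>R w)) (at r)"
proof -
 have "((%c. exp (\<i>*(of_real (pair xi z) + c * of_real (pair xi w)))) has_field_derivative
   \<i> * of_real (pair xi w)*exp (\<i>*(of_real (pair xi z) + of_real r * of_real (pair xi w)))) (at (of_real r))"
  by (auto intro!: derivative_eq_intros)
 from has_vector_derivative_real_field[OF this]
 show ?thesis unfolding ch_pair pair_line cis_conv_exp by simp
qed

lemma schwartz_line_derivative:
 assumes "ph : schwartz"
 shows "((%r. ph (z + r *\<^sub>R w)) has_vector_derivative iter_deriv [w] ph (z + r *\<^sub>R w)) (at r)"
proof -
 have "((%r. z + r *\<^sub>R w) has_derivative (%h. h *\<^sub>R w)) (at r)"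
  by (auto intro!: derivative_eq_intros)
 from has_derivative_compose[OF this schwartz_frechet[OF assms, of "[]", simplified]]
 have "((%r. ph (z + r *\<^sub>R w)) has_derivative (%h. iter_deriv [h *\<^sub>R w] ph (z + r *\<^sub>R w))) (at r)" by simp
 moreover have "iter_deriv [h *\<^sub>R w] ph y = h *\<^sub>R iter_deriv [w] ph y" for h y
 proof -
  have "linear (%v. iter_deriv [v] ph y)"
   using has_derivative_linear[OF schwartz_frechet[OF assms, of "[]" y]] by simp
  then show ?thesis by (rule linear_scale)
 qed
 ultimately show ?thesis by (simp add: has_vector_derivative_def del: iter_deriv.simps(2))
qed

text \<open>Integration by parts in the direction \<open>w\<close>; the boundary terms vanish by decay in time and by periodicity in
space.\<close>

lemma ft_schwartz_derivative:
 assumes ph: "ph : schwartz" and w: "w : {(1, 0, 0), (0, 1, 0), (0, 0, 1)}"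
 shows "ft (iter_deriv [w] ph) xi = \<i> * of_real (pair xi w)*ft ph xi"
proof -
 define ph' where "ph' = iter_deriv [w] ph"
 have ph': "ph' : schwartz" unfolding ph'_def by (rule schwartz_deriv[OF ph])
 note [measurable] = schwartz_measurable[OF ph] schwartz_measurable[OF ph']
 define G where "G z = ch (- xi) z*ph z" for z
 define k where "k = \<i>*complex_of_real (pair xi w)"
 define g where "g z = ch (- xi) z*ph' z - k*(ch (- xi) z*ph z)" for z
 have pm: "pair (- xi) w = - pair xi w" by (simp add: pair_def)
 have der: "((%r. G (z + r *\<^sub>R w)) has_vector_derivative g (z + r *\<^sub>R w)) (at r)" for z r
  unfolding G_def
  by (rule has_vector_derivative_eq_rhs[OF has_vector_derivative_mult[OF ch_line_derivative schwartz_line_derivative[OF ph]]])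
    (simp add: g_def ph'_def k_def pm algebra_simps del: iter_deriv.simps(2))
 have d1: "time_dominated (%z. ch (- xi) z*ph' z)" "time_dominated G"
  unfolding G_def by (rule time_dominated_mult_bounded[of _ _ 1]; auto intro: schwartz_time_dominated ph ph')+
 have dg: "time_dominated g"
 proof -
  obtain A B where AB: "!!z. cmod (ch (- xi) z*ph' z) <= A / (1 + (fst z)^2)" "!!z. cmod (G z) <= B / (1 + (fst z)^2)"
   using d1 unfolding time_dominated_def by blast
  have "cmod (g z) <= (A + cmod k*B) / (1 + (fst z)^2)" for z
  proof -
   have "cmod (g z) <= cmod (ch (- xi) z*ph' z) + cmod k*cmod (G z)"
    unfolding g_def G_def by (rule order_trans[OF norm_triangle_ineq4]) (simp add: norm_mult)
   also have "... <= A / (1 + (fst z)^2) + cmod k*(B / (1 + (fst z)^2))"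
    using AB by (intro add_mono mult_left_mono) auto
   finally show ?thesis by (simp add: add_divide_distrib)
  qed
  moreover have "g : BM borel" unfolding g_def by measurable
  ultimately show ?thesis unfolding time_dominated_def by blast
 qed
 have contch: "continuous_on UNIV (ch (- xi))" unfolding ch_def[abs_def] by (intro continuous_intros)
 have contg: "continuous_on UNIV g"
  unfolding g_def using contch schwartz_continuous[OF ph] schwartz_continuous[OF ph'] by (intro continuous_intros)
 have cline: "continuous_on UNIV (%r. g (z + r *\<^sub>R w))" for z
  by (rule continuous_on_compose2[OF contg]) (auto intro!: continuous_intros)
 have Gper: "G (t, x + 2*pi, y) = G (t, x, y)" "G (t, x, y + 2*pi) = G (t, x, y)" for t x y
 proof -
  have 1: "cis (r + of_int m*(2*pi)) = cis r" for r m
   using cis_multiple_2pi[of "of_int m"] by (simp add: cis_mult[symmetric] mult_ac)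
  have "ch (- xi) (t, x + 2*pi, y) = cis (pair (- xi) (t, x, y) + of_int (fst (snd (- xi)))*(2*pi))"
   "ch (- xi) (t, x, y + 2*pi) = cis (pair (- xi) (t, x, y) + of_int (snd (snd (- xi)))*(2*pi))"
   by (simp_all add: ch_pair pair_def algebra_simps)
  then have "ch (- xi) (t, x + 2*pi, y) = ch (- xi) (t, x, y)" "ch (- xi) (t, x, y + 2*pi) = ch (- xi) (t, x, y)"
   unfolding 1 ch_pair by simp_all
  then show "G (t, x + 2*pi, y) = G (t, x, y)" "G (t, x, y + 2*pi) = G (t, x, y)"
   using schwartz_periodic[OF ph] by (simp_all add: G_def periodic_space_def)
 qed
 have "integral\<^sup>L sl g = 0"
 proof -
  consider "w = (1, 0, 0)" | "w = (0, 1, 0)" | "w = (0, 0, 1)" using w by auto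
  then show ?thesis
  proof cases
   case 1
   obtain B where B: "!!z. cmod (G z) <= B / (1 + (fst z)^2)" using d1(2) unfolding time_dominated_def by blast
   have "(BT t. g (t, p)) = 0" for p
   proof (rule integral_line_derivative_zero[where F="%t. G (t, p)"])
    obtain x y where p: "p = (x, y)" by (cases p)
    show "((%t. G (t, p)) has_vector_derivative g (t, p)) (at t)" for t
     using der[of "(0, x, y)" t] by (simp add: 1 p)
    show "continuous_on UNIV (%t. g (t, p))" using cline[of "(0, x, y)"] by (simp add: 1 p)
    show "integrable lborel (%t. g (t, p))" by (rule time_dominated_integrable(2)[OF dg])
    have z: "(%n. B / (1 + (real n)^2)) \<longlonglongrightarrow> 0" by real_asymp
    show "(%n. G (real n, p)) \<longlonglongrightarrow> 0"
     by (rule Lim_null_comparison[OF _ z]) (use B[of "(real _, p)"] in \<open>auto intro!: always_eventually\<close>)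
    show "(%n. G (- real n, p)) \<longlonglongrightarrow> 0"
     by (rule Lim_null_comparison[OF _ z]) (use B[of "(- real _, p)"] in \<open>auto intro!: always_eventually\<close>)
   qed
   then show ?thesis unfolding integral_sl_iterated(3)[OF dg] by simp
  next
   case 2
   have "(\<integral>x. g (t, x, y) \<partial>tm) = G (t, 2*pi, y) - G (t, 0, y)" for t y
   proof (rule integral_tm_FTC)
    show "((%x. G (t, x, y)) has_vector_derivative g (t, x, y)) (at x)" for x
     using der[of "(t, 0, y)" x] by (simp add: 2)
    show "continuous_on UNIV (%x. g (t, x, y))" using cline[of "(t, 0, y)"] by (simp add: 2)
   qed
   then show ?thesis unfolding integral_sl_iterated(2)[OF dg] using Gper(1)[of _ 0] by simp
  next
   case 3
   have "(\<integral>y. g (t, x, y) \<partial>tm) = G (t, x, 2*pi) - G (t, x, 0)" for t x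
   proof (rule integral_tm_FTC)
    show "((%y. G (t, x, y)) has_vector_derivative g (t, x, y)) (at y)" for y
     using der[of "(t, x, 0)" y] by (simp add: 3)
    show "continuous_on UNIV (%y. g (t, x, y))" using cline[of "(t, x, 0)"] by (simp add: 3)
   qed
   then show ?thesis unfolding integral_sl_iterated(1)[OF dg] using Gper(2)[of _ _ 0] by simp
  qed
 qed
 moreover have "integral\<^sup>L sl g = ft ph' xi - k*ft ph xi"
  unfolding g_def ft_sl[OF schwartz_measurable[OF ph]] ft_sl[OF schwartz_measurable[OF ph']]
  using time_dominated_integrable(1)[OF d1(1)] time_dominated_integrable(1)[OF d1(2)]
  by (subst Bochner_Integration.integral_diff) (auto simp: G_def[abs_def])
 ultimately show ?thesis by (simp add: ph'_def k_def)
qed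

section \<open>Decay of the transform\<close>

lemma ft_diff:
 assumes "integrable sl f" "integrable sl g"
 shows "ft (%z. f z - g z) xi = ft f xi - ft g xi"
proof -
 have m: "f : BM borel" "g : BM borel"
  using assms[THEN borel_measurable_integrable] by simp_all
 have i: "integrable sl (%z. ch (- xi) z*h z)" if "integrable sl h" for h
  by (rule Bochner_Integration.integrable_bound[OF that])
    (use borel_measurable_integrable[OF that] in \<open>auto simp: norm_mult\<close>)
 show ?thesis using m i[OF assms(1)] i[OF assms(2)]
  by (simp add: ft_sl right_diff_distrib)
qed

lemma norm_ft_le:
 assumes "integrable sl g"
 shows "cmod (ft g xi) <= (BS z. cmod (g z))"
proof -
 have m: "g : BM borel" using borel_measurable_integrable[OF assms] by simp
 have "cmod (ft g xi) <= (BS z. cmod (ch (- xi) z*g z))"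
  unfolding ft_sl[OF m] by (rule integral_norm_bound)
 then show ?thesis by (simp add: norm_mult)
qed

lemma schwartz_integrable: "ph : schwartz ==> integrable sl ph"
 by (rule time_dominated_integrable(1)[OF schwartz_time_dominated])

lemma ft_measurable[measurable (raw)]:
 assumes "integrable sl g" shows "ft g : BM fm"
proof -
 have m[measurable]: "g : BM borel" using borel_measurable_integrable[OF assms] by simp
 have "(%xi. (BS z. ch (- xi) z*g z)) : BM fm"
  by (rule sls.borel_measurable_lebesgue_integral) measurable
 then show ?thesis by (simp add: ft_sl[OF m, abs_def])
qed

definition decay :: "frequency => real" where
 "decay xi = 1 / ((1 + (fst xi)^2)*((1 + (of_int (fst (snd xi)))^2)*(1 + (of_int (snd (snd xi)))^2)))"

text \<open>Apply \<open>1 - \<partial>\<^sup>2\<close> in each of the three directions. The statement can be iterated, so the decay is of any order.\<close>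

lemma ft_schwartz_smoothing:
 assumes "ph : schwartz"
 shows "EX ps:schwartz. ALL xi. ft ph xi = of_real (decay xi)*ft ps xi"
proof -
 define L where "L w f = (%z. f z - iter_deriv [w] (iter_deriv [w] f) z)" for w f
 have L: "L w f : schwartz" if "f : schwartz" for w f
  unfolding L_def by (intro schwartz_diff schwartz_deriv that)
 have fL: "ft (L w f) xi = of_real (1 + (pair xi w)^2)*ft f xi" if f: "f : schwartz" and w: "w : {(1, 0, 0), (0, 1, 0), (0, 0, 1)}" for w f xi
 proof -
  have d: "iter_deriv [w] f : schwartz" "iter_deriv [w] (iter_deriv [w] f) : schwartz" by (intro schwartz_deriv f)+
  have "ft (L w f) xi = ft f xi - ft (iter_deriv [w] (iter_deriv [w] f)) xi"
   unfolding L_def by (rule ft_diff[OF schwartz_integrable[OF f] schwartz_integrable[OF d(2)]])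
  also have "ft (iter_deriv [w] (iter_deriv [w] f)) xi = (\<i> * of_real (pair xi w))*(\<i> * of_real (pair xi w)*ft f xi)"
   unfolding ft_schwartz_derivative[OF d(1) w] ft_schwartz_derivative[OF f w] ..
  finally show ?thesis by (simp add: power2_eq_square algebra_simps)
 qed
 define ps where "ps = L (1, 0, 0) (L (0, 1, 0) (L (0, 0, 1) ph))"
 have ps: "ps : schwartz" unfolding ps_def by (intro L assms)
 have "ft ph xi = of_real (decay xi)*ft ps xi" for xi
 proof -
  define D where "D = (1 + (fst xi)^2)*((1 + (of_int (fst (snd xi)))^2)*(1 + (real_of_int (snd (snd xi)))^2))"
  have D: "0 < D" unfolding D_def by (intro mult_pos_pos) (auto simp: add_pos_nonneg)
  have "ft ps xi = of_real D*ft ph xi"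
   unfolding ps_def by (subst fL, intro L assms, simp, subst fL, intro L assms, simp, subst fL, rule assms, simp)
     (simp add: D_def pair_def)
  moreover have "decay xi = 1 / D" by (simp add: decay_def D_def)
  ultimately show ?thesis using D by simp
 qed
 then show ?thesis using ps by blast
qed

lemma ft_schwartz_decay:
 assumes "ph : schwartz"
 shows "EX C. ALL xi. cmod (ft ph xi) <= C*decay xi"
proof -
 obtain ps where ps: "ps : schwartz" and e: "!!xi. ft ph xi = of_real (decay xi)*ft ps xi"
  using ft_schwartz_smoothing[OF assms] by blast
 have "0 <= decay xi" for xi by (auto simp: decay_def intro!: mult_nonneg_nonneg)
 then have "cmod (ft ph xi) <= (BS z. cmod (ps z))*decay xi" for xi
  unfolding e using norm_ft_le[OF schwartz_integrable[OF ps], of xi] by (simp add: norm_mult mult.commute[of _ "decay xi"] mult_left_mono)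
 then show ?thesis by blast
qed

lemma nn_integral_count_int_le:
 fixes f :: "int => ennreal"
 shows "(\<integral>\<^sup>+n. f n \<partial>count_space UNIV) <= (\<Sum>k. f (int k)) + (\<Sum>k. f (- int k))"
proof -
 have 1: "(\<integral>\<^sup>+n. f n*indicator (range h) n \<partial>count_space UNIV) = (\<Sum>k. f (h k))" if "inj h" for h :: "nat => int"
 proof -
  have "(\<integral>\<^sup>+n. f n*indicator (range h) n \<partial>count_space UNIV) = (\<integral>\<^sup>+n. f n \<partial>count_space (range h))"
   by (subst nn_integral_count_space_indicator) auto
  also have "... = (\<integral>\<^sup>+k. f (h k) \<partial>count_space UNIV)"
   using that by (intro nn_integral_bij_count_space[symmetric]) (simp add: inj_on_imp_bij_betw)
  finally show ?thesis by (simp add: nn_integral_count_space_nat)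
 qed
 have "(\<integral>\<^sup>+n. f n \<partial>count_space UNIV) <= (\<integral>\<^sup>+n. f n*indicator (range int) n + f n*indicator (range (%k. - int k)) n \<partial>count_space UNIV)"
 proof (rule nn_integral_mono)
  fix n :: int
  have "n : range int | n : range (%k. - int k)"
   by (metis int_cases2 rangeI)
  then show "f n <= f n*indicator (range int) n + f n*indicator (range (%k. - int k)) n"
   by (auto simp: indicator_def)
 qed
 also have "... = (\<integral>\<^sup>+n. f n*indicator (range int) n \<partial>count_space UNIV) + (\<integral>\<^sup>+n. f n*indicator (range (%k. - int k)) n \<partial>count_space UNIV)"
  by (rule nn_integral_add) auto
 also have "... = (\<Sum>k. f (int k)) + (\<Sum>k. f (- int k))"
  by (subst 1, simp, subst 1) (auto simp: inj_def)
 finally show ?thesis .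
qed

lemma nn_integral_inverse_quadratic_int: "(\<integral>\<^sup>+n. ennreal (1 / (1 + (real_of_int n)^2)) \<partial>count_space UNIV) < \<top>"
proof -
 have s: "summable (%k. 1 / (1 + (real k)^2))"
 proof (rule summable_comparison_test')
  show "summable (%k. 2*(1 / (real k + 1)\<^sup>2))"
  proof (intro summable_mult)
   have "summable (%k. inverse ((real k) ^ 2))" by (rule inverse_power_summable) simp
   then show "summable (%k. 1 / (real k + 1)\<^sup>2)"
    by (subst (asm) summable_Suc_iff[symmetric]) (simp add: inverse_eq_divide add.commute)
  qed
  fix k :: nat
  have "(real k + 1)^2 <= 2*(1 + (real k)^2)" using zero_le_power2[of "real k - 1"] by (simp add: power2_eq_square algebra_simps)
  then show "norm (1 / (1 + (real k)^2)) <= 2*(1 / (real k + 1)\<^sup>2)" by (simp add: divide_simps add_pos_nonneg)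
 qed
 have "(\<integral>\<^sup>+n. ennreal (1 / (1 + (real_of_int n)^2)) \<partial>count_space UNIV) <= (\<Sum>k. ennreal (1 / (1 + (real k)^2))) + (\<Sum>k. ennreal (1 / (1 + (real k)^2)))"
  using nn_integral_count_int_le[of "%n. ennreal (1 / (1 + (real_of_int n)^2))"] by simp
 also have "(\<Sum>k. ennreal (1 / (1 + (real k)^2))) = ennreal (\<Sum>k. 1 / (1 + (real k)^2))"
  using s by (intro suminf_ennreal2) auto
 finally show ?thesis by (rule le_less_trans) simp
qed

lemma decay_measurable[measurable]: "decay : BM fm"
 unfolding decay_def[abs_def] by measurable

lemma decay_bounds: "0 <= decay xi" "decay xi <= 1"
proof -
 have "1*(1*1) <= (1 + (fst xi)^2)*((1 + (of_int (fst (snd xi)))^2)*(1 + (real_of_int (snd (snd xi)))^2))"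
  by (intro mult_mono) auto
 then show "0 <= decay xi" "decay xi <= 1" unfolding decay_def by (simp_all add: divide_le_eq_1)
qed

lemma nn_integral_decay: "(NF xi. ennreal (decay xi)) < \<top>"
proof -
 define q where "q n = ennreal (1 / (1 + (real_of_int n)^2))" for n
 define I where "I = (NT ta. ennreal (1 / (1 + ta^2)))"
 have "(NF xi. ennreal (decay xi)) = (\<integral>\<^sup>+n. (NT ta. (q (fst n)*q (snd n))*ennreal (1 / (1 + ta^2))) \<partial>count_space UNIV)"
  by (subst nn_integral_fm, measurable, intro nn_integral_cong)
    (simp add: decay_def q_def mult_ac flip: ennreal_mult)
 also have "... = (\<integral>\<^sup>+n. q (fst n)*q (snd n)*I \<partial>count_space UNIV)"
  unfolding I_def by (intro nn_integral_cong nn_integral_cmult) simp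
 also have "... = (\<integral>\<^sup>+n. q (fst n)*q (snd n) \<partial>count_space UNIV)*I"
  by (rule nn_integral_multc) simp
 also have "(\<integral>\<^sup>+n. q (fst n)*q (snd n) \<partial>count_space UNIV) = (\<integral>\<^sup>+a. \<integral>\<^sup>+b. q a*q b \<partial>count_space UNIV \<partial>count_space UNIV)"
  using nn_integral_fst_count_space[of "%n. q (fst n)*q (snd n)"] by simp
 also have "... = (\<integral>\<^sup>+a. q a \<partial>count_space UNIV)*(\<integral>\<^sup>+b. q b \<partial>count_space UNIV)"
  by (simp add: nn_integral_cmult nn_integral_multc)
 also have "...*I < \<top>"
 proof -
  have "I < \<top>" using integrable_inverse_quadratic[of 1] unfolding I_def by (simp add: integrable_iff_bounded)
  then show ?thesis using nn_integral_inverse_quadratic_int unfolding q_def by (simp add: ennreal_mult_less_top)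
 qed
 finally show ?thesis .
qed

lemma integrable_decay: "integrable fm decay"
 using nn_integral_decay decay_bounds by (intro integrableI_nonneg) auto

lemma ft_schwartz_integrable:
 assumes "ph : schwartz" shows "integrable fm (ft ph)"
proof -
 obtain C where C: "!!xi. cmod (ft ph xi) <= C*decay xi" using ft_schwartz_decay[OF assms] by blast
 show ?thesis
 proof (rule Bochner_Integration.integrable_bound[OF integrable_mult_right[OF integrable_decay, of C]])
  show "AE xi in fm. cmod (ft ph xi) <= norm (C*decay xi)"
   by (intro AE_I2) (rule order_trans[OF C], simp)
 qed (rule ft_measurable[OF schwartz_integrable[OF assms]])
qed

lemma count_int_integral_limit:
 fixes a :: "int => complex"
 assumes "integrable (count_space UNIV) a"
 shows "(%N. \<Sum>n=-int N..int N. a n) \<longlonglongrightarrow> integral\<^sup>L (count_space UNIV) a"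
proof -
 have "(%N. \<integral>n. indicator {-int N..int N} n *\<^sub>R a n \<partial>count_space UNIV) \<longlonglongrightarrow> integral\<^sup>L (count_space UNIV) a"
 proof (rule integral_dominated_convergence[where w="%n. cmod (a n)"])
  show "AE n in count_space UNIV. (%N. indicat_real {-int N..int N} n *\<^sub>R a n) \<longlonglongrightarrow> a n"
  proof (rule AE_I2)
   fix n :: int
   have "\<forall>\<^sub>F N in sequentially. a n = indicat_real {-int N..int N} n *\<^sub>R a n"
    using eventually_ge_at_top[of "nat \<bar>n\<bar>"] by eventually_elim (auto simp: indicator_def)
   then show "(%N. indicat_real {-int N..int N} n *\<^sub>R a n) \<longlonglongrightarrow> a n"
    by (rule Lim_transform_eventually[OF tendsto_const])
  qed
 qed (use assms in \<open>auto simp: indicator_def\<close>)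
 moreover have "(\<integral>n. indicator {-int N..int N} n *\<^sub>R a n \<partial>count_space UNIV) = (\<Sum>n=-int N..int N. a n)" for N
 proof -
  have fin: "finite {n. indicat_real {-int N..int N} n *\<^sub>R a n ~= 0}"
   by (rule finite_subset[of _ "{-int N..int N}"]) (auto simp: indicator_def split: if_splits)
  have "(\<integral>n. indicator {-int N..int N} n *\<^sub>R a n \<partial>count_space UNIV) = (\<Sum>n | indicat_real {-int N..int N} n *\<^sub>R a n ~= 0. indicat_real {-int N..int N} n *\<^sub>R a n)"
   using lebesgue_integral_count_space_finite_support[of UNIV "%n. indicat_real {-int N..int N} n *\<^sub>R a n"] fin by simp
  also have "... = (\<Sum>n=-int N..int N. a n)"
   by (intro sum.mono_neutral_cong_left) (auto simp: indicator_def split: if_splits)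
  finally show ?thesis .
 qed
 ultimately show ?thesis by simp
qed

section \<open>Fourier inversion for Schwartz functions\<close>

lemma schwartz_lipschitz:
 assumes "ph : schwartz"
 shows "EX K>=0. ALL z r. cmod (ph (z + r *\<^sub>R w) - ph z) <= K*\<bar>r\<bar>"
proof -
 obtain K where K: "!!z. cmod (iter_deriv [w] ph z) <= K"
  using schwartz_bdd[OF schwartz_deriv[OF assms, of "[w]"], of 0, unfolded power_0 mult_1_left] by blast
 have "cmod (ph (z + r *\<^sub>R w) - ph (z + 0 *\<^sub>R w)) <= K*norm (r - 0)" for z r
 proof (rule differentiable_bound[of UNIV "%r. ph (z + r *\<^sub>R w)"])
  show "((%r. ph (z + r *\<^sub>R w)) has_derivative (%h. h *\<^sub>R iter_deriv [w] ph (z + r *\<^sub>R w))) (at r within UNIV)" for r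
   using schwartz_line_derivative[OF assms] unfolding has_vector_derivative_def .
  show "onorm (%h. h *\<^sub>R iter_deriv [w] ph (z + r *\<^sub>R w)) <= K" for r
   using K by (intro onorm_le) (simp add: mult.commute[of K] mult_left_mono del: iter_deriv.simps)
 qed auto
 then show ?thesis using order_trans[OF norm_ge_zero K] by (intro exI[of _ K]) simp
qed

lemma fcoeff_diff_le:
 assumes "f : BM borel" "g : BM borel" "!!x. cmod (f x) <= B" "!!x. cmod (g x) <= B"
  and d: "!!x. cmod (f x - g x) <= D"
 shows "cmod (fcoeff f n - fcoeff g n) <= 2*pi*D"
proof -
 have i: "integrable tm (%x. f x*cis (- (of_int n*x)))" "integrable tm (%x. g x*cis (- (of_int n*x)))"
  by (rule integrable_tm_bounded[of _ B]; use assms in \<open>auto simp: norm_mult\<close>)+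
 have "fcoeff f n - fcoeff g n = (\<integral>x. (f x - g x)*cis (- (of_int n*x)) \<partial>tm)"
  unfolding fcoeff_def by (subst Bochner_Integration.integral_diff[symmetric, OF i]) (simp add: algebra_simps)
 also have "cmod ... <= (\<integral>x. cmod ((f x - g x)*cis (- (of_int n*x))) \<partial>tm)" by (rule integral_norm_bound)
 also have "... <= (\<integral>x. D \<partial>tm)"
 proof (rule integral_mono')
  show "cmod ((f x - g x)*cis (- (of_int n*x))) <= D" for x using d by (simp add: norm_mult)
  show "0 <= D" using order_trans[OF norm_ge_zero d] .
 qed simp
 also have "... = 2*pi*D" by (simp add: measure_def emeasure_tm)
 finally show ?thesis .
qed

lemma fcoeff_bound:
 assumes "f : BM borel" "!!x. cmod (f x) <= B"
 shows "cmod (fcoeff f n) <= 2*pi*B"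
 using fcoeff_diff_le[of f "%x. 0" B B n] assms order_trans[OF norm_ge_zero assms(2)] by (simp add: fcoeff_def)

definition c3 :: real where "c3 = 1 / (2*pi) ^ 3"

lemma c3_pos: "0 < c3" by (simp add: c3_def)

lemma integral_fm:
 fixes f :: "frequency => complex"
 assumes "integrable fm f"
 shows "integral\<^sup>L fm f = (\<integral>n. (BT ta. f (ta, n)) \<partial>count_space UNIV)"
  and "integrable (count_space UNIV) (%n. (BT ta. f (ta, n)))"
 using fmp.integral_snd[of "%ta n. f (ta, n)"] fmp.integrable_snd[of "%ta n. f (ta, n)"] assms
 by (simp_all add: frequency_measure_def)

lemma pair_count_int: "count_space (UNIV :: int set) \<Otimes>\<^sub>M count_space (UNIV :: int set) = count_space UNIV"
 using pair_measure_countable[of "UNIV :: int set" "UNIV :: int set"] by simp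

interpretation cic: pair_sigma_finite "count_space (UNIV :: int set)" "count_space (UNIV :: int set)"
 by (intro pair_sigma_finite.intro sigma_finite_measure_count_space)

lemma integral_count_pairs:
 fixes a :: "int \<times> int => complex"
 assumes "integrable (count_space UNIV) a"
 shows "integral\<^sup>L (count_space UNIV) a = (\<integral>m. \<integral>n. a (n, m) \<partial>count_space UNIV \<partial>count_space UNIV)"
  and "integrable (count_space UNIV) (%m. \<integral>n. a (n, m) \<partial>count_space UNIV)"
  and "integrable (count_space UNIV) (%n. a (n, m))"
proof -
 show "integral\<^sup>L (count_space UNIV) a = (\<integral>m. \<integral>n. a (n, m) \<partial>count_space UNIV \<partial>count_space UNIV)"
  and "integrable (count_space UNIV) (%m. \<integral>n. a (n, m) \<partial>count_space UNIV)"
  using cic.integral_snd[of "%n m. a (n, m)"] cic.integrable_snd[of "%n m. a (n, m)"] assms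
  by (simp_all add: pair_count_int)
 show "integrable (count_space UNIV) (%n. a (n, m))"
 proof (rule integrableI_bounded)
  have "(\<integral>\<^sup>+n. ennreal (cmod (a (n, m))) \<partial>count_space UNIV) = (\<integral>\<^sup>+p. ennreal (cmod (a p)) \<partial>count_space (range (%n. (n, m))))"
   by (rule nn_integral_bij_count_space) (auto simp: bij_betw_def inj_on_def)
  also have "... <= (\<integral>\<^sup>+p. ennreal (cmod (a p)) \<partial>count_space UNIV)"
   by (subst nn_integral_count_space_indicator) (auto intro!: nn_integral_mono simp: indicator_def)
  also have "... < \<top>" using assms by (simp add: integrable_iff_bounded)
  finally show "(\<integral>\<^sup>+n. ennreal (cmod (a (n, m))) \<partial>count_space UNIV) < \<infinity>" by simp
 qed simp
qed

text \<open>The inversion is done one variable at a time: on the line in \<open>t\<close>, then as a Fourier series in \<open>x\<close>, then in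
\<open>y\<close>. Each step is applied to a partial transform of \<open>\<phi>\<close>, which inherits a Lipschitz bound from \<open>\<phi>\<close>.\<close>

theorem schwartz_inversion:
 assumes ph: "ph : schwartz"
 shows "(BF xi. ft ph xi*ch xi z) = of_real ((2*pi) ^ 3)*ph z"
proof -
 obtain t x y where z: "z = (t, x, y)" by (cases z)
 note [measurable] = schwartz_measurable[OF ph]
 have phim: "ph : BM (borel \<Otimes>\<^sub>M (borel \<Otimes>\<^sub>M borel))"
  using schwartz_measurable[OF ph] by (simp add: borel_prod)
 obtain B where B: "!!z. cmod (ph z) <= B"
  using schwartz_bdd[OF ph, of 0, unfolded power_0 mult_1_left] by blast
 have B0: "0 <= B" using order_trans[OF norm_ge_zero B] .
 define b where "b t x n2 = fcoeff (%y. ph (t, x, y)) n2" for t x n2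
 define e where "e n t = fcoeff (%x. b t x (snd n)) (fst n)" for n t
 have yb: "(%y. ph (t, x, y)) : BM borel" for t x
  using phim by measurable
 have tybm: "(%t. b (fst t) (snd t) n2) : BM (borel \<Otimes>\<^sub>M borel)" for n2
  unfolding b_def fcoeff_def
  by (rule tm.borel_measurable_lebesgue_integral, unfold split_beta', use phim in measurable)
 have xb: "(%x. b t x n2) : BM borel" for t n2
  using measurable_compose[OF measurable_Pair1' tybm[of n2], of t] by simp
 have bb: "cmod (b t x n2) <= 2*pi*B" for t x n2
  unfolding b_def by (rule fcoeff_bound[OF yb B])
 have eb: "cmod (e n t) <= 2*pi*(2*pi*B)" for n t
  unfolding e_def by (rule fcoeff_bound[OF xb bb])
 have lip: "EX K>=0. ALL z r. cmod (ph (z + r *\<^sub>R w) - ph z) <= K*\<bar>r\<bar>" for w by (rule schwartz_lipschitz[OF ph])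
 obtain Kt where Kt: "!!z r. cmod (ph (z + r *\<^sub>R (1, 0, 0)) - ph z) <= Kt*\<bar>r\<bar>" using lip by blast
 obtain Kx where Kx: "!!z r. cmod (ph (z + r *\<^sub>R (0, 1, 0)) - ph z) <= Kx*\<bar>r\<bar>" using lip by blast
 obtain Ky where Ky: "!!z r. cmod (ph (z + r *\<^sub>R (0, 0, 1)) - ph z) <= Ky*\<bar>r\<bar>" using lip by blast
 have Lt: "cmod (ph (t, x, y) - ph (t', x, y)) <= Kt*\<bar>t - t'\<bar>" for t t' x y using Kt[of "(t', x, y)" "t - t'"] by simp
 have Lx: "cmod (ph (t, x, y) - ph (t, x', y)) <= Kx*\<bar>x - x'\<bar>" for t x x' y using Kx[of "(t, x', y)" "x - x'"] by simp
 have Ly: "cmod (ph (t, x, y) - ph (t, x, y')) <= Ky*\<bar>y - y'\<bar>" for t x y y' using Ky[of "(t, x, y')" "y - y'"] by simp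
 have bLt: "cmod (b t x n2 - b t' x n2) <= 2*pi*(Kt*\<bar>t - t'\<bar>)" for t t' x n2
  unfolding b_def by (rule fcoeff_diff_le[OF yb yb B B Lt])
 have bLx: "cmod (b t x n2 - b t x' n2) <= 2*pi*Kx*\<bar>x - x'\<bar>" for t x x' n2
  unfolding b_def using fcoeff_diff_le[OF yb yb B B Lx] by (simp add: mult_ac)
 have eL: "cmod (e n t - e n t') <= 2*pi*(2*pi*(Kt*\<bar>t - t'\<bar>))" for n t t'
  unfolding e_def by (rule fcoeff_diff_le[OF xb xb bb bb bLt])
 have econt: "continuous_on UNIV (e n)" for n
 proof (rule continuous_onI)
  fix t ep :: real assume "0 < ep"
  define M where "M = 2*pi*(2*pi*Kt) + 1"
  have "0 <= Kt" using Lt[of 1 0 0 0] order_trans[OF norm_ge_zero] by fastforce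
  then have M: "0 < M" unfolding M_def by (simp add: add_nonneg_pos)
  have "dist (e n t') (e n t) <= ep" if "dist t' t < ep / M" for t'
  proof -
   have "dist (e n t') (e n t) <= (M - 1)*dist t' t"
    using eL[of n t' t] by (simp add: dist_norm M_def mult_ac)
   also have "... <= M*dist t' t" by (simp add: algebra_simps)
   also have "... <= ep" using that M by (simp add: pos_less_divide_eq mult.commute less_imp_le)
   finally show ?thesis .
  qed
  then show "EX d>0. ALL t':UNIV. dist t' t < d --> dist (e n t') (e n t) <= ep"
   using M \<open>0 < ep\<close> by (intro exI[of _ "ep / M"]) auto
 qed
 have fe: "ft ph (ta, n) = (BT t. e n t*cis (- (ta*t)))" for ta n
 proof -
  have td: "time_dominated (%z. ch (- (ta, n)) z*ph z)"
   by (rule time_dominated_mult_bounded[OF schwartz_time_dominated[OF ph], of _ 1]) auto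
  have "ch (- (ta, n)) (t, x, y)*ph (t, x, y) = ph (t, x, y)*cis (- (of_int (snd n)*y))*cis (- (of_int (fst n)*x))*cis (- (ta*t))" for t x y
   by (simp add: ch_def cis_mult algebra_simps)
  then show ?thesis
   unfolding ft_sl[OF schwartz_measurable[OF ph]] integral_sl_iterated(1)[OF td]
   by (simp only: e_def b_def fcoeff_def integral_mult_left_zero)
 qed
 have eint: "integrable lborel (e n)" for n
 proof -
  obtain D where D: "!!z. cmod (ph z) <= D / (1 + (fst z)^2)"
   using schwartz_time_dominated[OF ph] unfolding time_dominated_def by blast
  have D0: "0 <= D" using order_trans[OF norm_ge_zero D[of "(0, 0, 0)"]] by simp
  have "cmod (b t x n2) <= 2*pi*(D / (1 + t^2))" for t x n2
   unfolding b_def using D[of "(t, x, _)"] by (intro fcoeff_bound[OF yb]) simp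
  then have "cmod (e n t) <= 2*pi*(2*pi*(D / (1 + t^2)))" for t
   unfolding e_def by (rule fcoeff_bound[OF xb])
  then have "cmod (e n t) <= norm ((2*pi*(2*pi*D)) / (1 + t^2))" for t
   by (simp add: mult_ac order_trans[OF _ abs_ge_self] D0 abs_mult)
  then show ?thesis
   by (intro Bochner_Integration.integrable_bound[OF integrable_inverse_quadratic[of "2*pi*(2*pi*D)"]])
     (auto intro: borel_measurable_continuous_onI econt)
 qed
 have Fi: "integrable fm (ft ph)" by (rule ft_schwartz_integrable[OF ph])
 have Ei: "integrable lborel (%ta. ft ph (ta, n))" for n
 proof -
  obtain C where C: "!!xi. cmod (ft ph xi) <= C*decay xi" using ft_schwartz_decay[OF ph] by blast
  have C0: "0 <= C" using order_trans[OF norm_ge_zero C[of "(0, 0, 0)"]] by (simp add: decay_def)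
  have "decay (ta, n) <= 1 / (1 + ta^2)" for ta
  proof -
   have "1*1 <= (1 + (of_int (fst n))^2)*(1 + (real_of_int (snd n))^2)" by (intro mult_mono) auto
   then have "(1 + ta^2)*1 <= (1 + ta^2)*((1 + (of_int (fst n))^2)*(1 + (real_of_int (snd n))^2))" by (intro mult_left_mono) auto
   then show ?thesis unfolding decay_def by (intro divide_left_mono) (auto intro!: mult_pos_pos simp: add_pos_nonneg)
  qed
  then have "cmod (ft ph (ta, n)) <= C / (1 + ta^2)" for ta
   using order_trans[OF C mult_left_mono[OF _ C0]] by fastforce
  moreover have "(%ta. ft ph (ta, n)) : BM borel"
   using ft_measurable[OF schwartz_integrable[OF ph]] unfolding meas_fm_iff by blast
  ultimately show ?thesis using C0
   by (intro Bochner_Integration.integrable_bound[OF integrable_inverse_quadratic[of C]]) auto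
 qed
 have inv_t: "(BT ta. ft ph (ta, n)*cis (ta*t)) = of_real (2*pi)*e n t" for n
  by (rule fourier_inversion_line[OF econt eb eint fe Ei])
 define a where "a n = of_real (2*pi)*e n t*cis (of_int (fst n)*x)*cis (of_int (snd n)*y)" for n
 have chi: "integrable fm (%xi. ft ph xi*ch xi z)"
  by (rule Bochner_Integration.integrable_bound[OF Fi]) (use Fi in \<open>auto simp: norm_mult\<close>)
 have an: "(BT ta. ft ph (ta, n)*ch (ta, n) z) = a n" for n
 proof -
  have "ft ph (ta, n)*ch (ta, n) z = ft ph (ta, n)*cis (ta*t)*(cis (of_int (fst n)*x)*cis (of_int (snd n)*y))" for ta
   by (simp add: ch_def z cis_mult algebra_simps)
  then show ?thesis unfolding a_def by (simp only: integral_mult_left_zero inv_t) (simp only: mult.assoc)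
 qed
 have ai: "integrable (count_space UNIV) a" using integral_fm(2)[OF chi] unfolding an .
 have per: "b t (x + 2*pi) n2 = b t x n2" "ph (t, x, y + 2*pi) = ph (t, x, y)" for t x y n2
  using schwartz_periodic[OF ph] by (simp_all add: b_def periodic_space_def)
 have inner: "(\<integral>n. a (n, m) \<partial>count_space UNIV) = of_real (2*pi)*(of_real (2*pi)*b t x m)*cis (of_int m*y)" for m
 proof (rule LIMSEQ_unique[OF count_int_integral_limit[OF integral_count_pairs(3)[OF ai]]])
  have "(%N. of_real (2*pi)*(\<Sum>n=-int N..int N. fcoeff (%x. b t x m) n*cis (of_int n*x))*cis (of_int m*y)) \<longlonglongrightarrow> of_real (2*pi)*(of_real (2*pi)*b t x m)*cis (of_int m*y)"
   by (intro tendsto_mult tendsto_const fourier_series_inversion[OF bLx per(1)])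
  then show "(%N. \<Sum>n=-int N..int N. a (n, m)) \<longlonglongrightarrow> of_real (2*pi)*(of_real (2*pi)*b t x m)*cis (of_int m*y)"
   unfolding sum_distrib_left sum_distrib_right by (simp add: a_def e_def mult.assoc)
 qed
 have outer: "(\<integral>m. \<integral>n. a (n, m) \<partial>count_space UNIV \<partial>count_space UNIV) = of_real (2*pi) * of_real (2*pi)*(of_real (2*pi)*ph (t, x, y))"
 proof (rule LIMSEQ_unique[OF count_int_integral_limit[OF integral_count_pairs(2)[OF ai]]])
  have "(%N. of_real (2*pi) * of_real (2*pi)*(\<Sum>m=-int N..int N. b t x m*cis (of_int m*y))) \<longlonglongrightarrow> of_real (2*pi) * of_real (2*pi)*(of_real (2*pi)*ph (t, x, y))"
   unfolding b_def by (intro tendsto_mult tendsto_const fourier_series_inversion[OF Ly per(2)])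
  then show "(%N. \<Sum>m=-int N..int N. \<integral>n. a (n, m) \<partial>count_space UNIV) \<longlonglongrightarrow> of_real (2*pi) * of_real (2*pi)*(of_real (2*pi)*ph (t, x, y))"
   unfolding sum_distrib_left inner by (simp add: mult.assoc)
 qed
 show ?thesis
  unfolding integral_fm(1)[OF chi] an integral_count_pairs(1)[OF ai] outer by (simp add: z power3_eq_cube)
qed

section \<open>Parseval identity and products\<close>

lemma (in pair_sigma_finite) integrable_dominated_product:
 fixes h :: "'a \<times> 'b => complex" and f :: "'a => complex" and g :: "'b => complex"
 assumes f: "integrable M1 f" and g: "integrable M2 g" and h[measurable]: "h : BM (M1 \<Otimes>\<^sub>M M2)"
  and le: "!!x y. cmod (h (x, y)) <= cmod (f x)*cmod (g y)"
 shows "integrable (M1 \<Otimes>\<^sub>M M2) h"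
proof (rule integrableI_bounded)
 have [measurable]: "f : BM M1" "g : BM M2" using f g by auto
 have "(\<integral>\<^sup>+p. ennreal (cmod (h p)) \<partial>(M1 \<Otimes>\<^sub>M M2)) = (\<integral>\<^sup>+x. \<integral>\<^sup>+y. ennreal (cmod (h (x, y))) \<partial>M2 \<partial>M1)"
  by (subst M2.nn_integral_fst[symmetric]) auto
 also have "... <= (\<integral>\<^sup>+x. \<integral>\<^sup>+y. ennreal (cmod (f x))*ennreal (cmod (g y)) \<partial>M2 \<partial>M1)"
  using le by (intro nn_integral_mono) (simp flip: ennreal_mult)
 also have "... = (\<integral>\<^sup>+x. ennreal (cmod (f x)) \<partial>M1)*(\<integral>\<^sup>+y. ennreal (cmod (g y)) \<partial>M2)"
  by (simp add: nn_integral_cmult nn_integral_multc)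
 also have "... < \<infinity>" using f g by (simp add: integrable_iff_bounded ennreal_mult_less_top)
 finally show "(\<integral>\<^sup>+p. ennreal (cmod (h p)) \<partial>(M1 \<Otimes>\<^sub>M M2)) < \<infinity>" .
qed measurable

lemma distr_fm_reflect: "distr fm fm (%xi. ze - xi) = fm"
proof (rule measure_eqI)
 fix A assume A: "A : sets (distr fm fm (%xi. ze - xi))"
 then have [measurable]: "A : sets fm" by simp
 have "emeasure (distr fm fm (%xi. ze - xi)) A = (\<integral>\<^sup>+xi. indicator A xi \<partial>distr fm fm (%xi. ze - xi))" by simp
 also have "... = (NF xi. indicator A (ze - xi))" by (rule nn_integral_distr) measurable
 also have "... = emeasure fm A" by (subst nn_integral_fm_reflect) auto
 finally show "emeasure (distr fm fm (%xi. ze - xi)) A = emeasure fm A" .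
qed simp

lemma integral_fm_reflect:
 fixes f :: "frequency => complex" assumes "f : BM fm"
 shows "(BF xi. f (ze - xi)) = integral\<^sup>L fm f" and "integrable fm (%xi. f (ze - xi)) \<longleftrightarrow> integrable fm f"
 using integral_distr[of "%xi. ze - xi" fm fm f] integrable_distr_eq[of "%xi. ze - xi" fm fm f] assms
 unfolding distr_fm_reflect by simp_all

lemma integral_fm_uminus:
 fixes f :: "frequency => complex" assumes "f : BM fm"
 shows "(BF xi. f (- xi)) = integral\<^sup>L fm f" and "integrable fm (%xi. f (- xi)) \<longleftrightarrow> integrable fm f"
 using integral_fm_reflect[OF assms, of 0] by simp_all

text \<open>Fubini and the inversion formula for \<open>\<psi>\<close>.\<close>

theorem parseval:
 assumes g: "integrable sl g" and ps: "ps : schwartz"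
 shows "integrable fm (%xi. ft g xi*ft ps (- xi))"
  and "(BS z. g z*ps z) = of_real c3*(BF xi. ft g xi*ft ps (- xi))"
proof -
 have gm[measurable]: "g : BM borel" using borel_measurable_integrable[OF g] by simp
 have [measurable]: "g : BM sl" using g by auto
 have F: "integrable fm (ft ps)" by (rule ft_schwartz_integrable[OF ps])
 have Fm[measurable]: "ft ps : BM fm" "ft g : BM fm"
  using F ft_measurable[OF g] by auto
 have F': "integrable fm (%xi. ft ps (- xi))" using F integral_fm_uminus(2)[OF Fm(1)] by simp
 show "integrable fm (%xi. ft g xi*ft ps (- xi))"
 proof (rule Bochner_Integration.integrable_bound[OF integrable_mult_right[OF F', of "of_real (BS z. cmod (g z))"]])
  show "AE xi in fm. cmod (ft g xi*ft ps (- xi)) <= cmod (of_real (BS z. cmod (g z))*ft ps (- xi))"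
   using norm_ft_le[OF g] by (intro AE_I2) (auto simp: norm_mult intro!: mult_right_mono order_trans[OF norm_ft_le[OF g]])
 qed measurable
 have "integrable (fm \<Otimes>\<^sub>M sl) (%(xi, z). ch (- xi) z*g z*ft ps (- xi))"
  by (rule fmsl.integrable_dominated_product[OF F' g]) (auto simp: norm_mult)
 note fub = fmsl.Fubini_integral[OF this]
 have "(BF xi. ft g xi*ft ps (- xi)) = (BF xi. (BS z. ch (- xi) z*g z*ft ps (- xi)))"
  by (simp add: ft_sl[OF gm])
 also have "... = (BS z. (BF xi. ch (- xi) z*g z*ft ps (- xi)))" using fub by simp
 also have "... = (BS z. g z*(of_real ((2*pi) ^ 3)*ps z))"
 proof (rule Bochner_Integration.integral_cong[OF refl])
  fix z
  have "(BF xi. ch (- xi) z*g z*ft ps (- xi)) = (BF xi. g z*(ft ps (- xi)*ch (- xi) z))"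
   by (simp add: mult_ac)
  also have "... = g z*(BF xi. ft ps (- xi)*ch (- xi) z)" by simp
  also have "(BF xi. ft ps (- xi)*ch (- xi) z) = (BF xi. ft ps xi*ch xi z)"
   by (rule integral_fm_uminus(1)) measurable
  also have "... = of_real ((2*pi) ^ 3)*ps z" by (rule schwartz_inversion[OF ps])
  finally show "(BF xi. ch (- xi) z*g z*ft ps (- xi)) = g z*(of_real ((2*pi) ^ 3)*ps z)" .
 qed
 also have "... = (BS z. of_real ((2*pi) ^ 3)*(g z*ps z))" by (simp add: mult_ac)
 also have "... = of_real ((2*pi) ^ 3)*(BS z. g z*ps z)" by (rule integral_mult_right_zero)
 finally show "(BS z. g z*ps z) = of_real c3*(BF xi. ft g xi*ft ps (- xi))"
  by (simp add: c3_def)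
qed

lemma dist_of_eq:
 assumes "integrable sl g" "ps : schwartz"
 shows "dist_of g ps = (BS z. g z*ps z)"
proof -
 have [measurable]: "g : BM borel" using borel_measurable_integrable[OF assms(1)] by simp
 note [measurable] = schwartz_measurable[OF assms(2)]
 show ?thesis unfolding dist_of_def by (subst integral_sl) auto
qed

lemma has_ft_dist_of:
 assumes "integrable sl g" shows "has_ft (dist_of g) (ft g)"
 unfolding has_ft_iff
 using ft_measurable[OF assms] parseval[OF assms] dist_of_eq[OF assms]
 by (simp add: scaleR_conv_of_real c3_def)

lemma schwartz_modulate:
 assumes "ps : schwartz" shows "(%z. ch xi z*ps z) : schwartz"
proof (rule schwartz_mult_bounded_class[where S="range (%c z. c*ch xi z)", OF _ _ _ _ assms])
 show "deriv_closed (range (%c z. c*ch xi z))"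
  unfolding deriv_closed_def
 proof clarify
  fix c
  have "bounded_linear (pair xi)"
   unfolding pair_def[abs_def] by (intro bounded_linear_intros)
  then have p: "(pair xi has_derivative pair xi) (at z)" for z by (rule bounded_linear_imp_has_derivative)
  have i: "((%z. \<i>*complex_of_real (pair xi z)) has_derivative (%v. \<i> * of_real (pair xi v))) (at z)" for z
   by (intro has_derivative_mult_right has_derivative_of_real p)
  have "((%z. exp (\<i>*complex_of_real (pair xi z))) has_derivative (%v. exp (\<i> * of_real (pair xi z))*(\<i> * of_real (pair xi v)))) (at z)" for z
   using has_derivative_compose[OF i DERIV_exp[unfolded has_field_derivative_def]] .
  from has_derivative_mult_right[OF this, of c]
  have "((%z. c*ch xi z) has_derivative (%v. c*\<i> * of_real (pair xi v)*ch xi z)) (at z)" for z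
   unfolding ch_pair cis_conv_exp by (simp add: mult_ac)
  then show "EX D. (ALL v. D v : range (%c z. c*ch xi z)) & (ALL z. ((%z. c*ch xi z) has_derivative (%v. D v z)) (at z))"
   by (intro exI[of _ "%v z. c*\<i> * of_real (pair xi v)*ch xi z"]) blast
 qed
 fix f assume "f : range (%c z. c*ch xi z)"
 then obtain c where f: "f = (%z. c*ch xi z)" by auto
 show "EX B. ALL z. cmod (f z) <= B" by (intro exI[of _ "cmod c"]) (simp add: f norm_mult)
 have 1: "cis (r + of_int m*(2*pi)) = cis r" for r m
  using cis_multiple_2pi[of "of_int m"] by (simp add: cis_mult[symmetric] mult_ac)
 have "ch xi (t, x + 2*pi, y) = cis (pair xi (t, x, y) + of_int (fst (snd xi))*(2*pi))"
  "ch xi (t, x, y + 2*pi) = cis (pair xi (t, x, y) + of_int (snd (snd xi))*(2*pi))" for t x y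
  by (simp_all add: ch_pair pair_def algebra_simps)
 then show "periodic_space f" unfolding 1 f periodic_space_def ch_pair by simp
qed (auto intro: image_eqI[of _ _ 1])

lemma ft_modulate:
 assumes ps: "ps : schwartz"
 shows "ft (%z. ch (- ze) z*ps z) (- xi) = ft ps (ze - xi)"
proof -
 have "ch (- (ze - xi)) z = ch xi z*ch (- ze) z" for z using ch_add[of xi "- ze" z] by (simp add: algebra_simps)
 then show ?thesis unfolding ft_sl[OF schwartz_measurable[OF schwartz_modulate[OF ps]]] ft_sl[OF schwartz_measurable[OF ps]]
  by (simp add: mult.assoc)
qed

text \<open>A modulated Schwartz function is a Schwartz function, so the product formula is the defining pairing of
\<^const>\<open>has_ft\<close> evaluated at \<open>\<psi>\<close> times a character.\<close>

theorem ft_product: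
 assumes U: "has_ft (dist_of ph) F" and ph: "ph : schwartz" and ps: "ps : schwartz"
 shows "integrable fm (%xi. F xi*ft ps (ze - xi))"
  and "ft (%z. ph z*ps z) ze = of_real c3*(BF xi. F xi*ft ps (ze - xi))"
proof -
 define ps' where "ps' z = ch (- ze) z*ps z" for z
 have ps': "ps' : schwartz" unfolding ps'_def[abs_def] by (rule schwartz_modulate[OF ps])
 have e: "ft ps' (- xi) = ft ps (ze - xi)" for xi
  unfolding ps'_def[abs_def] by (rule ft_modulate[OF ps])
 show "integrable fm (%xi. F xi*ft ps (ze - xi))"
  using U ps' unfolding has_ft_iff e[symmetric] by blast
 have "ft (%z. ph z*ps z) ze = dist_of ph ps'"
  unfolding dist_of_eq[OF schwartz_integrable[OF ph] ps'] ft_sl[OF schwartz_measurable[OF schwartz_mult[OF ph ps]]]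
  by (simp add: ps'_def mult_ac)
 also have "... = of_real c3*(BF xi. F xi*ft ps (ze - xi))"
  using U ps' unfolding has_ft_iff e[symmetric] by (simp add: scaleR_conv_of_real c3_def)
 finally show "ft (%z. ph z*ps z) ze = of_real c3*(BF xi. F xi*ft ps (ze - xi))" .
qed

lemma norm_ft_product_le:
 assumes U: "has_ft (dist_of ph) F" and ph: "ph : schwartz" and ps: "ps : schwartz"
 shows "ennreal (cmod (ft (%z. ph z*ps z) ze)) <= ennreal c3*(NF xi. ennreal (cmod (F xi))*ennreal (cmod (ft ps (ze - xi))))"
proof -
 have "ennreal (cmod (ft (%z. ph z*ps z) ze)) = ennreal c3*ennreal (cmod (BF xi. F xi*ft ps (ze - xi)))"
  unfolding ft_product(2)[OF assms] using c3_pos by (simp add: norm_mult ennreal_mult)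
 also have "ennreal (cmod (BF xi. F xi*ft ps (ze - xi))) <= (NF xi. ennreal (cmod (F xi*ft ps (ze - xi))))"
  by (rule integral_norm_bound_ennreal[OF ft_product(1)[OF assms]])
 finally show ?thesis by (simp add: norm_mult ennreal_mult mult_left_mono)
qed

lemma norm_ft_product3_le:
 assumes ph: "ph1 : schwartz" "ph2 : schwartz" "ph3 : schwartz"
 shows "ennreal (cmod (ft (%z. ph1 z*(ph2 z*ph3 z)) ze))
  <= ennreal (c3^2)*tri (%xi. ennreal (cmod (ft ph1 xi))) (%xi. ennreal (cmod (ft ph2 xi))) (%xi. ennreal (cmod (ft ph3 xi))) ze"
proof -
 note h = has_ft_dist_of[OF schwartz_integrable]
 note [measurable] = ft_measurable[OF schwartz_integrable[OF ph(1)]] ft_measurable[OF schwartz_integrable[OF ph(2)]] ft_measurable[OF schwartz_integrable[OF ph(3)]]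
 have "ennreal (cmod (ft (%z. ph1 z*(ph2 z*ph3 z)) ze)) <= ennreal c3*(NF xi. ennreal (cmod (ft ph1 xi))*ennreal (cmod (ft (%z. ph2 z*ph3 z) (ze - xi))))"
  by (rule norm_ft_product_le[OF h[OF ph(1)] ph(1) schwartz_mult[OF ph(2,3)]])
 also have "... <= ennreal c3*(NF xi. ennreal (cmod (ft ph1 xi))*(ennreal c3*(NF y. ennreal (cmod (ft ph2 y))*ennreal (cmod (ft ph3 (ze - xi - y))))))"
  by (intro mult_left_mono nn_integral_mono norm_ft_product_le[OF h[OF ph(2)] ph(2,3)]) auto
 also have "... = ennreal c3*(NF xi. ennreal c3*(NF y. ennreal (cmod (ft ph1 xi))*ennreal (cmod (ft ph2 y))*ennreal (cmod (ft ph3 (ze - xi - y)))))"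
  by (simp add: mult.assoc nn_integral_cmult mult.left_commute[of "ennreal (cmod _)" "ennreal c3"])
 also have "... = ennreal c3*(ennreal c3*tri (%xi. ennreal (cmod (ft ph1 xi))) (%xi. ennreal (cmod (ft ph2 xi))) (%xi. ennreal (cmod (ft ph3 xi))) ze)"
  unfolding tri_def by (subst nn_integral_cmult) auto
 finally show ?thesis using c3_pos by (simp add: power2_eq_square ennreal_mult mult.assoc)
qed

section \<open>Plancherel inequality\<close>

definition inv_ft :: "(frequency => complex) => spacetime => complex" where
 "inv_ft F z = of_real c3*(BF xi. F xi*ch xi z)"

lemma inv_ft_ft: "ph : schwartz ==> inv_ft (ft ph) = ph"
 by (rule ext) (simp add: inv_ft_def schwartz_inversion c3_def)

lemma inv_ft_measurable[measurable (raw)]: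
 assumes [measurable]: "F : BM fm" shows "inv_ft F : BM borel"
proof -
 have "(%z. of_real c3*(BF xi. F xi*ch xi z)) : BM sl"
  by (intro borel_measurable_times borel_measurable_const fms.borel_measurable_lebesgue_integral) measurable
 then show ?thesis by (simp add: inv_ft_def[abs_def])
qed

lemma integrable_mult_ch:
 assumes "integrable fm F" shows "integrable fm (%xi. F xi*ch xi z)"
 by (rule Bochner_Integration.integrable_bound[OF assms]) (use assms in \<open>auto simp: norm_mult\<close>)

lemma gaussian_time_dominated:
 assumes "a ~= 0" shows "time_dominated (%z. of_real (exp (- (a*fst z)\<^sup>2 / 2)))"
 unfolding time_dominated_def
proof (intro conjI exI allI)
 fix z :: spacetime
 define q where "q = (a*fst z)^2 / 2"
 have q: "0 <= q" by (simp add: q_def)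
 have "(fst z)^2 = 2 / a\<^sup>2*q" using assms by (simp add: q_def power_mult_distrib)
 moreover have "1 + c*q <= (1 + c)*(1 + q)" if "0 <= c" for c using q that by (simp add: algebra_simps)
 from this[of "2 / a\<^sup>2"] have "1 + 2 / a\<^sup>2*q <= (1 + 2 / a\<^sup>2)*(1 + q)" by simp
 ultimately have "1 + (fst z)^2 <= (1 + 2 / a\<^sup>2)*(1 + q)" by simp
 also have "... <= (1 + 2 / a\<^sup>2)*exp q" using exp_ge_add_one_self[of q] by (intro mult_left_mono) auto
 finally have "exp (- q)*(1 + (fst z)^2) <= exp (- q)*((1 + 2 / a\<^sup>2)*exp q)" by (rule mult_left_mono) simp
 also have "... = 1 + 2 / a\<^sup>2" using exp_minus_inverse[of q] by (simp add: mult.left_commute[of "exp (- q)"] mult.commute[of "exp (- q)"])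
 finally have "exp (- q)*(1 + (fst z)^2) <= 1 + 2 / a\<^sup>2" .
 moreover have "0 < 1 + (fst z)^2" by (simp add: add_pos_nonneg)
 ultimately show "cmod (of_real (exp (- (a*fst z)\<^sup>2 / 2))) <= (1 + 2 / a\<^sup>2) / (1 + (fst z)^2)"
  by (simp add: pos_le_divide_eq q_def)
qed measurable

lemma integral_gaussian_ch:
 assumes a: "0 < a"
 shows "(BS z. ch xi z * of_real (exp (- (a*fst z)\<^sup>2 / 2)))
  = of_real (if snd xi = 0 then (2*pi)\<^sup>2*(sqrt (2*pi) / a*exp (- (fst xi / a)\<^sup>2 / 2)) else 0)"
proof -
 have td: "time_dominated (%z. ch xi z * of_real (exp (- (a*fst z)\<^sup>2 / 2)))"
  by (rule time_dominated_mult_bounded[OF gaussian_time_dominated, of _ _ 1]) (use a in auto)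
 have e: "ch xi (t, x, y) * of_real (exp (- (a*t)\<^sup>2 / 2)) = cis (of_int (snd (snd xi))*y)*cis (of_int (fst (snd xi))*x)*(cis (t*fst xi) * of_real (exp (- (a*t)\<^sup>2 / 2)))" for t x y
  by (simp add: ch_def cis_mult mult_ac add_ac)
 have "(BS z. ch xi z * of_real (exp (- (a*fst z)\<^sup>2 / 2)))
   = (BT t. (\<integral>x. (\<integral>y. cis (of_int (snd (snd xi))*y)*cis (of_int (fst (snd xi))*x)*(cis (t*fst xi) * of_real (exp (- (a*t)\<^sup>2 / 2))) \<partial>tm) \<partial>tm))"
  unfolding integral_sl_iterated(1)[OF td] fst_conv e ..
 also have "... = (if snd (snd xi) = 0 then of_real (2*pi) else 0)*(if fst (snd xi) = 0 then of_real (2*pi) else 0) * of_real (sqrt (2*pi) / a*exp (- (fst xi / a)\<^sup>2 / 2))"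
  unfolding integral_mult_left_zero integral_mult_right_zero integral_tm_cis gaussian_fourier(2)[OF a] ..
 finally show ?thesis by (auto simp: prod_eq_iff power2_eq_square)
qed

lemma nn_integral_gaussian_kernel:
 assumes a: "0 < a"
 shows "(NF xi. ennreal (if snd xi = 0 then (2*pi)\<^sup>2*(sqrt (2*pi) / a*exp (- (fst xi / a)\<^sup>2 / 2)) else 0)) = ennreal ((2*pi) ^ 3)"
proof -
 have g: "(NT ta. ennreal (exp (- (ta / a)\<^sup>2 / 2))) = ennreal (a * sqrt (2*pi))"
 proof -
  have "(NT ta. ennreal (exp (- (ta / a)\<^sup>2 / 2))) = \<bar>a\<bar>*(NT s. ennreal (exp (- ((0 + a * s) / a)\<^sup>2 / 2)))"
   using a by (intro nn_integral_real_affine) auto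
  also have "(NT s. ennreal (exp (- ((0 + a * s) / a)\<^sup>2 / 2))) = (NT s. ennreal (exp (- s\<^sup>2 / 2)))"
   using a by simp
  also have "... = ennreal (sqrt (2*pi))"
   using nn_integral_eq_integral[OF gaussian_integral(1)] unfolding gaussian_integral(2) by simp
  finally show ?thesis using a by (simp add: ennreal_mult)
 qed
 have "(NF xi. ennreal (if snd xi = 0 then (2*pi)\<^sup>2*(sqrt (2*pi) / a*exp (- (fst xi / a)\<^sup>2 / 2)) else 0))
  = (\<integral>\<^sup>+n. (NT ta. ennreal ((2*pi)^2*(sqrt (2*pi) / a))*ennreal (exp (- (ta / a)\<^sup>2 / 2)))*indicator {0 :: int \<times> int} n \<partial>count_space UNIV)"
 proof (subst nn_integral_fm)
  have [measurable]: "Measurable.pred fm (%xi. snd xi = 0)" by (simp add: meas_fm_iff)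
  show "(%xi. ennreal (if snd xi = 0 then (2*pi)\<^sup>2*(sqrt (2*pi) / a*exp (- (fst xi / a)\<^sup>2 / 2)) else 0)) : BM fm"
   by (simp add: meas_fm_iff)
  show "(\<integral>\<^sup>+n. (NT ta. ennreal (if snd (ta, n) = (0 :: int \<times> int) then (2*pi)\<^sup>2*(sqrt (2*pi) / a*exp (- (fst (ta, n) / a)\<^sup>2 / 2)) else 0)) \<partial>count_space UNIV)
   = (\<integral>\<^sup>+n. (NT ta. ennreal ((2*pi)^2*(sqrt (2*pi) / a))*ennreal (exp (- (ta / a)\<^sup>2 / 2)))*indicator {0 :: int \<times> int} n \<partial>count_space UNIV)"
  proof (rule nn_integral_cong)
   fix n :: "int \<times> int"
   show "(NT ta. ennreal (if snd (ta, n) = (0 :: int \<times> int) then (2*pi)\<^sup>2*(sqrt (2*pi) / a*exp (- (fst (ta, n) / a)\<^sup>2 / 2)) else 0))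
    = (NT ta. ennreal ((2*pi)^2*(sqrt (2*pi) / a))*ennreal (exp (- (ta / a)\<^sup>2 / 2)))*indicator {0 :: int \<times> int} n"
   proof (cases "n = 0")
    case True
    have "(2*pi)^2*(sqrt (2*pi) / a*exp (- (ta / a)\<^sup>2 / 2)) = (2*pi)^2*(sqrt (2*pi) / a)*exp (- (ta / a)\<^sup>2 / 2)" for ta by simp
    then have "ennreal ((2*pi)^2*(sqrt (2*pi) / a*exp (- (ta / a)\<^sup>2 / 2))) = ennreal ((2*pi)^2*(sqrt (2*pi) / a))*ennreal (exp (- (ta / a)\<^sup>2 / 2))" for ta
     using a by (simp only: ennreal_mult[symmetric, of "(2*pi)^2*(sqrt (2*pi) / a)"] exp_ge_zero) (rule ennreal_mult, auto)
    then show ?thesis unfolding True by (simp only: snd_conv fst_conv if_True refl indicator_simps singletonI mult_1_right)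
   qed simp
  qed
 qed
 also have "... = (NT ta. ennreal ((2*pi)^2*(sqrt (2*pi) / a))*ennreal (exp (- (ta / a)\<^sup>2 / 2)))"
  by (subst nn_integral_indicator_singleton) auto
 also have "... = ennreal ((2*pi)^2*(sqrt (2*pi) / a))*ennreal (a * sqrt (2*pi))"
  by (subst nn_integral_cmult, measurable) (simp only: g)
 also have "... = ennreal ((2*pi)^2*(sqrt (2*pi) / a)*(a * sqrt (2*pi)))"
  by (rule ennreal_mult[symmetric]) (use a in auto)
 also have "(2*pi)^2*(sqrt (2*pi) / a)*(a * sqrt (2*pi)) = (2*pi)^2*(sqrt (2*pi) * sqrt (2*pi))" using a by simp
 also have "... = (2*pi) ^ 3" by (simp add: power2_eq_square power3_eq_cube)
 finally show ?thesis .
qed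

text \<open>With a Gaussian in time the double integral over frequencies can be computed: the torus forces equal spatial
frequencies and the line gives a Gaussian kernel of mass independent of \<open>a\<close>, to which Schur's test applies.\<close>

lemma plancherel_weighted:
 assumes F: "integrable fm F" and a: "0 < a"
 shows "(NS z. ennreal ((cmod (BF xi. F xi*ch xi z))^2*exp (- (a*fst z)\<^sup>2 / 2)))
  <= ennreal ((2*pi) ^ 3)*(NF xi. ennreal ((cmod (F xi))^2))"
proof -
 note [measurable] = borel_measurable_integrable[OF F]
 define f where "f z = (BF xi. F xi*ch xi z)" for z
 define w where "w z = exp (- (a*fst z)\<^sup>2 / 2)" for z :: spacetime
 define K where "K xi = (if snd xi = 0 then (2*pi)\<^sup>2*(sqrt (2*pi) / a*exp (- (fst xi / a)\<^sup>2 / 2)) else 0)" for xi :: frequency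
 define G where "G p = F (fst p)*cnj (F (snd p))" for p
 have K0: "0 <= K xi" "K (- xi) = K xi" for xi using a by (auto simp: K_def prod_eq_iff)
 have Km[measurable]: "K : BM fm" by (simp add: K_def meas_fm_iff)
 have w: "integrable sl (%z. complex_of_real (w z))"
  unfolding w_def using a by (intro time_dominated_integrable(1)[OF gaussian_time_dominated]) auto
 have wm[measurable]: "w : BM borel" unfolding w_def by measurable
 have fbd: "cmod (f z) <= (BF xi. cmod (F xi))" for z
  unfolding f_def by (rule order_trans[OF integral_norm_bound]) (simp add: norm_mult)
 have fmeas[measurable]: "f : BM borel"
 proof -
  have "(%z. (BF xi. F xi*ch xi z)) : BM sl"
   by (intro fms.borel_measurable_lebesgue_integral) measurable
  then show ?thesis by (simp add: f_def[abs_def])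
 qed
 have [measurable]: "G : BM (fm \<Otimes>\<^sub>M fm)" unfolding G_def by measurable
 have Gi: "integrable (fm \<Otimes>\<^sub>M fm) G"
  by (rule fm2.integrable_dominated_product[OF F F]) (auto simp: G_def norm_mult)
 interpret P: pair_sigma_finite sl "fm \<Otimes>\<^sub>M fm"
  by (intro pair_sigma_finite.intro sls.sigma_finite_measure_axioms sigma_finite_pair_measure fms.sigma_finite_measure_axioms)
 have ff: "f z*cnj (f z) = (\<integral>p. G p*ch (fst p - snd p) z \<partial>(fm \<Otimes>\<^sub>M fm))" for z
 proof -
  have i: "integrable (fm \<Otimes>\<^sub>M fm) (%p. G p*ch (fst p - snd p) z)"
   by (rule Bochner_Integration.integrable_bound[OF Gi]) (auto simp: norm_mult)
  have "(\<integral>p. G p*ch (fst p - snd p) z \<partial>(fm \<Otimes>\<^sub>M fm)) = (BF xi. (BF ze. G (xi, ze)*ch (xi - ze) z))"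
   using fm2.integral_fst'[OF i] by simp
  also have "... = (BF xi. (BF ze. (F xi*ch xi z)*cnj (F ze*ch ze z)))"
   by (simp add: G_def ch_diff[of _ _ z] ch_uminus mult_ac)
  also have "... = f z*cnj (f z)"
   unfolding integral_mult_right_zero integral_mult_left_zero f_def Bochner_Integration.integral_cnj ..
  finally show ?thesis by simp
 qed
 have int: "integrable (sl \<Otimes>\<^sub>M (fm \<Otimes>\<^sub>M fm)) (%(z, p). of_real (w z)*(G p*ch (fst p - snd p) z))"
  by (rule P.integrable_dominated_product[OF w Gi]) (auto simp: norm_mult)
 have sq: "integrable sl (%z. (cmod (f z))^2*w z)"
 proof (rule Bochner_Integration.integrable_bound[OF integrable_mult_right[OF w, of "of_real ((BF xi. cmod (F xi))^2)"]])
  show "AE z in sl. norm ((cmod (f z))^2*w z) <= norm (complex_of_real ((BF xi. cmod (F xi))^2)*complex_of_real (w z))"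
   using fbd by (intro AE_I2) (auto simp: norm_mult w_def norm_power intro!: mult_right_mono power_mono)
 qed measurable
 have "complex_of_real (BS z. (cmod (f z))^2*w z) = (BS z. of_real (w z)*(f z*cnj (f z)))"
  by (subst integral_complex_of_real[symmetric]) (simp only: of_real_mult complex_norm_square mult.commute)
 also have "... = (BS z. \<integral>p. of_real (w z)*(G p*ch (fst p - snd p) z) \<partial>(fm \<Otimes>\<^sub>M fm))"
  unfolding ff by simp
 also have "... = (\<integral>p. (BS z. of_real (w z)*(G p*ch (fst p - snd p) z)) \<partial>(fm \<Otimes>\<^sub>M fm))"
  using P.Fubini_integral[OF int] by simp
 also have "... = (\<integral>p. G p * of_real (K (fst p - snd p)) \<partial>(fm \<Otimes>\<^sub>M fm))"
 proof (rule Bochner_Integration.integral_cong[OF refl])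
  fix p
  have "(BS z. of_real (w z)*(G p*ch (fst p - snd p) z)) = (BS z. G p*(ch (fst p - snd p) z * of_real (w z)))"
   by (simp add: mult_ac)
  also have "... = G p * of_real (K (fst p - snd p))"
   unfolding integral_mult_right_zero w_def integral_gaussian_ch[OF a] K_def ..
  finally show "(BS z. of_real (w z)*(G p*ch (fst p - snd p) z)) = G p * of_real (K (fst p - snd p))" .
 qed
 finally have eq: "complex_of_real (BS z. (cmod (f z))^2*w z) = (\<integral>p. G p * of_real (K (fst p - snd p)) \<partial>(fm \<Otimes>\<^sub>M fm))" .
 have nn: "0 <= (BS z. (cmod (f z))^2*w z)" by (rule Bochner_Integration.integral_nonneg) (simp add: w_def)
 let ?I = "(NF xi. ennreal ((cmod (F xi))^2))"
 have "(NS z. ennreal ((cmod (f z))^2*w z)) = ennreal (BS z. (cmod (f z))^2*w z)"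
  by (rule nn_integral_eq_integral[OF sq]) (simp add: w_def)
 also have "... = ennreal (cmod (\<integral>p. G p * of_real (K (fst p - snd p)) \<partial>(fm \<Otimes>\<^sub>M fm)))"
  unfolding eq[symmetric] using nn by simp
 also have "... <= (\<integral>\<^sup>+p. ennreal (cmod (G p * of_real (K (fst p - snd p)))) \<partial>(fm \<Otimes>\<^sub>M fm))"
 proof (rule integral_norm_bound_ennreal)
  define M where "M = (2*pi)^2*(sqrt (2*pi) / a)"
  have KM: "K xi <= M" for xi
  proof -
   have "M*exp (- (fst xi / a)\<^sup>2 / 2) <= M*1" unfolding M_def using a by (intro mult_left_mono) auto
   then show ?thesis using a by (auto simp: K_def M_def mult.assoc)
  qed
  show "integrable (fm \<Otimes>\<^sub>M fm) (%p. G p * of_real (K (fst p - snd p)))"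
  proof (rule Bochner_Integration.integrable_bound[OF integrable_mult_left[OF Gi, of "of_real M"]])
   show "AE p in fm \<Otimes>\<^sub>M fm. cmod (G p * of_real (K (fst p - snd p))) <= cmod (G p * of_real M)"
    using KM K0(1) by (intro AE_I2) (auto simp: norm_mult intro!: mult_left_mono order_trans[OF KM])
  qed measurable
 qed
 also have "... = (NF xi. (NF ze. ennreal (cmod (F xi)*cmod (F ze)*K (xi - ze))))"
  using K0(1) by (subst fms.nn_integral_fst[symmetric]) (auto simp: G_def norm_mult)
 also have "... <= (NF xi. (NF ze. ennreal ((cmod (F xi))^2 / 2)*ennreal (K (xi - ze)) + ennreal ((cmod (F ze))^2 / 2)*ennreal (K (ze - xi))))"
 proof (intro nn_integral_mono)
  fix xi ze
  have "cmod (F xi)*cmod (F ze) <= (cmod (F xi))^2 / 2 + (cmod (F ze))^2 / 2"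
   using zero_le_power2[of "cmod (F xi) - cmod (F ze)"] by (simp add: power2_eq_square algebra_simps)
  from mult_right_mono[OF this K0(1)[of "xi - ze"]]
  have "cmod (F xi)*cmod (F ze)*K (xi - ze) <= (cmod (F xi))^2 / 2*K (xi - ze) + (cmod (F ze))^2 / 2*K (ze - xi)"
   using K0(2)[of "xi - ze"] by (simp add: algebra_simps)
  then show "ennreal (cmod (F xi)*cmod (F ze)*K (xi - ze)) <= ennreal ((cmod (F xi))^2 / 2)*ennreal (K (xi - ze)) + ennreal ((cmod (F ze))^2 / 2)*ennreal (K (ze - xi))"
   using K0(1) by (simp add: ennreal_leI flip: ennreal_mult ennreal_plus)
 qed
 also have "... = (NF xi. (NF ze. ennreal ((cmod (F xi))^2 / 2)*ennreal (K (xi - ze)))) + (NF xi. (NF ze. ennreal ((cmod (F ze))^2 / 2)*ennreal (K (ze - xi))))"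
  by (simp add: nn_integral_add)
 also have "(NF xi. (NF ze. ennreal ((cmod (F ze))^2 / 2)*ennreal (K (ze - xi)))) = (NF ze. (NF xi. ennreal ((cmod (F ze))^2 / 2)*ennreal (K (ze - xi))))"
  by (rule fm2.Fubini'[of "%ze xi. ennreal ((cmod (F ze))^2 / 2)*ennreal (K (ze - xi))"]) measurable
 also have "(NF xi. (NF ze. ennreal ((cmod (F xi))^2 / 2)*ennreal (K (xi - ze)))) = (NF xi. ennreal ((cmod (F xi))^2 / 2)*ennreal ((2*pi) ^ 3))"
 proof (rule nn_integral_cong)
  fix xi
  have "(NF ze. ennreal (K (xi - ze))) = ennreal ((2*pi) ^ 3)"
   using nn_integral_fm_reflect[of "%ze. ennreal (K ze)" xi] nn_integral_gaussian_kernel[OF a] by (simp add: K_def[abs_def] Km[unfolded K_def[abs_def]])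
  then show "(NF ze. ennreal ((cmod (F xi))^2 / 2)*ennreal (K (xi - ze))) = ennreal ((cmod (F xi))^2 / 2)*ennreal ((2*pi) ^ 3)"
   by (subst nn_integral_cmult) auto
 qed
 also have "(NF xi. ennreal ((cmod (F xi))^2 / 2)*ennreal ((2*pi) ^ 3)) + (NF xi. ennreal ((cmod (F xi))^2 / 2)*ennreal ((2*pi) ^ 3)) = (NF xi. ennreal ((2*pi) ^ 3)*ennreal ((cmod (F xi))^2))"
  by (subst nn_integral_add[symmetric], measurable, rule nn_integral_cong)
    (simp flip: ennreal_mult ennreal_plus add: algebra_simps)
 also have "... = ennreal ((2*pi) ^ 3)*?I" by (rule nn_integral_cmult) measurable
 finally show ?thesis unfolding f_def w_def .
qed

theorem plancherel_le:
 assumes F: "integrable fm F"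
 shows "(NS z. ennreal ((cmod (inv_ft F z))^2)) <= ennreal c3*(NF xi. ennreal ((cmod (F xi))^2))"
proof -
 note [measurable] = borel_measurable_integrable[OF F]
 let ?I = "(NF xi. ennreal ((cmod (F xi))^2))"
 define f where "f z = (BF xi. F xi*ch xi z)" for z
 have fi: "inv_ft F z = of_real c3*f z" for z by (simp add: inv_ft_def f_def)
 have fm': "f : BM borel"
 proof -
  have "(%z. (BF xi. F xi*ch xi z)) : BM sl"
   by (intro fms.borel_measurable_lebesgue_integral) measurable
  then show ?thesis by (simp add: f_def[abs_def])
 qed
 note [measurable] = fm'
 have lim: "(%n. ennreal ((cmod (f z))^2*exp (- (1 / real (Suc n)*fst z)\<^sup>2 / 2))) \<longlonglongrightarrow> ennreal ((cmod (f z))^2)" for z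
 proof -
  have "(%n. (cmod (f z))^2*exp (- (1 / real (Suc n)*fst z)\<^sup>2 / 2)) \<longlonglongrightarrow> (cmod (f z))\<^sup>2*exp (- (0*fst z)\<^sup>2 / 2)"
   using LIMSEQ_inverse_real_of_nat unfolding inverse_eq_divide by (intro tendsto_intros) auto
  then show ?thesis by (intro tendsto_ennrealI) simp
 qed
 have "(NS z. ennreal ((cmod (f z))^2)) = (NS z. liminf (%n. ennreal ((cmod (f z))^2*exp (- (1 / real (Suc n)*fst z)\<^sup>2 / 2))))"
  by (simp only: lim_imp_Liminf[OF sequentially_bot lim])
 also have "... <= liminf (%n. (NS z. ennreal ((cmod (f z))^2*exp (- (1 / real (Suc n)*fst z)\<^sup>2 / 2))))"
  by (rule nn_integral_liminf) measurable
 also have "... <= ennreal ((2*pi) ^ 3)*?I"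
  unfolding f_def by (intro Liminf_le always_eventually allI plancherel_weighted[OF F]) auto
 finally have *: "(NS z. ennreal ((cmod (f z))^2)) <= ennreal ((2*pi) ^ 3)*?I" .
 have "(NS z. ennreal ((cmod (inv_ft F z))^2)) = (NS z. ennreal (c3^2)*ennreal ((cmod (f z))^2))"
  using c3_pos by (intro nn_integral_cong) (simp add: fi norm_mult power_mult_distrib ennreal_mult)
 also have "... = ennreal (c3^2)*(NS z. ennreal ((cmod (f z))^2))" by (rule nn_integral_cmult) measurable
 also have "... <= ennreal (c3^2)*(ennreal ((2*pi) ^ 3)*?I)" by (intro mult_left_mono *) auto
 also have "... = ennreal c3*?I"
 proof -
  have "c3*(2*pi) ^ 3 = 1" by (simp add: c3_def)
  then have "c3^2*(2*pi) ^ 3 = c3" by (simp add: power2_eq_square mult.assoc)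
  then show ?thesis by (simp flip: mult.assoc ennreal_mult add: c3_pos)
 qed
 finally show ?thesis .
qed

text \<open>The inverse transform turns convolutions into products.\<close>

lemma inv_ft_mult:
 assumes F: "integrable fm F" and G: "integrable fm G"
 shows "integrable fm (%ze. (BF xi. F xi*G (ze - xi)))"
  and "inv_ft F z*inv_ft G z = of_real c3*inv_ft (%ze. (BF xi. F xi*G (ze - xi))) z"
proof -
 note [measurable] = borel_measurable_integrable[OF F] borel_measurable_integrable[OF G]
 have i: "integrable (fm \<Otimes>\<^sub>M fm) (%(ze, xi). F xi*G (ze - xi))"
 proof (rule integrableI_bounded)
  have "(\<integral>\<^sup>+p. ennreal (cmod (case p of (ze, xi) => F xi*G (ze - xi))) \<partial>(fm \<Otimes>\<^sub>M fm)) = (NF xi. (NF ze. ennreal (cmod (F xi))*ennreal (cmod (G (ze - xi)))))"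
   by (subst fm2.nn_integral_snd[symmetric]) (auto simp: norm_mult ennreal_mult)
  also have "... = (NF xi. ennreal (cmod (F xi))*(NF ze. ennreal (cmod (G ze))))"
  proof (rule nn_integral_cong)
   fix xi
   have "(NF ze. ennreal (cmod (G (ze - xi)))) = (NF ze. ennreal (cmod (G ze)))"
    using nn_integral_fm_translate[of "%ze. ennreal (cmod (G ze))" "- xi"] by simp
   then show "(NF ze. ennreal (cmod (F xi))*ennreal (cmod (G (ze - xi)))) = ennreal (cmod (F xi))*(NF ze. ennreal (cmod (G ze)))"
    by (subst nn_integral_cmult) auto
  qed
  also have "... < \<infinity>" using F G by (simp add: nn_integral_multc integrable_iff_bounded ennreal_mult_less_top)
  finally show "(\<integral>\<^sup>+p. ennreal (cmod (case p of (ze, xi) => F xi*G (ze - xi))) \<partial>(fm \<Otimes>\<^sub>M fm)) < \<infinity>" .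
 qed measurable
 show "integrable fm (%ze. (BF xi. F xi*G (ze - xi)))" using fm2.integrable_fst'[OF i] by simp
 have i': "integrable (fm \<Otimes>\<^sub>M fm) (%(ze, xi). F xi*G (ze - xi)*ch ze z)"
  by (rule Bochner_Integration.integrable_bound[OF i]) (auto simp: norm_mult)
 have "(BF ze. (BF xi. F xi*G (ze - xi))*ch ze z) = (BF ze. (BF xi. F xi*G (ze - xi)*ch ze z))" by simp
 also have "... = (BF xi. (BF ze. F xi*G (ze - xi)*ch ze z))" using fm2.Fubini_integral[OF i'] by simp
 also have "... = (BF xi. (F xi*ch xi z)*(BF ze. G ze*ch ze z))"
 proof (rule Bochner_Integration.integral_cong[OF refl])
  fix xi
  have e: "distr fm fm (%ze. ze - xi) = fm"
  proof (rule measure_eqI)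
   fix A assume "A : sets (distr fm fm (%ze. ze - xi))"
   then have [measurable]: "A : sets fm" by simp
   have "emeasure (distr fm fm (%ze. ze - xi)) A = (\<integral>\<^sup>+ze. indicator A ze \<partial>distr fm fm (%ze. ze - xi))" by simp
   also have "... = (NF ze. indicator A (ze - xi))" by (rule nn_integral_distr) measurable
   also have "... = emeasure fm A" using nn_integral_fm_translate[of "indicator A" "- xi"] by simp
   finally show "emeasure (distr fm fm (%ze. ze - xi)) A = emeasure fm A" .
  qed simp
  have "F xi*G (ze - xi)*ch ze z = (F xi*ch xi z)*(G (ze - xi)*ch (ze - xi) z)" for ze
   using ch_add[of "ze - xi" xi z] by simp
  then have "(BF ze. F xi*G (ze - xi)*ch ze z) = (F xi*ch xi z)*(BF ze. G (ze - xi)*ch (ze - xi) z)"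
   by (simp only: integral_mult_right_zero)
  also have "(BF ze. G (ze - xi)*ch (ze - xi) z) = (\<integral>ze. G ze*ch ze z \<partial>distr fm fm (%ze. ze - xi))"
   by (rule integral_distr[symmetric]) measurable
  finally show "(BF ze. F xi*G (ze - xi)*ch ze z) = (F xi*ch xi z)*(BF ze. G ze*ch ze z)" unfolding e .
 qed
 also have "... = (BF xi. F xi*ch xi z)*(BF ze. G ze*ch ze z)" by simp
 finally show "inv_ft F z*inv_ft G z = of_real c3*inv_ft (%ze. (BF xi. F xi*G (ze - xi))) z"
  by (simp add: inv_ft_def mult_ac)
qed

text \<open>The fourth power of \<open>f\<close> is the square of \<open>f\<^sup>2\<close>, the inverse transform of a convolution.\<close>

lemma l4_le:
 assumes F: "integrable fm F"
 shows "(NS z. ennreal ((cmod (inv_ft F z)) ^ 4))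
  <= ennreal (c3 ^ 3)*(NF ze. (NF xi. ennreal (cmod (F xi))*ennreal (cmod (F (ze - xi))))^2)"
proof -
 note [measurable] = borel_measurable_integrable[OF F]
 define H where "H ze = (BF xi. F xi*F (ze - xi))" for ze
 have H: "integrable fm H" unfolding H_def[abs_def] by (rule inv_ft_mult(1)[OF F F])
 note [measurable] = borel_measurable_integrable[OF H]
 have HH: "ennreal ((cmod (H ze))^2) <= (NF xi. ennreal (cmod (F xi))*ennreal (cmod (F (ze - xi))))^2" for ze
 proof -
  have "ennreal (cmod (H ze)) <= (NF xi. ennreal (cmod (F xi*F (ze - xi))))"
  proof (cases "integrable fm (%xi. F xi*F (ze - xi))")
   case True then show ?thesis unfolding H_def by (rule integral_norm_bound_ennreal)
  qed (simp add: H_def not_integrable_integral_eq)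
  then have "(ennreal (cmod (H ze)))^2 <= (NF xi. ennreal (cmod (F xi*F (ze - xi))))^2" by (rule power_mono) simp
  then show ?thesis by (simp add: norm_mult ennreal_mult ennreal_power)
 qed
 have "(cmod (inv_ft F z)) ^ 4 = c3^2*(cmod (inv_ft H z))^2" for z
 proof -
  have "(cmod (inv_ft F z)) ^ 4 = (cmod (inv_ft F z*inv_ft F z))^2" by (simp add: norm_mult power2_eq_square power4_eq_xxxx)
  also have "... = c3^2*(cmod (inv_ft H z))^2" unfolding inv_ft_mult(2)[OF F F] H_def[abs_def] by (simp add: norm_mult power_mult_distrib)
  finally show ?thesis .
 qed
 then have "(NS z. ennreal ((cmod (inv_ft F z)) ^ 4)) = (NS z. ennreal (c3^2)*ennreal ((cmod (inv_ft H z))^2))"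
  by (simp add: ennreal_mult)
 also have "... = ennreal (c3^2)*(NS z. ennreal ((cmod (inv_ft H z))^2))" by (rule nn_integral_cmult) measurable
 also have "... <= ennreal (c3^2)*(ennreal c3*(NF ze. (NF xi. ennreal (cmod (F xi))*ennreal (cmod (F (ze - xi))))^2))"
  by (intro mult_left_mono order_trans[OF plancherel_le[OF H]] nn_integral_mono HH) auto
 also have "... = ennreal (c3 ^ 3)*(NF ze. (NF xi. ennreal (cmod (F xi))*ennreal (cmod (F (ze - xi))))^2)"
  using c3_pos by (simp flip: mult.assoc ennreal_mult add: power2_eq_square power3_eq_cube)
 finally show ?thesis .
qed

section \<open>Time cutoffs\<close>

definition bump :: "real => real" where "bump = flatf 1"

lemma bump_eq: "bump x = (if 0 < x then exp (- 1 / x) else 0)" by (simp add: bump_def flatf_def)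
lemma bump_range: "0 <= bump x" "bump x <= 1" by (auto simp: bump_eq)
lemma bump_pos: "0 < x ==> 0 < bump x" by (simp add: bump_eq)
lemma bump_zero: "x <= 0 ==> bump x = 0" by (simp add: bump_eq)

text \<open>Composing a bump with \<open>k q\<close> for large \<open>k\<close> produces the indicator of \<open>q > 0\<close>.\<close>

lemma bump_limit:
 assumes q: "q \<longlonglongrightarrow> l" and pos: "0 < l"
 shows "(%k. bump (real k*q k)) \<longlonglongrightarrow> 1"
proof -
 have lim: "filterlim (%k. q k*real k) at_top sequentially"
  by (rule filterlim_tendsto_pos_mult_at_top[OF q pos filterlim_real_sequentially])
 have "(%k. exp (- inverse (q k*real k))) \<longlonglongrightarrow> exp (- 0)"
  using filterlim_compose[OF tendsto_inverse_0_at_top lim[unfolded]] lim by (intro tendsto_intros tendsto_inverse_0_at_top)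
 moreover have "\<forall>\<^sub>F k in sequentially. exp (- inverse (q k*real k)) = bump (real k*q k)"
  using lim[unfolded filterlim_at_top_dense, rule_format, of 0]
  by eventually_elim (simp add: bump_eq mult.commute inverse_eq_divide)
 ultimately show ?thesis by (simp add: Lim_transform_eventually)
qed

text \<open>Quotients of bumps make a smooth function that equals one on \<open>[0, 1]\<close> and vanishes outside \<open>[-1, 2]\<close>.\<close>

definition plateau :: "real => real" where
 "plateau x = bump (2 - x)*inverse (bump (2 - x) + bump (x - 1))*(bump (1 + x)*inverse (bump (1 + x) + bump (- x)))"

lemma bump_sum_pos: "0 < bump (2 - x) + bump (x - 1)" "0 < bump (1 + x) + bump (- x)"
proof -
 show "0 < bump (2 - x) + bump (x - 1)"
  using bump_pos[of "2 - x"] bump_pos[of "x - 1"] bump_range(1)[of "2 - x"] bump_range(1)[of "x - 1"]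
  by (cases "x < 2") (auto intro: add_pos_nonneg add_nonneg_pos)
 show "0 < bump (1 + x) + bump (- x)"
  using bump_pos[of "1 + x"] bump_pos[of "- x"] bump_range(1)[of "1 + x"] bump_range(1)[of "- x"]
  by (cases "x < 0") (auto intro: add_pos_nonneg add_nonneg_pos)
qed

lemma plateau_one: "0 <= x ==> x <= 1 ==> plateau x = 1"
 using bump_sum_pos[of x] by (simp add: plateau_def bump_zero)
lemma plateau_zero: "x \<notin> {-1..2} ==> plateau x = 0"
 by (auto simp: plateau_def bump_zero)
lemma plateau_range: "0 <= plateau x" "plateau x <= 1"
proof -
 have q: "0 <= a*inverse (a + b)" "a*inverse (a + b) <= 1" if "0 <= a" "0 <= b" for a b :: real
  using that by (cases "a + b = 0"; simp add: divide_simps flip: divide_inverse)+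
 show "0 <= plateau x" unfolding plateau_def by (intro mult_nonneg_nonneg q bump_range)
 show "plateau x <= 1" unfolding plateau_def by (intro mult_le_one mult_nonneg_nonneg q bump_range)
qed

definition cut :: "real => spacetime => complex" where "cut T z = of_real (plateau (fst z / T))"

lemma smf_bump_time: "(%z. of_real (bump (fst z*c + d))) : smf"
 using smf.flat_t[of 1 "(c, 0, 0)" d] by (simp add: bump_def inner_prod_def)

lemma cut_schwartz:
 assumes "0 < T" shows "cut T : schwartz"
proof (rule schwartz_compact_timeI[OF smf_deriv_closed, of _ "- T" "2*T"])
 have "(%z. of_real (bump (fst z*(- (1 / T)) + 2))*inverse (of_real (bump (fst z*(- (1 / T)) + 2)) + of_real (bump (fst z*(1 / T) + (- 1)))) *
   (of_real (bump (fst z*(1 / T) + 1))*inverse (of_real (bump (fst z*(1 / T) + 1)) + of_real (bump (fst z*(- (1 / T)) + 0))))) : smf"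
 proof (intro smf.mult smf.inv smf.add smf_bump_time)
  show "complex_of_real (bump (fst z*(- (1 / T)) + 2)) + of_real (bump (fst z*(1 / T) + (- 1))) ~= 0" for z :: spacetime
   using bump_sum_pos(1)[of "fst z / T"] unfolding of_real_add[symmetric] of_real_eq_0_iff by (simp add: algebra_simps)
  show "complex_of_real (bump (fst z*(1 / T) + 1)) + of_real (bump (fst z*(- (1 / T)) + 0)) ~= 0" for z :: spacetime
   using bump_sum_pos(2)[of "fst z / T"] unfolding of_real_add[symmetric] of_real_eq_0_iff by (simp add: algebra_simps)
 qed
 then show "cut T : smf" by (simp add: cut_def[abs_def] plateau_def algebra_simps)
 show "periodic_space (cut T)" by (simp add: periodic_space_def cut_def)
 show "cut T (t, x, y) = 0" if "t \<notin> {- T..2*T}" for t x y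
 proof -
  have "t / T \<notin> {-1..2}" using that assms by (auto simp: field_simps)
  then show ?thesis by (simp add: cut_def plateau_zero)
 qed
qed

lemma cut_one: "0 < T ==> 0 <= fst z ==> fst z <= T ==> cut T z = 1"
 by (simp add: cut_def plateau_one)
lemma norm_cut_le: "cmod (cut T z) <= 1" using plateau_range[of "fst z / T"] by (simp add: cut_def)

definition plateau_ft :: "real => complex" where
 "plateau_ft ta = (BT t. cis (- (ta*t)) * of_real (plateau t))"

lemma ft_cut:
 assumes T: "0 < T"
 shows "ft (cut T) (ta, n) = (if n = 0 then of_real ((2*pi)^2*T)*plateau_ft (T*ta) else 0)"
proof -
 have td: "time_dominated (%z. ch (- (ta, n)) z*cut T z)"
  by (rule time_dominated_mult_bounded[OF schwartz_time_dominated[OF cut_schwartz[OF T]], of _ 1]) auto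
 have e: "ch (- (ta, n)) (t, x, y)*cut T (t, x, y) = cis (of_int (- snd n)*y)*cis (of_int (- fst n)*x)*(cis (- (ta*t)) * of_real (plateau (t / T)))" for t x y
  by (simp add: ch_def cut_def cis_mult, intro disjI2 arg_cong[where f=cis], simp)
 have "ft (cut T) (ta, n) = (if - snd n = 0 then of_real (2*pi) else 0)*(if - fst n = 0 then of_real (2*pi) else 0)*(BT t. cis (- (ta*t)) * of_real (plateau (t / T)))"
  unfolding ft_sl[OF schwartz_measurable[OF cut_schwartz[OF T]]] integral_sl_iterated(1)[OF td] e
   integral_mult_left_zero integral_mult_right_zero integral_tm_cis ..
 also have "(BT t. cis (- (ta*t)) * of_real (plateau (t / T))) = of_real T*plateau_ft (T*ta)"
 proof -
  have "(BT t. cis (- (ta*t)) * of_real (plateau (t / T))) = \<bar>T\<bar> *\<^sub>R (BT t. cis (- (ta*(0 + T*t))) * of_real (plateau ((0 + T*t) / T)))"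
   using T by (intro lborel_integral_real_affine) simp
  then show ?thesis using T by (simp add: plateau_ft_def scaleR_conv_of_real mult_ac)
 qed
 finally show ?thesis by (auto simp: prod_eq_iff power2_eq_square)
qed

lemma plateau_ft_decay: "EX C>=0. ALL ta. cmod (plateau_ft ta) <= C / (1 + ta^2)"
proof -
 obtain C where C: "!!xi. cmod (ft (cut 1) xi) <= C*decay xi" using ft_schwartz_decay[OF cut_schwartz[of 1]] by auto
 have C0: "0 <= C" using order_trans[OF norm_ge_zero C[of "(0, 0, 0)"]] by (simp add: decay_def)
 have "cmod (plateau_ft ta) <= C / (1 + ta^2)" for ta
 proof -
  have "1 <= (2*pi)^2" using pi_gt3 by (intro one_le_power) auto
  then have "1*cmod (plateau_ft ta) <= (2*pi)^2*cmod (plateau_ft ta)" by (rule mult_right_mono) simp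
  also have "... = cmod (ft (cut 1) (ta, 0))" by (simp add: ft_cut norm_mult norm_power)
  also have "... <= C / (1 + ta^2)" using C[of "(ta, 0)"] by (simp add: decay_def)
  finally show ?thesis by simp
 qed
 then show ?thesis using C0 by blast
qed

text \<open>The cutoff does not depend on space, so its transform is concentrated on spatial frequency zero and the
convolution acts in time frequency only.\<close>

lemma norm_ft_cut_mult_le:
 "EX C>=0. ALL T G (ze :: frequency). 0 < T --> G : schwartz -->
   ennreal (cmod (ft (%z. cut T z*G z) ze)) <= ennreal C*(NT mu. ennreal (ckern T (fst ze - mu))*ennreal (cmod (ft G (mu, snd ze))))"
proof -
 obtain C where C0: "0 <= C" and C: "!!ta. cmod (plateau_ft ta) <= C / (1 + ta^2)" using plateau_ft_decay by blast
 show ?thesis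
 proof (intro exI[of _ "c3*((2*pi)^2*C)"] conjI allI impI)
  show "0 <= c3*((2*pi)^2*C)" using C0 c3_pos by simp
  fix T :: real and G and ze :: frequency assume T: "0 < T" and G: "G : schwartz"
  note cs = cut_schwartz[OF T]
  note [measurable] = ft_measurable[OF schwartz_integrable[OF G]] ft_measurable[OF schwartz_integrable[OF cs]]
  define K where "K = (2*pi)^2*C"
  have K: "0 <= K" using C0 by (simp add: K_def)
  have kle: "cmod (ft (cut T) (ta, 0)) <= K*ckern T ta" for ta
  proof -
   have "cmod (ft (cut T) (ta, 0)) = (2*pi)^2*T*cmod (plateau_ft (T*ta))" using T by (simp add: ft_cut[OF T] norm_mult norm_power)
   also have "... <= (2*pi)^2*T*(C / (1 + (T*ta)^2))" using T C by (intro mult_left_mono) auto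
   finally show ?thesis by (simp add: K_def ckern_def mult_ac)
  qed
  have k0: "0 <= ckern T ta" for ta using T by (simp add: ckern_def add_nonneg_nonneg)
  have [measurable]: "(%ta. ft G (ta, snd ze)) : BM borel" "(%ta. ft (cut T) (ta, 0)) : BM borel"
   using ft_measurable[OF schwartz_integrable[OF G]] ft_measurable[OF schwartz_integrable[OF cs]] unfolding meas_fm_iff by blast+
  have [measurable]: "ckern T : BM borel" unfolding ckern_def[abs_def] by measurable
  have "(NF xi. ennreal (cmod (ft (cut T) xi))*ennreal (cmod (ft G (ze - xi))))
   = (\<integral>\<^sup>+n. (NT ta. ennreal (cmod (ft (cut T) (ta, 0)))*ennreal (cmod (ft G (fst ze - ta, snd ze))))*indicator {0 :: int \<times> int} n \<partial>count_space UNIV)"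
  proof (subst nn_integral_fm, measurable, rule nn_integral_cong)
   fix n :: "int \<times> int"
   show "(NT ta. ennreal (cmod (ft (cut T) (ta, n)))*ennreal (cmod (ft G (ze - (ta, n)))))
    = (NT ta. ennreal (cmod (ft (cut T) (ta, 0)))*ennreal (cmod (ft G (fst ze - ta, snd ze))))*indicator {0 :: int \<times> int} n"
    by (cases "n = 0") (auto simp: ft_cut[OF T] minus_prod_def)
  qed
  also have "... = (NT ta. ennreal (cmod (ft (cut T) (ta, 0)))*ennreal (cmod (ft G (fst ze - ta, snd ze))))"
   by (subst nn_integral_indicator_singleton) auto
  also have "... <= (NT ta. ennreal K*(ennreal (ckern T ta)*ennreal (cmod (ft G (fst ze - ta, snd ze)))))"
   using kle k0 K by (intro nn_integral_mono) (simp add: ennreal_leI mult_right_mono mult.assoc[symmetric] flip: ennreal_mult)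
  also have "... = ennreal K*(NT ta. ennreal (ckern T ta)*ennreal (cmod (ft G (fst ze - ta, snd ze))))"
   by (rule nn_integral_cmult) measurable
  also have "(NT ta. ennreal (ckern T ta)*ennreal (cmod (ft G (fst ze - ta, snd ze)))) = (NT mu. ennreal (ckern T (fst ze - mu))*ennreal (cmod (ft G (mu, snd ze))))"
   using nn_integral_real_affine[of "%ta. ennreal (ckern T ta)*ennreal (cmod (ft G (fst ze - ta, snd ze)))" "-1" "fst ze"] by simp
  finally have le: "(NF xi. ennreal (cmod (ft (cut T) xi))*ennreal (cmod (ft G (ze - xi)))) <= ennreal K*(NT mu. ennreal (ckern T (fst ze - mu))*ennreal (cmod (ft G (mu, snd ze))))" .
  have "ennreal (cmod (ft (%z. cut T z*G z) ze)) <= ennreal c3*(ennreal K*(NT mu. ennreal (ckern T (fst ze - mu))*ennreal (cmod (ft G (mu, snd ze)))))"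
   by (rule order_trans[OF norm_ft_product_le[OF has_ft_dist_of[OF schwartz_integrable[OF cs]] cs G] mult_left_mono[OF le]]) simp
  then show "ennreal (cmod (ft (%z. cut T z*G z) ze)) <= ennreal (c3*((2*pi)^2*C))*(NT mu. ennreal (ckern T (fst ze - mu))*ennreal (cmod (ft G (mu, snd ze))))"
   unfolding K_def[symmetric] using K c3_pos by (simp add: ennreal_mult mult.assoc)
 qed
qed

section \<open>Test functions separate integrable functions\<close>

text \<open>Boxes are stable under intersection and generate the Borel sets, so the integrals over all Borel sets vanish.\<close>

lemma AE_zero_of_boxes:
 fixes h :: "'a::euclidean_space => complex"
 assumes s: "sets M = sets borel" and h: "integrable M h"
  and box: "!!a b. (\<integral>z. indicator (box a b) z *\<^sub>R h z \<partial>M) = 0"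
 shows "AE z in M. h z = 0"
proof -
 note [measurable_cong] = s
 note [measurable] = borel_measurable_integrable[OF h]
 have sp: "space M = UNIV" using sets_eq_imp_space_eq[OF s] by simp
 have si: "integrable M (%z. indicator A z *\<^sub>R h z)" if "A : sets borel" for A
  using h that s by (intro integrable_mult_indicator) auto
 have univ: "integral\<^sup>L M h = 0"
 proof (rule LIMSEQ_unique)
  show "(%n::nat. \<integral>z. indicator (box (- (real n *\<^sub>R One)) (real n *\<^sub>R One)) z *\<^sub>R h z \<partial>M) \<longlonglongrightarrow> integral\<^sup>L M h"
  proof (rule integral_dominated_convergence[where w="%z. cmod (h z)"])
   show "AE z in M. (%n. indicat_real (box (- (real n *\<^sub>R One)) (real n *\<^sub>R One)) z *\<^sub>R h z) \<longlonglongrightarrow> h z"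
   proof (rule AE_I2)
    fix z :: 'a
    obtain N :: nat where N: "z : box (- (real N *\<^sub>R One)) (real N *\<^sub>R One)"
     using UN_box_eq_UNIV[where 'a='a] by blast
    have "\<forall>\<^sub>F n in sequentially. h z = indicat_real (box (- (real n *\<^sub>R One)) (real n *\<^sub>R One)) z *\<^sub>R h z"
     using eventually_ge_at_top[of N]
    proof eventually_elim
     case (elim n)
     have "- (real n) < z \<bullet> i & z \<bullet> i < real n" if "i : Basis" for i
     proof -
      have "- (real N) < z \<bullet> i & z \<bullet> i < real N" using N that by (auto simp: mem_box)
      moreover have "real N <= real n" using elim by simp
      ultimately show ?thesis by linarith
     qed
     then have "z : box (- (real n *\<^sub>R One)) (real n *\<^sub>R One)" by (auto simp: mem_box)
     then show ?case by simp
    qed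
    then show "(%n. indicat_real (box (- (real n *\<^sub>R One)) (real n *\<^sub>R One)) z *\<^sub>R h z) \<longlonglongrightarrow> h z"
     by (rule Lim_transform_eventually[OF tendsto_const])
   qed
  qed (use h in \<open>auto simp: indicator_def\<close>)
  show "(%n::nat. \<integral>z. indicator (box (- (real n *\<^sub>R One)) (real n *\<^sub>R One)) z *\<^sub>R h z \<partial>M) \<longlonglongrightarrow> 0"
   unfolding box by simp
 qed
 have all: "(\<integral>z\<in>A. h z \<partial>M) = 0" if "A : sets borel" for A
 proof -
  let ?G = "range (%(a, b). box a b :: 'a set)"
  have bs: "sets borel = sigma_sets UNIV ?G" unfolding borel_eq_box by simp
  have "Int_stable ?G" by (auto simp: Int_stable_def box_Int_box)
  moreover have "?G \<subseteq> Pow UNIV" by simp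
  moreover have "A : sigma_sets UNIV ?G" using that bs by simp
  ultimately show ?thesis
  proof (induction rule: sigma_sets_induct_disjoint)
   case (basic A)
   then show ?case using box by (auto simp: set_lebesgue_integral_def)
  next
   case (compl A)
   then have [measurable]: "A : sets borel" by (simp add: bs)
   have "(\<integral>z\<in>UNIV - A. h z \<partial>M) = (\<integral>z. h z - indicator A z *\<^sub>R h z \<partial>M)"
    unfolding set_lebesgue_integral_def by (intro Bochner_Integration.integral_cong) (auto simp: indicator_def)
   also have "... = 0" using compl.IH univ si[of A] h by (simp add: set_lebesgue_integral_def)
   finally show ?case .
  next
   case (union A)
   have [measurable]: "A i : sets borel" for i using union.hyps(2) by (auto simp: bs)
   have "(\<integral>z\<in>(\<Union>i. A i). h z \<partial>M) = (\<Sum>i. \<integral>z\<in>A i. h z \<partial>M)"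
   proof (rule lebesgue_integral_countable_add)
    show "A i \<inter> A j = {}" if "i ~= j" for i j using union.hyps(1) that by (auto simp: disjoint_family_on_def)
    show "set_integrable M (\<Union>i. A i) h" unfolding set_integrable_def by (rule si) auto
   qed (simp add: s)
   then show ?case using union.IH by simp
  qed (simp add: set_lebesgue_integral_def)
 qed
 have "AE z in M. Re (h z) = 0"
 proof (rule density_unique_real)
  fix A assume "A : sets M"
  then have A: "A : sets borel" by (simp add: s)
  show "(\<integral>z\<in>A. Re (h z) \<partial>M) = (\<integral>z\<in>A. 0 \<partial>M)"
   using all[OF A] integral_Re[OF si[OF A]] by (simp add: set_lebesgue_integral_def)
 qed (use h in auto)
 moreover have "AE z in M. Im (h z) = 0"
 proof (rule density_unique_real)
  fix A assume "A : sets M"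
  then have A: "A : sets borel" by (simp add: s)
  show "(\<integral>z\<in>A. Im (h z) \<partial>M) = (\<integral>z\<in>A. 0 \<partial>M)"
   using all[OF A] integral_Im[OF si[OF A]] by (simp add: set_lebesgue_integral_def)
 qed (use h in auto)
 ultimately show ?thesis by eventually_elim (simp add: complex_eq_iff)
qed

lemma bump_limit_indicator:
 assumes q: "q \<longlonglongrightarrow> l" and P: "P ==> 0 < l" and nP: "!!k. ~ P ==> q k <= 0"
 shows "(%k. bump (real k*q k)) \<longlonglongrightarrow> of_bool P"
proof (cases P)
 case True
 then show ?thesis using bump_limit[OF q P] by simp
next
 case False
 then have "bump (real k*q k) = 0" for k using nP[of k] by (intro bump_zero) (simp add: mult_nonneg_nonpos)
 then show ?thesis using False by simp
qed

text \<open>An arc is a superlevel set of a cosine. In this form its indicator is a limit of smooth periodic bumps.\<close>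

lemma cos_arc:
 assumes "0 <= x1" "x1 < x2" "x2 <= 2*pi" "0 < x" "x < 2*pi"
 shows "0 < cos (x - (x1 + x2) / 2) - cos ((x2 - x1) / 2) \<longleftrightarrow> x1 < x & x < x2"
proof -
 define r tht where "r = (x2 - x1) / 2" and "tht = \<bar>x - (x1 + x2) / 2\<bar>"
 have r: "0 < r" "r <= pi" and tht: "0 <= tht" "tht <= 2*pi - r" and iff: "tht < r \<longleftrightarrow> x1 < x & x < x2"
  using assms by (auto simp: r_def tht_def abs_if field_simps)
 have "cos r < cos tht \<longleftrightarrow> tht < r"
 proof (cases "tht <= pi")
  case True then show ?thesis using r tht by (intro cos_mono_less_eq) auto
 next
  case False
  have "cos tht = cos (2*pi - tht)" by (simp add: cos_diff)
  also have "... <= cos r" using False r tht by (intro cos_monotone_0_pi_le) auto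
  finally show ?thesis using False r by auto
 qed
 moreover have "cos tht = cos (x - (x1 + x2) / 2)" unfolding tht_def by (rule cos_abs_real)
 ultimately show ?thesis using iff by (simp add: r_def)
qed

lemma smf_bump_arc:
 "(%z. of_real (bump (k*(cos (fst (snd z) - c) - d)))) : smf" "(%z. of_real (bump (k*(cos (snd (snd z) - c) - d)))) : smf"
proof -
 have s: "sin (x + (pi / 2 - c)) = cos (x - c)" for x
  using sin_add[of "x - c" "pi / 2"] by (simp add: algebra_simps)
 show "(%z. of_real (bump (k*(cos (fst (snd z) - c) - d)))) : smf"
  using smf.flat_s[of 1 k "(0, 1, 0)" "pi / 2 - c" "- (k*d)"] by (simp add: bump_def inner_prod_def s right_diff_distrib)
 show "(%z. of_real (bump (k*(cos (snd (snd z) - c) - d)))) : smf"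
  using smf.flat_s[of 1 k "(0, 0, 1)" "pi / 2 - c" "- (k*d)"] by (simp add: bump_def inner_prod_def s right_diff_distrib)
qed

lemma AE_sl_interior: "AE z in sl. 0 < fst (snd z) & fst (snd z) < 2*pi & 0 < snd (snd z) & snd (snd z) < 2*pi"
proof -
 have "AE z in lborel. z \<bullet> ((0, 1, 0) :: spacetime) ~= 0" "AE z in lborel. z \<bullet> ((0, 0, 1) :: spacetime) ~= 0"
  by (intro AE_lborel_inner_neq; simp add: Basis_prod_def)+
 then have "AE z in lborel. 0 < ennreal (indicator (slab UNIV) z) --> 0 < fst (snd z) & fst (snd z) < 2*pi & 0 < snd (snd z) & snd (snd z) < 2*pi"
  by eventually_elim (auto simp: slab_def indicator_def inner_prod_def)
 then show ?thesis unfolding sl_density by (subst AE_density) auto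
qed

text \<open>Products of bumps in \<open>t\<close> and of bumps in cosines of \<open>x\<close> and \<open>y\<close> converge boundedly to indicators of boxes.\<close>

theorem test_functions_separate:
 assumes T: "0 < T" and h: "integrable sl h" and hz: "!!z. fst z \<notin> {0<..<T} ==> h z = 0"
  and test: "!!ps. ps : test_functions T ==> (BS z. h z*ps z) = 0"
 shows "AE z in sl. h z = 0"
proof (rule AE_zero_of_boxes[OF sets_sl h])
 fix a b :: spacetime
 note [measurable] = borel_measurable_integrable[OF h]
 obtain a0 a1 a2 b0 b1 b2 where ab: "a = (a0, a1, a2)" "b = (b0, b1, b2)" by (cases a, cases b)
 have bx: "z : box a b \<longleftrightarrow> a0 < fst z & fst z < b0 & a1 < fst (snd z) & fst (snd z) < b1 & a2 < snd (snd z) & snd (snd z) < b2" for z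
  by (cases z) (auto simp: ab mem_box Basis_prod_def)
 define x1 x2 y1 y2 where "x1 = max a1 0" and "x2 = min b1 (2*pi)" and "y1 = max a2 0" and "y2 = min b2 (2*pi)"
 show "(BS z. indicator (box a b) z *\<^sub>R h z) = 0"
 proof (cases "x1 < x2 & y1 < y2")
  case False
  have "AE z in sl. indicator (box a b) z *\<^sub>R h z = 0"
   using AE_sl_interior by eventually_elim (use False in \<open>auto simp: indicator_def bx x1_def x2_def y1_def y2_def\<close>)
  then show ?thesis by (rule integral_eq_zero_AE)
 next
  case True
  \<comment> \<open>the cut-offs at \<open>0\<close> and \<open>T\<close> move outward with \<open>k\<close>, which keeps every support inside \<open>(0, T)\<close>\<close>
  define A B where "A k = max a0 (T / real (k + 2))" and "B k = min b0 (T - T / real (k + 2))" for k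
  define ps where "ps k z = complex_of_real (bump (real k*(fst z - A k))) * of_real (bump (real k*(B k - fst z)))
   * of_real (bump (real k*(cos (fst (snd z) - (x1 + x2) / 2) - cos ((x2 - x1) / 2))))
   * of_real (bump (real k*(cos (snd (snd z) - (y1 + y2) / 2) - cos ((y2 - y1) / 2))))" for k z
  have smf: "ps k : smf" for k
  proof -
   have "(%z. complex_of_real (bump (fst z*real k + (- (real k*A k))))) : smf" "(%z. complex_of_real (bump (fst z*(- real k) + real k*B k))) : smf"
    by (rule smf_bump_time)+
   then have "(%z. complex_of_real (bump (real k*(fst z - A k)))) : smf" "(%z. complex_of_real (bump (real k*(B k - fst z)))) : smf"
    by (simp_all add: algebra_simps)
   then show ?thesis unfolding ps_def[abs_def] by (intro smf.mult smf_bump_arc)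
  qed
  have cp: "cos (x + 2*pi - c) = cos (x - c)" for x c :: real using cos_periodic[of "x - c"] by (simp add: algebra_simps)
  have supp: "ps k (t, x, y) = 0" if "t \<notin> {A k..B k}" for k t x y
  proof -
   have "t - A k <= 0 | B k - t <= 0" using that by auto
   then have "real k*(t - A k) <= 0 | real k*(B k - t) <= 0" by (auto intro: mult_nonneg_nonpos)
   then show ?thesis by (auto simp: ps_def bump_zero)
  qed
  have "ps k : schwartz" for k
   by (rule schwartz_compact_timeI[OF smf_deriv_closed smf _ supp]) (simp add: periodic_space_def ps_def cp)
  moreover have "0 < A k" "B k < T" for k using T by (auto simp: A_def B_def less_max_iff_disj min_less_iff_disj)
  ultimately have tf: "ps k : test_functions T" for k unfolding test_functions_def using supp by blast
  have bd: "cmod (ps k z) <= 1" for k z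
   unfolding ps_def norm_mult using bump_range by (intro mult_le_one mult_nonneg_nonneg) auto
  have t0: "(%k. T / real (k + 2)) \<longlonglongrightarrow> 0" by real_asymp
  have AB: "A \<longlonglongrightarrow> max a0 0" "B \<longlonglongrightarrow> min b0 T"
  proof -
   show "A \<longlonglongrightarrow> max a0 0" unfolding A_def[abs_def] by (intro tendsto_max tendsto_const t0)
   have "(%k. min b0 (T - T / real (k + 2))) \<longlonglongrightarrow> min b0 (T - 0)" by (intro tendsto_min tendsto_diff tendsto_const t0)
   then show "B \<longlonglongrightarrow> min b0 T" unfolding B_def[abs_def] by simp
  qed
  have lim: "AE z in sl. (%k. h z*ps k z) \<longlonglongrightarrow> indicator (box a b) z *\<^sub>R h z"
   using AE_sl_interior
  proof eventually_elim
   case (elim z)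
   show ?case
   proof (cases "fst z : {0<..<T}")
    case False then show ?thesis using hz by simp
   next
    case tT: True
    have "(%k. bump (real k*(fst z - A k))) \<longlonglongrightarrow> of_bool (a0 < fst z)"
     by (rule bump_limit_indicator[OF tendsto_diff[OF tendsto_const AB(1)]]) (use tT in \<open>auto simp: A_def\<close>)
    moreover have "(%k. bump (real k*(B k - fst z))) \<longlonglongrightarrow> of_bool (fst z < b0)"
     by (rule bump_limit_indicator[OF tendsto_diff[OF AB(2) tendsto_const]]) (use tT in \<open>auto simp: B_def\<close>)
    moreover have "(%k. bump (real k*(cos (fst (snd z) - (x1 + x2) / 2) - cos ((x2 - x1) / 2)))) \<longlonglongrightarrow> of_bool (a1 < fst (snd z) & fst (snd z) < b1)"
    proof -
     have "0 < cos (fst (snd z) - (x1 + x2) / 2) - cos ((x2 - x1) / 2) \<longleftrightarrow> x1 < fst (snd z) & fst (snd z) < x2"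
      by (rule cos_arc) (use True elim in \<open>auto simp: x1_def x2_def\<close>)
     also have "... \<longleftrightarrow> a1 < fst (snd z) & fst (snd z) < b1" using elim by (auto simp: x1_def x2_def)
     finally have e: "0 < cos (fst (snd z) - (x1 + x2) / 2) - cos ((x2 - x1) / 2) \<longleftrightarrow> a1 < fst (snd z) & fst (snd z) < b1" .
     show ?thesis by (rule bump_limit_indicator[OF tendsto_const]) (use e in linarith)+
    qed
    moreover have "(%k. bump (real k*(cos (snd (snd z) - (y1 + y2) / 2) - cos ((y2 - y1) / 2)))) \<longlonglongrightarrow> of_bool (a2 < snd (snd z) & snd (snd z) < b2)"
    proof -
     have "0 < cos (snd (snd z) - (y1 + y2) / 2) - cos ((y2 - y1) / 2) \<longleftrightarrow> y1 < snd (snd z) & snd (snd z) < y2"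
      by (rule cos_arc) (use True elim in \<open>auto simp: y1_def y2_def\<close>)
     also have "... \<longleftrightarrow> a2 < snd (snd z) & snd (snd z) < b2" using elim by (auto simp: y1_def y2_def)
     finally have e: "0 < cos (snd (snd z) - (y1 + y2) / 2) - cos ((y2 - y1) / 2) \<longleftrightarrow> a2 < snd (snd z) & snd (snd z) < b2" .
     show ?thesis by (rule bump_limit_indicator[OF tendsto_const]) (use e in linarith)+
    qed
    ultimately have "(%k. h z*ps k z) \<longlonglongrightarrow> h z*(complex_of_real (of_bool (a0 < fst z)) * of_real (of_bool (fst z < b0))
     * of_real (of_bool (a1 < fst (snd z) & fst (snd z) < b1)) * of_real (of_bool (a2 < snd (snd z) & snd (snd z) < b2)))"
     unfolding ps_def by (intro tendsto_mult tendsto_const tendsto_of_real)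
    also have "h z*(complex_of_real (of_bool (a0 < fst z)) * of_real (of_bool (fst z < b0))
     * of_real (of_bool (a1 < fst (snd z) & fst (snd z) < b1)) * of_real (of_bool (a2 < snd (snd z) & snd (snd z) < b2))) = indicator (box a b) z *\<^sub>R h z"
     by (auto simp: indicator_def bx)
    finally show ?thesis .
   qed
  qed
  have psm: "ps k : BM borel" for k using tf[of k] by (auto simp: test_functions_def intro: schwartz_measurable)
  have "(%k. (BS z. h z*ps k z)) \<longlonglongrightarrow> (BS z. indicator (box a b) z *\<^sub>R h z)"
  proof (rule integral_dominated_convergence[where w="%z. cmod (h z)"])
   show "AE z in sl. cmod (h z*ps k z) <= cmod (h z)" for k
    by (intro AE_I2) (simp add: norm_mult mult_left_le bd)
   show "(%z. h z*ps k z) : BM sl" for k using psm[of k] by measurable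
  qed (use h lim in \<open>measurable, simp_all\<close>)
  then show ?thesis unfolding test[OF tf] by (simp add: LIMSEQ_const_iff)
 qed
qed

section \<open>Uniqueness of the transform\<close>

text \<open>The total mass is a multiple of the value of the plateau at zero, by inversion.\<close>

lemma plateau_ft_integrable: "integrable lborel plateau_ft" and plateau_ft_integral: "(BT sgm. plateau_ft sgm) ~= 0"
proof -
 note cs = cut_schwartz[OF zero_less_one]
 have f: "ft (cut 1) (ta, n) = (if n = 0 then of_real ((2*pi)^2)*plateau_ft ta else 0)" for ta n
  using ft_cut[of 1 ta n] by simp
 have "(%ta. ft (cut 1) (ta, 0)) : BM borel"
  using ft_measurable[OF schwartz_integrable[OF cs]] unfolding meas_fm_iff by blast
 then have "(%ta. of_real (1 / (2*pi)\<^sup>2)*ft (cut 1) (ta, 0)) : BM borel" by measurable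
 then have m[measurable]: "plateau_ft : BM borel" by (simp add: f)
 obtain C where C0: "0 <= C" and C: "!!ta. cmod (plateau_ft ta) <= C / (1 + ta^2)" using plateau_ft_decay by blast
 show i: "integrable lborel plateau_ft"
  by (rule Bochner_Integration.integrable_bound[OF integrable_inverse_quadratic[of C]])
    (use m in measurable, intro AE_I2, rule order_trans[OF C], simp add: C0)
 have "of_real ((2*pi) ^ 3)*cut 1 0 = (BF xi. ft (cut 1) xi*ch xi 0)" using schwartz_inversion[OF cs] by simp
 also have "... = (BF xi. ft (cut 1) xi)" by (simp add: ch_def)
 also have "... = (\<integral>n. (BT ta. ft (cut 1) (ta, n)) \<partial>count_space UNIV)" by (rule integral_fm(1)[OF ft_schwartz_integrable[OF cs]])
 finally have e: "of_real ((2*pi) ^ 3)*cut 1 0 = (\<integral>n. (BT ta. ft (cut 1) (ta, n)) \<partial>count_space UNIV)" .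
 have "cut 1 0 = 1" by (rule cut_one) auto
 show "(BT sgm. plateau_ft sgm) ~= 0"
 proof
  assume z: "(BT sgm. plateau_ft sgm) = 0"
  have "(BT ta. ft (cut 1) (ta, n)) = 0" for n using z by (cases "n = 0") (simp_all add: f)
  then show False using e \<open>cut 1 0 = 1\<close> by simp
 qed
qed

lemma integral_count_single:
 fixes g :: "int \<times> int => complex"
 assumes "!!m. m ~= n ==> g m = 0"
 shows "integral\<^sup>L (count_space UNIV) g = g n"
proof -
 have e: "g = (%m. indicator {n} m *\<^sub>R g n)" using assms by (auto simp: fun_eq_iff indicator_def)
 have "integral\<^sup>L (count_space UNIV) (%m. indicator {n} m *\<^sub>R g n) = g n" by simp
 then show ?thesis using e by simp
qed

lemma locally_square_integrable:
 fixes d :: "real => complex"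
 assumes [measurable]: "d : BM borel" and M: "(NT ta. ennreal ((cmod (d ta))^2)) <= ennreal M" "0 <= M"
 shows "(NT ta. ennreal (indicator {al<..<be} ta*cmod (d (ta - e)))) <= ennreal (\<bar>be - al\<bar> + M)"
proof -
 have "(NT ta. ennreal (indicator {al<..<be} ta*cmod (d (ta - e)))) <= (NT ta. indicator {al<..<be} ta + ennreal ((cmod (d (- e + 1*ta)))^2))"
 proof (rule nn_integral_mono)
  fix ta
  have "r <= 1 + r^2" for r :: real using zero_le_power2[of "r - 1 / 2"] by (simp add: power2_eq_square algebra_simps)
  from ennreal_leI[OF this[of "cmod (d (ta - e))"]]
  show "ennreal (indicator {al<..<be} ta*cmod (d (ta - e))) <= indicator {al<..<be} ta + ennreal ((cmod (d (- e + 1*ta)))^2)"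
   by (auto simp: indicator_def ennreal_plus)
 qed
 also have "... = (NT ta. indicator {al<..<be} ta) + (NT ta. ennreal ((cmod (d (- e + 1*ta)))^2))"
  by (rule nn_integral_add) auto
 also have "(NT ta. ennreal ((cmod (d (- e + 1*ta)))^2)) = (NT ta. ennreal ((cmod (d ta))^2))"
  using nn_integral_real_affine[of "%ta. ennreal ((cmod (d ta))^2)" 1 "- e"] by simp
 also have "(NT ta. indicator {al<..<be} ta) <= ennreal \<bar>be - al\<bar>" by (cases "al <= be") auto
 finally show ?thesis using M by (simp add: ennreal_plus add_mono order_trans[OF _ add_left_mono])
qed

text \<open>Testing with modulated cutoffs of length \<open>k\<close> shows that the convolution of each slice of \<open>D\<close> with the rescaled
transform of the plateau vanishes. Integrated over an interval, this approximate identity converges to a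
nonzero multiple of the integral of the slice.\<close>

theorem ft_separates:
 assumes D[measurable]: "D : BM fm" and fin: "(NF xi. ennreal ((cmod (D xi))^2)) < \<top>"
  and int: "!!ph. ph : schwartz ==> integrable fm (%xi. D xi*ft ph (- xi))"
  and zero: "!!ph. ph : schwartz ==> (BF xi. D xi*ft ph (- xi)) = 0"
 shows "AE xi in fm. D xi = 0"
proof -
 have slice: "AE ta in lborel. D (ta, n) = 0" for n
 proof -
  define d where "d ta = D (ta, n)" for ta
  have [measurable]: "d : BM borel" using D unfolding d_def[abs_def] meas_fm_iff by blast
  have "(NT ta. ennreal ((cmod (d ta))^2)) <= (\<integral>\<^sup>+n. (NT ta. ennreal ((cmod (D (ta, n)))^2)) \<partial>count_space UNIV)"
   unfolding d_def by (rule nn_integral_ge_point) simp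
  also have "... < \<top>" using fin by (subst (asm) nn_integral_fm) auto
  finally have "(NT ta. ennreal ((cmod (d ta))^2)) < \<top>" .
  then obtain M where M: "0 <= M" "(NT ta. ennreal ((cmod (d ta))^2)) <= ennreal M"
   by (cases "(NT ta. ennreal ((cmod (d ta))^2))") auto
  note loc = locally_square_integrable[OF \<open>d : BM borel\<close> M(2,1)]
  note qi = plateau_ft_integrable
  note [measurable] = borel_measurable_integrable[OF qi, unfolded measurable_lborel1]
  have di: "integrable lborel (%ta. indicator {al<..<be} ta *\<^sub>R d (ta - e))" for al be e
  proof (rule integrableI_bounded)
   have "(NT ta. ennreal (cmod (indicator {al<..<be} ta *\<^sub>R d (ta - e)))) = (NT ta. ennreal (indicator {al<..<be} ta*cmod (d (ta - e))))" by simp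
   also have "... < \<infinity>" using loc[of al be e] by (simp add: le_less_trans)
   finally show "(NT ta. ennreal (cmod (indicator {al<..<be} ta *\<^sub>R d (ta - e)))) < \<infinity>" .
  qed measurable
  have conv: "(BT sgm. d (ta0 - sgm / k)*plateau_ft sgm) = 0" if k: "0 < k" for ta0 k :: real
  proof -
   \<comment> \<open>dual to a translate of the rescaled transform of the plateau on the slice at \<open>n\<close>\<close>
   define ps where "ps z = ch (- (ta0, n)) z*cut k z" for z
   have ps: "ps : schwartz" unfolding ps_def[abs_def] by (rule schwartz_modulate[OF cut_schwartz[OF k]])
   have f: "ft ps (- xi) = ft (cut k) ((ta0, n) - xi)" for xi
    unfolding ps_def[abs_def] by (rule ft_modulate[OF cut_schwartz[OF k]])
   have "0 = (\<integral>m. (BT ta. D (ta, m)*ft (cut k) ((ta0, n) - (ta, m))) \<partial>count_space UNIV)"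
    using integral_fm(1)[OF int[OF ps]] zero[OF ps] unfolding f by simp
   also have "... = (BT ta. D (ta, n)*ft (cut k) ((ta0, n) - (ta, n)))"
    by (rule integral_count_single) (simp add: ft_cut[OF k] diff_Pair)
   also have "... = (BT ta. of_real ((2*pi)^2*k)*(d ta*plateau_ft (k*(ta0 - ta))))"
    by (simp add: ft_cut[OF k] diff_Pair d_def mult_ac)
   also have "... = of_real ((2*pi)^2*k)*(BT ta. d ta*plateau_ft (k*(ta0 - ta)))"
    by (rule integral_mult_right_zero)
   finally have "(BT ta. d ta*plateau_ft (k*(ta0 - ta))) = 0" using k by simp
   moreover have "(BT ta. d ta*plateau_ft (k*(ta0 - ta))) = \<bar>- 1 / k\<bar> *\<^sub>R (BT sgm. d (ta0 + - 1 / k * sgm)*plateau_ft (k*(ta0 - (ta0 + - 1 / k * sgm))))"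
    using k by (intro lborel_integral_real_affine) simp
   ultimately show ?thesis using k by simp
  qed
  have I0: "(BT ta. indicator {al<..<be} ta *\<^sub>R d ta) = 0" for al be
  proof -
   define B where "B e = (BT ta. indicator {al<..<be} ta *\<^sub>R d (ta - e))" for e
   have Bbd: "cmod (B e) <= \<bar>be - al\<bar> + M" for e
   proof -
    have "ennreal (cmod (B e)) <= (NT ta. ennreal (cmod (indicator {al<..<be} ta *\<^sub>R d (ta - e))))"
     unfolding B_def by (rule integral_norm_bound_ennreal[OF di])
    also have "... <= ennreal (\<bar>be - al\<bar> + M)" using loc[of al be e] by simp
    finally show ?thesis using M by (subst (asm) ennreal_le_iff) auto
   qed
   have Bm: "(%sgm. B (sgm / k)) : BM borel" for k
    unfolding B_def by (rule lborel.borel_measurable_lebesgue_integral) measurable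
   have zero': "(BT sgm. plateau_ft sgm*B (sgm / k)) = 0" if k: "0 < k" for k :: real
   proof -
    have i: "integrable (lborel \<Otimes>\<^sub>M lborel) (%(sgm, ta). plateau_ft sgm*(indicator {al<..<be} ta *\<^sub>R d (ta - sgm / k)))"
    proof (rule integrableI_bounded)
     have "(\<integral>\<^sup>+p. ennreal (cmod (case p of (sgm, ta) => plateau_ft sgm*(indicator {al<..<be} ta *\<^sub>R d (ta - sgm / k)))) \<partial>(lborel \<Otimes>\<^sub>M lborel))
      = (NT sgm. (NT ta. ennreal (cmod (plateau_ft sgm))*ennreal (indicator {al<..<be} ta*cmod (d (ta - sgm / k)))))"
      by (subst lborel.nn_integral_fst[symmetric]) (auto simp: norm_mult ennreal_mult mult_ac)
     also have "... <= (NT sgm. ennreal (cmod (plateau_ft sgm))*ennreal (\<bar>be - al\<bar> + M))"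
      by (rule nn_integral_mono, subst nn_integral_cmult) (auto intro!: mult_left_mono loc)
     also have "... < \<infinity>" using qi by (simp add: nn_integral_multc integrable_iff_bounded ennreal_mult_less_top)
     finally show "(\<integral>\<^sup>+p. ennreal (cmod (case p of (sgm, ta) => plateau_ft sgm*(indicator {al<..<be} ta *\<^sub>R d (ta - sgm / k)))) \<partial>(lborel \<Otimes>\<^sub>M lborel)) < \<infinity>" .
    qed measurable
    have "(BT sgm. plateau_ft sgm*B (sgm / k)) = (BT sgm. (BT ta. plateau_ft sgm*(indicator {al<..<be} ta *\<^sub>R d (ta - sgm / k))))"
     unfolding B_def integral_mult_right_zero ..
    also have "... = (BT ta. (BT sgm. plateau_ft sgm*(indicator {al<..<be} ta *\<^sub>R d (ta - sgm / k))))"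
     using lborel_pair.Fubini_integral[OF i] by simp
    also have "... = (BT ta. indicator {al<..<be} ta *\<^sub>R (BT sgm. d (ta - sgm / k)*plateau_ft sgm))"
     unfolding integral_scaleR_right[symmetric] by (simp add: mult_ac)
    finally show ?thesis unfolding conv[OF k] by simp
   qed
   have Blim: "(%k. B (sgm / real (Suc k))) \<longlonglongrightarrow> B 0" for sgm
   proof -
    have Bs: "B e = (BT ta. indicator {al<..<be} (ta + e) *\<^sub>R d ta)" for e
     unfolding B_def using lborel_integral_real_affine[of 1 "%ta. indicator {al<..<be} ta *\<^sub>R d (ta - e)" e] by (simp add: add.commute)
    have s0: "(%k. sgm / real (Suc k)) \<longlonglongrightarrow> 0" by real_asymp
    have "(%k. (BT ta. indicator {al<..<be} (ta + sgm / real (Suc k)) *\<^sub>R d ta)) \<longlonglongrightarrow> (BT ta. indicator {al<..<be} (ta + 0) *\<^sub>R d ta)"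
    proof (rule integral_dominated_convergence[where w="%ta. cmod (indicator {al - \<bar>sgm\<bar><..<be + \<bar>sgm\<bar>} ta *\<^sub>R d (ta - 0))"])
     show "integrable lborel (%ta. cmod (indicator {al - \<bar>sgm\<bar><..<be + \<bar>sgm\<bar>} ta *\<^sub>R d (ta - 0)))" by (rule integrable_norm[OF di])
     show "AE ta in lborel. (%k. indicator {al<..<be} (ta + sgm / real (Suc k)) *\<^sub>R d ta) \<longlonglongrightarrow> indicator {al<..<be} (ta + 0) *\<^sub>R d ta"
      using AE_lborel_singleton[of al] AE_lborel_singleton[of be]
     proof eventually_elim
      case (elim ta)
      have l: "(%k. ta + sgm / real (Suc k)) \<longlonglongrightarrow> ta + 0" by (intro tendsto_add tendsto_const s0)
      have "\<forall>\<^sub>F k in sequentially. (al < ta + sgm / real (Suc k) \<longleftrightarrow> al < ta) & (ta + sgm / real (Suc k) < be \<longleftrightarrow> ta < be)"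
      proof (rule eventually_conj)
       show "\<forall>\<^sub>F k in sequentially. (al < ta + sgm / real (Suc k) \<longleftrightarrow> al < ta)"
       proof (cases "al < ta")
        case True then show ?thesis using order_tendstoD(1)[OF l, of al] by simp
       next
        case False
        then have "ta + 0 < al" using elim by simp
        from order_tendstoD(2)[OF l this] show ?thesis by eventually_elim (use False in auto)
       qed
       show "\<forall>\<^sub>F k in sequentially. (ta + sgm / real (Suc k) < be \<longleftrightarrow> ta < be)"
       proof (cases "ta < be")
        case True then show ?thesis using order_tendstoD(2)[OF l, of be] by simp
       next
        case False
        then have "be < ta + 0" using elim by simp
        from order_tendstoD(1)[OF l this] show ?thesis by eventually_elim (use False in auto)
       qed
      qed
      then have "\<forall>\<^sub>F k in sequentially. indicator {al<..<be} (ta + 0) *\<^sub>R d ta = indicator {al<..<be} (ta + sgm / real (Suc k)) *\<^sub>R d ta"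
       by eventually_elim (simp add: indicator_def)
      then show ?case by (rule Lim_transform_eventually[OF tendsto_const])
     qed
     show "AE ta in lborel. cmod (indicator {al<..<be} (ta + sgm / real (Suc k)) *\<^sub>R d ta) <= cmod (indicator {al - \<bar>sgm\<bar><..<be + \<bar>sgm\<bar>} ta *\<^sub>R d (ta - 0))" for k
     proof (rule AE_I2)
      fix ta
      have "\<bar>sgm / real (Suc k)\<bar> <= \<bar>sgm\<bar>" by (simp add: abs_divide divide_le_eq mult_le_cancel_left1)
      then have "sgm / real (Suc k) <= \<bar>sgm\<bar>" "- \<bar>sgm\<bar> <= sgm / real (Suc k)" by linarith+
      then show "cmod (indicator {al<..<be} (ta + sgm / real (Suc k)) *\<^sub>R d ta) <= cmod (indicator {al - \<bar>sgm\<bar><..<be + \<bar>sgm\<bar>} ta *\<^sub>R d (ta - 0))"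
       by (auto simp: indicator_def simp del: of_nat_Suc)
     qed
    qed measurable
    then show ?thesis unfolding Bs .
   qed
   have "(%k. (BT sgm. plateau_ft sgm*B (sgm / real (Suc k)))) \<longlonglongrightarrow> (BT sgm. plateau_ft sgm*B 0)"
   proof (rule integral_dominated_convergence[where w="%sgm. cmod (plateau_ft sgm)*(\<bar>be - al\<bar> + M)"])
    show "integrable lborel (%sgm. cmod (plateau_ft sgm)*(\<bar>be - al\<bar> + M))" by (intro integrable_mult_left integrable_norm qi)
    show "AE sgm in lborel. (%k. plateau_ft sgm*B (sgm / real (Suc k))) \<longlonglongrightarrow> plateau_ft sgm*B 0"
     by (intro AE_I2 tendsto_mult tendsto_const Blim)
    show "AE sgm in lborel. cmod (plateau_ft sgm*B (sgm / real (Suc k))) <= cmod (plateau_ft sgm)*(\<bar>be - al\<bar> + M)" for k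
     unfolding norm_mult by (intro AE_I2 mult_left_mono Bbd) simp
   qed (use Bm in measurable)
   moreover have "(BT sgm. plateau_ft sgm*B (sgm / real (Suc k))) = 0" for k by (rule zero') simp
   ultimately have "(BT sgm. plateau_ft sgm)*B 0 = 0" by (simp add: LIMSEQ_const_iff)
   then show ?thesis using plateau_ft_integral by (simp add: B_def)
  qed
  have "AE ta in lborel. indicator {- real N<..<real N} ta *\<^sub>R d ta = 0" for N :: nat
  proof (rule AE_zero_of_boxes)
   show "integrable lborel (%ta. indicator {- real N<..<real N} ta *\<^sub>R d ta)" using di[of _ _ 0] by simp
   fix a b :: real
   have "indicator (box a b) ta *\<^sub>R (indicator {- real N<..<real N} ta *\<^sub>R d ta) = indicator {max a (- real N)<..<min b (real N)} ta *\<^sub>R d ta" for ta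
    by (auto simp: indicator_def)
   then show "(BT ta. indicator (box a b) ta *\<^sub>R (indicator {- real N<..<real N} ta *\<^sub>R d ta)) = 0" by (simp only: I0)
  qed simp
  then have "AE ta in lborel. ALL N::nat. indicator {- real N<..<real N} ta *\<^sub>R d ta = 0" unfolding AE_all_countable by blast
  then show ?thesis
  proof eventually_elim
   case (elim ta)
   obtain N :: nat where "\<bar>ta\<bar> < real N" using reals_Archimedean2 by blast
   then have "ta : {- real N<..<real N}" by auto
   then show ?case using elim[rule_format, of N] by (simp add: d_def)
  qed
 qed
 have "(NF xi. ennreal (cmod (D xi))) = (\<integral>\<^sup>+n. (NT ta. ennreal (cmod (D (ta, n)))) \<partial>count_space UNIV)"
  by (rule nn_integral_fm) measurable
 also have "... = (\<integral>\<^sup>+(n :: int \<times> int). 0 \<partial>count_space UNIV)"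
 proof (rule nn_integral_cong)
  fix n :: "int \<times> int"
  have "(NT ta. ennreal (cmod (D (ta, n)))) = (\<integral>\<^sup>+(ta :: real). 0 \<partial>lborel)"
   by (rule nn_integral_cong_AE) (use slice[of n] in \<open>eventually_elim, simp\<close>)
  then show "(NT ta. ennreal (cmod (D (ta, n)))) = 0" by simp
 qed
 finally have "(NF xi. ennreal (cmod (D xi))) = 0" by simp
 then show ?thesis by (subst (asm) nn_integral_0_iff_AE) auto
qed

section \<open>The cubic integrability estimate\<close>

lemma xsb_weight_measurable[measurable]: "xsb_weight s b : BM fm"
 unfolding xsb_weight_eq[abs_def] jb_def by measurable

lemma xsb_weight_pos: "0 < xsb_weight s b xi"
 unfolding xsb_weight_eq using jn_pos[of "snd xi"] jb_pos[of "\<bar>fst xi\<bar> - jn (snd xi)"] by (intro mult_pos_pos) simp_all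

lemma xsb_weight_ge_1: "0 <= s ==> 0 <= b ==> 1 <= xsb_weight s b xi"
proof -
 assume "0 <= s" "0 <= b"
 then have "1*1 <= jn (snd xi) powr s*jb (\<bar>fst xi\<bar> - jn (snd xi)) powr b"
  by (intro mult_mono ge_one_powr_ge_zero jn_ge1 jb_ge1) auto
 then show ?thesis by (simp add: xsb_weight_eq)
qed

definition level :: "frequency => nat" where "level xi = nat \<lfloor>log 2 (jn (snd xi))\<rfloor>"

lemma level_bounds: "2 powr real (level xi) <= jn (snd xi)" "jn (snd xi) <= 2 powr (real (level xi) + 1)"
proof -
 have l: "0 <= log 2 (jn (snd xi))" using jn_ge1[of "snd xi"] by simp
 then have "real (level xi) <= log 2 (jn (snd xi))" "log 2 (jn (snd xi)) <= real (level xi) + 1"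
  by (simp_all add: level_def)
 then have "2 powr real (level xi) <= 2 powr (log 2 (jn (snd xi)))" "2 powr (log 2 (jn (snd xi))) <= 2 powr (real (level xi) + 1)"
  by simp_all
 then show "2 powr real (level xi) <= jn (snd xi)" "jn (snd xi) <= 2 powr (real (level xi) + 1)"
  using jn_pos[of "snd xi"] by simp_all
qed

lemma level_measurable[measurable]: "level : measurable fm (count_space UNIV)"
 unfolding level_def by measurable

text \<open>Every summand is at most \<open>\<rho>\<^sup>-\<^sup>k\<close> times the cube root of the weighted sum on the right, and the geometric
series converges.\<close>

lemma dyadic_cube_sum:
 fixes a :: "nat => real"
 assumes a: "!!k. 0 <= a k" and rh: "1 < rh"
 shows "(\<Sum>k<N. a k) ^ 3 <= (1 / (1 - 1 / rh)) ^ 3*(\<Sum>k<N. rh ^ (3*k)*a k ^ 3)"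
proof -
 define S where "S = (\<Sum>k<N. rh ^ (3*k)*a k ^ 3)"
 define m where "m = root 3 S"
 have S: "0 <= S" unfolding S_def using a rh by (intro sum_nonneg mult_nonneg_nonneg) auto
 have m: "0 <= m" "m ^ 3 = S" using S by (simp_all add: m_def odd_real_root_pow)
 have ak: "a k <= m*(1 / rh) ^ k" if "k < N" for k
 proof -
  have "(rh ^ k*a k) ^ 3 = rh ^ (3*k)*a k ^ 3" by (simp add: power_mult_distrib power_mult[symmetric] mult.commute)
  also have "... <= S" unfolding S_def using that a rh by (intro member_le_sum) auto
  finally have "(rh ^ k*a k) ^ 3 <= m ^ 3" by (simp add: m)
  then have "rh ^ k*a k <= m" using a[of k] rh m(1) by (subst (asm) power_mono_iff) auto
  then show ?thesis using rh by (simp add: power_one_over field_simps)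
 qed
 have "(\<Sum>k<N. a k) <= (\<Sum>k<N. m*(1 / rh) ^ k)" by (intro sum_mono ak) simp
 also have "... = m*(\<Sum>k<N. (1 / rh) ^ k)" by (simp add: sum_distrib_left)
 also have "... <= m*(1 / (1 - 1 / rh))"
 proof (rule mult_left_mono[OF _ m(1)])
  have "(\<Sum>k<N. (1 / rh) ^ k) <= (\<Sum>k. (1 / rh) ^ k)" using rh by (intro sum_le_suminf summable_geometric) auto
  also have "... = 1 / (1 - 1 / rh)" using rh by (intro suminf_geometric) simp
  finally show "(\<Sum>k<N. (1 / rh) ^ k) <= 1 / (1 - 1 / rh)" .
 qed
 finally have "(\<Sum>k<N. a k) ^ 3 <= (m*(1 / (1 - 1 / rh))) ^ 3" using a by (intro power_mono sum_nonneg) auto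
 then show ?thesis unfolding S_def[symmetric] by (simp only: power_mult_distrib m(2) mult.commute)
qed

lemma ennreal_square_le:
 fixes x :: ennreal
 assumes "x^2 <= ennreal (c^2)" "0 <= c" shows "x <= ennreal c"
proof (cases x)
 case (real r)
 then have "r^2 <= c^2" using assms by (simp add: ennreal_power)
 then have "r <= c" using assms(2) by (rule power2_le_imp_le)
 then show ?thesis unfolding real(2) by (rule ennreal_leI)
next
 case top
 then show ?thesis using assms by (simp add: power2_eq_square top_unique)
qed

text \<open>On a dyadic piece, the fourth powers are controlled by the bilinear estimate and the squares by Plancherel;
their geometric mean controls the cubes with a factor \<open>2\<^sup>k\<^sup>(\<^sup>\<theta>\<^sup>-\<^sup>3\<^sup>s\<^sup>)\<close>. For \<open>s > 1/4\<close> one can choose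
\<open>3/4 < \<theta> < 3s\<close>, and the pieces can be summed.\<close>

theorem l3_estimate:
 fixes s b :: real
 assumes s: "1/4 < s" and b: "1/2 < b"
 shows "EX C>=0. ALL ph:schwartz. ALL A>=0. (NF xi. ennreal ((xsb_weight s b xi*cmod (ft ph xi))^2)) <= ennreal (A^2) -->
  (NS z. ennreal ((cmod (ph z)) ^ 3)) <= ennreal (C*A ^ 3)"
proof -
 \<comment> \<open>strictly between the threshold of the bilinear estimate and the exponent of decay of the cubes\<close>
 define tht where "tht = (3/4 + 3 * s) / 2"
 have tht: "3/4 < tht" "tht < 3 * s" using s by (simp_all add: tht_def)
 obtain C1 where C1: "0 <= C1" and bil: "!!f g. f : BM fm ==> g : BM fm ==>
   (NF ze. (NF xi. (wt tht xi + wt tht (ze - xi))*((md b xi*f xi)*(md b (ze - xi)*g (ze - xi))))^2)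
    <= ennreal C1*((NF xi. (f xi)^2)*(NF xi. (g xi)^2))"
  using bilinear_estimate[of tht "2*b" "2*b"] tht b by (auto simp: max_def)
 define ka where "ka = (3 * s - tht) / 2"
 have ka: "0 < ka" using tht by (simp add: ka_def)
 \<comment> \<open>with \<open>rh\<^sup>3 = 2\<^sup>ka\<close> the summation of the pieces spends half of their decay \<open>2 powr (- 2*ka*k)\<close>\<close>
 define rh where "rh = 2 powr (ka / 3)"
 have rh: "1 < rh" unfolding rh_def by (rule gr_one_powr) (use ka in auto)
 define K where "K = sqrt (c3 ^ 3*C1*2 powr (2*tht)*c3)"
 have K: "0 <= K" unfolding K_def using C1 c3_pos by simp
 define C where "C = (1 / (1 - 1 / rh)) ^ 3*(K*(1 / (1 - 2 powr (- ka))))"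
 have r1: "2 powr (- ka) < 1" using ka by (simp add: powr_less_one)
 have C: "0 <= C" unfolding C_def using K rh r1 by (intro mult_nonneg_nonneg zero_le_power) auto
 have "(NS z. ennreal ((cmod (ph z)) ^ 3)) <= ennreal (C*A ^ 3)"
  if ph: "ph : schwartz" and A: "0 <= A"
   and le: "(NF xi. ennreal ((xsb_weight s b xi*cmod (ft ph xi))^2)) <= ennreal (A^2)" for ph A
 proof -
  define F where "F k xi = (if level xi = k then ft ph xi else 0)" for k xi
  note fi = ft_schwartz_integrable[OF ph]
  note [measurable] = borel_measurable_integrable[OF fi] schwartz_measurable[OF ph]
  have Fm[measurable]: "F k : BM fm" for k unfolding F_def by measurable
  have Fi: "integrable fm (F k)" for k
   by (rule Bochner_Integration.integrable_bound[OF fi]) (auto simp: F_def)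
  define f where "f k = inv_ft (F k)" for k
  have fm'[measurable]: "f k : BM borel" for k unfolding f_def by measurable
  define g where "g k xi = ennreal (jb (\<bar>fst xi\<bar> - jn (snd xi)) powr b*cmod (F k xi))" for k xi
  have gm[measurable]: "g k : BM fm" for k unfolding g_def jb_def by measurable
  have mdg: "md b xi*g k xi = ennreal (cmod (F k xi))" for k xi
   using jb_pos[of "\<bar>fst xi\<bar> - jn (snd xi)"] by (simp add: md_def g_def mult.assoc[symmetric] flip: ennreal_mult powr_add)
  have gle: "(NF xi. (g k xi)^2) <= ennreal (2 powr (- 2 * s*k)*A^2)" for k
  proof -
   have "(g k xi)^2 <= ennreal (2 powr (- 2 * s*k))*ennreal ((xsb_weight s b xi*cmod (ft ph xi))^2)" for xi
   proof (cases "level xi = k")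
    case True
    let ?j = "jb (\<bar>fst xi\<bar> - jn (snd xi)) powr b*cmod (ft ph xi)"
    have "2 powr (s*k) <= jn (snd xi) powr s"
     using powr_mono2[OF _ _ level_bounds(1)[of xi], of s] s by (simp add: True powr_powr mult.commute)
    then have "2 powr (s*k)*?j <= jn (snd xi) powr s*?j" by (intro mult_right_mono) auto
    then have "(2 powr (s*k)*?j)^2 <= (xsb_weight s b xi*cmod (ft ph xi))^2"
     unfolding xsb_weight_eq by (intro power_mono) (auto simp: mult.assoc)
    then have m1: "2 powr (- 2 * s*k)*(2 powr (s*k)*?j)^2 <= 2 powr (- 2 * s*k)*(xsb_weight s b xi*cmod (ft ph xi))^2"
     by (intro mult_left_mono) auto
    have m2: "2 powr (- 2 * s*k)*(2 powr (s*k)*?j)^2 = ?j\<^sup>2"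
    proof -
     have "2 powr (- 2 * s*k)*(2 powr (s*k))^2 = 1" by (simp add: power2_eq_square flip: powr_add)
     then show ?thesis by (simp only: power_mult_distrib mult.assoc[symmetric] mult_1_left)
    qed
    have "?j\<^sup>2 <= 2 powr (- 2 * s*k)*(xsb_weight s b xi*cmod (ft ph xi))^2"
     by (rule ord_eq_le_trans[OF m2[symmetric] m1])
    then show ?thesis using True by (simp add: g_def F_def ennreal_power ennreal_leI flip: ennreal_mult)
   qed (simp add: g_def F_def)
   then have "(NF xi. (g k xi)^2) <= (NF xi. ennreal (2 powr (- 2 * s*k))*ennreal ((xsb_weight s b xi*cmod (ft ph xi))^2))"
    by (rule nn_integral_mono)
   also have "... = ennreal (2 powr (- 2 * s*k))*(NF xi. ennreal ((xsb_weight s b xi*cmod (ft ph xi))^2))"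
    by (rule nn_integral_cmult) measurable
   also have "... <= ennreal (2 powr (- 2 * s*k))*ennreal (A^2)" by (intro mult_left_mono le) simp
   finally show ?thesis by (simp add: ennreal_mult)
  qed
  have f2: "(NS z. ennreal ((cmod (f k z))^2)) <= ennreal (c3*(2 powr (- 2 * s*k)*A^2))" for k
  proof -
   have "ennreal ((cmod (F k xi))^2) <= (g k xi)^2" for xi
   proof -
    have "1 <= jb (\<bar>fst xi\<bar> - jn (snd xi)) powr b" using b by (intro ge_one_powr_ge_zero jb_ge1) auto
    then have "1*cmod (F k xi) <= jb (\<bar>fst xi\<bar> - jn (snd xi)) powr b*cmod (F k xi)" by (rule mult_right_mono) simp
    then have "(cmod (F k xi))^2 <= (jb (\<bar>fst xi\<bar> - jn (snd xi)) powr b*cmod (F k xi))^2" by (intro power_mono) auto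
    then show ?thesis by (simp add: g_def ennreal_power ennreal_leI)
   qed
   then have "(NF xi. ennreal ((cmod (F k xi))^2)) <= ennreal (2 powr (- 2 * s*k)*A^2)"
    by (intro order_trans[OF nn_integral_mono gle])
   then have "ennreal c3*(NF xi. ennreal ((cmod (F k xi))^2)) <= ennreal c3*ennreal (2 powr (- 2 * s*k)*A^2)" by (intro mult_left_mono) auto
   then show ?thesis using c3_pos order_trans[OF plancherel_le[OF Fi]] unfolding f_def by (simp add: ennreal_mult)
  qed
  have f4: "(NS z. ennreal ((cmod (f k z)) ^ 4)) <= ennreal (c3 ^ 3*(C1*2 powr (2*tht*(k + 1))*(2 powr (- 2 * s*k)*A^2)^2))" for k
  proof -
   let ?w = "2 powr (tht*(real k + 1))"
   have "ennreal (cmod (F k xi))*ennreal (cmod (F k (ze - xi))) <= ennreal ?w*((wt tht xi + wt tht (ze - xi))*((md b xi*g k xi)*(md b (ze - xi)*g k (ze - xi))))" for ze xi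
   proof (cases "level xi = k")
    case True
    have "jn (snd xi) powr tht <= (2 powr (real k + 1)) powr tht"
     using level_bounds(2)[of xi] tht jn_pos[of "snd xi"] by (intro powr_mono2) (auto simp: True)
    also have "... = ?w" by (simp add: powr_powr mult.commute)
    finally have "jn (snd xi) powr tht*jn (snd xi) powr (- tht) <= ?w*jn (snd xi) powr (- tht)" by (intro mult_right_mono) auto
    then have "1 <= ?w*jn (snd xi) powr (- tht)" using jn_pos[of "snd xi"] by (simp flip: powr_add)
    then have "ennreal 1 <= ennreal ?w*wt tht xi" unfolding wt_def by (simp add: ennreal_leI flip: ennreal_mult)
    also have "... <= ennreal ?w*(wt tht xi + wt tht (ze - xi))" by (intro mult_left_mono) auto
    finally have "1*(ennreal (cmod (F k xi))*ennreal (cmod (F k (ze - xi)))) <= ennreal ?w*(wt tht xi + wt tht (ze - xi))*(ennreal (cmod (F k xi))*ennreal (cmod (F k (ze - xi))))"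
     by (intro mult_right_mono) auto
    then show ?thesis unfolding mdg by (simp add: mult.assoc)
   qed (simp add: F_def)
   then have "(NF xi. ennreal (cmod (F k xi))*ennreal (cmod (F k (ze - xi)))) <= ennreal ?w*(NF xi. (wt tht xi + wt tht (ze - xi))*((md b xi*g k xi)*(md b (ze - xi)*g k (ze - xi))))" for ze
    by (subst nn_integral_cmult[symmetric], measurable) (rule nn_integral_mono)
   then have "(NF ze. (NF xi. ennreal (cmod (F k xi))*ennreal (cmod (F k (ze - xi))))^2)
     <= (NF ze. (ennreal ?w*(NF xi. (wt tht xi + wt tht (ze - xi))*((md b xi*g k xi)*(md b (ze - xi)*g k (ze - xi)))))^2)"
    by (intro nn_integral_mono power_mono) auto
   also have "... = (ennreal ?w)^2*(NF ze. (NF xi. (wt tht xi + wt tht (ze - xi))*((md b xi*g k xi)*(md b (ze - xi)*g k (ze - xi))))^2)"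
    unfolding power_mult_distrib by (rule nn_integral_cmult) measurable
   also have "... <= (ennreal ?w)^2*(ennreal C1*(ennreal (2 powr (- 2 * s*k)*A^2)*ennreal (2 powr (- 2 * s*k)*A^2)))"
    by (intro mult_left_mono order_trans[OF bil] mult_mono gle) auto
   also have "... = ennreal (C1*2 powr (2*tht*(k + 1))*(2 powr (- 2 * s*k)*A^2)^2)"
   proof -
    have "?w\<^sup>2 = 2 powr (2*tht*(k + 1))" by (simp add: power2_eq_square algebra_simps flip: powr_add)
    then show ?thesis using C1 A by (simp add: power2_eq_square mult_ac flip: ennreal_mult)
   qed
   finally have "ennreal (c3 ^ 3)*(NF ze. (NF xi. ennreal (cmod (F k xi))*ennreal (cmod (F k (ze - xi))))^2)
    <= ennreal (c3 ^ 3)*ennreal (C1*2 powr (2*tht*(k + 1))*(2 powr (- 2 * s*k)*A^2)^2)" by (intro mult_left_mono) auto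
   then show ?thesis using order_trans[OF l4_le[OF Fi]] c3_pos C1 unfolding f_def by (simp add: ennreal_mult)
  qed
  have f3: "(NS z. ennreal ((cmod (f k z)) ^ 3)) <= ennreal (K*2 powr (- 2*ka*k)*A ^ 3)" for k
  proof -
   have "(NS z. ennreal ((cmod (f k z)) ^ 3))^2 = (NS z. ennreal ((cmod (f k z))^2)*ennreal (cmod (f k z)))^2"
    by (simp add: power3_eq_cube power2_eq_square flip: ennreal_mult)
   also have "... <= (NS z. (ennreal ((cmod (f k z))^2))^2)*(NS z. (ennreal (cmod (f k z)))^2)"
    by (rule Cauchy_Schwarz_nn_integral) measurable
   also have "... = (NS z. ennreal ((cmod (f k z)) ^ 4))*(NS z. ennreal ((cmod (f k z))^2))"
    by (simp add: ennreal_power flip: power_mult)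
   also have "... <= ennreal (c3 ^ 3*(C1*2 powr (2*tht*(k + 1))*(2 powr (- 2 * s*k)*A^2)^2))*ennreal (c3*(2 powr (- 2 * s*k)*A^2))"
    by (intro mult_mono f2 f4) auto
   also have "... = ennreal ((K*2 powr (- 2*ka*k)*A ^ 3)^2)"
   proof -
    have K2: "K^2 = c3 ^ 3*C1*2 powr (2*tht)*c3" unfolding K_def using C1 c3_pos by simp
    have p: "2 powr (2*tht*(k + 1))*(2 powr (- 2 * s*k))^2*2 powr (- 2 * s*k) = 2 powr (2*tht)*(2 powr (- 2*ka*k))^2"
    proof -
     have "2*tht*(real k + 1) + (- 2 * s*k + - 2 * s*k) + - 2 * s*k = 2*tht + (- 2*ka*k + - 2*ka*k)"
      by (simp add: ka_def algebra_simps)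
     then show ?thesis by (simp only: power2_eq_square powr_add[symmetric] of_nat_add of_nat_1)
    qed
    have "c3 ^ 3*(C1*2 powr (2*tht*(k + 1))*(2 powr (- 2 * s*k)*A^2)^2)*(c3*(2 powr (- 2 * s*k)*A^2))
     = (c3 ^ 3*C1*c3)*(2 powr (2*tht*(k + 1))*(2 powr (- 2 * s*k))^2*2 powr (- 2 * s*k))*(A ^ 3)^2"
     by (simp add: power_mult_distrib mult_ac eval_nat_numeral)
    also have "... = (K*2 powr (- 2*ka*k)*A ^ 3)^2" unfolding p power_mult_distrib K2 by (simp only: mult_ac)
    finally show ?thesis using C1 c3_pos A by (simp flip: ennreal_mult)
   qed
   finally have "(NS z. ennreal ((cmod (f k z)) ^ 3))^2 <= ennreal ((K*2 powr (- 2*ka*k)*A ^ 3)^2)" .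
   then show ?thesis by (rule ennreal_square_le) (use K A in auto)
  qed
  define S where "S N z = (\<Sum>k<N. f k z)" for N z
  have Slim: "(%N. S N z) \<longlonglongrightarrow> ph z" for z
  proof -
   have "S N z = of_real c3*(BF xi. (if level xi < N then ft ph xi else 0)*ch xi z)" for N
   proof -
    have "S N z = of_real c3*(BF xi. (\<Sum>k<N. F k xi*ch xi z))"
     unfolding S_def f_def inv_ft_def by (subst Bochner_Integration.integral_sum) (auto simp: sum_distrib_left intro: integrable_mult_ch Fi)
    also have "(%xi. \<Sum>k<N. F k xi*ch xi z) = (%xi. (if level xi < N then ft ph xi else 0)*ch xi z)"
     by (auto simp: F_def fun_eq_iff sum_distrib_right[symmetric])
    finally show ?thesis .
   qed
   moreover have "(%N. of_real c3*(BF xi. (if level xi < N then ft ph xi else 0)*ch xi z)) \<longlonglongrightarrow> of_real c3*(BF xi. ft ph xi*ch xi z)"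
   proof (rule tendsto_mult[OF tendsto_const], rule integral_dominated_convergence[where w="%xi. cmod (ft ph xi)"])
    show "AE xi in fm. (%N. (if level xi < N then ft ph xi else 0)*ch xi z) \<longlonglongrightarrow> ft ph xi*ch xi z"
    proof (rule AE_I2)
     fix xi
     have "\<forall>\<^sub>F N in sequentially. ft ph xi*ch xi z = (if level xi < N then ft ph xi else 0)*ch xi z"
      using eventually_gt_at_top[of "level xi"] by eventually_elim simp
     then show "(%N. (if level xi < N then ft ph xi else 0)*ch xi z) \<longlonglongrightarrow> ft ph xi*ch xi z"
      by (rule Lim_transform_eventually[OF tendsto_const])
    qed
    show "AE xi in fm. cmod ((if level xi < N then ft ph xi else 0)*ch xi z) <= cmod (ft ph xi)" for N
     by (rule AE_I2) (simp add: norm_mult)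
   qed (use fi in \<open>measurable, simp_all\<close>)
   moreover have "of_real c3*(BF xi. ft ph xi*ch xi z) = ph z"
    using fun_cong[OF inv_ft_ft[OF ph], of z] unfolding inv_ft_def .
   ultimately show ?thesis by (simp only:)
  qed
  have Sle: "(NS z. ennreal ((cmod (S N z)) ^ 3)) <= ennreal (C*A ^ 3)" for N
  proof -
   let ?M = "(1 / (1 - 1 / rh)) ^ 3"
   have M: "0 <= ?M" using rh by simp
   have "(NS z. ennreal ((cmod (S N z)) ^ 3)) <= (NS z. ennreal ?M*(\<Sum>k<N. ennreal (rh ^ (3*k))*ennreal ((cmod (f k z)) ^ 3)))"
   proof (rule nn_integral_mono)
    fix z
    have "(cmod (S N z)) ^ 3 <= (\<Sum>k<N. cmod (f k z)) ^ 3" unfolding S_def by (intro power_mono norm_sum) simp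
    also have "... <= ?M*(\<Sum>k<N. rh ^ (3*k)*(cmod (f k z)) ^ 3)" by (rule dyadic_cube_sum[OF norm_ge_zero rh])
    finally have "ennreal ((cmod (S N z)) ^ 3) <= ennreal (?M*(\<Sum>k<N. rh ^ (3*k)*(cmod (f k z)) ^ 3))" by (rule ennreal_leI)
    also have "... = ennreal ?M*(\<Sum>k<N. ennreal (rh ^ (3*k))*ennreal ((cmod (f k z)) ^ 3))"
     using M rh by (simp add: ennreal_mult sum_nonneg sum_ennreal[symmetric] del: sum_ennreal)
    finally show "ennreal ((cmod (S N z)) ^ 3) <= ennreal ?M*(\<Sum>k<N. ennreal (rh ^ (3*k))*ennreal ((cmod (f k z)) ^ 3))" .
   qed
   also have "... = ennreal ?M*(\<Sum>k<N. ennreal (rh ^ (3*k))*(NS z. ennreal ((cmod (f k z)) ^ 3)))"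
    by (subst nn_integral_cmult, measurable, subst nn_integral_sum, measurable, simp add: nn_integral_cmult)
   also have "... <= ennreal ?M*(\<Sum>k<N. ennreal (rh ^ (3*k))*ennreal (K*2 powr (- 2*ka*k)*A ^ 3))"
    by (intro mult_left_mono sum_mono f3) auto
   also have "... = ennreal (?M*(\<Sum>k<N. rh ^ (3*k)*(K*2 powr (- 2*ka*k)*A ^ 3)))"
    using M rh K A by (simp add: ennreal_mult[symmetric] sum_nonneg)
   also have "... <= ennreal (C*A ^ 3)"
   proof (rule ennreal_leI)
    have e: "rh ^ (3*k)*(K*2 powr (- 2*ka*k)*A ^ 3) = (K*A ^ 3)*(2 powr (- ka)) ^ k" for k
    proof -
     have "rh ^ (3*k) = 2 powr (ka*k)" unfolding rh_def by (simp add: powr_powr flip: powr_realpow)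
     moreover have "2 powr (ka*k)*2 powr (- 2*ka*k) = (2 powr (- ka)) ^ k"
      by (simp add: powr_powr flip: powr_add powr_realpow)
     moreover have "rh ^ (3*k)*(K*2 powr (- 2*ka*k)*A ^ 3) = (K*A ^ 3)*(rh ^ (3*k)*2 powr (- 2*ka*k))"
      by (simp only: mult_ac)
     ultimately show ?thesis by (simp only:)
    qed
    have "(\<Sum>k<N. (2 powr (- ka)) ^ k) <= (\<Sum>k. (2 powr (- ka)) ^ k)" using r1 by (intro sum_le_suminf summable_geometric) auto
    also have "... = 1 / (1 - 2 powr (- ka))" using r1 by (intro suminf_geometric) simp
    finally have "(\<Sum>k<N. (2 powr (- ka)) ^ k) <= 1 / (1 - 2 powr (- ka))" .
    then have "?M*((K*A ^ 3)*(\<Sum>k<N. (2 powr (- ka)) ^ k)) <= ?M*((K*A ^ 3)*(1 / (1 - 2 powr (- ka))))"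
     using M K A by (intro mult_left_mono) auto
    then show "?M*(\<Sum>k<N. rh ^ (3*k)*(K*2 powr (- 2*ka*k)*A ^ 3)) <= C*A ^ 3"
     unfolding e sum_distrib_left[symmetric] C_def by (simp only: mult_ac)
   qed
   finally show ?thesis .
  qed
  have "(NS z. ennreal ((cmod (ph z)) ^ 3)) = (NS z. liminf (%N. ennreal ((cmod (S N z)) ^ 3)))"
   by (intro nn_integral_cong lim_imp_Liminf[symmetric] tendsto_ennrealI tendsto_power tendsto_norm Slim) simp
  also have "... <= liminf (%N. (NS z. ennreal ((cmod (S N z)) ^ 3)))"
   unfolding S_def by (rule nn_integral_liminf) measurable
  also have "... <= ennreal (C*A ^ 3)" by (intro Liminf_le always_eventually allI Sle) simp
  finally show ?thesis .
 qed
 then show ?thesis using C by blast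
qed

section \<open>Weighted square norms and the cutoff product\<close>

text \<open>\<open>A\<close> bounds the weighted \<open>L\<^sup>2\<close> norm of \<open>F\<close>; real bounds are easier to handle than extended real norms.\<close>

definition wmass :: "real => real => (frequency => complex) => real => bool" where
 "wmass s b F A \<longleftrightarrow> F : BM fm & (NF xi. ennreal ((xsb_weight s b xi*cmod (F xi))^2)) <= ennreal (A^2)"

lemma wmass_l2_norm:
 "F : BM fm ==> 0 <= A ==> l2_norm (%z. of_real (xsb_weight s b z)*F z) <= ennreal A \<longleftrightarrow> wmass s b F A"
 by (simp add: l2_norm_eq wmass_def norm_mult less_imp_le[OF xsb_weight_pos])

lemma minkowski_ennreal:
 assumes [measurable]: "f : BM M" "g : BM M"
  and f: "(\<integral>\<^sup>+x. (f x)\<^sup>2 \<partial>M) <= ennreal (A^2)" and g: "(\<integral>\<^sup>+x. (g x)\<^sup>2 \<partial>M) <= ennreal (B^2)" and AB: "0 <= A" "0 <= B"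
 shows "(\<integral>\<^sup>+x. (f x + g x)\<^sup>2 \<partial>M) <= ennreal ((A + B)^2)"
proof -
 have "(\<integral>\<^sup>+x. f x*g x \<partial>M)^2 <= (\<integral>\<^sup>+x. (f x)\<^sup>2 \<partial>M)*(\<integral>\<^sup>+x. (g x)\<^sup>2 \<partial>M)"
  by (rule Cauchy_Schwarz_nn_integral) measurable
 also have "... <= ennreal (A^2)*ennreal (B^2)" by (intro mult_mono f g) auto
 also have "... = ennreal ((A*B)^2)" unfolding power_mult_distrib by (rule ennreal_mult[symmetric]) auto
 finally have fg: "(\<integral>\<^sup>+x. f x*g x \<partial>M) <= ennreal (A*B)"
  by (rule ennreal_square_le) (use AB in simp)
 have "(\<integral>\<^sup>+x. (f x + g x)\<^sup>2 \<partial>M) = (\<integral>\<^sup>+x. (f x)\<^sup>2 + (2*(f x*g x) + (g x)^2) \<partial>M)"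
  by (intro nn_integral_cong) (simp only: power2_eq_square mult_2 distrib_left distrib_right add.assoc mult.commute)
 also have "... = (\<integral>\<^sup>+x. (f x)\<^sup>2 \<partial>M) + (2*(\<integral>\<^sup>+x. f x*g x \<partial>M) + (\<integral>\<^sup>+x. (g x)\<^sup>2 \<partial>M))"
  by (simp add: nn_integral_add nn_integral_cmult)
 also have "... <= ennreal (A^2) + (2*ennreal (A*B) + ennreal (B^2))" by (intro add_mono mult_left_mono f g fg) auto
 also have "... = ennreal (A^2 + (2*(A*B) + B^2))" using AB
  by (simp add: ennreal_plus[symmetric] ennreal_mult''[symmetric] del: ennreal_plus flip: ennreal_numeral)
 also have "A^2 + (2*(A*B) + B^2) = (A + B)^2" by (simp add: power2_eq_square algebra_simps)
 finally show ?thesis .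
qed

lemma wmass_measurable: "wmass s b F A ==> F : BM fm" by (simp add: wmass_def)

lemma wmass_le_add:
 assumes F: "wmass s b F A" and G: "wmass s b G B" and AB: "0 <= A" "0 <= B"
  and H: "H : BM fm" and le: "AE xi in fm. cmod (H xi) <= cmod (F xi) + cmod (G xi)"
 shows "wmass s b H (A + B)"
proof -
 note [measurable] = wmass_measurable[OF F] wmass_measurable[OF G] H
 let ?w = "xsb_weight s b"
 have w: "0 <= ?w xi" for xi using xsb_weight_pos[of s b xi] by simp
 have "(NF xi. ennreal ((?w xi*cmod (H xi))^2)) <= (NF xi. (ennreal (?w xi*cmod (F xi)) + ennreal (?w xi*cmod (G xi)))^2)"
 proof (rule nn_integral_mono_AE)
  show "AE xi in fm. ennreal ((?w xi*cmod (H xi))^2) <= (ennreal (?w xi*cmod (F xi)) + ennreal (?w xi*cmod (G xi)))^2"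
   using le
  proof eventually_elim
   case (elim xi)
   have "?w xi*cmod (H xi) <= ?w xi*cmod (F xi) + ?w xi*cmod (G xi)"
    using mult_left_mono[OF elim w] by (simp add: distrib_left)
   then have "(?w xi*cmod (H xi))^2 <= (?w xi*cmod (F xi) + ?w xi*cmod (G xi))^2"
    using w by (intro power_mono) auto
   then show ?case using w by (simp add: ennreal_plus[symmetric] ennreal_power ennreal_leI del: ennreal_plus)
  qed
 qed
 also have "... <= ennreal ((A + B)^2)"
  by (rule minkowski_ennreal) (use F G AB w in \<open>simp_all add: wmass_def ennreal_power\<close>)
 finally show ?thesis using H by (simp add: wmass_def)
qed

lemma wmass_fatou:
 assumes F: "!!j::nat. wmass s b (F j) A" and lim: "!!xi. (%j. F j xi) \<longlonglongrightarrow> G xi"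
 shows "wmass s b G A"
proof -
 note [measurable] = wmass_measurable[OF F]
 have G[measurable]: "G : BM fm"
  by (rule borel_measurable_LIMSEQ_metric[OF _ lim]) measurable
 have "(NF xi. ennreal ((xsb_weight s b xi*cmod (G xi))^2)) = (NF xi. liminf (%j. ennreal ((xsb_weight s b xi*cmod (F j xi))^2)))"
  by (intro nn_integral_cong lim_imp_Liminf[symmetric] tendsto_ennrealI tendsto_power tendsto_mult tendsto_const tendsto_norm lim) simp
 also have "... <= liminf (%j. (NF xi. ennreal ((xsb_weight s b xi*cmod (F j xi))^2)))"
  by (rule nn_integral_liminf) measurable
 also have "... <= ennreal (A^2)" using F unfolding wmass_def by (intro Liminf_le always_eventually allI) auto
 finally show ?thesis using G by (simp add: wmass_def)
qed

text \<open>For exponents at most one the weight times \<open>decay\<close> is bounded, so two orders of smoothing leave an integrable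
factor.\<close>

lemma schwartz_wmass:
 assumes ph: "ph : schwartz" and s: "s <= 1" and b: "b <= 1"
 shows "EX A>=0. wmass s b (ft ph) A"
proof -
 obtain ps where ps: "ps : schwartz" and e1: "!!xi. ft ph xi = of_real (decay xi)*ft ps xi"
  using ft_schwartz_smoothing[OF ph] by blast
 obtain C where C: "!!xi. cmod (ft ps xi) <= C*decay xi" using ft_schwartz_decay[OF ps] by blast
 have C0: "0 <= C" using order_trans[OF norm_ge_zero C[of "(0, 0, 0)"]] by (simp add: decay_def)
 have w: "xsb_weight s b xi*decay xi <= 3" for xi
 proof -
  define N where "N = jn (snd xi)"
  define t where "t = \<bar>fst xi\<bar>"
  have N: "1 <= N" unfolding N_def by (rule jn_ge1)
  have t: "0 <= t" by (simp add: t_def)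
  have "xsb_weight s b xi <= N powr 1*jb (t - N) powr 1"
   unfolding xsb_weight_eq N_def t_def using s b jn_ge1 jb_ge1 by (intro mult_mono powr_mono) auto
  also have "... = N*jb (t - N)" using N jb_pos[of "t - N"] by simp
  also have "jb (t - N) <= 1 + t + N"
  proof -
   have "jb (t - N) <= sqrt ((1 + \<bar>t - N\<bar>)^2)" unfolding jb_def by (rule real_sqrt_le_mono) (simp add: power2_eq_square algebra_simps abs_mult_self_eq)
   also have "... <= 1 + t + N" using t N by simp
   finally show ?thesis .
  qed
  finally have W: "xsb_weight s b xi <= N*(1 + t + N)" using N by simp
  have N2: "N^2 <= (1 + (real_of_int (fst (snd xi)))^2)*(1 + (real_of_int (snd (snd xi)))^2)"
   unfolding N_def jn_def by (simp add: algebra_simps)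
  have "(1 + t^2)*N^2 <= (1 + (fst xi)^2)*((1 + (real_of_int (fst (snd xi)))^2)*(1 + (real_of_int (snd (snd xi)))^2))"
   unfolding t_def using N2 by (intro mult_mono) auto
  then have d: "decay xi <= 1 / ((1 + t^2)*N^2)" unfolding decay_def
   using N by (intro divide_left_mono mult_pos_pos) (auto simp: add_pos_nonneg)
  have "1 + t <= 2*(1 + t^2)"
  proof -
   have "2*t <= 1 + t^2" using zero_le_power2[of "t - 1"] by (simp add: power2_eq_square algebra_simps)
   moreover have "0 <= t^2" by simp
   ultimately show ?thesis unfolding distrib_left by linarith
  qed
  moreover have "(1 + t)*1 <= (1 + t)*N" "N*1 <= N*(1 + t^2)" using N t by (intro mult_left_mono; simp)+
  moreover have "(1 + t)*N <= 2*(1 + t^2)*N" using calculation(1) N by (intro mult_right_mono) auto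
  ultimately have "1 + t + N <= 3*((1 + t^2)*N)" by (simp add: algebra_simps)
  then have "N*(1 + t + N) <= N*(3*((1 + t^2)*N))" using N by (intro mult_left_mono) auto
  then have *: "N*(1 + t + N) <= 3*((1 + t^2)*N^2)" by (simp add: power2_eq_square algebra_simps)
  have p: "0 < (1 + t^2)*N^2" using N by (intro mult_pos_pos) (auto simp: add_pos_nonneg)
  have "xsb_weight s b xi*decay xi <= (N*(1 + t + N))*(1 / ((1 + t^2)*N^2))"
   using W d N t decay_bounds xsb_weight_pos by (intro mult_mono) auto
  also have "... <= 3*((1 + t^2)*N^2)*(1 / ((1 + t^2)*N^2))" using*p by (intro mult_right_mono) auto
  also have "... = 3"
  proof -
   have "3*X*(1 / X) = 3" if "0 < X" for X :: real using that by simp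
   from this[OF p] show ?thesis .
  qed
  finally show ?thesis .
 qed
 have sq: "(xsb_weight s b xi*cmod (ft ph xi))^2 <= (3*C)^2*decay xi" for xi
 proof -
  have "xsb_weight s b xi*cmod (ft ph xi) = (xsb_weight s b xi*decay xi)*cmod (ft ps xi)"
   using decay_bounds[of xi] by (simp add: e1 norm_mult)
  also have "... <= 3*(C*decay xi)"
   using w C decay_bounds xsb_weight_pos[of s b xi] by (intro mult_mono) auto
  finally have "(xsb_weight s b xi*cmod (ft ph xi))^2 <= (3*(C*decay xi))^2"
   using xsb_weight_pos[of s b xi] by (intro power_mono) auto
  also have "... = (3*C)^2*(decay xi*decay xi)" by (simp add: power2_eq_square mult_ac)
  also have "... <= (3*C)^2*(decay xi*1)" using decay_bounds by (intro mult_left_mono) auto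
  finally show ?thesis by simp
 qed
 have "(NF xi. ennreal ((xsb_weight s b xi*cmod (ft ph xi))^2)) <= (NF xi. ennreal ((3*C)^2)*ennreal (decay xi))"
  using sq by (intro nn_integral_mono) (simp add: ennreal_leI decay_bounds flip: ennreal_mult)
 also have "... = ennreal ((3*C)^2)*(NF xi. ennreal (decay xi))" by (rule nn_integral_cmult) measurable
 also have "... < \<top>" using nn_integral_decay by (simp add: ennreal_mult_less_top)
 finally obtain M where M: "0 <= M" "(NF xi. ennreal ((xsb_weight s b xi*cmod (ft ph xi))^2)) = ennreal M"
  by (cases "(NF xi. ennreal ((xsb_weight s b xi*cmod (ft ph xi))^2))") auto
 then show ?thesis using ft_measurable[OF schwartz_integrable[OF ph]]
  by (intro exI[of _ "sqrt M"]) (simp add: wmass_def)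
qed

text \<open>The weight in the spatial frequency commutes with the time cutoff; the cutoff gain and the trilinear estimate
are applied one after the other, with modulation exponents \<open>a\<close> and \<open>a'\<close>.\<close>

theorem schwartz_trilinear:
 fixes s b a a' :: real
 assumes s: "1/4 < s" "s <= 1" and b: "1/2 < b" and a: "1/4 < a'" "a' < a" "a < 1/2"
 shows "EX C>=0. ALL T. ALL ph1:schwartz. ALL ph2:schwartz. ALL ph3:schwartz. ALL A1>=0. ALL A2>=0. ALL A3>=0.
   0 < T --> T <= 1 --> wmass s b (ft ph1) A1 --> wmass s b (ft ph2) A2 --> wmass s b (ft ph3) A3 -->
   wmass (s - 1) (- a) (ft (%z. cut T z*(ph1 z*(ph2 z*ph3 z)))) (C*T powr (a - a')*(A1*A2*A3))"
proof -
 obtain C1 where C1: "0 <= C1" and cut: "!!T G ze. 0 < T ==> G : schwartz ==>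
   ennreal (cmod (ft (%z. cut T z*G z) ze)) <= ennreal C1*(NT mu. ennreal (ckern T (fst ze - mu))*ennreal (cmod (ft G (mu, snd ze))))"
  using norm_ft_cut_mult_le by blast
 obtain C2 where C2: "0 <= C2" and gain: "!!T G. G : BM fm ==> 0 < T ==> T <= 1 ==>
   (NF ze. (md a ze*(NT mu. ennreal (ckern T (fst ze - mu))*G (mu, snd ze)))^2)
    <= ennreal (C2*T powr (2*(a - a')))*(NF ze. (md a' ze*G ze)^2)"
  using time_cutoff_gain[of a' a] a by auto
 obtain C3 where C3: "0 <= C3" and tril: "!!f1 f2 f3. f1 : BM fm ==> f2 : BM fm ==> f3 : BM fm ==>
  (NF ze. (wt (1 - s) ze*md a' ze*tri (%xi. wt s xi*md b xi*f1 xi) (%xi. wt s xi*md b xi*f2 xi) (%xi. wt s xi*md b xi*f3 xi) ze)^2)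
   <= ennreal C3*((NF xi. (f1 xi)^2)*(NF xi. (f2 xi)^2)*(NF xi. (f3 xi)^2))"
  using trilinear_estimate[OF s b a(1)] by auto
 define C where "C = C1 * sqrt C2*(c3^2 * sqrt C3)"
 have C: "0 <= C" using C1 C2 C3 by (simp add: C_def)
 have "wmass (s - 1) (- a) (ft (%z. cut T z*(ph1 z*(ph2 z*ph3 z)))) (C*T powr (a - a')*(A1*A2*A3))"
  if ph: "ph1 : schwartz" "ph2 : schwartz" "ph3 : schwartz" and A: "0 <= A1" "0 <= A2" "0 <= A3" and T: "0 < T" "T <= 1"
   and m: "wmass s b (ft ph1) A1" "wmass s b (ft ph2) A2" "wmass s b (ft ph3) A3" for T ph1 ph2 ph3 A1 A2 A3
 proof -
  define G where "G z = ph1 z*(ph2 z*ph3 z)" for z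
  have G: "G : schwartz" unfolding G_def[abs_def] by (intro schwartz_mult ph)
  define H where "H z = cut T z*G z" for z
  have H: "H : schwartz" unfolding H_def[abs_def] by (intro schwartz_mult cut_schwartz G T)
  note [measurable] = ft_measurable[OF schwartz_integrable[OF G]] ft_measurable[OF schwartz_integrable[OF H]]
   wmass_measurable[OF m(1)] wmass_measurable[OF m(2)] wmass_measurable[OF m(3)]
  define f where "f ph xi = ennreal (xsb_weight s b xi*cmod (ft ph xi))" for ph and xi :: frequency
  have fi: "wt s xi*md b xi*f ph xi = ennreal (cmod (ft ph xi))" for ph xi
  proof -
   have "jn (snd xi) powr (- s)*jb (\<bar>fst xi\<bar> - jn (snd xi)) powr (- b)*xsb_weight s b xi = 1"
    unfolding xsb_weight_eq using jn_pos[of "snd xi"] jb_pos[of "\<bar>fst xi\<bar> - jn (snd xi)"]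
    by (simp add: powr_minus field_simps)
   then show ?thesis unfolding wt_def md_def f_def
    using less_imp_le[OF xsb_weight_pos[of s b xi]] by (simp add: mult.assoc[symmetric] ennreal_mult[symmetric])
  qed
  have f2: "(NF xi. (f ph xi)^2) <= ennreal (A^2)" if "wmass s b (ft ph) A" for ph A
  proof -
   have "(f ph xi)^2 = ennreal ((xsb_weight s b xi*cmod (ft ph xi))^2)" for xi
    unfolding f_def using xsb_weight_pos[of s b xi] by (simp add: ennreal_power)
   then show ?thesis using that by (simp add: wmass_def)
  qed
  have fmeas: "f ph : BM fm" if "ft ph : BM fm" for ph
   using that unfolding f_def[abs_def] by measurable
  define V where "V ze = wt (1 - s) ze*ennreal (cmod (ft G ze))" for ze
  have Vm[measurable]: "V : BM fm" unfolding V_def by measurable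
  define R where "R = (A1*A2*A3)"
  have "(NF ze. (md a' ze*V ze)^2) <= (NF ze. (ennreal (c3^2))^2*(wt (1 - s) ze*md a' ze*tri (%xi. wt s xi*md b xi*f ph1 xi) (%xi. wt s xi*md b xi*f ph2 xi) (%xi. wt s xi*md b xi*f ph3 xi) ze)^2)"
  proof (rule nn_integral_mono)
   fix ze
   let ?t = "tri (%xi. ennreal (cmod (ft ph1 xi))) (%xi. ennreal (cmod (ft ph2 xi))) (%xi. ennreal (cmod (ft ph3 xi))) ze"
   have "md a' ze*V ze = (wt (1 - s) ze*md a' ze)*ennreal (cmod (ft G ze))" unfolding V_def by (simp only: mult_ac)
   also have "... <= (wt (1 - s) ze*md a' ze)*(ennreal (c3^2)*?t)"
    unfolding G_def[abs_def] by (intro mult_left_mono norm_ft_product3_le ph) simp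
   finally have "(md a' ze*V ze)^2 <= (ennreal (c3^2)*(wt (1 - s) ze*md a' ze*?t))^2"
    by (intro power_mono) (simp_all only: mult_ac, simp)
   then show "(md a' ze*V ze)^2 <= (ennreal (c3^2))^2*(wt (1 - s) ze*md a' ze*tri (%xi. wt s xi*md b xi*f ph1 xi) (%xi. wt s xi*md b xi*f ph2 xi) (%xi. wt s xi*md b xi*f ph3 xi) ze)^2"
    unfolding fi power_mult_distrib .
  qed
  also have "... = (ennreal (c3^2))^2*(NF ze. (wt (1 - s) ze*md a' ze*tri (%xi. wt s xi*md b xi*f ph1 xi) (%xi. wt s xi*md b xi*f ph2 xi) (%xi. wt s xi*md b xi*f ph3 xi) ze)^2)"
   unfolding fi tri_def by (rule nn_integral_cmult) measurable
  also have "... <= (ennreal (c3^2))^2*(ennreal C3*(ennreal (A1^2)*ennreal (A2^2)*ennreal (A3^2)))"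
   by (intro mult_left_mono order_trans[OF tril] mult_mono f2 m fmeas wmass_measurable[OF m(1)] wmass_measurable[OF m(2)] wmass_measurable[OF m(3)]) auto
  also have "... = ennreal ((c3^2 * sqrt C3 * R)^2)"
   using C3 by (simp add: R_def power_mult_distrib ennreal_power ennreal_mult mult.assoc)
  finally have V2: "(NF ze. (md a' ze*V ze)^2) <= ennreal ((c3^2 * sqrt C3 * R)^2)" .
  have "(NF ze. ennreal ((xsb_weight (s - 1) (- a) ze*cmod (ft H ze))^2))
   <= (NF ze. (ennreal C1)^2*(md a ze*(NT mu. ennreal (ckern T (fst ze - mu))*V (mu, snd ze)))^2)"
  proof (rule nn_integral_mono)
   fix ze :: frequency
   have [measurable]: "(%ta. ft G (ta, snd ze)) : BM borel"
    using ft_measurable[OF schwartz_integrable[OF G]] unfolding meas_fm_iff by blast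
   have [measurable]: "ckern T : BM borel" unfolding ckern_def[abs_def] by measurable
   have w: "xsb_weight (s - 1) (- a) ze = jn (snd ze) powr (- (1 - s))*jb (\<bar>fst ze\<bar> - jn (snd ze)) powr (- a)"
    unfolding xsb_weight_eq by simp
   have "ennreal (xsb_weight (s - 1) (- a) ze*cmod (ft H ze)) = wt (1 - s) ze*md a ze*ennreal (cmod (ft H ze))"
    unfolding w wt_def md_def by (simp add: ennreal_mult)
   also have "... <= wt (1 - s) ze*md a ze*(ennreal C1*(NT mu. ennreal (ckern T (fst ze - mu))*ennreal (cmod (ft G (mu, snd ze)))))"
    unfolding H_def[abs_def] by (intro mult_left_mono cut T G) simp
   also have "... = ennreal C1*(md a ze*(wt (1 - s) ze*(NT mu. ennreal (ckern T (fst ze - mu))*ennreal (cmod (ft G (mu, snd ze))))))"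
    by (simp only: mult_ac)
   also have "wt (1 - s) ze*(NT mu. ennreal (ckern T (fst ze - mu))*ennreal (cmod (ft G (mu, snd ze))))
     = (NT mu. wt (1 - s) ze*(ennreal (ckern T (fst ze - mu))*ennreal (cmod (ft G (mu, snd ze)))))"
    by (rule nn_integral_cmult[symmetric]) measurable
   also have "... = (NT mu. ennreal (ckern T (fst ze - mu))*V (mu, snd ze))"
    unfolding V_def wt_def snd_conv by (simp only: mult.left_commute)
   finally have "ennreal (xsb_weight (s - 1) (- a) ze*cmod (ft H ze)) <= ennreal C1*(md a ze*(NT mu. ennreal (ckern T (fst ze - mu))*V (mu, snd ze)))" .
   then have "(ennreal (xsb_weight (s - 1) (- a) ze*cmod (ft H ze)))^2 <= (ennreal C1*(md a ze*(NT mu. ennreal (ckern T (fst ze - mu))*V (mu, snd ze))))^2"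
    by (rule power_mono) simp
   then show "ennreal ((xsb_weight (s - 1) (- a) ze*cmod (ft H ze))^2) <= (ennreal C1)^2*(md a ze*(NT mu. ennreal (ckern T (fst ze - mu))*V (mu, snd ze)))^2"
    unfolding power_mult_distrib[of "ennreal C1"] using xsb_weight_pos[of "s - 1" "- a" ze] by (simp add: ennreal_power)
  qed
  also have "... = (ennreal C1)^2*(NF ze. (md a ze*(NT mu. ennreal (ckern T (fst ze - mu))*V (mu, snd ze)))^2)"
  proof (rule nn_integral_cmult)
   have "(%ta. (NT mu. ennreal (ckern T (ta - mu))*V (mu, n))) : BM borel" for n
   proof -
    have [measurable]: "(%mu. V (mu, n)) : BM borel" using Vm unfolding meas_fm_iff by blast
    have [measurable]: "ckern T : BM borel" unfolding ckern_def[abs_def] by measurable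
    show ?thesis by (rule lborel.borel_measurable_nn_integral) measurable
   qed
   then have [measurable]: "(%ze. (NT mu. ennreal (ckern T (fst ze - mu))*V (mu, snd ze))) : BM fm"
    unfolding meas_fm_iff by simp
   show "(%ze. (md a ze*(NT mu. ennreal (ckern T (fst ze - mu))*V (mu, snd ze)))^2) : BM fm" by measurable
  qed
  also have "... <= (ennreal C1)^2*(ennreal (C2*T powr (2*(a - a')))*ennreal ((c3^2 * sqrt C3 * R)^2))"
   by (intro mult_left_mono order_trans[OF gain[OF Vm T] mult_left_mono[OF V2]]) auto
  also have "... = ennreal ((C*T powr (a - a') * R)^2)"
  proof -
   have "T powr (2*(a - a')) = (T powr (a - a'))^2" by (simp add: power2_eq_square flip: powr_add)
   then have "C1^2*(C2*T powr (2*(a - a'))*(c3^2 * sqrt C3 * R)^2) = (C*T powr (a - a') * R)^2"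
    using C2 by (simp add: C_def power_mult_distrib)
   moreover have "(ennreal C1)^2*(ennreal (C2*T powr (2*(a - a')))*ennreal ((c3^2 * sqrt C3 * R)^2)) = ennreal (C1^2*(C2*T powr (2*(a - a'))*(c3^2 * sqrt C3 * R)^2))"
    using C1 C2 by (simp add: ennreal_power ennreal_mult)
   ultimately show ?thesis by (simp only:)
  qed
  finally have "wmass (s - 1) (- a) (ft H) (C*T powr (a - a') * R)"
   unfolding wmass_def using ft_measurable[OF schwartz_integrable[OF H]] by simp
  then show ?thesis unfolding H_def[abs_def] G_def R_def .
 qed
 then show ?thesis using C by blast
qed

section \<open>Approximation by Schwartz functions\<close>

lemma wmass_mono: "wmass s b F A ==> 0 <= A ==> A <= B ==> wmass s b F B"
 unfolding wmass_def by (auto elim!: order_trans intro!: ennreal_leI power_mono)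

lemma l2_of_wmass:
 assumes "wmass s b F A" "0 <= s" "0 <= b"
 shows "(NF xi. ennreal ((cmod (F xi))^2)) <= ennreal (A^2)"
proof -
 have "(NF xi. ennreal ((cmod (F xi))^2)) <= (NF xi. ennreal ((xsb_weight s b xi*cmod (F xi))^2))"
 proof (intro nn_integral_mono ennreal_leI power_mono)
  fix xi show "cmod (F xi) <= xsb_weight s b xi*cmod (F xi)"
   using mult_right_mono[OF xsb_weight_ge_1[OF assms(2,3), of xi] norm_ge_zero[of "F xi"]] by simp
 qed simp
 then show ?thesis by (rule order_trans) (use assms(1) in \<open>simp add: wmass_def\<close>)
qed

lemma norm_pairing_le:
 assumes [measurable]: "F : BM fm" "G : BM fm" and i: "integrable fm (%xi. F xi*G (- xi))"
  and F: "(NF xi. ennreal ((cmod (F xi))^2)) <= ennreal (A^2)" and G: "(NF xi. ennreal ((cmod (G xi))^2)) <= ennreal (B^2)"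
  and AB: "0 <= A" "0 <= B"
 shows "cmod (BF xi. F xi*G (- xi)) <= A*B"
proof -
 have "(NF xi. ennreal (cmod (F xi))*ennreal (cmod (G (- xi))))^2 <= (NF xi. (ennreal (cmod (F xi)))^2)*(NF xi. (ennreal (cmod (G (- xi))))^2)"
  by (rule Cauchy_Schwarz_nn_integral) measurable
 also have "(NF xi. (ennreal (cmod (G (- xi))))^2) = (NF xi. (ennreal (cmod (G xi)))^2)"
  by (rule nn_integral_fm_uminus) measurable
 also have "(NF xi. (ennreal (cmod (F xi)))^2)*(NF xi. (ennreal (cmod (G xi)))^2) <= ennreal (A^2)*ennreal (B^2)"
  using F G by (intro mult_mono) (auto simp: ennreal_power)
 also have "... = ennreal ((A*B)^2)" unfolding power_mult_distrib by (rule ennreal_mult[symmetric]) auto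
 finally have *: "(NF xi. ennreal (cmod (F xi))*ennreal (cmod (G (- xi)))) <= ennreal (A*B)"
  by (rule ennreal_square_le) (use AB in simp)
 have "ennreal (cmod (BF xi. F xi*G (- xi))) <= (NF xi. ennreal (cmod (F xi*G (- xi))))"
  by (rule integral_norm_bound_ennreal[OF i])
 also have "... <= ennreal (A*B)" using*by (simp add: norm_mult ennreal_mult)
 finally show ?thesis using AB by (subst (asm) ennreal_le_iff) auto
qed

text \<open>The definition of the norm chooses some transform of \<open>U\<close> and some transform of the error. By uniqueness their
difference is the transform of the Schwartz approximant, so that the norms can be added.\<close>

lemma ft_eq_of_has_ft:
 assumes ph: "ph : schwartz" and s: "0 <= s" "s <= 1" and b: "0 <= b" "b <= 1"
  and U: "has_ft U F" and V: "has_ft (%ps. U ps - dist_of ph ps) H"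
  and F: "wmass s b F A" "0 <= A" and H: "wmass s b H B" "0 <= B"
 shows "AE xi in fm. ft ph xi = F xi - H xi"
proof -
 note d = has_ft_dist_of[OF schwartz_integrable[OF ph]]
 note [measurable] = wmass_measurable[OF F(1)] wmass_measurable[OF H(1)] ft_measurable[OF schwartz_integrable[OF ph]]
 define D where "D xi = F xi - H xi - ft ph xi" for xi
 have Dm[measurable]: "D : BM fm" unfolding D_def by measurable
 obtain M where M: "0 <= M" "wmass s b (ft ph) M" using schwartz_wmass[OF ph s(2) b(2)] by blast
 have 1: "wmass s b (%xi. F xi - H xi) (A + B)"
  by (rule wmass_le_add[OF F(1) H(1) F(2) H(2)]) (auto intro: norm_triangle_ineq4)
 have "wmass s b D (A + B + M)"
  by (rule wmass_le_add[OF 1 M(2) _ M(1) Dm]) (use F H in \<open>auto simp: D_def intro: norm_triangle_ineq4\<close>)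
 from l2_of_wmass[OF this s(1) b(1)] have fin: "(NF xi. ennreal ((cmod (D xi))^2)) < \<top>" by (rule le_less_trans) simp
 have i: "integrable fm (%xi. F xi*ft ps (- xi))" "integrable fm (%xi. H xi*ft ps (- xi))" "integrable fm (%xi. ft ph xi*ft ps (- xi))"
  if "ps : schwartz" for ps using U V d that unfolding has_ft_iff by blast+
 have e: "(%xi. D xi*ft ps (- xi)) = (%xi. F xi*ft ps (- xi) - H xi*ft ps (- xi) - ft ph xi*ft ps (- xi))" for ps
  by (auto simp: D_def algebra_simps)
 have "AE xi in fm. D xi = 0"
 proof (rule ft_separates[OF Dm fin])
  fix ps assume ps: "ps : schwartz"
  show "integrable fm (%xi. D xi*ft ps (- xi))" unfolding e using i[OF ps] by simp
  define k where "k = complex_of_real c3"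
  have k: "k ~= 0" using c3_pos by (simp add: k_def)
  have u: "U ps = k*(BF xi. F xi*ft ps (- xi))" "U ps - dist_of ph ps = k*(BF xi. H xi*ft ps (- xi))" "dist_of ph ps = k*(BF xi. ft ph xi*ft ps (- xi))"
   using U V d ps unfolding has_ft_iff k_def c3_def scaleR_conv_of_real by blast+
  have "(BF xi. D xi*ft ps (- xi)) = (BF xi. F xi*ft ps (- xi)) - (BF xi. H xi*ft ps (- xi)) - (BF xi. ft ph xi*ft ps (- xi))"
   unfolding e using i[OF ps] by simp
  then have "k*(BF xi. D xi*ft ps (- xi)) = 0"
   unfolding right_diff_distrib[of k] by (simp only: right_diff_distrib u(2)[symmetric] u(3)[symmetric]) (simp add: u(1))
  then show "(BF xi. D xi*ft ps (- xi)) = 0" using k by simp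
 qed
 then show ?thesis by eventually_elim (simp add: D_def algebra_simps)
qed

lemma xsb_norm_lessD:
 assumes "xsb_norm s b U < ennreal A" "0 < A"
 shows "EX F A0. has_ft U F & wmass s b F A0 & 0 <= A0 & A0 < A"
proof -
 obtain F where F: "has_ft U F" and l: "l2_norm (%z. of_real (xsb_weight s b z)*F z) < ennreal A"
  using assms(1) unfolding xsb_norm_def INF_less_iff by blast
 then obtain A0 where A0: "0 <= A0" "l2_norm (%z. of_real (xsb_weight s b z)*F z) = ennreal A0"
  by (cases "l2_norm (%z. of_real (xsb_weight s b z)*F z)") auto
 have "F : BM fm" using F by (simp add: has_ft_iff)
 then have "wmass s b F A0" using wmass_l2_norm[OF _ A0(1), of F s b] A0(2) by simp
 moreover have "A0 < A" using l A0 by (simp add: ennreal_less_iff)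
 ultimately show ?thesis using F A0(1) by blast
qed

text \<open>A sequence of Schwartz functions that converges to \<open>U\<close> at a fixed geometric rate, fast enough for convergence
almost everywhere.\<close>

definition approximates :: "real => real => (nat => spacetime => complex) => functional => real => bool" where
 "approximates s b ph U A \<longleftrightarrow> (ALL j. ph j : schwartz & wmass s b (ft (ph j)) A) &
   (ALL i j. wmass s b (ft (%z. ph i z - ph j z)) ((1/8) ^ i + (1/8) ^ j)) &
   (ALL ps:schwartz. (%j. dist_of (ph j) ps) \<longlonglongrightarrow> U ps)"

theorem approximating_sequence:
 assumes s: "0 <= s" "s <= 1" and b: "0 <= b" "b <= 1" and U: "U : Xsb s b" and less: "xsb_norm s b U < ennreal A" and A: "0 < A"
 shows "EX ph. approximates s b ph U A"
proof -
 obtain F A0 where F: "has_ft U F" "wmass s b F A0" and A0: "0 <= A0" "A0 < A" using xsb_norm_lessD[OF less A] by blast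
 \<comment> \<open>small enough to keep the norms of the approximants below \<open>A\<close>\<close>
 define e where "e j = min ((1/8) ^ j) (A - A0)" for j :: nat
 have e: "0 < e j" "e j <= (1/8) ^ j" "A0 + e j <= A" for j using A0 by (auto simp: e_def)
 have "EX ph:schwartz. xsb_norm s b (%ps. U ps - dist_of ph ps) < ennreal (e j)" for j
 proof -
  have "0 < ennreal (e j)" using e(1)[of j] by simp
  then show ?thesis using U unfolding Xsb_def by blast
 qed
 then obtain ph where ph: "!!j. ph j : schwartz" and n: "!!j. xsb_norm s b (%ps. U ps - dist_of (ph j) ps) < ennreal (e j)" by metis
 have "EX H. has_ft (%ps. U ps - dist_of (ph j) ps) H & wmass s b H (e j)" for j
  using xsb_norm_lessD[OF n[of j] e(1)] wmass_mono by (meson less_imp_le)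
 then obtain H where H: "!!j. has_ft (%ps. U ps - dist_of (ph j) ps) (H j)" "!!j. wmass s b (H j) (e j)" by metis
 note ej = less_imp_le[OF e(1)]
 have eq: "AE xi in fm. ft (ph j) xi = F xi - H j xi" for j
  by (rule ft_eq_of_has_ft[OF ph s b F(1) H(1) F(2) A0(1) H(2) ej])
 note fmm = ft_measurable[OF schwartz_integrable]
 have "wmass s b (ft (ph j)) A" for j
 proof (rule wmass_mono)
  show "wmass s b (ft (ph j)) (A0 + e j)"
  proof (rule wmass_le_add[OF F(2) H(2) A0(1) ej fmm[OF ph]])
   show "AE xi in fm. cmod (ft (ph j) xi) <= cmod (F xi) + cmod (H j xi)"
    using eq[of j] by eventually_elim (simp add: norm_triangle_ineq4)
  qed
  show "0 <= A0 + e j" using A0 ej[of j] by simp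
 qed (rule e)
 moreover have "wmass s b (ft (%z. ph i z - ph j z)) ((1/8) ^ i + (1/8) ^ j)" for i j
 proof (rule wmass_le_add[OF wmass_mono[OF H(2) ej e(2)] wmass_mono[OF H(2) ej e(2)]])
  show "AE xi in fm. cmod (ft (%z. ph i z - ph j z) xi) <= cmod (H i xi) + cmod (H j xi)"
   using eq[of i] eq[of j]
  proof eventually_elim
   case (elim xi)
   have "ft (%z. ph i z - ph j z) xi = H j xi - H i xi"
    using elim ft_diff[OF schwartz_integrable[OF ph[of i]] schwartz_integrable[OF ph[of j]], of xi] by simp
   then show ?case using norm_triangle_ineq4[of "H j xi" "H i xi"] by simp
  qed
 qed (auto intro: fmm schwartz_diff ph)
 moreover have "(%j. dist_of (ph j) ps) \<longlonglongrightarrow> U ps" if ps: "ps : schwartz" for ps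
 proof -
  obtain B where B: "0 <= B" "wmass 0 0 (ft ps) B" using schwartz_wmass[OF ps, of 0 0] by auto
  have bd: "cmod (dist_of (ph j) ps - U ps) <= c3*B*(1/8) ^ j" for j
  proof -
   have i: "integrable fm (%xi. H j xi*ft ps (- xi))" "U ps - dist_of (ph j) ps = of_real c3*(BF xi. H j xi*ft ps (- xi))"
    using H(1)[of j] ps unfolding has_ft_iff c3_def scaleR_conv_of_real by blast+
   have "cmod (dist_of (ph j) ps - U ps) = c3*cmod (BF xi. H j xi*ft ps (- xi))"
    using i(2) c3_pos by (simp add: norm_minus_commute norm_mult)
   also have "... <= c3*((1/8) ^ j*B)"
    using c3_pos by (intro mult_left_mono norm_pairing_le wmass_measurable[OF H(2)] wmass_measurable[OF B(2)] i(1)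
     l2_of_wmass[OF wmass_mono[OF H(2) ej e(2)] s(1) b(1)] l2_of_wmass[OF B(2)] B(1)) auto
   finally show ?thesis by (simp add: mult_ac)
  qed
  have z0: "(%j. c3*B*(1/8) ^ j) \<longlonglongrightarrow> 0" by (intro tendsto_mult_right_zero LIMSEQ_power_zero) simp
  have "(%j. dist_of (ph j) ps - U ps) \<longlonglongrightarrow> 0"
   by (rule Lim_null_comparison[OF always_eventually z0]) (use bd in blast)
  then show ?thesis by (simp add: LIM_zero_iff)
 qed
 ultimately show ?thesis using ph unfolding approximates_def by blast
qed

lemma schwartz_l2_le:
 assumes ph: "ph : schwartz" and "wmass s b (ft ph) A" "0 <= s" "0 <= b"
 shows "(NS z. ennreal ((cmod (ph z))^2)) <= ennreal (c3*A^2)"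
proof -
 have "(NS z. ennreal ((cmod (ph z))^2)) <= ennreal c3*(NF xi. ennreal ((cmod (ft ph xi))^2))"
  using plancherel_le[OF ft_schwartz_integrable[OF ph]] unfolding inv_ft_ft[OF ph] .
 also have "... <= ennreal c3*ennreal (A^2)" by (intro mult_left_mono l2_of_wmass[OF assms(2-4)]) simp
 finally show ?thesis using c3_pos by (simp add: ennreal_mult)
qed

lemma power_mean_fatou:
 fixes ph :: "nat => spacetime => complex"
 assumes [measurable]: "!!j. ph j : BM borel" "f : BM borel"
  and lim: "AE z in sl. (%j. ph j z) \<longlonglongrightarrow> f z" and le: "!!j. j >= N ==> (NS z. ennreal ((cmod (ph j z)) ^ p)) <= ennreal B"
 shows "(NS z. ennreal ((cmod (f z)) ^ p)) <= ennreal B"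
proof -
 have "(NS z. ennreal ((cmod (f z)) ^ p)) = (NS z. liminf (%j. ennreal ((cmod (ph j z)) ^ p)))"
 proof (rule nn_integral_cong_AE)
  show "AE z in sl. ennreal ((cmod (f z)) ^ p) = liminf (%j. ennreal ((cmod (ph j z)) ^ p))"
   using lim by eventually_elim (intro lim_imp_Liminf[symmetric] tendsto_ennrealI tendsto_power tendsto_norm, auto)
 qed
 also have "... <= liminf (%j. (NS z. ennreal ((cmod (ph j z)) ^ p)))"
  by (rule nn_integral_liminf) measurable
 also have "... <= ennreal B" by (intro Liminf_le eventually_mono[OF eventually_ge_at_top[of N]] le) auto
 finally show ?thesis .
qed

text \<open>The differences are geometrically small in \<open>L\<^sup>3\<close>; hence a weighted sum of their cubes is integrable and the
sequence converges almost everywhere. The bounds follow from Fatou's lemma.\<close>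

theorem approximation_limit:
 assumes s: "1/4 < s" and b: "1/2 < b" and A: "0 <= A" and C0: "0 <= C"
  and C: "!!ph A. ph : schwartz ==> 0 <= A ==> wmass s b (ft ph) A ==> (NS z. ennreal ((cmod (ph z)) ^ 3)) <= ennreal (C*A ^ 3)"
  and ph: "approximates s b ph U A"
 shows "EX f:BM borel. (AE z in sl. (%j. ph j z) \<longlonglongrightarrow> f z) &
  (NS z. ennreal ((cmod (f z)) ^ 3)) <= ennreal (C*A ^ 3) &
  (ALL j. (NS z. ennreal ((cmod (ph j z - f z)) ^ 3)) <= ennreal (C*(2*(1/8) ^ j) ^ 3)) &
  (ALL j. (NS z. ennreal ((cmod (ph j z - f z))^2)) <= ennreal (c3*(2*(1/8) ^ j)^2))"
proof -
 have sch: "ph j : schwartz" and m: "wmass s b (ft (ph j)) A" and d: "wmass s b (ft (%z. ph i z - ph j z)) ((1/8) ^ i + (1/8) ^ j)" for i j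
  using ph unfolding approximates_def by blast+
 have [measurable]: "ph j : BM borel" for j by (rule schwartz_measurable[OF sch])
 have d2: "wmass s b (ft (%z. ph j z - ph i z)) (2*(1/8) ^ j)" if "j <= i" for i j
 proof (rule wmass_mono[OF d])
  have "(1/8) ^ i <= ((1/8) ^ j :: real)" using that by (intro power_decreasing) auto
  then show "(1/8) ^ j + (1/8) ^ i <= 2*((1/8) ^ j :: real)" by simp
 qed simp
 have l3: "(NS z. ennreal ((cmod (ph j z - ph i z)) ^ 3)) <= ennreal (C*(2*(1/8) ^ j) ^ 3)" if "j <= i" for i j
  by (rule C[OF schwartz_diff[OF sch sch] _ d2[OF that]]) simp
 have "(NS z. (\<Sum>j. ennreal (8 ^ j*(cmod (ph j z - ph (Suc j) z)) ^ 3))) = (\<Sum>j. (NS z. ennreal (8 ^ j)*ennreal ((cmod (ph j z - ph (Suc j) z)) ^ 3)))"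
  by (subst nn_integral_suminf) (auto simp: ennreal_mult)
 also have "... = (\<Sum>j. ennreal (8 ^ j)*(NS z. ennreal ((cmod (ph j z - ph (Suc j) z)) ^ 3)))"
  by (intro suminf_cong nn_integral_cmult) measurable
 also have "... <= (\<Sum>j. ennreal (8*C*(1/64) ^ j))"
 proof (intro suminf_le summableI)
  fix j
  have "ennreal (8 ^ j)*(NS z. ennreal ((cmod (ph j z - ph (Suc j) z)) ^ 3)) <= ennreal (8 ^ j)*ennreal (C*(2*(1/8) ^ j) ^ 3)"
   by (intro mult_left_mono l3) auto
  also have "... = ennreal (8 ^ j*(C*(2*(1/8) ^ j) ^ 3))" by (rule ennreal_mult[symmetric]) (use C0 in auto)
  also have "8 ^ j*(C*(2*(1/8) ^ j) ^ 3) = 8*C*(1/64) ^ j"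
  proof -
   have "8 ^ j*((1/8) ^ j*((1/8) ^ j*(1/8) ^ j)) = ((1/64) ^ j :: real)"
    unfolding power_mult_distrib[symmetric] by simp
   then show ?thesis by (simp add: power3_eq_cube mult_ac)
  qed
  finally show "ennreal (8 ^ j)*(NS z. ennreal ((cmod (ph j z - ph (Suc j) z)) ^ 3)) <= ennreal (8*C*(1/64) ^ j)" .
 qed
 also have "... = ennreal (\<Sum>j. 8*C*(1/64) ^ j)" using C0 by (intro suminf_ennreal2 summable_mult summable_geometric) auto
 also have "... < \<infinity>" by simp
 finally have "(NS z. (\<Sum>j. ennreal (8 ^ j*(cmod (ph j z - ph (Suc j) z)) ^ 3))) ~= \<infinity>" by simp
 then have "AE z in sl. (\<Sum>j. ennreal (8 ^ j*(cmod (ph j z - ph (Suc j) z)) ^ 3)) ~= \<infinity>"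
  by (intro nn_integral_noteq_infinite) measurable
 then have conv: "AE z in sl. convergent (%j. ph j z)"
 proof eventually_elim
  case (elim z)
  define X where "X = (\<Sum>j. ennreal (8 ^ j*(cmod (ph j z - ph (Suc j) z)) ^ 3))"
  have "X ~= \<infinity>" unfolding X_def by (rule elim)
  then obtain M where M: "0 <= M" "X = ennreal M" by (cases X) auto
  define m where "m = root 3 M"
  have m: "0 <= m" "m ^ 3 = M" using M by (simp_all add: m_def odd_real_root_pow)
  have inc: "cmod (ph (Suc j) z - ph j z) <= m*(1/2) ^ j" for j
  proof -
   let ?g = "%j. ennreal (8 ^ j*(cmod (ph j z - ph (Suc j) z)) ^ 3)"
   have "?g j = (\<Sum>i\<in>{j}. ?g i)" by simp
   also have "... <= (\<Sum>i. ?g i)" by (rule sum_le_suminf) auto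
   finally have "8 ^ j*(cmod (ph j z - ph (Suc j) z)) ^ 3 <= M" unfolding X_def[symmetric] M(2) using M(1) by (subst (asm) ennreal_le_iff)
   moreover have "(2 ^ j*cmod (ph j z - ph (Suc j) z)) ^ 3 = 8 ^ j*(cmod (ph j z - ph (Suc j) z)) ^ 3"
   proof -
    have "((2::real) ^ j) ^ 3 = 8 ^ j" by (simp add: power_mult[symmetric] mult.commute[of j] power_mult)
    then show ?thesis by (simp only: power_mult_distrib)
   qed
   ultimately have "(2 ^ j*cmod (ph j z - ph (Suc j) z)) ^ 3 <= m ^ 3" by (simp only: m)
   then have "2 ^ j*cmod (ph j z - ph (Suc j) z) <= m" using m(1) by (subst (asm) power_mono_iff) auto
   then show ?thesis by (simp add: norm_minus_commute power_one_over field_simps)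
  qed
  have "summable (%j. ph (Suc j) z - ph j z)"
  proof (rule summable_comparison_test'[of "%j. m*(1/2) ^ j" 0])
   show "summable (%j. m*(1/2) ^ j)" by (rule summable_mult, rule summable_geometric) simp
  qed (rule inc)
  then have "(%n. \<Sum>j<n. ph (Suc j) z - ph j z) \<longlonglongrightarrow> (\<Sum>j. ph (Suc j) z - ph j z)" by (rule summable_LIMSEQ)
  then have "(%n. ph n z - ph 0 z) \<longlonglongrightarrow> (\<Sum>j. ph (Suc j) z - ph j z)" by (simp only: sum_lessThan_telescope[of "%j. ph j z"])
  from tendsto_add[OF tendsto_const[of "ph 0 z"] this] have "(%n. ph n z) \<longlonglongrightarrow> ph 0 z + (\<Sum>j. ph (Suc j) z - ph j z)" by simp
  then show ?case by (auto simp: convergent_def)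
 qed
 define f where "f z = lim (%j. ph j z)" for z
 have fm'[measurable]: "f : BM borel" unfolding f_def by measurable
 have lim: "AE z in sl. (%j. ph j z) \<longlonglongrightarrow> f z" using conv by eventually_elim (simp add: f_def convergent_LIMSEQ_iff)
 have limd: "AE z in sl. (%i. ph j z - ph i z) \<longlonglongrightarrow> ph j z - f z" for j
  using lim by eventually_elim (intro tendsto_diff tendsto_const)
 have "(NS z. ennreal ((cmod (f z)) ^ 3)) <= ennreal (C*A ^ 3)"
  by (rule power_mean_fatou[OF _ fm' lim, of 0]) (auto intro: C[OF sch A m])
 moreover have "(NS z. ennreal ((cmod (ph j z - f z)) ^ 3)) <= ennreal (C*(2*(1/8) ^ j) ^ 3)" for j
  by (rule power_mean_fatou[OF _ _ limd, where N=j]) (measurable, rule l3, assumption)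
 moreover have "(NS z. ennreal ((cmod (ph j z - f z))^2)) <= ennreal (c3*(2*(1/8) ^ j)^2)" for j
  by (rule power_mean_fatou[OF _ _ limd, where N=j]) (measurable, rule schwartz_l2_le[OF schwartz_diff[OF sch sch] d2], assumption, use s b in auto)
 ultimately show ?thesis using lim fm' by blast
qed

section \<open>Extensions and their restriction\<close>

lemma young_product:
 fixes x y w :: real assumes "0 <= x" "0 <= y" "0 <= w"
 shows "x*(y*w) <= x ^ 3 + (y ^ 3 + w ^ 3)"
proof -
 define m where "m = max x (max y w)"
 have m: "x <= m" "y <= m" "w <= m" "0 <= m" using assms by (auto simp: m_def)
 have "x*(y*w) <= m*(m*m)" using assms m by (intro mult_mono) auto
 also have "... = m ^ 3" by (simp add: power3_eq_cube)
 also have "... <= x ^ 3 + (y ^ 3 + w ^ 3)"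
  using zero_le_power[OF assms(1), of 3] zero_le_power[OF assms(2), of 3] zero_le_power[OF assms(3), of 3]
  unfolding m_def by (auto simp: max_def)
 finally show ?thesis .
qed

lemma ennreal_combination:
 "0 <= p ==> 0 <= x ==> 0 <= q ==> 0 <= y ==> 0 <= w ==>
  ennreal (p*x + q*(y + w)) = ennreal p*ennreal x + ennreal q*(ennreal y + ennreal w)"
 by (simp add: ennreal_plus ennreal_mult)

text \<open>The free parameter makes a product small when one factor is small and the others are only bounded, which
avoids the Hoelder inequality with three factors.\<close>

lemma l1_product:
 assumes [measurable]: "f : BM borel" "g : BM borel" "h : BM borel" and ka: "0 < ka"
  and f: "(NS z. ennreal ((cmod (f z)) ^ 3)) <= ennreal X" and g: "(NS z. ennreal ((cmod (g z)) ^ 3)) <= ennreal Y"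
  and h: "(NS z. ennreal ((cmod (h z)) ^ 3)) <= ennreal Z" and XYZ: "0 <= X" "0 <= Y" "0 <= Z"
 shows "(NS z. ennreal (cmod (f z*(g z*h z)))) <= ennreal (1 / ka ^ 6*X + ka ^ 3*(Y + Z))"
proof -
 have "(NS z. ennreal (cmod (f z*(g z*h z))))
   <= (NS z. ennreal (1 / ka ^ 6)*ennreal ((cmod (f z)) ^ 3) + ennreal (ka ^ 3)*(ennreal ((cmod (g z)) ^ 3) + ennreal ((cmod (h z)) ^ 3)))"
 proof (rule nn_integral_mono)
  fix z
  let ?f = "cmod (f z)" and ?g = "cmod (g z)" and ?h = "cmod (h z)"
  have "?f*(?g*?h) = (?f / ka\<^sup>2)*((ka*?g)*(ka*?h))" using ka by (simp add: power2_eq_square)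
  also have "... <= (?f / ka\<^sup>2) ^ 3 + ((ka*?g) ^ 3 + (ka*?h) ^ 3)" by (rule young_product) (use ka in auto)
  also have "... = 1 / ka ^ 6*?f ^ 3 + ka ^ 3*(?g ^ 3 + ?h ^ 3)"
   by (simp add: power_divide power_mult_distrib distrib_left flip: power_mult)
  finally have "ennreal (cmod (f z*(g z*h z))) <= ennreal (1 / ka ^ 6*?f ^ 3 + ka ^ 3*(?g ^ 3 + ?h ^ 3))"
   by (intro ennreal_leI) (simp add: norm_mult)
  also have "... = ennreal (1 / ka ^ 6)*ennreal (?f ^ 3) + ennreal (ka ^ 3)*(ennreal (?g ^ 3) + ennreal (?h ^ 3))"
   using ka by (intro ennreal_combination) auto
  finally show "ennreal (cmod (f z*(g z*h z))) <= ennreal (1 / ka ^ 6)*ennreal (?f ^ 3) + ennreal (ka ^ 3)*(ennreal (?g ^ 3) + ennreal (?h ^ 3))" .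
 qed
 also have "... = ennreal (1 / ka ^ 6)*(NS z. ennreal ((cmod (f z)) ^ 3)) + ennreal (ka ^ 3)*((NS z. ennreal ((cmod (g z)) ^ 3)) + (NS z. ennreal ((cmod (h z)) ^ 3)))"
  by (simp add: nn_integral_add nn_integral_cmult)
 also have "... <= ennreal (1 / ka ^ 6)*ennreal X + ennreal (ka ^ 3)*(ennreal Y + ennreal Z)"
  by (intro add_mono mult_left_mono f g h) auto
 also have "... = ennreal (1 / ka ^ 6*X + ka ^ 3*(Y + Z))"
  using ka XYZ by (intro ennreal_combination[symmetric]) auto
 finally show ?thesis .
qed

lemma tempered_dist_of:
 assumes g: "integrable sl g" shows "tempered (dist_of g)"
 unfolding tempered_def
proof (intro conjI ballI allI impI)
 have [measurable]: "g : BM borel" using borel_measurable_integrable[OF g] by simp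
 have i: "integrable sl (%z. g z*ps z)" if ps: "ps : schwartz" for ps
 proof -
  note [measurable] = schwartz_measurable[OF ps]
  obtain B where B: "!!z. cmod (ps z) <= B" using schwartz_bdd[OF ps, of 0, unfolded power_0 mult_1_left] by blast
  have B0: "0 <= B" using order_trans[OF norm_ge_zero B] .
  have le: "cmod (g z*ps z) <= cmod (of_real B*g z)" for z
   using mult_left_mono[OF B norm_ge_zero, of "g z" z] B0 by (simp add: norm_mult mult.commute)
  show ?thesis
   by (rule Bochner_Integration.integrable_bound[OF integrable_mult_right[OF g, of "of_real B"]])
     (measurable, rule AE_I2, rule le)
 qed
 fix ph ps c assume ph: "ph : schwartz"
 show "dist_of g (%z. c*ph z) = c*dist_of g ph"
  unfolding dist_of_eq[OF g schwartz_scale[OF ph]] dist_of_eq[OF g ph] mult.left_commute[of _ c] by (rule integral_mult_right_zero)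
 assume ps: "ps : schwartz"
 show "dist_of g (%z. ph z + ps z) = dist_of g ph + dist_of g ps"
  unfolding dist_of_eq[OF g schwartz_add[OF ph ps]] dist_of_eq[OF g ph] dist_of_eq[OF g ps] distrib_left
  by (rule Bochner_Integration.integral_add[OF i[OF ph] i[OF ps]])
next
 fix Ph assume n: "schwartz_null_seq Ph"
 then have Ph: "Ph j : schwartz" for j by (simp add: schwartz_null_seq_def)
 have u: "uniform_limit UNIV (%j z. \<bar>fst z\<bar> ^ 0 *\<^sub>R iter_deriv [] (Ph j) z) (%z. 0) sequentially"
  using n unfolding schwartz_null_seq_def by blast
 define M where "M = (BS z. cmod (g z)) + 1"
 have M: "0 < M" unfolding M_def by (intro add_nonneg_pos Bochner_Integration.integral_nonneg) auto
 show "(%j. dist_of g (Ph j)) \<longlonglongrightarrow> 0"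
 proof (rule tendstoI)
  fix e :: real assume e: "0 < e"
  have "\<forall>\<^sub>F j in sequentially. ALL z:UNIV. dist (\<bar>fst z\<bar> ^ 0 *\<^sub>R iter_deriv [] (Ph j) z) 0 < e / M"
   using u e M unfolding uniform_limit_iff by simp
  then show "\<forall>\<^sub>F j in sequentially. dist (dist_of g (Ph j)) 0 < e"
  proof eventually_elim
   case (elim j)
   have le: "cmod (Ph j z) <= e / M" for z using bspec[OF elim UNIV_I[of z]] by simp
   have "cmod (dist_of g (Ph j)) <= (BS z. cmod (g z*Ph j z))"
    unfolding dist_of_eq[OF g Ph] by (rule integral_norm_bound)
   also have "... <= (BS z. cmod (g z)*(e / M))"
   proof (rule integral_mono')
    show "integrable sl (%z. cmod (g z)*(e / M))" by (intro integrable_mult_left integrable_norm g)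
    show "cmod (g z*Ph j z) <= cmod (g z)*(e / M)" for z
     unfolding norm_mult by (rule mult_left_mono[OF le norm_ge_zero])
    show "0 <= cmod (g z)*(e / M)" for z using e M by simp
   qed
   also have "... = (M - 1)*(e / M)" by (simp add: M_def)
   also have "... < M*(e / M)" using e M by (intro mult_strict_right_mono) auto
   also have "... = e" using M by simp
   finally show ?case by (simp add: dist_norm)
  qed
 qed
qed

lemma AE_sl_time: "AE z in sl. fst z ~= c"
proof -
 have "AE z in lborel. z \<bullet> ((1, 0, 0) :: spacetime) ~= c" by (intro AE_lborel_inner_neq) (simp add: Basis_prod_def zero_prod_def)
 then have "AE z in lborel. 0 < ennreal (indicator (slab UNIV) z) --> fst z ~= c"
  by eventually_elim (simp add: inner_prod_def)
 then show ?thesis unfolding sl_density by (subst AE_density) auto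
qed

text \<open>A function whose integrability is known on the slab only may fail to be measurable elsewhere; this is its
extension by zero.\<close>

definition on_slab :: "real => (spacetime => complex) => spacetime => complex" where
 "on_slab T u z = indicator (slab {0..T}) z *\<^sub>R u z"

lemma slab_subset: "slab {0..T} \<subseteq> slab UNIV" by (auto simp: slab_def)

lemma integrable_on_slab: "set_integrable lborel (slab {0..T}) u \<longleftrightarrow> integrable lborel (on_slab T u)"
 by (simp add: set_integrable_def on_slab_def[abs_def])

lemma integrable_sl_on_slab:
 assumes "on_slab T u : BM borel"
 shows "integrable sl (on_slab T u) \<longleftrightarrow> set_integrable lborel (slab {0..T}) u"
proof -
 have "(%z. indicator (slab UNIV) z *\<^sub>R on_slab T u z) = on_slab T u"
  using slab_subset[of T] by (auto simp: on_slab_def fun_eq_iff indicator_def)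
 then show ?thesis unfolding integrable_sl[OF assms] integrable_on_slab by (simp only: set_integrable_def)
qed

lemma dist_of_on_slab:
 assumes "ps : test_functions T" shows "dist_of u ps = dist_of (on_slab T u) ps"
proof -
 obtain a b where ab: "0 < a" "b < T" "!!t x y. t \<notin> {a..b} ==> ps (t, x, y) = 0" using assms unfolding test_functions_def by blast
 have "indicator (slab UNIV) z *\<^sub>R (u z*ps z) = indicator (slab UNIV) z *\<^sub>R (on_slab T u z*ps z)" for z
 proof (cases "fst z : {a..b}")
  case True
  then have "z : slab UNIV ==> z : slab {0..T}" using ab by (auto simp: slab_def)
  then show ?thesis by (auto simp: on_slab_def indicator_def)
 next
  case False
  then have "ps z = 0" using ab(3)[of "fst z" "fst (snd z)" "snd (snd z)"] by simp
  then show ?thesis by simp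
 qed
 then show ?thesis unfolding dist_of_def set_lebesgue_integral_def by (rule Bochner_Integration.integral_cong[OF refl])
qed

lemma test_function_outside:
 assumes "ps : test_functions T" "fst z \<notin> {0<..<T}" shows "ps z = 0"
proof -
 obtain a b where ab: "0 < a" "b < T" "!!t x y. t \<notin> {a..b} ==> ps (t, x, y) = 0" using assms unfolding test_functions_def by blast
 then show ?thesis using ab(3)[of "fst z" "fst (snd z)" "snd (snd z)"] assms(2) by auto
qed

text \<open>On test functions supported in \<open>(0, T)\<close> both functions are the distribution \<open>U\<close>: one by restriction, the other
as the limit of the approximants in \<open>L\<^sup>2\<close>.\<close>

theorem extension_limit_eq:
 assumes T: "0 < T" and u: "set_integrable lborel (slab {0..T}) u" and res: "restricts_to T U (dist_of u)"
  and sch: "!!j. ph j : schwartz" and lim: "!!ps. ps : schwartz ==> (%j. dist_of (ph j) ps) \<longlonglongrightarrow> U ps"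
  and f[measurable]: "f : BM borel" and f3: "(NS z. ennreal ((cmod (f z)) ^ 3)) <= ennreal X"
  and l2: "!!j. (NS z. ennreal ((cmod (ph j z - f z))^2)) <= ennreal (c3*(2*(1/8) ^ j)^2)"
 shows "AE z in sl. fst z : {0<..<T} --> on_slab T u z = f z"
proof -
 have ul: "integrable lborel (on_slab T u)" using u by (simp add: integrable_on_slab)
 have um[measurable]: "on_slab T u : BM borel" using borel_measurable_integrable[OF ul] by simp
 have us: "integrable sl (on_slab T u)" using u by (simp add: integrable_sl_on_slab[OF um])
 define f0 where "f0 z = indicator {0<..<T} (fst z) *\<^sub>R f z" for z
 have [measurable]: "f0 : BM borel" unfolding f0_def by measurable
 have f0i: "integrable sl f0"
 proof (rule integrableI_bounded)
  have "(NS z. ennreal (cmod (f0 z))) <= (NS z. indicator {0<..<T} (fst z) + ennreal ((cmod (f z)) ^ 3))"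
  proof (rule nn_integral_mono)
   fix z
   have "cmod (f z) <= 1 + (cmod (f z)) ^ 3"
   proof (cases "cmod (f z) <= 1")
    case False
    then have "cmod (f z) ^ 1 <= (cmod (f z)) ^ 3" by (intro power_increasing) auto
    then show ?thesis by simp
   qed (simp add: add_increasing2)
   from ennreal_leI[OF this] show "ennreal (cmod (f0 z)) <= indicator {0<..<T} (fst z) + ennreal ((cmod (f z)) ^ 3)"
    by (auto simp: f0_def indicator_def ennreal_plus)
  qed
  also have "... = (NS z. indicator {0<..<T} (fst z)) + (NS z. ennreal ((cmod (f z)) ^ 3))"
   by (rule nn_integral_add) measurable
  also have "(NS z. indicator {0<..<T} (fst z)) = (NT t. \<integral>\<^sup>+p. indicator {0<..<T} t \<partial>(tm \<Otimes>\<^sub>M tm))"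
   unfolding sl_def
   by (subst sigma_finite_measure.nn_integral_fst[symmetric]) (auto intro: sigma_finite_pair_measure tm.sigma_finite_measure_axioms)
  also have "... = emeasure (tm \<Otimes>\<^sub>M tm) UNIV*ennreal T"
   using T by (simp add: space_pair_measure nn_integral_cmult mult.commute nn_integral_multc)
  also have "emeasure (tm \<Otimes>\<^sub>M tm) UNIV*ennreal T + (NS z. ennreal ((cmod (f z)) ^ 3)) < \<infinity>"
  proof -
   have "emeasure (tm \<Otimes>\<^sub>M tm) (UNIV \<times> UNIV) = emeasure tm UNIV*emeasure tm UNIV" by (rule tm.emeasure_pair_measure_Times) auto
   then have "emeasure (tm \<Otimes>\<^sub>M tm) UNIV < \<infinity>" by (simp add: emeasure_tm ennreal_mult_less_top)
   then show ?thesis using f3 by (auto simp: ennreal_mult_less_top intro: le_less_trans)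
  qed
  finally show "(NS z. ennreal (cmod (f0 z))) < \<infinity>" .
 qed measurable
 have "AE z in sl. indicator {0<..<T} (fst z) *\<^sub>R on_slab T u z - f0 z = 0"
 proof (rule test_functions_separate[OF T])
  have ui: "integrable sl (%z. indicator {0<..<T} (fst z) *\<^sub>R on_slab T u z)"
   by (rule Bochner_Integration.integrable_bound[OF us]) (measurable, rule AE_I2, simp add: indicator_def)
  show hi: "integrable sl (%z. indicator {0<..<T} (fst z) *\<^sub>R on_slab T u z - f0 z)"
   using ui f0i by simp
  show "indicator {0<..<T} (fst z) *\<^sub>R on_slab T u z - f0 z = 0" if "fst z \<notin> {0<..<T}" for z using that by (simp add: f0_def)
  fix ps assume ps: "ps : test_functions T"
  then have pss: "ps : schwartz" by (simp add: test_functions_def)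
  note [measurable] = schwartz_measurable[OF pss]
  obtain B where B: "!!z. cmod (ps z) <= B" using schwartz_bdd[OF pss, of 0, unfolded power_0 mult_1_left] by blast
  have B0: "0 <= B" using order_trans[OF norm_ge_zero B] .
  have mi: "integrable sl (%z. g z*ps z)" if g: "integrable sl g" for g
  proof (rule Bochner_Integration.integrable_bound[OF integrable_mult_right[OF g, of "of_real B"]])
   note [measurable] = borel_measurable_integrable[OF g]
   show "(%z. g z*ps z) : BM sl" by measurable
   have "cmod (g z*ps z) <= cmod (of_real B*g z)" for z
    using mult_left_mono[OF B norm_ge_zero, of "g z" z] B0 by (simp add: norm_mult mult.commute)
   then show "AE z in sl. cmod (g z*ps z) <= cmod (of_real B*g z)" by (rule AE_I2)
  qed
  have "integrable sl (%z. ps z)" by (rule schwartz_integrable[OF pss])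
  obtain M where M: "0 <= M" "wmass 0 0 (ft ps) M" using schwartz_wmass[OF pss, of 0 0] by auto
  have ps2: "(NS z. ennreal ((cmod (ps z))^2)) <= ennreal (c3*M^2)" by (rule schwartz_l2_le[OF pss M(2)]) auto
  have bd: "cmod (dist_of (ph j) ps - (BS z. f0 z*ps z)) <= 2*c3*M*(1/8) ^ j" for j
  proof -
   note [measurable] = schwartz_measurable[OF sch[of j]]
   have "dist_of (ph j) ps - (BS z. f0 z*ps z) = (BS z. ph j z*ps z - f0 z*ps z)"
    unfolding dist_of_eq[OF schwartz_integrable[OF sch] pss]
    by (rule Bochner_Integration.integral_diff[symmetric, OF mi[OF schwartz_integrable[OF sch]] mi[OF f0i]])
   also have "ennreal (cmod ...) <= (NS z. ennreal (cmod (ph j z*ps z - f0 z*ps z)))"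
    by (rule integral_norm_bound_ennreal[OF Bochner_Integration.integrable_diff[OF mi[OF schwartz_integrable[OF sch]] mi[OF f0i]]])
   also have "... = (NS z. ennreal (cmod (ph j z - f z))*ennreal (cmod (ps z)))"
   proof (rule nn_integral_cong)
    fix z
    have "ph j z*ps z - f0 z*ps z = (ph j z - f z)*ps z"
     using test_function_outside[OF ps, of z] by (cases "fst z : {0<..<T}") (auto simp: f0_def algebra_simps)
    then show "ennreal (cmod (ph j z*ps z - f0 z*ps z)) = ennreal (cmod (ph j z - f z))*ennreal (cmod (ps z))"
     by (simp add: norm_mult ennreal_mult)
   qed
   also have "... <= ennreal (2*c3*M*(1/8) ^ j)"
   proof (rule ennreal_square_le)
    have "(NS z. ennreal (cmod (ph j z - f z))*ennreal (cmod (ps z)))^2 <= (NS z. (ennreal (cmod (ph j z - f z)))^2)*(NS z. (ennreal (cmod (ps z)))^2)"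
     by (rule Cauchy_Schwarz_nn_integral) measurable
    also have "... <= ennreal (c3*(2*(1/8) ^ j)^2)*ennreal (c3*M^2)"
     using l2[of j] ps2 by (intro mult_mono) (auto simp: ennreal_power)
    also have "... = ennreal (c3*(2*(1/8) ^ j)^2*(c3*M^2))"
     by (rule ennreal_mult[symmetric]) (use c3_pos in auto)
    also have "c3*(2*(1/8) ^ j)^2*(c3*M^2) = (2*c3*M*(1/8) ^ j)^2"
     by (simp only: power_mult_distrib power2_eq_square mult_ac)
    finally show "(NS z. ennreal (cmod (ph j z - f z))*ennreal (cmod (ps z)))^2 <= ennreal ((2*c3*M*(1/8) ^ j)^2)" .
   qed (use c3_pos M in simp)
   finally show ?thesis using c3_pos M by (subst (asm) ennreal_le_iff) auto
  qed
  have z0: "(%j. 2*c3*M*(1/8) ^ j) \<longlonglongrightarrow> 0" by (intro tendsto_mult_right_zero LIMSEQ_power_zero) simp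
  have "(%j. dist_of (ph j) ps - (BS z. f0 z*ps z)) \<longlonglongrightarrow> 0"
   by (rule Lim_null_comparison[OF always_eventually z0]) (use bd in blast)
  then have "(%j. dist_of (ph j) ps) \<longlonglongrightarrow> (BS z. f0 z*ps z)" by (simp only: LIM_zero_iff)
  then have "U ps = (BS z. f0 z*ps z)" using lim[OF pss] LIMSEQ_unique by blast
  moreover have "U ps = dist_of (on_slab T u) ps" using res ps dist_of_on_slab[OF ps, of u] by (simp add: restricts_to_def)
  moreover have "dist_of (on_slab T u) ps = (BS z. indicator {0<..<T} (fst z) *\<^sub>R on_slab T u z*ps z)"
   unfolding dist_of_eq[OF us pss]
  proof (rule Bochner_Integration.integral_cong[OF refl])
   fix z show "on_slab T u z*ps z = indicator {0<..<T} (fst z) *\<^sub>R on_slab T u z*ps z"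
    using test_function_outside[OF ps, of z] by (cases "fst z : {0<..<T}") auto
  qed
  ultimately show "(BS z. (indicator {0<..<T} (fst z) *\<^sub>R on_slab T u z - f0 z)*ps z) = 0"
   unfolding left_diff_distrib by (subst Bochner_Integration.integral_diff[OF mi[OF ui] mi[OF f0i]]) simp
 qed
 then show ?thesis by eventually_elim (auto simp: f0_def)
qed

section \<open>The product of three extensions\<close>

lemma has_ft_diff:
 assumes "has_ft U F" "has_ft V G" shows "has_ft (%ps. U ps - V ps) (%xi. F xi - G xi)"
 unfolding has_ft_iff
proof (intro conjI ballI)
 show "(%xi. F xi - G xi) : BM fm" using assms by (auto simp: has_ft_iff)
 fix ps assume ps: "ps : schwartz"
 have i: "integrable fm (%xi. F xi*ft ps (- xi))" "integrable fm (%xi. G xi*ft ps (- xi))"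
  using assms ps unfolding has_ft_iff by blast+
 show "integrable fm (%xi. (F xi - G xi)*ft ps (- xi))" unfolding left_diff_distrib by (rule Bochner_Integration.integrable_diff[OF i])
 have u: "U ps = (1 / (2*pi) ^ 3) *\<^sub>R (BF xi. F xi*ft ps (- xi))" "V ps = (1 / (2*pi) ^ 3) *\<^sub>R (BF xi. G xi*ft ps (- xi))"
  using assms ps unfolding has_ft_iff by blast+
 show "U ps - V ps = (1 / (2*pi) ^ 3) *\<^sub>R (BF xi. (F xi - G xi)*ft ps (- xi))"
  unfolding left_diff_distrib Bochner_Integration.integral_diff[OF i] u scaleR_diff_right ..
qed

lemma xsb_norm_le:
 assumes "has_ft U F" "wmass s b F A" "0 <= A" shows "xsb_norm s b U <= ennreal A"
proof -
 have "xsb_norm s b U <= l2_norm (%z. of_real (xsb_weight s b z)*F z)"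
  unfolding xsb_norm_def using assms(1) by (intro INF_lower) simp
 also have "... <= ennreal A" using wmass_l2_norm[OF wmass_measurable[OF assms(2)] assms(3)] assms(2) by simp
 finally show ?thesis .
qed

text \<open>The extension of the product is the cutoff product of the limits of the approximants. Multilinearity writes the
difference of two approximating products as three products with a small factor each.\<close>

theorem product_extension:
 fixes s b a a' :: real
 assumes s: "1/4 < s" "s <= 1" and b: "1/2 < b" "b <= 1"
  and K0: "0 <= K" and tri: "!!ph1 ph2 ph3 A1 A2 A3. ph1 : schwartz ==> ph2 : schwartz ==> ph3 : schwartz ==> 0 <= A1 ==> 0 <= A2 ==> 0 <= A3 ==>
    wmass s b (ft ph1) A1 ==> wmass s b (ft ph2) A2 ==> wmass s b (ft ph3) A3 ==>
    wmass (s - 1) (- a) (ft (%z. cut T z*(ph1 z*(ph2 z*ph3 z)))) (K*(A1*A2*A3))"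
  and T: "0 < T"
  and u: "!!i. i < 3 ==> set_integrable lborel (slab {0..T}) (u i)" and U: "!!i. i < 3 ==> U i : Xsb s b"
  and res: "!!i. i < 3 ==> restricts_to T (U i) (dist_of (u i))"
  and A: "!!i. i < 3 ==> 0 < A i" "!!i. i < 3 ==> xsb_norm s b (U i) < ennreal (A i)"
 shows "set_integrable lborel (slab {0..T}) (%z. u 0 z*u 1 z*u (2 :: nat) z)"
  and "EX W:Xsb (s - 1) (- a). restricts_to T W (dist_of (%z. u 0 z*u 1 z*u 2 z)) & xsb_norm (s - 1) (- a) W <= ennreal (K*(A 0*A 1*A 2))"
proof -
 have s0: "0 <= s" and b0: "0 <= b" using s b by simp_all
 obtain C where C0: "0 <= C" and C: "!!ph A. ph : schwartz ==> 0 <= A ==> wmass s b (ft ph) A ==> (NS z. ennreal ((cmod (ph z)) ^ 3)) <= ennreal (C*A ^ 3)"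
  using l3_estimate[OF s(1) b(1)] unfolding wmass_def by blast
 have "EX ph. approximates s b ph (U i) (A i)" if "i < 3" for i
  by (rule approximating_sequence[OF s0 s(2) b0 b(2) U[OF that] A(2)[OF that] A(1)[OF that]])
 then obtain ph where ph: "!!i. i < 3 ==> approximates s b (ph i) (U i) (A i)" by metis
 have sch: "ph i j : schwartz" and m: "wmass s b (ft (ph i j)) (A i)" and d: "wmass s b (ft (%z. ph i k z - ph i j z)) ((1/8) ^ k + (1/8) ^ j)"
  and wlim: "ps : schwartz ==> (%j. dist_of (ph i j) ps) \<longlonglongrightarrow> U i ps" if "i < 3" for i j k ps
  using ph[OF that] unfolding approximates_def by blast+
 define Q where "Q i g \<longleftrightarrow> g : BM borel &
  (NS z. ennreal ((cmod (g z)) ^ 3)) <= ennreal (C*A i ^ 3) &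
  (ALL j. (NS z. ennreal ((cmod (ph i j z - g z)) ^ 3)) <= ennreal (C*(2*(1/8) ^ j) ^ 3)) &
  (ALL j. (NS z. ennreal ((cmod (ph i j z - g z))^2)) <= ennreal (c3*(2*(1/8) ^ j)^2))" for i g
 define f where "f i = (SOME g. Q i g)" for i
 have Q: "Q i (f i)" if i: "i < 3" for i
 proof -
  have "EX g. Q i g"
   using approximation_limit[OF s(1) b(1) less_imp_le[OF A(1)[OF i]] C0 C ph[OF i]] unfolding Q_def by blast
  then show ?thesis unfolding f_def by (rule someI_ex)
 qed
 have fm': "f i : BM borel"
  and f3: "(NS z. ennreal ((cmod (f i z)) ^ 3)) <= ennreal (C*A i ^ 3)"
  and d3: "(NS z. ennreal ((cmod (ph i j z - f i z)) ^ 3)) <= ennreal (C*(2*(1/8) ^ j) ^ 3)"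
  and d2: "(NS z. ennreal ((cmod (ph i j z - f i z))^2)) <= ennreal (c3*(2*(1/8) ^ j)^2)" if i: "i < 3" for i j
  using Q[OF i] unfolding Q_def by blast+
 have [measurable]: "f 0 : BM borel" "f 1 : BM borel" "f 2 : BM borel"
  by (rule fm', simp)+
 have phm[measurable]: "ph 0 j : BM borel" "ph 1 j : BM borel" "ph 2 j : BM borel" for j
  by (rule schwartz_measurable[OF sch], simp)+
 have uf: "AE z in sl. fst z : {0<..<T} --> on_slab T (u i) z = f i z" if i: "i < 3" for i
  by (rule extension_limit_eq[OF T u[OF i] res[OF i] sch[OF i] wlim[OF i] fm'[OF i] f3[OF i] d2[OF i]])
 define A' where "A' = max (A 0) (max (A 1) (A 2))"
 have A': "0 <= A'" "A i <= A'" if "i < 3" for i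
 proof -
  show "0 <= A'" using A(1)[of 0] by (simp add: A'_def)
  have "i = 0 | i = 1 | i = 2" using that by auto
  then show "A i <= A'" by (auto simp: A'_def)
 qed
 have A0': "0 <= A'" using A'(1)[of 0] by simp
 have f3': "(NS z. ennreal ((cmod (f i z)) ^ 3)) <= ennreal (C*A' ^ 3)" if i: "i < 3" for i
  by (rule order_trans[OF f3[OF i]]) (intro ennreal_leI mult_left_mono power_mono A'[OF i] C0 less_imp_le[OF A(1)[OF i]])
 have m': "wmass s b (ft (ph i j)) A'" if i: "i < 3" for i j
  by (rule wmass_mono[OF m[OF i] less_imp_le[OF A(1)[OF i]] A'(2)[OF i]])
 have p3': "(NS z. ennreal ((cmod (ph i j z)) ^ 3)) <= ennreal (C*A' ^ 3)" if i: "i < 3" for i j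
  by (rule C[OF sch[OF i] A0' m'[OF i]])
 define F where "F z = f 0 z*(f 1 z*f 2 z)" for z
 have [measurable]: "F : BM borel" unfolding F_def by measurable
 have Y: "0 <= C*A' ^ 3" using C0 A0' by simp
 have Fi: "integrable sl F"
 proof (rule integrableI_bounded)
  have "(NS z. ennreal (cmod (F z))) <= ennreal (1 / 1 ^ 6*(C*A' ^ 3) + 1 ^ 3*(C*A' ^ 3 + C*A' ^ 3))"
   unfolding F_def by (rule l1_product[OF _ _ _ _ f3' f3' f3' Y Y Y]; (measurable | simp))
  also have "... < \<infinity>" by simp
  finally show "(NS z. ennreal (cmod (F z))) < \<infinity>" .
 qed measurable
 define g where "g z = cut T z*F z" for z
 note cs = cut_schwartz[OF T]
 note [measurable] = schwartz_measurable[OF cs]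
 have gi: "integrable sl g"
 proof (rule Bochner_Integration.integrable_bound[OF Fi])
  show "g : BM sl" unfolding g_def by measurable
  have "cmod (g z) <= cmod (F z)" for z
   unfolding g_def norm_mult using mult_right_mono[OF norm_cut_le norm_ge_zero, of T z "F z"] by simp
  then show "AE z in sl. cmod (g z) <= cmod (F z)" by (rule AE_I2)
 qed
 define G where "G j z = cut T z*(ph 0 j z*(ph 1 j z*ph 2 j z))" for j z
 have G: "G j : schwartz" for j unfolding G_def[abs_def] by (intro schwartz_mult cs sch) auto
 note [measurable] = schwartz_measurable[OF G]
 define E where "E = 3*(8*C + 2*(C*A' ^ 3))"
 have E0: "0 <= E" using C0 Y by (simp add: E_def)
 have L1: "(BS z. cmod (G j z - g z)) <= E*(1/8) ^ j" for j
 proof -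
  \<comment> \<open>the small factor has cube of size \<open>(1/8)^(3 j)\<close>, so both terms are of size \<open>(1/8)^j\<close>\<close>
  define ka where "ka = (1/2 :: real) ^ j"
  have ka: "0 < ka" by (simp add: ka_def)
  have e3: "1 / ka ^ 6*(C*(2*(1/8) ^ j) ^ 3) + ka ^ 3*(C*A' ^ 3 + C*A' ^ 3) = (8*C + 2*(C*A' ^ 3))*(1/8) ^ j"
  proof -
   have k3: "ka ^ 3 = (1/8) ^ j" unfolding ka_def power_mult[symmetric] mult.commute[of j] unfolding power_mult by (simp add: power3_eq_cube)
   have "ka ^ 6 = ka ^ 3*ka ^ 3" by (simp flip: power_add)
   then have "ka ^ 6 = (1/8) ^ j*(1/8) ^ j" by (simp only: k3)
   then show ?thesis unfolding k3 by (simp add: power3_eq_cube field_simps)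
  qed
  define P where "P z = (ph 0 j z - f 0 z)*(ph 1 j z*ph 2 j z)" for z
  define Q' where "Q' z = (ph 1 j z - f 1 z)*(f 0 z*ph 2 j z)" for z
  define R where "R z = (ph 2 j z - f 2 z)*(f 0 z*f 1 z)" for z
  have X: "0 <= C*(2*(1/8) ^ j) ^ 3" using C0 by simp
  have P: "(NS z. ennreal (cmod (P z))) <= ennreal ((8*C + 2*(C*A' ^ 3))*(1/8) ^ j)"
   unfolding e3[symmetric] P_def by (rule l1_product[OF _ _ _ ka d3 p3' p3' X Y Y]; (measurable | simp))
  have Q2: "(NS z. ennreal (cmod (Q' z))) <= ennreal ((8*C + 2*(C*A' ^ 3))*(1/8) ^ j)"
   unfolding e3[symmetric] Q'_def by (rule l1_product[OF _ _ _ ka d3 f3' p3' X Y Y]; (measurable | simp))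
  have R: "(NS z. ennreal (cmod (R z))) <= ennreal ((8*C + 2*(C*A' ^ 3))*(1/8) ^ j)"
   unfolding e3[symmetric] R_def by (rule l1_product[OF _ _ _ ka d3 f3' f3' X Y Y]; (measurable | simp))
  have [measurable]: "P : BM borel" "Q' : BM borel" "R : BM borel"
   unfolding P_def Q'_def R_def by measurable
  have "(NS z. ennreal (cmod (G j z - g z))) <= (NS z. ennreal (cmod (P z)) + (ennreal (cmod (Q' z)) + ennreal (cmod (R z))))"
  proof (rule nn_integral_mono)
   fix z
   have eqz: "G j z - g z = cut T z*(P z + (Q' z + R z))" by (simp add: G_def g_def F_def P_def Q'_def R_def algebra_simps)
   have "cmod (G j z - g z) <= 1*cmod (P z + (Q' z + R z))"
    unfolding eqz norm_mult by (rule mult_right_mono[OF norm_cut_le norm_ge_zero])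
   also have "... <= cmod (P z) + (cmod (Q' z) + cmod (R z))"
    using norm_triangle_ineq[of "P z" "Q' z + R z"] norm_triangle_ineq[of "Q' z" "R z"] by simp
   finally have "ennreal (cmod (G j z - g z)) <= ennreal (cmod (P z) + (cmod (Q' z) + cmod (R z)))" by (rule ennreal_leI)
   then show "ennreal (cmod (G j z - g z)) <= ennreal (cmod (P z)) + (ennreal (cmod (Q' z)) + ennreal (cmod (R z)))" by (simp add: ennreal_plus)
  qed
  also have "... = (NS z. ennreal (cmod (P z))) + ((NS z. ennreal (cmod (Q' z))) + (NS z. ennreal (cmod (R z))))"
   by (simp add: nn_integral_add)
  also have "... <= ennreal ((8*C + 2*(C*A' ^ 3))*(1/8) ^ j) + (ennreal ((8*C + 2*(C*A' ^ 3))*(1/8) ^ j) + ennreal ((8*C + 2*(C*A' ^ 3))*(1/8) ^ j))"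
   by (intro add_mono P Q2 R)
  also have "... = ennreal (E*(1/8) ^ j)"
  proof -
   define q where "q = (8*C + 2*(C*A' ^ 3))*(1/8) ^ j"
   have "0 <= q" unfolding q_def using C0 A0' by (intro mult_nonneg_nonneg add_nonneg_nonneg zero_le_power) auto
   moreover have "E*(1/8) ^ j = q + (q + q)" unfolding E_def q_def by (simp add: algebra_simps)
   ultimately show ?thesis unfolding q_def[symmetric] by (simp only: ennreal_plus add_nonneg_nonneg)
  qed
  finally have le: "(NS z. ennreal (cmod (G j z - g z))) <= ennreal (E*(1/8) ^ j)" .
  have i: "integrable sl (%z. G j z - g z)" using schwartz_integrable[OF G] gi by simp
  have eq: "ennreal (BS z. cmod (G j z - g z)) = (NS z. ennreal (cmod (G j z - g z)))"
   by (rule nn_integral_eq_integral[symmetric]) (use i in auto)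
  have "ennreal (BS z. cmod (G j z - g z)) <= ennreal (E*(1/8) ^ j)" unfolding eq by (rule le)
  then show ?thesis using E0 by (subst (asm) ennreal_le_iff) auto
 qed
 have ftlim: "(%j. ft (G j) xi) \<longlonglongrightarrow> ft g xi" for xi
 proof -
  have bd: "cmod (ft (G j) xi - ft g xi) <= E*(1/8) ^ j" for j
   unfolding ft_diff[OF schwartz_integrable[OF G] gi, symmetric]
   by (rule order_trans[OF norm_ft_le L1]) (use schwartz_integrable[OF G] gi in simp)
  have z0: "(%j. E*(1/8) ^ j) \<longlonglongrightarrow> 0" by (intro tendsto_mult_right_zero LIMSEQ_power_zero) simp
  have "(%j. ft (G j) xi - ft g xi) \<longlonglongrightarrow> 0" by (rule Lim_null_comparison[OF always_eventually z0]) (use bd in blast)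
  then show ?thesis by (simp only: LIM_zero_iff)
 qed
 have Gm: "wmass (s - 1) (- a) (ft (G j)) (K*(A 0*A 1*A 2))" for j
  unfolding G_def[abs_def] using A(1)[of 0] A(1)[of 1] A(1)[of 2] by (intro tri sch m) auto
 have gm: "wmass (s - 1) (- a) (ft g) (K*(A 0*A 1*A 2))" by (rule wmass_fatou[OF Gm ftlim])
 define B where "B = K*(2*A'^2)"
 have B0: "0 <= B" using K0 by (simp add: B_def)
 have Gd: "wmass (s - 1) (- a) (%xi. ft (G i) xi - ft (G j) xi) (3*B*(1/8) ^ j)" if ij: "j <= i" for i j
 proof -
  define h where "h = 2*(1/8 :: real) ^ j"
  have h: "0 <= h" by (simp add: h_def)
  have dd: "wmass s b (ft (%z. ph k i z - ph k j z)) h" if k: "k < 3" for k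
  proof (rule wmass_mono[OF d[OF k]])
   have "(1/8) ^ i <= ((1/8) ^ j :: real)" using ij by (intro power_decreasing) auto
   then show "(1/8) ^ i + (1/8) ^ j <= h" by (simp add: h_def)
  qed simp
  \<comment> \<open>the factors are replaced one at a time\<close>
  define P1 where "P1 z = cut T z*(ph 0 j z*(ph 1 i z*ph 2 i z))" for z
  define P2 where "P2 z = cut T z*(ph 0 j z*(ph 1 j z*ph 2 i z))" for z
  have P: "P1 : schwartz" "P2 : schwartz" unfolding P1_def[abs_def] P2_def[abs_def] by (intro schwartz_mult cs sch; simp)+
  have Bh: "K*(h*A'*A') = B*(1/8) ^ j" by (simp add: B_def h_def power2_eq_square)
  have e: "(%z. cut T z*((ph 0 i z - ph 0 j z)*(ph 1 i z*ph 2 i z))) = (%z. G i z - P1 z)"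
   "(%z. cut T z*(ph 0 j z*((ph 1 i z - ph 1 j z)*ph 2 i z))) = (%z. P1 z - P2 z)"
   "(%z. cut T z*(ph 0 j z*(ph 1 j z*(ph 2 i z - ph 2 j z)))) = (%z. P2 z - G j z)"
   unfolding G_def P1_def P2_def by (rule ext, simp add: right_diff_distrib left_diff_distrib)+
  have w1: "wmass (s - 1) (- a) (ft (%z. G i z - P1 z)) (B*(1/8) ^ j)"
   unfolding e(1)[symmetric] Bh[symmetric] by (intro tri schwartz_diff sch dd m' A0' h) simp_all
  have "wmass (s - 1) (- a) (ft (%z. P1 z - P2 z)) (K*(A'*h*A'))"
   unfolding e(2)[symmetric] by (intro tri schwartz_diff sch dd m' A0' h) simp_all
  then have w2: "wmass (s - 1) (- a) (ft (%z. P1 z - P2 z)) (B*(1/8) ^ j)" unfolding Bh[symmetric] by (simp only: mult_ac)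
  have "wmass (s - 1) (- a) (ft (%z. P2 z - G j z)) (K*(A'*A'*h))"
   unfolding e(3)[symmetric] by (intro tri schwartz_diff sch dd m' A0' h) simp_all
  then have w3: "wmass (s - 1) (- a) (ft (%z. P2 z - G j z)) (B*(1/8) ^ j)" unfolding Bh[symmetric] by (simp only: mult_ac)
  have q: "0 <= B*(1/8) ^ j" using B0 by simp
  note fd = ft_diff[OF schwartz_integrable schwartz_integrable]
  have mm: "ft ps : BM fm" if "ps : schwartz" for ps using ft_measurable[OF schwartz_integrable[OF that]] .
  have w12: "wmass (s - 1) (- a) (%xi. ft (G i) xi - ft P2 xi) (B*(1/8) ^ j + B*(1/8) ^ j)"
  proof (rule wmass_le_add[OF w1 w2 q q])
   show "(%xi. ft (G i) xi - ft P2 xi) : BM fm" by (intro borel_measurable_diff mm G P)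
   have "cmod (ft (G i) xi - ft P2 xi) <= cmod (ft (%z. G i z - P1 z) xi) + cmod (ft (%z. P1 z - P2 z) xi)" for xi
    unfolding fd[OF G P(1)] fd[OF P] using norm_triangle_ineq[of "ft (G i) xi - ft P1 xi" "ft P1 xi - ft P2 xi"] by simp
   then show "AE xi in fm. cmod (ft (G i) xi - ft P2 xi) <= cmod (ft (%z. G i z - P1 z) xi) + cmod (ft (%z. P1 z - P2 z) xi)" by (rule AE_I2)
  qed
  have "wmass (s - 1) (- a) (%xi. ft (G i) xi - ft (G j) xi) (B*(1/8) ^ j + B*(1/8) ^ j + B*(1/8) ^ j)"
  proof (rule wmass_le_add[OF w12 w3 _ q])
   show "(%xi. ft (G i) xi - ft (G j) xi) : BM fm" by (intro borel_measurable_diff mm G)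
   have "cmod (ft (G i) xi - ft (G j) xi) <= cmod (ft (G i) xi - ft P2 xi) + cmod (ft (%z. P2 z - G j z) xi)" for xi
    unfolding fd[OF P(2) G] using norm_triangle_ineq[of "ft (G i) xi - ft P2 xi" "ft P2 xi - ft (G j) xi"] by simp
   then show "AE xi in fm. cmod (ft (G i) xi - ft (G j) xi) <= cmod (ft (G i) xi - ft P2 xi) + cmod (ft (%z. P2 z - G j z) xi)" by (rule AE_I2)
  qed (use q in simp)
  then show ?thesis by (simp add: algebra_simps)
 qed
 have gd: "wmass (s - 1) (- a) (%xi. ft g xi - ft (G j) xi) (3*B*(1/8) ^ j)" for j
 proof (rule wmass_fatou)
  show "wmass (s - 1) (- a) (%xi. ft (G (k + j)) xi - ft (G j) xi) (3*B*(1/8) ^ j)" for k by (rule Gd) simp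
  show "(%k. ft (G (k + j)) xi - ft (G j) xi) \<longlonglongrightarrow> ft g xi - ft (G j) xi" for xi
   by (intro tendsto_diff tendsto_const LIMSEQ_ignore_initial_segment ftlim)
 qed
 have W: "dist_of g : Xsb (s - 1) (- a)"
  unfolding Xsb_def
 proof (intro CollectI conjI allI impI)
  show "tempered (dist_of g)" by (rule tempered_dist_of[OF gi])
  fix e :: ennreal assume e: "0 < e"
  have "(%j. 3*B*(1/8) ^ j) \<longlonglongrightarrow> 0" by (intro tendsto_mult_right_zero LIMSEQ_power_zero) simp
  then have "(%j. ennreal (3*B*(1/8) ^ j)) \<longlonglongrightarrow> ennreal 0" by (rule tendsto_ennrealI)
  then have "\<forall>\<^sub>F j in sequentially. ennreal (3*B*(1/8) ^ j) < e" using e by (intro order_tendstoD(2)) simp_all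
  then obtain j where j: "ennreal (3*B*(1/8) ^ j) < e" by (auto dest: eventually_happens)
  have "xsb_norm (s - 1) (- a) (%ps. dist_of g ps - dist_of (G j) ps) <= ennreal (3*B*(1/8) ^ j)"
   by (rule xsb_norm_le[OF has_ft_diff[OF has_ft_dist_of[OF gi] has_ft_dist_of[OF schwartz_integrable[OF G]]] gd]) (use B0 in simp)
  then show "EX ph:schwartz. xsb_norm (s - 1) (- a) (%ps. dist_of g ps - dist_of ph ps) < e" using j G[of j] by (auto intro: le_less_trans)
 qed
 have Wn: "xsb_norm (s - 1) (- a) (dist_of g) <= ennreal (K*(A 0*A 1*A 2))"
  by (rule xsb_norm_le[OF has_ft_dist_of[OF gi] gm]) (use K0 A(1)[of 0] A(1)[of 1] A(1)[of 2] in simp)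
 define p where "p = on_slab T (%z. u 0 z*u 1 z*u 2 z)"
 have pu: "p z = on_slab T (u 0) z * on_slab T (u 1) z * on_slab T (u 2) z" for z
  by (simp add: p_def on_slab_def indicator_def)
 have um: "on_slab T (u i) : BM borel" if "i < 3" for i
  using borel_measurable_integrable[OF u[OF that, unfolded integrable_on_slab]] by simp
 have [measurable]: "on_slab T (u 0) : BM borel" "on_slab T (u 1) : BM borel" "on_slab T (u 2) : BM borel"
  by (rule um, simp)+
 have uf3: "AE z in sl. fst z : {0<..<T} --> on_slab T (u 0) z = f 0 z" "AE z in sl. fst z : {0<..<T} --> on_slab T (u 1) z = f 1 z"
  "AE z in sl. fst z : {0<..<T} --> on_slab T (u 2) z = f 2 z" by (rule uf, simp)+
 have pm[measurable]: "p : BM borel" unfolding pu[abs_def] by measurable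
 have pF: "AE z in sl. p z = indicator {0<..<T} (fst z) *\<^sub>R F z"
  using uf3 AE_sl_time[of 0] AE_sl_time[of T]
 proof eventually_elim
  case (elim z)
  show ?case
  proof (cases "fst z : {0<..<T}")
   case True then show ?thesis using elim by (simp add: pu F_def mult.assoc)
  next
   case False
   then have "z \<notin> slab {0..T}" using elim by (auto simp: slab_def)
   then show ?thesis using False by (simp add: p_def on_slab_def)
  qed
 qed
 have "integrable sl (%z. indicator {0<..<T} (fst z) *\<^sub>R F z)"
  by (rule Bochner_Integration.integrable_bound[OF Fi]) (measurable, rule AE_I2, simp add: indicator_def)
 moreover have "integrable sl p \<longleftrightarrow> integrable sl (%z. indicator {0<..<T} (fst z) *\<^sub>R F z)"
 proof (rule integrable_cong_AE)
  show "(%z. indicat_real {0<..<T} (fst z) *\<^sub>R F z) : BM sl" by measurable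
  show "p : BM sl" by measurable
 qed (rule pF)
 ultimately have pi: "integrable sl p" by simp
 show si: "set_integrable lborel (slab {0..T}) (%z. u 0 z*u 1 z*u 2 z)"
  using pi integrable_sl_on_slab[OF pm[unfolded p_def]] by (simp add: p_def)
 have "restricts_to T (dist_of g) (dist_of (%z. u 0 z*u 1 z*u 2 z))"
  unfolding restricts_to_def
 proof
  fix ps assume ps: "ps : test_functions T"
  then have pss: "ps : schwartz" by (simp add: test_functions_def)
  note [measurable] = schwartz_measurable[OF pss]
  have "dist_of g ps = (BS z. g z*ps z)" by (rule dist_of_eq[OF gi pss])
  also have "... = (BS z. p z*ps z)"
  proof (rule integral_cong_AE)
   show "(%z. g z*ps z) : BM sl" unfolding g_def by measurable
   show "AE z in sl. g z*ps z = p z*ps z"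
    using pF
   proof eventually_elim
    case (elim z)
    show ?case
    proof (cases "fst z : {0<..<T}")
     case True
     then have "cut T z = 1" by (intro cut_one[OF T]) auto
     then show ?thesis using elim True by (simp add: g_def)
    next
     case False
     then show ?thesis using test_function_outside[OF ps] by simp
    qed
   qed
  qed measurable
  also have "... = dist_of p ps" by (rule dist_of_eq[OF pi pss, symmetric])
  also have "... = dist_of (%z. u 0 z*u 1 z*u 2 z) ps" unfolding p_def by (rule dist_of_on_slab[OF ps, symmetric])
  finally show "dist_of g ps = dist_of (%z. u 0 z*u 1 z*u 2 z) ps" .
 qed
 then show "EX W:Xsb (s - 1) (- a). restricts_to T W (dist_of (%z. u 0 z*u 1 z*u 2 z)) & xsb_norm (s - 1) (- a) W <= ennreal (K*(A 0*A 1*A 2))"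
  using W Wn by blast
qed

text \<open>An element is at distance less than one from a Schwartz function, whose norm is finite.\<close>

lemma xsb_norm_finite:
 assumes U: "U : Xsb s b" and s: "s <= 1" and b: "b <= 1"
 shows "xsb_norm s b U < \<top>"
proof -
 obtain ph where ph: "ph : schwartz" and l: "xsb_norm s b (%ps. U ps - dist_of ph ps) < ennreal 1"
 proof -
  have "ALL e>0. EX ph:schwartz. xsb_norm s b (%ps. U ps - dist_of ph ps) < e" using U by (simp add: Xsb_def)
  moreover have "(0 :: ennreal) < ennreal 1" by simp
  ultimately show thesis using that by blast
 qed
 obtain H B where H: "has_ft (%ps. U ps - dist_of ph ps) H" "wmass s b H B" "0 <= B" using xsb_norm_lessD[OF l] by auto
 obtain A where A: "0 <= A" "wmass s b (ft ph) A" using schwartz_wmass[OF ph s b] by blast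
 note d = has_ft_dist_of[OF schwartz_integrable[OF ph]]
 have z: "has_ft (%ps. dist_of ph ps - dist_of ph ps) (%xi. ft ph xi - ft ph xi)" by (rule has_ft_diff[OF d d])
 have "has_ft (%ps. (dist_of ph ps - dist_of ph ps) - dist_of ph ps) (%xi. (ft ph xi - ft ph xi) - ft ph xi)" by (rule has_ft_diff[OF z d])
 from has_ft_diff[OF H(1) this] have U: "has_ft U (%xi. H xi + ft ph xi)" by simp
 have "wmass s b (%xi. H xi + ft ph xi) (B + A)"
  by (rule wmass_le_add[OF H(2) A(2) H(3) A(1)]) (use wmass_measurable[OF H(2)] wmass_measurable[OF A(2)] in \<open>auto intro: norm_triangle_ineq\<close>)
 from xsb_norm_le[OF U this] H(3) A(1) show ?thesis by (simp add: le_less_trans)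
qed

section \<open>The trilinear estimate in the restricted spaces\<close>

text \<open>Both upper bounds come from \<open>\<epsilon> < (5 - 8\<alpha>)\<^sup>2/(32(1 - \<alpha>))\<close>: cancel one factor \<open>5 - 8\<alpha>\<close> and use
\<open>5 - 8\<alpha> \<le> 8(1 - \<alpha>)\<close> for the first and \<open>5 - 8\<alpha> \<le> 4(1 - \<alpha>)\<close>, that is \<open>\<alpha> \<ge> 1/4\<close>, for the second.\<close>

lemma exponents_admissible:
 fixes al ep :: real
 assumes "1/4 <= al" and "al < 3/8" and "0 < ep" and eps: "ep < (5 - 8*al)^2 / (32*(1 - al))"
 shows "1/4 < 2*al - 1/4 + ep" and "2*al - 1/4 + ep <= 1" and "2*ep / (5 - 8*al) < 1/4"
proof -
 have p: "0 < 5 - 8*al" "0 < 32*(1 - al)" using assms by simp_all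
 show "1/4 < 2*al - 1/4 + ep" using assms by simp
 have e: "ep*(32*(1 - al)) < (5 - 8*al)*(5 - 8*al)" using eps p(2) by (simp add: pos_less_divide_eq power2_eq_square)
 have "(5 - 8*al)*(5 - 8*al) <= (5 - 8*al)*(4*(1 - al))" using assms p by (intro mult_left_mono) auto
 then have "ep*(8*(4*(1 - al))) < (5 - 8*al)*(4*(1 - al))" using e by (simp add: mult_ac)
 then have "(ep*8)*(4*(1 - al)) < (5 - 8*al)*(4*(1 - al))" by (simp only: mult.assoc)
 then have "ep*8 < 5 - 8*al" by (rule mult_right_less_imp_less) (use p in simp)
 then show "2*ep / (5 - 8*al) < 1/4" using p by (simp add: pos_divide_less_eq)
 have "(5 - 8*al)*(5 - 8*al) <= (5 - 8*al)*(8*(1 - al))" using p by (intro mult_left_mono) auto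
 then have "ep*(4*(8*(1 - al))) < (5 - 8*al)*(8*(1 - al))" using e by (simp add: mult_ac)
 then have "(ep*4)*(8*(1 - al)) < (5 - 8*al)*(8*(1 - al))" by (simp only: mult.assoc)
 then have "ep*4 < 5 - 8*al" by (rule mult_right_less_imp_less) (use p in simp)
 then show "2*al - 1/4 + ep <= 1" by simp
qed

lemma xsbT_norm_lessD:
 assumes "xsbT_norm T s b V < ennreal A"
 shows "EX W:Xsb s b. restricts_to T W V & xsb_norm s b W < ennreal A"
 using assms unfolding xsbT_norm_def INF_less_iff by blast

lemma xsbT_norm_finite:
 assumes "V : XsbT T s b" "s <= 1" "b <= 1" shows "EX n>=0. xsbT_norm T s b V = ennreal n"
proof -
 obtain W where W: "W : Xsb s b" "restricts_to T W V" using assms(1) unfolding XsbT_def by blast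
 have "xsbT_norm T s b V <= xsb_norm s b W" unfolding xsbT_norm_def using W by (intro INF_lower) simp
 also have "... < \<top>" by (rule xsb_norm_finite[OF W(1) assms(2,3)])
 finally have "xsbT_norm T s b V ~= \<top>" by simp
 then show ?thesis by (cases "xsbT_norm T s b V") auto
qed

text \<open>The norms of the restrictions are infima that need not be attained. Extensions with norms exceeding them by
\<open>e > 0\<close> are used, and \<open>e \<rightarrow> 0\<close> in the end; this needs the norms to be finite.\<close>

theorem trilinear_in_restriction_space:
 fixes s b a a' :: real
 assumes s: "1/4 < s" "s <= 1" and b: "1/2 < b" "b <= 1" and a: "1/4 < a'" "a' < a" "a < 1/2"
 shows "EX C>0. ALL T::real. 0 < T & T <= 1 -->
   (ALL u v w. u : XsbT_fun T s b & v : XsbT_fun T s b & w : XsbT_fun T s b -->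
    (%z. u z * v z*w z) : XsbT_fun T (s - 1) (- a) &
    xsbT_norm T (s - 1) (- a) (dist_of (%z. u z * v z*w z))
     <= ennreal (C*T powr (a - a'))*xsbT_norm T s b (dist_of u)*xsbT_norm T s b (dist_of v)*xsbT_norm T s b (dist_of w))"
proof -
 obtain C0 where C0: "0 <= C0" and tri: "!!T ph1 ph2 ph3 A1 A2 A3. ph1 : schwartz ==> ph2 : schwartz ==> ph3 : schwartz ==> 0 <= A1 ==> 0 <= A2 ==> 0 <= A3 ==>
   0 < T ==> T <= 1 ==> wmass s b (ft ph1) A1 ==> wmass s b (ft ph2) A2 ==> wmass s b (ft ph3) A3 ==>
   wmass (s - 1) (- a) (ft (%z. cut T z*(ph1 z*(ph2 z*ph3 z)))) (C0*T powr (a - a')*(A1*A2*A3))"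
  using schwartz_trilinear[OF s b(1) a] by blast
 define C where "C = C0 + 1"
 have C: "0 < C" "C0 <= C" using C0 by (simp_all add: C_def)
 show ?thesis
 proof (intro exI[of _ C] conjI C(1) allI impI; elim conjE)
  fix T :: real and u v w
  assume T: "0 < T" "T <= 1" and uvw: "u : XsbT_fun T s b" "v : XsbT_fun T s b" "w : XsbT_fun T s b"
  define K where "K = C0*T powr (a - a')"
  have K: "0 <= K" using C0 by (simp add: K_def)
  define q where "q i = (if i = 0 then u else if i = 1 then v else w)" for i :: nat
  have q: "q i : XsbT_fun T s b" for i using uvw by (simp add: q_def)
  have q012: "q 0 = u" "q 1 = v" "q 2 = w" by (simp_all add: q_def)
  have qi: "set_integrable lborel (slab {0..T}) (q i)" and qx: "dist_of (q i) : XsbT T s b" for i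
   using q[of i] by (simp_all add: XsbT_fun_def)
  have "EX n>=0. xsbT_norm T s b (dist_of (q i)) = ennreal n" for i by (rule xsbT_norm_finite[OF qx s(2) b(2)])
  then obtain n where n: "!!i. 0 <= n i" "!!i. xsbT_norm T s b (dist_of (q i)) = ennreal (n i)" by metis
  have main: "set_integrable lborel (slab {0..T}) (%z. u z * v z*w z) &
    (EX W:Xsb (s - 1) (- a). restricts_to T W (dist_of (%z. u z * v z*w z)) & xsb_norm (s - 1) (- a) W <= ennreal (K*((n 0 + e)*(n 1 + e)*(n 2 + e))))"
   if e: "0 < e" for e
  proof -
   have "EX W:Xsb s b. restricts_to T W (dist_of (q i)) & xsb_norm s b W < ennreal (n i + e)" for i
    by (rule xsbT_norm_lessD) (use n[of i] e in \<open>simp add: ennreal_less_iff\<close>)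
   then obtain W where W: "!!i. W i : Xsb s b" "!!i. restricts_to T (W i) (dist_of (q i))" "!!i. xsb_norm s b (W i) < ennreal (n i + e)" by metis
   have pos: "0 < n i + e" for i using n(1)[of i] e by simp
   note pe = product_extension[of s b K a T q W "%i. n i + e", OF s b K tri[OF _ _ _ _ _ _ T, folded K_def] T(1) qi W(1) W(2) pos W(3)]
   show ?thesis using pe unfolding q012 by blast
  qed
  have per: "periodic_space (%z. u z * v z*w z)" using uvw by (simp add: XsbT_fun_def periodic_space_def)
  have "dist_of (%z. u z * v z*w z) : XsbT T (s - 1) (- a)" using main[OF zero_less_one] unfolding XsbT_def by blast
  then show "(%z. u z * v z*w z) : XsbT_fun T (s - 1) (- a)" using per main[OF zero_less_one] by (simp add: XsbT_fun_def)
  define X where "X = xsbT_norm T (s - 1) (- a) (dist_of (%z. u z * v z*w z))"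
  have X: "X <= ennreal (K*((n 0 + e)*(n 1 + e)*(n 2 + e)))" if e: "0 < e" for e
  proof -
   obtain W where W: "W : Xsb (s - 1) (- a)" "restricts_to T W (dist_of (%z. u z * v z*w z))" "xsb_norm (s - 1) (- a) W <= ennreal (K*((n 0 + e)*(n 1 + e)*(n 2 + e)))"
    using main[OF e] by blast
   have "X <= xsb_norm (s - 1) (- a) W" unfolding X_def xsbT_norm_def using W by (intro INF_lower) simp
   then show ?thesis using W(3) by (rule order_trans)
  qed
  have l: "(%k. 1 / real (Suc k)) \<longlonglongrightarrow> 0" using LIMSEQ_inverse_real_of_nat by (simp add: inverse_eq_divide)
  have "(%k. ennreal (K*((n 0 + 1 / real (Suc k))*(n 1 + 1 / real (Suc k))*(n 2 + 1 / real (Suc k))))) \<longlonglongrightarrow> ennreal (K*((n 0 + 0)*(n 1 + 0)*(n 2 + 0)))"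
   by (intro tendsto_ennrealI tendsto_mult tendsto_add tendsto_const l)
  then have "X <= ennreal (K*((n 0 + 0)*(n 1 + 0)*(n 2 + 0)))" by (rule LIMSEQ_le_const) (use X in auto)
  also have "... <= ennreal (C*T powr (a - a')*(n 0*n 1*n 2))"
   unfolding K_def using C n(1) by (intro ennreal_leI) (simp add: mult_right_mono)
  also have "... = ennreal (C*T powr (a - a'))*xsbT_norm T s b (dist_of u)*xsbT_norm T s b (dist_of v)*xsbT_norm T s b (dist_of w)"
   using n(2)[of 0] n(2)[of 1] n(2)[of 2] n(1)[of 0] n(1)[of 1] n(1)[of 2] C unfolding q012 by (simp add: ennreal_mult mult.assoc)
  finally show "xsbT_norm T (s - 1) (- a) (dist_of (%z. u z * v z*w z))
     <= ennreal (C*T powr (a - a'))*xsbT_norm T s b (dist_of u)*xsbT_norm T s b (dist_of v)*xsbT_norm T s b (dist_of w)"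
   unfolding X_def .
 qed
qed

text \<open>The exponent \<open>\<eta>\<close> may not depend on \<open>\<delta>\<close>, so it is half the room that the largest admissible \<open>\<delta>\<close> leaves
between \<open>1/2 - \<delta>\<close> and the threshold \<open>1/4\<close> of the trilinear estimate.\<close>

theorem proposition5p9:
  fixes \<alpha> \<epsilon> :: real
  assumes "1/4 \<le> \<alpha>" and "\<alpha> < 3/8"
    and "0 < \<epsilon>" and "\<epsilon> < (5 - 8 * \<alpha>)\<^sup>2 / (32 * (1 - \<alpha>))"
  shows "\<exists>\<eta>>0. \<forall>\<delta>::real. 0 < \<delta> \<and> \<delta> < 2 * \<epsilon> / (5 - 8 * \<alpha>) \<longrightarrow>
    (\<exists>C>0. \<forall>T::real. 0 < T \<and> T \<le> 1 \<longrightarrow>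
      (\<forall>u v w.
        u \<in> XsbT_fun T (2 * \<alpha> - 1/4 + \<epsilon>) (1/2 + \<delta>) \<and>
        v \<in> XsbT_fun T (2 * \<alpha> - 1/4 + \<epsilon>) (1/2 + \<delta>) \<and>
        w \<in> XsbT_fun T (2 * \<alpha> - 1/4 + \<epsilon>) (1/2 + \<delta>) \<longrightarrow>
        (\<lambda>z. u z * v z * w z) \<in> XsbT_fun T (2 * \<alpha> - 1/4 + \<epsilon> - 1) (- 1/2 + \<delta>) \<and>
        xsbT_norm T (2 * \<alpha> - 1/4 + \<epsilon> - 1) (- 1/2 + \<delta>) (dist_of (\<lambda>z. u z * v z * w z))
          \<le> ennreal (C * T powr \<eta>) *
             xsbT_norm T (2 * \<alpha> - 1/4 + \<epsilon>) (1/2 + \<delta>) (dist_of u) *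
             xsbT_norm T (2 * \<alpha> - 1/4 + \<epsilon>) (1/2 + \<delta>) (dist_of v) *
             xsbT_norm T (2 * \<alpha> - 1/4 + \<epsilon>) (1/2 + \<delta>) (dist_of w)))"
proof -
  define s where "s = 2 * \<alpha> - 1/4 + \<epsilon>"
  \<comment> \<open>the supremum of the admissible values of \<open>\<delta>\<close>\<close>
  define D where "D = 2 * \<epsilon> / (5 - 8 * \<alpha>)"
  have s: "1/4 < s" "s \<le> 1" and D: "D < 1/4" using exponents_admissible[OF assms] by (simp_all add: s_def D_def)
  define \<eta> where "\<eta> = (1/4 - D) / 2"
  have \<eta>: "0 < \<eta>" using D by (simp add: \<eta>_def)
  have main: "\<exists>C>0. \<forall>T::real. 0 < T \<and> T \<le> 1 \<longrightarrow>
      (\<forall>u v w. u \<in> XsbT_fun T s (1/2 + \<delta>) \<and> v \<in> XsbT_fun T s (1/2 + \<delta>) \<and> w \<in> XsbT_fun T s (1/2 + \<delta>) \<longrightarrow>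
        (\<lambda>z. u z * v z * w z) \<in> XsbT_fun T (s - 1) (- 1/2 + \<delta>) \<and>
        xsbT_norm T (s - 1) (- 1/2 + \<delta>) (dist_of (\<lambda>z. u z * v z * w z))
          \<le> ennreal (C * T powr \<eta>) * xsbT_norm T s (1/2 + \<delta>) (dist_of u) * xsbT_norm T s (1/2 + \<delta>) (dist_of v) * xsbT_norm T s (1/2 + \<delta>) (dist_of w))"
    if \<delta>: "0 < \<delta> \<and> \<delta> < D" for \<delta>
  proof -
    have b: "1/2 < 1/2 + \<delta>" "1/2 + \<delta> \<le> 1" using \<delta> D by simp_all
    have a: "1/4 < 1/2 - \<delta> - \<eta>" "1/2 - \<delta> - \<eta> < 1/2 - \<delta>" "1/2 - \<delta> < 1/2" using \<delta> D by (simp_all add: \<eta>_def field_simps)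
    have e: "- (1/2 - \<delta>) = - 1/2 + \<delta>" "1/2 - \<delta> - (1/2 - \<delta> - \<eta>) = \<eta>" by simp_all
    show ?thesis using trilinear_in_restriction_space[OF s b a] unfolding e .
  qed
  show ?thesis unfolding s_def[symmetric] D_def[symmetric] using main \<eta> by blast
qed

end
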